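(* (All manifolds are three-dimensional Riemannian.) (1) There are no real-analytic manifolds that satisfy the chaotic curvature condition of order $\le1$; equivalently, every real-analytic manifold is $3$-exceptional. (2) There exists a real-analytic manifold $\mathcal M_1$ satisfying the chaotic curvature condition of order $\le2$ and such that every sufficiently small smooth perturbation of it also satisfies the chaotic curvature condition of order $\le2$. There also exists a real-analytic manifold $\mathcal M_2$ failing the chaotic curvature condition of order $\le2$ and such that every sufficiently small smooth perturbation of it also fails the chaotic curvature condition of order $\le2$. (3) For every real-analytic Riemannian metric $\{g_{ij}(\mathbf x)\}_{1\le i,j\le3}$ defined on a small neighborhood of the origin $0\in\mathbb R^3$, every $\epsilon>0$ and every sufficiently large integer $K$ ($K\ge10$ is enough), there exist $\delta>0$ and a real-analytic Riemannian metric $\{\widetilde g_{ij}(\mathbf x)\}_{1\le i,j\le3}$ on the ball $\mathbb B^{(3)}_\delta\subset\mathbb R^3$ of radius $\delta$ centered at the origin such that $$\|g_{ij}-\widetilde g_{ij}\|_{C^K(\mathbb B^{(3)}_\delta)}\le\epsilon,\qquad 1\le i,j\le3,$$ and $\widetilde g$ satisfies the chaotic curvature condition of order $\le3$ on $\mathbb B^{(3)}_\delta$.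
   Context: Chaotic curvature: let $\overline{\mathrm{Ric}}$ be the Ricci endomorphism. For a unit-speed geodesic $\gamma$ and a unit vector $X(0)\perp\gamma'(0)$ at $\gamma(0)$, let $X(t)$ be its parallel transport along $\gamma$, $Y(t)=\overline{\mathrm{Ric}}(X(t))$, and $Y^\perp(t)$ the projection of $Y(t)$ to the orthogonal complement of $\mathrm{span}\{\gamma'(t),X(t)\}$. A three-dimensional Riemannian manifold satisfies the chaotic curvature condition of order $\le k$ if for every point $p$, every unit-speed geodesic $\gamma$ with $\gamma(0)=p$, and every such $X(0)$, one has $|Y^\perp(0)|+|\nabla_{\gamma'}Y^\perp(0)|+\dots+|\nabla^k_{\gamma'}Y^\perp(0)|\ne0$. It fails the condition otherwise. Exceptional: with $\mathcal R$ the Riemann curvature tensor and $q\ge2$, let $\mathcal R^q_{\gamma(0)}(v)=(\nabla^{q-2}_{\gamma'(0)}\mathcal R)(v,\gamma'(0))\gamma'(0)$. A unit-speed geodesic $\gamma$ is $k$-exceptional ($k\ge2$) if there is a two-dimensional subspace $V\subset T_{\gamma(0)}\mathcal M$ with $\gamma'(0)\in V$ and $\mathcal R^q_{\gamma(0)}(V)\subset V$ for all $2\le q\le k$. A manifold is $k$-exceptional if it has a $k$-exceptional geodesic. In (2), the manifolds are given by metrics on a ball $U$ around the origin in $\mathbb R^3$, and "every sufficiently small smooth perturbation of $g$ has property P" means: there exist an integer $K$ and $\eta>0$ such that every smooth Riemannian metric $\widetilde g$ on $U$ with $\|\widetilde g_{ij}-g_{ij}\|_{C^K(U)}\le\eta$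 for all $i,j$ has property P. *)

theory Defs
  imports "HOL-Analysis.Analysis" "HOL-Library.Function_Algebras"
begin

section \<open>Regularity of functions on open subsets of \<open>\<real>\<^sup>3\<close>\<close>

type_synonym R3 = "real ^ 3"

text \<open>The index list \<open>[i\<^sub>1, \<dots>, i\<^sub>m]\<close> stands for the iterated partial derivative
  \<open>\<partial>\<^bsub>i\<^sub>1\<^esub> \<dots> \<partial>\<^bsub>i\<^sub>m\<^esub> f\<close>.\<close>

primrec partials :: "3 list \<Rightarrow> (R3 \<Rightarrow> real) \<Rightarrow> R3 \<Rightarrow> real" where
  "partials [] f = f"
| "partials (i # ks) f = (\<lambda>x. frechet_derivative (partials ks f) (at x) (axis i 1))"

definition smooth_on :: "R3 set \<Rightarrow> (R3 \<Rightarrow> real) \<Rightarrow> bool" where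
  "smooth_on U f \<longleftrightarrow> (\<forall>ks. \<forall>x\<in>U. partials ks f differentiable at x)"

definition real_analytic_on :: "R3 set \<Rightarrow> (R3 \<Rightarrow> real) \<Rightarrow> bool" where
  "real_analytic_on U f \<longleftrightarrow>
    (\<forall>x\<in>U. \<exists>a :: (3 \<Rightarrow> nat) \<Rightarrow> real. \<exists>r>0. \<forall>y\<in>ball x r.
       ((\<lambda>\<alpha>. a \<alpha> * (\<Prod>i\<in>UNIV. (y $ i - x $ i) ^ \<alpha> i)) has_sum f y) UNIV)"

text \<open>An extended real, so that an unbounded derivative yields the norm \<open>\<infinity>\<close>.\<close>

definition CK_norm :: "nat \<Rightarrow> R3 set \<Rightarrow> (R3 \<Rightarrow> real) \<Rightarrow> ereal" where
  "CK_norm K U f = (SUP (ks, x) \<in> {ks. length ks \<le> K} \<times> U. ereal \<bar>partials ks f x\<bar>)"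


section \<open>Metrics and curvature in coordinates\<close>

type_synonym metric = "R3 \<Rightarrow> real ^ 3 ^ 3"

definition riemannian_metric :: "R3 set \<Rightarrow> metric \<Rightarrow> bool" where
  "riemannian_metric U g \<longleftrightarrow>
    (\<forall>x\<in>U. transpose (g x) = g x \<and> (\<forall>v. v \<noteq> 0 \<longrightarrow> v \<bullet> (g x *v v) > 0))"

definition smooth_metric :: "R3 set \<Rightarrow> metric \<Rightarrow> bool" where
  "smooth_metric U g \<longleftrightarrow>
    riemannian_metric U g \<and> (\<forall>i j. smooth_on U (\<lambda>x. g x $ i $ j))"

definition analytic_metric :: "R3 set \<Rightarrow> metric \<Rightarrow> bool" where
  "analytic_metric U g \<longleftrightarrow>
    riemannian_metric U g \<and> (\<forall>i j. real_analytic_on U (\<lambda>x. g x $ i $ j))"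

definition metric_deriv :: "metric \<Rightarrow> R3 \<Rightarrow> 3 \<Rightarrow> 3 \<Rightarrow> 3 \<Rightarrow> real" where
  "metric_deriv g x l i j = partials [l] (\<lambda>y. g y $ i $ j) x"

text \<open>\<open>christoffel g x a b\<close> is the vector with components
  \<open>\<Sum>\<^sub>i \<Sum>\<^sub>j \<Gamma>\<^sup>k\<^sub>i\<^sub>j(x) a\<^sup>i b\<^sup>j\<close>.\<close>

definition christoffel :: "metric \<Rightarrow> R3 \<Rightarrow> R3 \<Rightarrow> R3 \<Rightarrow> R3" where
  "christoffel g x a b = (\<chi> k. \<Sum>i\<in>UNIV. \<Sum>j\<in>UNIV.
     (1 / 2) * (\<Sum>l\<in>UNIV. matrix_inv (g x) $ k $ l *
        (metric_deriv g x i j l + metric_deriv g x j i l - metric_deriv g x l i j))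
     * a $ i * b $ j)"

text \<open>\<open>\<R>(u, v) w = \<nabla>\<^sub>u \<nabla>\<^sub>v w - \<nabla>\<^sub>v \<nabla>\<^sub>u w - \<nabla>\<^bsub>[u, v]\<^esub> w\<close>, computed with the vector fields
  whose coordinates are constant, for which \<open>[u, v] = 0\<close>.\<close>

definition riemann :: "metric \<Rightarrow> R3 \<Rightarrow> R3 \<Rightarrow> R3 \<Rightarrow> R3 \<Rightarrow> R3" where
  "riemann g x u v w =
     frechet_derivative (\<lambda>y. christoffel g y v w) (at x) u
     - frechet_derivative (\<lambda>y. christoffel g y u w) (at x) v
     + christoffel g x u (christoffel g x v w)
     - christoffel g x v (christoffel g x u w)"

text \<open>The Ricci form is the trace of \<open>u \<mapsto> \<R>(u, v) w\<close>; the Ricci endomorphism is obtained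
  from it by raising an index.\<close>

definition ricci :: "metric \<Rightarrow> R3 \<Rightarrow> R3 \<Rightarrow> R3 \<Rightarrow> real" where
  "ricci g x v w = (\<Sum>i\<in>UNIV. riemann g x (axis i 1) v w $ i)"

definition ricci_endo :: "metric \<Rightarrow> R3 \<Rightarrow> R3 \<Rightarrow> R3" where
  "ricci_endo g x v = matrix_inv (g x) *v (\<chi> i. ricci g x (axis i 1) v)"


section \<open>Three-dimensional Riemannian manifolds\<close>

type_synonym 'a chart = "'a set \<times> ('a \<Rightarrow> R3)"

abbreviation chart_dom :: "'a chart \<Rightarrow> 'a set" where "chart_dom \<equiv> fst"
abbreviation chart_map :: "'a chart \<Rightarrow> 'a \<Rightarrow> R3" where "chart_map \<equiv> snd"

text \<open>The metric is recorded through its coefficient matrix in each chart, as a function of the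
  coordinates of that chart.\<close>

record 'a riem_manifold =
  mtop :: "'a topology"
  atlas :: "'a chart set"
  met :: "'a chart \<Rightarrow> metric"

definition transition :: "'a chart \<Rightarrow> 'a chart \<Rightarrow> R3 \<Rightarrow> R3" where
  "transition c d x = chart_map d (inv_into (chart_dom c) (chart_map c) x)"

definition overlap :: "'a chart \<Rightarrow> 'a chart \<Rightarrow> R3 set" where
  "overlap c d = chart_map c ` (chart_dom c \<inter> chart_dom d)"

definition analytic_riemannian_manifold :: "'a riem_manifold \<Rightarrow> bool" where
  "analytic_riemannian_manifold M \<longleftrightarrow>
     Hausdorff_space (mtop M) \<and> second_countable (mtop M) \<and> topspace (mtop M) \<noteq> {} \<and>
     \<Union> (chart_dom ` atlas M) = topspace (mtop M) \<and>
     (\<forall>c\<in>atlas M. openin (mtop M) (chart_dom c) \<and> open (chart_map c ` chart_dom c) \<and>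
        homeomorphic_map (subtopology (mtop M) (chart_dom c))
          (top_of_set (chart_map c ` chart_dom c)) (chart_map c) \<and>
        analytic_metric (chart_map c ` chart_dom c) (met M c)) \<and>
     (\<forall>c\<in>atlas M. \<forall>d\<in>atlas M.
        (\<forall>i. real_analytic_on (overlap c d) (\<lambda>x. transition c d x $ i)) \<and>
        (\<forall>x\<in>overlap c d. \<forall>u v.
           u \<bullet> (met M c x *v v) =
           frechet_derivative (transition c d) (at x) u
             \<bullet> (met M d (transition c d x) *v frechet_derivative (transition c d) (at x) v)))"

text \<open>A region of \<open>\<real>\<^sup>3\<close> with a metric, as a manifold with a single chart.\<close>

definition region :: "R3 set \<Rightarrow> metric \<Rightarrow> R3 riem_manifold" where
  "region U g = \<lparr>mtop = top_of_set U, atlas = {(U, \<lambda>x. x)}, met = (\<lambda>_. g)\<rparr>"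


lemma real_analytic_on_component: "real_analytic_on U (\<lambda>x. x $ i)"
  unfolding real_analytic_on_def
proof (intro ballI)
  fix x :: R3 assume "x \<in> U"
  define e where "e = (\<lambda>j::3. if j = i then 1 else 0 :: nat)"
  define a where "a = (\<lambda>\<alpha>. if \<alpha> = (\<lambda>_. 0) then x $ i else if \<alpha> = e then 1 else 0)"
  have ne: "e \<noteq> (\<lambda>_. 0)" by (auto simp: e_def fun_eq_iff)
  have "((\<lambda>\<alpha>. a \<alpha> * (\<Prod>j\<in>UNIV. (y $ j - x $ j) ^ \<alpha> j)) has_sum y $ i) UNIV" for y :: R3
  proof -
    have *: "(\<Prod>j\<in>UNIV. (y $ j - x $ j) ^ e j) = y $ i - x $ i"
      by (simp add: e_def if_distrib[of "\<lambda>n. _ ^ n"] prod.delta cong: if_cong)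
    have "((\<lambda>\<alpha>. a \<alpha> * (\<Prod>j\<in>UNIV. (y $ j - x $ j) ^ \<alpha> j)) has_sum y $ i) {\<lambda>_. 0, e}"
      by (rule has_sum_finiteI) (use ne * in \<open>auto simp: a_def\<close>)
    then show ?thesis
      by (rule has_sum_cong_neutral[THEN iffD1, rotated -1]) (auto simp: a_def)
  qed
  then show "\<exists>a. \<exists>r>0. \<forall>y\<in>ball x r.
      ((\<lambda>\<alpha>. a \<alpha> * (\<Prod>j\<in>UNIV. (y $ j - x $ j) ^ \<alpha> j)) has_sum y $ i) UNIV"
    by (intro exI[of _ a] exI[of _ 1]) auto
qed

lemma analytic_riemannian_manifold_region:
  assumes "open U" "U \<noteq> {}" "analytic_metric U g"
  shows "analytic_riemannian_manifold (region U g)"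
proof -
  let ?c = "(U, \<lambda>x::R3. x)"
  have tr: "transition ?c ?c x = x" if "x \<in> U" for x
    using that by (simp add: transition_def inv_into_f_f[of "\<lambda>x. x", simplified])
  have an: "real_analytic_on U (\<lambda>x. transition ?c ?c x $ i)" for i
    unfolding real_analytic_on_def
  proof (intro ballI)
    fix x assume "x \<in> U"
    obtain e where e: "e > 0" "ball x e \<subseteq> U" using assms(1) \<open>x \<in> U\<close> by (meson openE)
    obtain a r where ar: "r > 0" "\<forall>y\<in>ball x r.
       ((\<lambda>\<alpha>. a \<alpha> * (\<Prod>i\<in>UNIV. (y $ i - x $ i) ^ \<alpha> i)) has_sum y $ i) UNIV"
      using real_analytic_on_component[of U i] \<open>x \<in> U\<close> unfolding real_analytic_on_def by blast
    show "\<exists>a. \<exists>r>0. \<forall>y\<in>ball x r.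
      ((\<lambda>\<alpha>. a \<alpha> * (\<Prod>j\<in>UNIV. (y $ j - x $ j) ^ \<alpha> j)) has_sum transition ?c ?c y $ i) UNIV"
      by (rule exI[of _ a], rule exI[of _ "min e r"]) (use e ar tr in \<open>auto simp: subset_iff\<close>)
  qed
  have fd: "frechet_derivative (transition ?c ?c) (at x) = (\<lambda>v. v)" if "x \<in> U" for x
  proof -
    have "((\<lambda>x. x) has_derivative (\<lambda>v::R3. v)) (at x)" by (rule has_derivative_ident)
    then have "(transition ?c ?c has_derivative (\<lambda>v. v)) (at x)"
      by (rule has_derivative_transform_within_open[OF _ assms(1) that]) (simp add: tr)
    then show ?thesis by (simp add: frechet_derivative_at[symmetric])
  qed
  have "second_countable (euclidean :: R3 topology)"
  proof -
    obtain B :: "R3 set set" where B: "countable B" "\<And>C. C \<in> B \<Longrightarrow> open C"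
      "\<And>S. open S \<Longrightarrow> \<exists>V. V \<subseteq> B \<and> S = \<Union> V"
      using univ_second_countable by blast
    show ?thesis
      unfolding second_countable_def
    proof (intro exI[of _ B] conjI allI impI)
      fix S and x :: R3 assume "openin euclidean S \<and> x \<in> S"
      moreover from this obtain V where "V \<subseteq> B" "S = \<Union> V"
        using B(3) by auto
      ultimately show "\<exists>V\<in>B. x \<in> V \<and> V \<subseteq> S" by blast
    qed (use B in auto)
  qed
  then have sc: "second_countable (top_of_set U)"
    by (rule second_countable_subtopology)
  show ?thesis
    using assms an
    by (auto simp: analytic_riemannian_manifold_def region_def overlap_def fd tr sc
        Hausdorff_space_subtopology homeomorphic_map_id[unfolded id_def] subtopology_subtopology)
qed


section \<open>Tangent vectors\<close>

definition charts_at :: "'a riem_manifold \<Rightarrow> 'a \<Rightarrow> 'a chart set" where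
  "charts_at M p = {c \<in> atlas M. p \<in> chart_dom c}"

instantiation "fun" :: (type, real_vector) real_vector
begin
definition "r *\<^sub>R f = (\<lambda>x. r *\<^sub>R f x)"
instance
  by standard (auto simp: scaleR_fun_def fun_eq_iff scaleR_add_right scaleR_add_left)
end

text \<open>A tangent vector at \<open>p\<close> is the family of its coordinates in all charts around \<open>p\<close>, related by
  the usual transformation law. Extending the family by \<open>0\<close> to the other charts makes the tangent
  space a three-dimensional subspace of the space of all families, with pointwise operations.\<close>

type_synonym 'a tvec = "'a chart \<Rightarrow> R3"

definition tangent_space :: "'a riem_manifold \<Rightarrow> 'a \<Rightarrow> 'a tvec set" where
  "tangent_space M p = {v. (\<forall>c. c \<notin> charts_at M p \<longrightarrow> v c = 0) \<and>
     (\<forall>c\<in>charts_at M p. \<forall>d\<in>charts_at M p.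
        v d = frechet_derivative (transition c d) (at (chart_map c p)) (v c))}"

text \<open>For tangent vectors the values do not depend on the selected chart.\<close>

definition tinner :: "'a riem_manifold \<Rightarrow> 'a \<Rightarrow> 'a tvec \<Rightarrow> 'a tvec \<Rightarrow> real" where
  "tinner M p u v = (let c = (SOME c. c \<in> charts_at M p) in
     u c \<bullet> (met M c (chart_map c p) *v v c))"

definition tnorm :: "'a riem_manifold \<Rightarrow> 'a \<Rightarrow> 'a tvec \<Rightarrow> real" where
  "tnorm M p v = sqrt (tinner M p v v)"

definition tricci :: "'a riem_manifold \<Rightarrow> 'a \<Rightarrow> 'a tvec \<Rightarrow> 'a tvec" where
  "tricci M p v = (\<lambda>c. if c \<in> charts_at M p
     then ricci_endo (met M c) (chart_map c p) (v c) else 0)"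

text \<open>The orthogonal projection of \<open>y\<close> to the orthogonal complement of the span of \<open>S\<close>.\<close>

definition perp_part :: "'a riem_manifold \<Rightarrow> 'a \<Rightarrow> 'a tvec set \<Rightarrow> 'a tvec \<Rightarrow> 'a tvec" where
  "perp_part M p S y = (THE w. w \<in> tangent_space M p \<and> y - w \<in> span S \<and>
     (\<forall>s\<in>span S. tinner M p w s = 0))"


section \<open>Fields along curves\<close>

definition velocity :: "'a riem_manifold \<Rightarrow> (real \<Rightarrow> 'a) \<Rightarrow> real \<Rightarrow> 'a tvec" where
  "velocity M \<gamma> t = (\<lambda>c. if c \<in> charts_at M (\<gamma> t)
     then vector_derivative (\<lambda>s. chart_map c (\<gamma> s)) (at t) else 0)"

definition cov_deriv ::
    "'a riem_manifold \<Rightarrow> (real \<Rightarrow> 'a) \<Rightarrow> (real \<Rightarrow> 'a tvec) \<Rightarrow> real \<Rightarrow> 'a tvec" where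
  "cov_deriv M \<gamma> V t = (\<lambda>c. if c \<in> charts_at M (\<gamma> t)
     then vector_derivative (\<lambda>s. V s c) (at t)
          + christoffel (met M c) (chart_map c (\<gamma> t)) (velocity M \<gamma> t c) (V t c)
     else 0)"

definition differentiable_field ::
    "'a riem_manifold \<Rightarrow> (real \<Rightarrow> 'a) \<Rightarrow> real set \<Rightarrow> (real \<Rightarrow> 'a tvec) \<Rightarrow> bool" where
  "differentiable_field M \<gamma> I V \<longleftrightarrow>
     (\<forall>t\<in>I. V t \<in> tangent_space M (\<gamma> t) \<and>
        (\<forall>c\<in>charts_at M (\<gamma> t). (\<lambda>s. V s c) differentiable at t))"

definition parallel_field ::
    "'a riem_manifold \<Rightarrow> (real \<Rightarrow> 'a) \<Rightarrow> real set \<Rightarrow> (real \<Rightarrow> 'a tvec) \<Rightarrow> bool" where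
  "parallel_field M \<gamma> I V \<longleftrightarrow>
     differentiable_field M \<gamma> I V \<and> (\<forall>t\<in>I. cov_deriv M \<gamma> V t = 0)"

definition unit_speed_geodesic ::
    "'a riem_manifold \<Rightarrow> real set \<Rightarrow> (real \<Rightarrow> 'a) \<Rightarrow> bool" where
  "unit_speed_geodesic M I \<gamma> \<longleftrightarrow>
     open I \<and> is_interval I \<and> 0 \<in> I \<and> continuous_map (top_of_set I) (mtop M) \<gamma> \<and>
     (\<forall>t\<in>I. \<forall>c\<in>charts_at M (\<gamma> t). (\<lambda>s. chart_map c (\<gamma> s)) differentiable at t) \<and>
     parallel_field M \<gamma> I (velocity M \<gamma>) \<and>
     (\<forall>t\<in>I. tnorm M (\<gamma> t) (velocity M \<gamma> t) = 1)"

text \<open>A \<open>(1,3)\<close>-tensor at a point is given in each chart by its trilinear map; \<open>tensor_cov_deriv\<close> is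
  the covariant derivative along \<open>\<gamma>\<close> of such tensors. Along a geodesic, the \<open>m\<close>-th iterate applied to
  the curvature tensor is the \<open>m\<close>-fold covariant derivative of the tensor in the direction \<open>\<gamma>'\<close>.\<close>

type_synonym 'a tensor13 = "'a chart \<Rightarrow> R3 \<Rightarrow> R3 \<Rightarrow> R3 \<Rightarrow> R3"

definition curvature_tensor :: "'a riem_manifold \<Rightarrow> 'a \<Rightarrow> 'a tensor13" where
  "curvature_tensor M p = (\<lambda>c. if c \<in> charts_at M p
     then riemann (met M c) (chart_map c p) else (\<lambda>u v w. 0))"

definition tensor_cov_deriv ::
    "'a riem_manifold \<Rightarrow> (real \<Rightarrow> 'a) \<Rightarrow> (real \<Rightarrow> 'a tensor13) \<Rightarrow> real \<Rightarrow> 'a tensor13" where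
  "tensor_cov_deriv M \<gamma> T t = (\<lambda>c u v w. if c \<in> charts_at M (\<gamma> t)
     then let G = christoffel (met M c) (chart_map c (\<gamma> t)) (velocity M \<gamma> t c) in
          vector_derivative (\<lambda>s. T s c u v w) (at t)
          + G (T t c u v w) - T t c (G u) v w - T t c u (G v) w - T t c u v (G w)
     else 0)"


section \<open>Chaotic curvature and exceptional geodesics\<close>

text \<open>A parallel field \<open>X\<close> along \<open>\<gamma>\<close> is the parallel transport of \<open>X 0\<close>.\<close>

definition Yperp ::
    "'a riem_manifold \<Rightarrow> (real \<Rightarrow> 'a) \<Rightarrow> (real \<Rightarrow> 'a tvec) \<Rightarrow> real \<Rightarrow> 'a tvec" where
  "Yperp M \<gamma> X t = perp_part M (\<gamma> t) {velocity M \<gamma> t, X t} (tricci M (\<gamma> t) (X t))"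

definition chaotic_curvature :: "'a riem_manifold \<Rightarrow> nat \<Rightarrow> bool" where
  "chaotic_curvature M k \<longleftrightarrow>
     (\<forall>p \<in> topspace (mtop M). \<forall>I \<gamma> X.
        unit_speed_geodesic M I \<gamma> \<and> \<gamma> 0 = p \<and> parallel_field M \<gamma> I X \<and>
        tnorm M p (X 0) = 1 \<and> tinner M p (X 0) (velocity M \<gamma> 0) = 0 \<longrightarrow>
        (\<Sum>j\<le>k. tnorm M p ((cov_deriv M \<gamma> ^^ j) (Yperp M \<gamma> X) 0)) \<noteq> 0)"

definition exc_operator ::
    "'a riem_manifold \<Rightarrow> (real \<Rightarrow> 'a) \<Rightarrow> nat \<Rightarrow> 'a tvec \<Rightarrow> 'a tvec" where
  "exc_operator M \<gamma> q v = (\<lambda>c. if c \<in> charts_at M (\<gamma> 0)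
     then (tensor_cov_deriv M \<gamma> ^^ (q - 2)) (\<lambda>t. curvature_tensor M (\<gamma> t)) 0 c
            (v c) (velocity M \<gamma> 0 c) (velocity M \<gamma> 0 c)
     else 0)"

definition exceptional_geodesic ::
    "'a riem_manifold \<Rightarrow> nat \<Rightarrow> real set \<Rightarrow> (real \<Rightarrow> 'a) \<Rightarrow> bool" where
  "exceptional_geodesic M k I \<gamma> \<longleftrightarrow>
     unit_speed_geodesic M I \<gamma> \<and>
     (\<exists>V. subspace V \<and> V \<subseteq> tangent_space M (\<gamma> 0) \<and> dim V = 2 \<and> velocity M \<gamma> 0 \<in> V \<and>
        (\<forall>q\<in>{2..k}. exc_operator M \<gamma> q ` V \<subseteq> V))"

definition exceptional_manifold :: "'a riem_manifold \<Rightarrow> nat \<Rightarrow> bool" where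
  "exceptional_manifold M k \<longleftrightarrow> (\<exists>I \<gamma>. exceptional_geodesic M k I \<gamma>)"

end

theory Submission
  imports Defs
begin

text \<open>
  Along a geodesic \<open>\<gamma>\<close> with parallel orthonormal fields \<open>X, Z \<bottom> \<gamma>'\<close> one has \<open>Y\<^sup>\<bottom> = Ric(Z, X) Z\<close>, so
  \<open>\<nabla>\<^sup>j Y\<^sup>\<bottom> = \<phi>\<^sub>j Z\<close> with \<open>\<phi>\<^sub>j\<close> the \<open>j\<close>-th derivative of \<open>Ric(Z, X)\<close>. Each \<open>\<phi>\<^sub>j\<close> is a universal expression in the
  jet of order \<open>j + 2\<close> of the metric and in the frame \<open>(\<gamma>', X, Z)\<close>: the chaotic curvature condition of order
  \<open>k\<close> at a point says that no orthonormal frame is a common zero of \<open>\<phi>\<^sub>0, \<dots>, \<phi>\<^sub>k\<close>.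

  (1) If \<open>\<gamma>'\<close> is normal to a circular section of the Ricci form then \<open>\<phi>\<^sub>0 = 0\<close> for all \<open>X, Z\<close>, and
  \<open>\<phi>\<^sub>1\<close> changes sign when \<open>(X, Z)\<close> is replaced by \<open>(Z, -X)\<close>, hence vanishes for some \<open>X\<close>. The plane spanned by \<open>\<gamma>'\<close>
  and \<open>X\<close> is then invariant, since \<open>\<R>(X, \<gamma>')\<gamma>'\<close> has the component \<open>Ric(Z, X)\<close> along \<open>Z\<close>.

  (2) and (3) use conformal changes of the metric. A term \<open>c (w \<bullet> x)\<^bsup>j + 2\<^esup>\<close> in the conformal factor alters \<open>\<phi>\<^sub>j\<close> at \<open>0\<close>
  by a multiple of \<open>c (w \<bullet> \<gamma>')\<^sup>j (w \<bullet> X) (w \<bullet> Z)\<close> and leaves \<open>\<phi>\<^sub>0, \<dots>, \<phi>\<^bsub>j - 1\<^esub>\<close> unchanged. For \<open>k = 2\<close> the three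
  equations on the three-dimensional frame manifold can be given no common zero, or a nondegenerate one, which persists
  by Brouwer's theorem. For \<open>k = 3\<close> there are four equations, and the conditions that some frame satisfies them
  confine the coefficients to a null set.
\<close>

section \<open>Smooth functions\<close>

text \<open>The expressions \<open>FE j\<close> are kept as syntax trees rather than as functions.
  One structural induction each then yields differentiability, continuity in the jet and the frame,
  affine dependence on the top order of the jet, and homogeneity in the number of derivatives;
  iterated covariant derivatives never have to be expanded. Openness statements come from
  compactness: a limit of zero frames for convergent jets is a zero frame of the limit
  (\<open>zero_frame_limit\<close>).

  The obstacle in (2) is that \<open>FE 2\<close> contains products of second derivatives of the
  metric. Scaling the second order part by a small \<epsilon> leaves the equation for
  \<open>FE 0\<close> the same up to a factor and makes these products disappear in the limit, so
  that only three explicit multilinear forms have to be studied. The obstacle in (3) is that one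
  direction w controls only the frames none of whose vectors is orthogonal to w. Seven points of the
  moment curve reach every frame, and their perturbations are added one at a time, each too small to
  destroy what the previous ones achieved.\<close>

lemma partials_append: "partials ks (partials ls f) = partials (ks @ ls) f"
  by (induction ks) auto

lemma smooth_on_subset: "smooth_on U f \<Longrightarrow> V \<subseteq> U \<Longrightarrow> smooth_on V f"
  by (auto simp: smooth_on_def)

lemma smooth_on_partials: "smooth_on U f \<Longrightarrow> smooth_on U (partials ks f)"
  by (simp add: smooth_on_def partials_append)

lemma linear_R3_sum:
  fixes L :: "R3 \<Rightarrow> 'b::real_vector"
  assumes "linear L"
  shows "L u = (\<Sum>i\<in>UNIV. u $ i *\<^sub>R L (axis i 1))"
proof -
  have "L u = L (\<Sum>i\<in>UNIV. u $ i *\<^sub>R axis i 1)"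
    using basis_expansion[of u] by (simp add: scalar_mult_eq_scaleR)
  then show ?thesis
    using assms by (simp add: linear_sum linear_scale)
qed

lemma has_derivative_partials:
  assumes "smooth_on U f" "x \<in> U"
  shows "(partials ks f has_derivative (\<lambda>u. \<Sum>l\<in>UNIV. u $ l * partials (l # ks) f x)) (at x)"
proof -
  have d: "partials ks f differentiable at x"
    by (rule assms(1)[unfolded smooth_on_def, rule_format, OF assms(2)])
  have "frechet_derivative (partials ks f) (at x)
      = (\<lambda>u. \<Sum>l\<in>UNIV. u $ l * partials (l # ks) f x)"
  proof
    fix u
    show "frechet_derivative (partials ks f) (at x) u = (\<Sum>l\<in>UNIV. u $ l * partials (l # ks) f x)"
      using linear_R3_sum[OF linear_frechet_derivative[OF d], of u] by simp
  qed
  then show ?thesis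
    using d unfolding frechet_derivative_works by simp
qed

lemma continuous_on_partials: "smooth_on U f \<Longrightarrow> continuous_on U (partials ks f)"
  by (meson continuous_at_imp_continuous_on has_derivative_continuous has_derivative_partials)

lemma partials_eqI:
  assumes "(partials ks f has_derivative D) (at x)"
  shows "partials (l # ks) f x = D (axis l 1)"
  using frechet_derivative_at[OF assms] by simp

lemma frechet_derivative_cong_open:
  assumes "open U" "x \<in> U" "\<And>y. y \<in> U \<Longrightarrow> f y = g y"
  shows "frechet_derivative f (at x) = frechet_derivative g (at x)"
proof -
  have "(f has_derivative D) (at x) \<longleftrightarrow> (g has_derivative D) (at x)" for D
    using has_derivative_transform_within_open[OF _ assms(1,2), of f D UNIV g]
      has_derivative_transform_within_open[OF _ assms(1,2), of g D UNIV f] assms(3) by auto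
  then show ?thesis by (simp add: frechet_derivative_def)
qed

lemma partials_cong:
  assumes "open U" "x \<in> U" "\<And>y. y \<in> U \<Longrightarrow> f y = g y"
  shows "partials ks f x = partials ks g x"
proof -
  have "\<forall>x\<in>U. partials ks f x = partials ks g x"
  proof (induction ks)
    case (Cons l ks)
    then show ?case
      using frechet_derivative_cong_open[OF assms(1), of _ "partials ks f" "partials ks g"] by auto
  qed (use assms in auto)
  with assms(2) show ?thesis by blast
qed

lemma smooth_on_cong:
  assumes "open U" "smooth_on U f" "\<And>y. y \<in> U \<Longrightarrow> f y = g y"
  shows "smooth_on U g"
  unfolding smooth_on_def
proof (intro allI ballI)
  fix ks x assume x: "x \<in> U"
  have "(partials ks g has_derivative (\<lambda>u. \<Sum>l\<in>UNIV. u $ l * partials (l # ks) f x)) (at x)"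
    by (rule has_derivative_transform_within_open[OF has_derivative_partials[OF assms(2) x] assms(1) x])
       (use assms partials_cong[OF assms(1) _ assms(3)] in auto)
  then show "partials ks g differentiable at x" by (rule differentiableI)
qed

text \<open>A family of candidates for all iterated partial derivatives, closed under differentiation,
  is the family of partial derivatives.\<close>

lemma partials_unique:
  assumes "open U" "\<And>x. x \<in> U \<Longrightarrow> F [] x = f x"
    and D: "\<And>ks x. x \<in> U \<Longrightarrow> (F ks has_derivative (\<lambda>u. \<Sum>l\<in>UNIV. u $ l * F (l # ks) x)) (at x)"
  shows "smooth_on U f" "\<And>ks x. x \<in> U \<Longrightarrow> partials ks f x = F ks x"
proof -
  have A: "\<forall>x\<in>U. partials ks f x = F ks x" for ks
  proof (induction ks)
    case (Cons i ks)
    show ?case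
    proof
      fix x assume x: "x \<in> U"
      have "frechet_derivative (partials ks f) (at x) = frechet_derivative (F ks) (at x)"
        by (rule frechet_derivative_cong_open[OF assms(1) x]) (use Cons in auto)
      also have "\<dots> = (\<lambda>u. \<Sum>l\<in>UNIV. u $ l * F (l # ks) x)"
        using frechet_derivative_at[OF D[OF x]] by simp
      finally show "partials (i # ks) f x = F (i # ks) x"
        by (simp add: axis_def if_distrib[of "\<lambda>c. c * _"] cong: if_cong)
    qed
  qed (use assms in auto)
  then show "\<And>ks x. x \<in> U \<Longrightarrow> partials ks f x = F ks x" by blast
  show "smooth_on U f"
    unfolding smooth_on_def
  proof (intro allI ballI)
    fix ks x assume x: "x \<in> U"
    have "(partials ks f has_derivative (\<lambda>u. \<Sum>l\<in>UNIV. u $ l * F (l # ks) x)) (at x)"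
      by (rule has_derivative_transform_within_open[OF D[OF x] assms(1) x]) (use A in auto)
    then show "partials ks f differentiable at x" by (rule differentiableI)
  qed
qed

lemma
  assumes "open U" "smooth_on U f" "smooth_on U g"
  shows smooth_on_lincomb: "smooth_on U (\<lambda>x. a * f x + b * g x)"
    and partials_lincomb: "x \<in> U \<Longrightarrow>
      partials ks (\<lambda>x. a * f x + b * g x) x = a * partials ks f x + b * partials ks g x"
proof -
  let ?F = "\<lambda>ks x. a * partials ks f x + b * partials ks g x"
  have D: "(?F ks has_derivative (\<lambda>u. \<Sum>l\<in>UNIV. u $ l * ?F (l # ks) x)) (at x)"
    if "x \<in> U" for ks x
    by (rule derivative_eq_intros has_derivative_partials assms that refl)+
       (simp add: fun_eq_iff sum.distrib sum_distrib_left distrib_left mult.left_commute)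
  show "smooth_on U (\<lambda>x. a * f x + b * g x)"
    by (rule partials_unique(1)[OF assms(1), of ?F]) (use D in auto)
  show "x \<in> U \<Longrightarrow> partials ks (\<lambda>x. a * f x + b * g x) x = ?F ks x"
    by (rule partials_unique(2)[OF assms(1), of ?F]) (use D in auto)
qed

lemma partials_diff:
  assumes "open U" "smooth_on U f" "smooth_on U g" "x \<in> U"
  shows "partials ks (\<lambda>x. f x - g x) x = partials ks f x - partials ks g x"
  using partials_lincomb[OF assms, of ks 1 "-1"] by simp

lemma has_derivative_inner_power_fact:
  "((\<lambda>x. (w \<bullet> x) ^ Suc d / fact (Suc d)) has_derivative (\<lambda>u. (w \<bullet> u) * ((w \<bullet> x) ^ d / fact d)))
    (at (x::'a::real_inner))"
proof -
  have "((\<lambda>x. (w \<bullet> x) ^ Suc d) has_derivative (\<lambda>u. real (Suc d) * (w \<bullet> u) * (w \<bullet> x) ^ d)) (at x)"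
    by (rule derivative_eq_intros refl)+ simp
  from has_derivative_mult_right[OF this, of "1 / fact (Suc d)"]
  have "((\<lambda>x. (w \<bullet> x) ^ Suc d / fact (Suc d)) has_derivative
      (\<lambda>u. real (Suc d) * (w \<bullet> u) * (w \<bullet> x) ^ d / fact (Suc d))) (at x)"
    by (simp del: power_Suc fact_Suc of_nat_Suc)
  moreover have "real (Suc d) * c * e / fact (Suc d) = c * (e / fact d)" for c e :: real
    by (simp add: fact_Suc del: of_nat_Suc)
  ultimately show ?thesis by (simp del: power_Suc fact_Suc of_nat_Suc)
qed

text \<open>This is the iterated partial derivative along \<open>ks\<close> of (w . x)^d / d!.
  Thanks to the factorial each derivative only lowers the exponent and multiplies by a component of
  w, so at the origin the jet sits in the single order d.\<close>

definition linpow :: "R3 \<Rightarrow> nat \<Rightarrow> 3 list \<Rightarrow> R3 \<Rightarrow> real" where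
  "linpow w d ks x = (if length ks \<le> d then
     prod_list (map (($) w) ks) * ((w \<bullet> x) ^ (d - length ks) / fact (d - length ks)) else 0)"

lemma
  shows smooth_on_linpow: "smooth_on U (\<lambda>x. (w \<bullet> x) ^ d / fact d)"
    and partials_linpow: "partials ks (\<lambda>x. (w \<bullet> x) ^ d / fact d) x = linpow w d ks x"
proof -
  have D: "(linpow w d ks has_derivative (\<lambda>u. \<Sum>l\<in>UNIV. u $ l * linpow w d (l # ks) x)) (at x)"
    for ks x
  proof (cases "length ks < d")
    case True
    then obtain e where e: "d - length ks = Suc e" "d - Suc (length ks) = e"
      by (metis Suc_diff_Suc)
    have eq: "linpow w d ks = (\<lambda>x. prod_list (map (($) w) ks) * ((w \<bullet> x) ^ Suc e / fact (Suc e)))"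
      using True e by (auto simp: linpow_def fun_eq_iff simp del: fact_Suc power_Suc)
    have "(linpow w d ks has_derivative
        (\<lambda>u. prod_list (map (($) w) ks) * ((w \<bullet> u) * ((w \<bullet> x) ^ e / fact e)))) (at x)"
      unfolding eq by (rule has_derivative_mult_right has_derivative_inner_power_fact)+
    moreover have "(\<Sum>l\<in>UNIV. u $ l * linpow w d (l # ks) x)
        = prod_list (map (($) w) ks) * ((w \<bullet> u) * ((w \<bullet> x) ^ e / fact e))" for u
    proof -
      let ?c = "prod_list (map (($) w) ks) * ((w \<bullet> x) ^ e / fact e)"
      have "linpow w d (l # ks) x = w $ l * ?c" for l
        using True by (simp add: linpow_def e)
      then have "(\<Sum>l\<in>UNIV. u $ l * linpow w d (l # ks) x) = (\<Sum>l\<in>UNIV. w $ l * u $ l) * ?c"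
        by (simp only: sum_distrib_right) (rule sum.cong, simp_all add: mult_ac)
      then show ?thesis by (simp add: inner_vec_def)
    qed
    ultimately show ?thesis by simp
  next
    case False
    then have "linpow w d ks = (\<lambda>x. if length ks = d then prod_list (map (($) w) ks) else 0)"
      "linpow w d (l # ks) x = 0" for l
      by (auto simp: linpow_def fun_eq_iff)
    then show ?thesis by simp
  qed
  have "smooth_on UNIV (\<lambda>x. (w \<bullet> x) ^ d / fact d)"
    by (rule partials_unique(1)[where F="linpow w d"]) (use D in \<open>auto simp: linpow_def\<close>)
  then show "smooth_on U (\<lambda>x. (w \<bullet> x) ^ d / fact d)" by (rule smooth_on_subset) simp
  show "partials ks (\<lambda>x. (w \<bullet> x) ^ d / fact d) x = linpow w d ks x"
    by (rule partials_unique(2)[where F="linpow w d" and U=UNIV]) (use D in \<open>auto simp: linpow_def\<close>)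
qed

lemma smooth_on_const: "smooth_on U (\<lambda>x. c)" and partials_const: "partials ks (\<lambda>x. c) x = (if ks = [] then c else 0)"
proof -
  have D: "((\<lambda>x. if ks = [] then c else 0) has_derivative
      (\<lambda>u. \<Sum>l\<in>UNIV. u $ l * (if l # ks = [] then c else 0))) (at x)" for ks :: "3 list" and x :: R3
    by simp
  have "smooth_on UNIV (\<lambda>x. c)"
    by (rule partials_unique(1)[where F="\<lambda>ks x. if ks = [] then c else 0"]) (use D in auto)
  then show "smooth_on U (\<lambda>x. c)" by (rule smooth_on_subset) simp
  show "partials ks (\<lambda>x. c) x = (if ks = [] then c else 0)"
    by (rule partials_unique(2)[where F="\<lambda>ks x. if ks = [] then c else 0" and U=UNIV]) (use D in auto)
qed

lemma
  shows smooth_on_sum_list: "(\<And>p. p \<in> set ps \<Longrightarrow> smooth_on U (f p)) \<Longrightarrow> open U \<Longrightarrow>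
      smooth_on U (\<lambda>x. \<Sum>p\<leftarrow>ps. f p x)"
    and partials_sum_list: "(\<And>p. p \<in> set ps \<Longrightarrow> smooth_on U (f p)) \<Longrightarrow> open U \<Longrightarrow> x \<in> U \<Longrightarrow>
      partials ks (\<lambda>x. \<Sum>p\<leftarrow>ps. f p x) x = (\<Sum>p\<leftarrow>ps. partials ks (f p) x)"
proof -
  have "(\<forall>p\<in>set ps. smooth_on U (f p)) \<longrightarrow> open U \<longrightarrow> smooth_on U (\<lambda>x. \<Sum>p\<leftarrow>ps. f p x) \<and>
     (\<forall>ks. \<forall>x\<in>U. partials ks (\<lambda>x. \<Sum>p\<leftarrow>ps. f p x) x = (\<Sum>p\<leftarrow>ps. partials ks (f p) x))"
  proof (induction ps)
    case Nil
    then show ?case by (auto simp: smooth_on_const partials_const)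
  next
    case (Cons p ps)
    show ?case
    proof (intro impI conjI allI ballI)
      assume *: "\<forall>p\<in>set (p # ps). smooth_on U (f p)" "open U"
      then have 1: "smooth_on U (f p)" "smooth_on U (\<lambda>x. \<Sum>p\<leftarrow>ps. f p x)" using Cons by auto
      show "smooth_on U (\<lambda>x. \<Sum>p\<leftarrow>p # ps. f p x)"
        using smooth_on_lincomb[OF *(2) 1, of 1 1] by simp
      fix ks x assume "x \<in> U"
      then show "partials ks (\<lambda>x. \<Sum>p\<leftarrow>p # ps. f p x) x = (\<Sum>p\<leftarrow>p # ps. partials ks (f p) x)"
        using partials_lincomb[OF *(2) 1, of x ks 1 1] Cons * by simp
    qed
  qed
  then show "(\<And>p. p \<in> set ps \<Longrightarrow> smooth_on U (f p)) \<Longrightarrow> open U \<Longrightarrow>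
      smooth_on U (\<lambda>x. \<Sum>p\<leftarrow>ps. f p x)"
    "(\<And>p. p \<in> set ps \<Longrightarrow> smooth_on U (f p)) \<Longrightarrow> open U \<Longrightarrow> x \<in> U \<Longrightarrow>
      partials ks (\<lambda>x. \<Sum>p\<leftarrow>ps. f p x) x = (\<Sum>p\<leftarrow>ps. partials ks (f p) x)" by auto
qed

subsection \<open>Symmetry of second derivatives\<close>

lemma partials_line_DERIV:
  assumes "smooth_on U f" "y + s *\<^sub>R axis i 1 \<in> U"
  shows "((\<lambda>s. partials ks f (y + s *\<^sub>R axis i 1)) has_real_derivative
    partials (i # ks) f (y + s *\<^sub>R axis i 1)) (at s)"
proof -
  have "((\<lambda>s. partials ks f (y + s *\<^sub>R axis i 1)) has_derivative
      (\<lambda>t. \<Sum>l\<in>UNIV. (t *\<^sub>R axis i 1) $ l * partials (l # ks) f (y + s *\<^sub>R axis i 1))) (at s)"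
    by (rule has_derivative_compose[where f="\<lambda>s. y + s *\<^sub>R axis i 1" and g="partials ks f",
          OF _ has_derivative_partials[OF assms]]) (rule derivative_eq_intros refl | simp)+
  moreover have "(\<Sum>l\<in>UNIV. (t *\<^sub>R axis i 1) $ l * partials (l # ks) f z) = t * partials (i # ks) f z"
    for t z by (simp add: axis_def if_distrib[of "\<lambda>c. c * _"] if_distrib[of "\<lambda>c. _ * c"] cong: if_cong)
  ultimately show ?thesis
    by (simp add: has_field_derivative_def mult_commute_abs)
qed

text \<open>The mean value theorem is applied first in direction i, to a difference taken in
  direction j, and then in direction j to the resulting partial derivative. The second difference is
  symmetric in i and j while the right side is not; \<open>partials_2_commute\<close> exploits
  this.\<close>

lemma second_difference_mean_value:
  fixes x :: R3
  assumes f: "smooth_on U f" and U: "\<And>s t. \<lbrakk>0 \<le> s; s \<le> h; 0 \<le> t; t \<le> h\<rbrakk> \<Longrightarrow>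
      x + s *\<^sub>R axis i 1 + t *\<^sub>R axis j 1 \<in> U" and h: "h > 0"
  obtains s t where "0 \<le> s" "s \<le> h" "0 \<le> t" "t \<le> h"
    "f (x + h *\<^sub>R axis i 1 + h *\<^sub>R axis j 1) - f (x + h *\<^sub>R axis i 1) - f (x + h *\<^sub>R axis j 1) + f x
      = h * h * partials [j, i] f (x + s *\<^sub>R axis i 1 + t *\<^sub>R axis j 1)"
proof -
  define \<phi> where "\<phi> s = f (x + h *\<^sub>R axis j 1 + s *\<^sub>R axis i 1) - f (x + s *\<^sub>R axis i 1)" for s
  have U': "x + h *\<^sub>R axis j 1 + s *\<^sub>R axis i 1 \<in> U" "x + s *\<^sub>R axis i 1 \<in> U" if "0 \<le> s" "s \<le> h" for s
    using U[of s h] U[of s 0] that h by (auto simp: add_ac)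
  have "(\<phi> has_real_derivative partials [i] f (x + h *\<^sub>R axis j 1 + s *\<^sub>R axis i 1)
      - partials [i] f (x + s *\<^sub>R axis i 1)) (at s)" if "0 \<le> s" "s \<le> h" for s
    unfolding \<phi>_def
    by (rule DERIV_diff partials_line_DERIV[OF f, of _ _ _ "[]", simplified partials.simps(1)] U' that)+
  from MVT2[OF h this] obtain s where s: "0 < s" "s < h"
    "\<phi> h - \<phi> 0 = h * (partials [i] f (x + h *\<^sub>R axis j 1 + s *\<^sub>R axis i 1)
      - partials [i] f (x + s *\<^sub>R axis i 1))" by auto
  have "((\<lambda>t. partials [i] f (x + s *\<^sub>R axis i 1 + t *\<^sub>R axis j 1)) has_real_derivative
      partials [j, i] f (x + s *\<^sub>R axis i 1 + t *\<^sub>R axis j 1)) (at t)" if "0 \<le> t" "t \<le> h" for t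
    by (rule partials_line_DERIV[OF f]) (use U s that in auto)
  from MVT2[OF h this] obtain t where t: "0 < t" "t < h"
    "partials [i] f (x + s *\<^sub>R axis i 1 + h *\<^sub>R axis j 1) - partials [i] f (x + s *\<^sub>R axis i 1)
      = h * partials [j, i] f (x + s *\<^sub>R axis i 1 + t *\<^sub>R axis j 1)" by auto
  show ?thesis
  proof (rule that[of s t])
    have "x + h *\<^sub>R axis j 1 + s *\<^sub>R axis i 1 = x + s *\<^sub>R axis i 1 + h *\<^sub>R axis j 1"
      "x + h *\<^sub>R axis j 1 + h *\<^sub>R axis i 1 = x + h *\<^sub>R axis i 1 + h *\<^sub>R axis j 1"
      by (simp_all add: add_ac)
    then show "f (x + h *\<^sub>R axis i 1 + h *\<^sub>R axis j 1) - f (x + h *\<^sub>R axis i 1)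
        - f (x + h *\<^sub>R axis j 1) + f x
      = h * h * partials [j, i] f (x + s *\<^sub>R axis i 1 + t *\<^sub>R axis j 1)"
      using s(3) t(3) by (simp add: \<phi>_def algebra_simps)
  qed (use s t in auto)
qed

lemma partials_2_commute:
  assumes U: "open U" "x \<in> U" and f: "smooth_on U f"
  shows "partials [i, j] f x = partials [j, i] f x"
proof (rule ccontr)
  assume "partials [i, j] f x \<noteq> partials [j, i] f x"
  then have e: "\<bar>partials [i, j] f x - partials [j, i] f x\<bar> / 2 > 0" (is "?e > 0") by simp
  have "\<exists>d>0. \<forall>y. dist y x < d \<longrightarrow> y \<in> U \<and> \<bar>partials [a, b] f y - partials [a, b] f x\<bar> < ?e" for a b
  proof -
    have "isCont (partials [a, b] f) x"
      using continuous_on_partials[OF f] U continuous_on_eq_continuous_at by blast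
    then obtain d1 where d1: "d1 > 0" "\<And>y. dist y x < d1 \<Longrightarrow> dist (partials [a, b] f y) (partials [a, b] f x) < ?e"
      unfolding continuous_at_eps_delta using e by meson
    obtain d2 where d2: "d2 > 0" "ball x d2 \<subseteq> U" using U by (meson openE)
    show ?thesis
      by (rule exI[of _ "min d1 d2"]) (use d1 d2 in \<open>auto simp: dist_real_def dist_commute subset_iff\<close>)
  qed
  from this[of i j] this[of j i] obtain d1 d2 where d12: "d1 > 0" "d2 > 0"
    "\<And>y. dist y x < d1 \<Longrightarrow> y \<in> U \<and> \<bar>partials [i, j] f y - partials [i, j] f x\<bar> < ?e"
    "\<And>y. dist y x < d2 \<Longrightarrow> y \<in> U \<and> \<bar>partials [j, i] f y - partials [j, i] f x\<bar> < ?e" by blast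
  define d where "d = min d1 d2"
  have d: "d > 0" "\<And>y. dist y x < d \<Longrightarrow> y \<in> U"
    "\<And>y. dist y x < d \<Longrightarrow> \<bar>partials [i, j] f y - partials [i, j] f x\<bar> < ?e"
    "\<And>y. dist y x < d \<Longrightarrow> \<bar>partials [j, i] f y - partials [j, i] f x\<bar> < ?e"
    using d12 by (auto simp: d_def)
  define h where "h = d / 3"
  have h: "h > 0" using d by (simp add: h_def)
  have near: "dist (x + s *\<^sub>R axis a 1 + t *\<^sub>R axis b 1) x < d"
    if "0 \<le> s" "s \<le> h" "0 \<le> t" "t \<le> h" for s t and a b :: 3
  proof -
    have "norm (s *\<^sub>R axis a 1 + t *\<^sub>R axis b (1::real)) \<le> s + t"
      using norm_triangle_ineq[of "s *\<^sub>R axis a (1::real)" "t *\<^sub>R axis b 1"] that by simp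
    then show ?thesis using that d(1) by (simp add: dist_norm h_def add.assoc)
  qed
  obtain s t where st: "0 \<le> s" "s \<le> h" "0 \<le> t" "t \<le> h"
    "f (x + h *\<^sub>R axis i 1 + h *\<^sub>R axis j 1) - f (x + h *\<^sub>R axis i 1) - f (x + h *\<^sub>R axis j 1) + f x
      = h * h * partials [j, i] f (x + s *\<^sub>R axis i 1 + t *\<^sub>R axis j 1)"
    using second_difference_mean_value[OF f _ h, of x i j] near d(2) by metis
  obtain s' t' where st': "0 \<le> s'" "s' \<le> h" "0 \<le> t'" "t' \<le> h"
    "f (x + h *\<^sub>R axis j 1 + h *\<^sub>R axis i 1) - f (x + h *\<^sub>R axis j 1) - f (x + h *\<^sub>R axis i 1) + f x
      = h * h * partials [i, j] f (x + s' *\<^sub>R axis j 1 + t' *\<^sub>R axis i 1)"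
    using second_difference_mean_value[OF f _ h, of x j i] near d(2) by metis
  have "x + h *\<^sub>R axis j 1 + h *\<^sub>R axis i 1 = x + h *\<^sub>R axis i 1 + h *\<^sub>R axis j 1" by (simp add: add_ac)
  \<comment> \<open>One second difference equals h^2 times either mixed partial, at points close to
    x. Both partials stay within \<open>?e\<close>, half of their distance at x, of their values
    there, so they cannot agree.\<close>
  from st(5) st'(5)[unfolded this] have "h * h * partials [j, i] f (x + s *\<^sub>R axis i 1 + t *\<^sub>R axis j 1)
      = h * h * partials [i, j] f (x + s' *\<^sub>R axis j 1 + t' *\<^sub>R axis i 1)"
    by linarith
  with h have "partials [j, i] f (x + s *\<^sub>R axis i 1 + t *\<^sub>R axis j 1)
      = partials [i, j] f (x + s' *\<^sub>R axis j 1 + t' *\<^sub>R axis i 1)" by (simp del: partials.simps)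
  with d(3)[OF near[OF st'(1-4), of j i]] d(4)[OF near[OF st(1-4), of i j]] show False
    by argo
qed

lemma partials_swap:
  assumes "open U" "x \<in> U" "smooth_on U f"
  shows "partials (i # j # ks) f x = partials (j # i # ks) f x"
  using partials_2_commute[OF assms(1,2) smooth_on_partials[OF assms(3), of ks]] by simp

section \<open>Real analytic functions are smooth\<close>

definition mono3 :: "R3 \<Rightarrow> R3 \<Rightarrow> (3 \<Rightarrow> nat) \<Rightarrow> real" where
  "mono3 x y \<alpha> = (\<Prod>i\<in>UNIV. (y $ i - x $ i) ^ \<alpha> i)"

text \<open>Differentiation and multiplication by a coordinate act on coefficient families through
  this injective shift, whose range consists of the multi-indices with positive i-th entry.\<close>

definition upd :: "3 \<Rightarrow> (3 \<Rightarrow> nat) \<Rightarrow> (3 \<Rightarrow> nat)" where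
  "upd i \<alpha> = \<alpha>(i := Suc (\<alpha> i))"

lemma upd_inj: "inj (upd i)"
  by (auto simp: inj_def upd_def fun_eq_iff split: if_splits)

lemma range_upd: "range (upd i) = {\<alpha>. \<alpha> i > 0}"
proof (intro equalityI subsetI)
  fix \<alpha> :: "3 \<Rightarrow> nat" assume "\<alpha> \<in> {\<alpha>. \<alpha> i > 0}"
  then have "\<alpha> = upd i (\<alpha>(i := \<alpha> i - 1))" by (auto simp: upd_def)
  then show "\<alpha> \<in> range (upd i)" by blast
qed (auto simp: upd_def)

lemma prod_3: "prod f (UNIV :: 3 set) = f 1 * f 2 * (f 3 :: 'a::comm_monoid_mult)"
  unfolding UNIV_3 by (simp add: mult_ac)

lemma mono3_upd: "mono3 x y (upd i \<alpha>) = (y $ i - x $ i) * mono3 x y \<alpha>"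
proof -
  have "mono3 x y (upd i \<alpha>) = (\<Prod>j\<in>UNIV. (if j = i then y $ i - x $ i else 1) * (y $ j - x $ j) ^ \<alpha> j)"
    unfolding mono3_def by (rule prod.cong) (auto simp: upd_def)
  then show ?thesis by (simp add: prod.distrib mono3_def)
qed

lemma has_derivative_mono3:
  "((\<lambda>y. mono3 x y \<alpha>) has_derivative
    (\<lambda>u. \<Sum>i\<in>UNIV. u $ i * (real (\<alpha> i) * mono3 x y (\<alpha>(i := \<alpha> i - 1))))) (at y)"
proof -
  have "((\<lambda>y. \<Prod>i\<in>UNIV. (y $ i - x $ i) ^ \<alpha> i) has_derivative
    (\<lambda>u. \<Sum>i\<in>UNIV. (real (\<alpha> i) * (u $ i) * (y $ i - x $ i) ^ (\<alpha> i - 1)) *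
       (\<Prod>j\<in>UNIV - {i}. (y $ j - x $ j) ^ \<alpha> j))) (at y)"
  proof (rule has_derivative_prod)
    fix i :: 3
    have "((\<lambda>y. y $ i - x $ i) has_derivative (\<lambda>u. u $ i - 0)) (at y)"
      by (intro has_derivative_diff has_derivative_const bounded_linear.has_derivative[OF bounded_linear_vec_nth] has_derivative_ident)
    from has_derivative_power[OF this, of "\<alpha> i"]
    show "((\<lambda>y. (y $ i - x $ i) ^ \<alpha> i) has_derivative (\<lambda>u. real (\<alpha> i) * (u $ i) * (y $ i - x $ i) ^ (\<alpha> i - 1))) (at y)"
      by (simp add: mult_ac)
  qed
  moreover have "mono3 x y (\<alpha>(i := \<alpha> i - 1)) = (y $ i - x $ i) ^ (\<alpha> i - 1) *
       (\<Prod>j\<in>UNIV - {i}. (y $ j - x $ j) ^ \<alpha> j)" for i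
    unfolding mono3_def by (subst prod.remove[of _ i]) auto
  ultimately show ?thesis
    by (simp add: mono3_def[symmetric] mult_ac)
qed

lemma abs_mono3_le:
  assumes "\<And>i. \<bar>y $ i - x $ i\<bar> \<le> \<rho>"
  shows "\<bar>mono3 x y \<alpha>\<bar> \<le> \<rho> ^ (\<alpha> 1 + \<alpha> 2 + \<alpha> 3)"
proof -
  have "\<bar>mono3 x y \<alpha>\<bar> = (\<Prod>i\<in>UNIV. \<bar>y $ i - x $ i\<bar> ^ \<alpha> i)"
    by (simp add: mono3_def abs_prod power_abs)
  also have "\<dots> \<le> (\<Prod>i\<in>UNIV. \<rho> ^ \<alpha> i)"
    by (rule prod_mono) (auto intro: power_mono assms)
  finally show ?thesis by (simp add: prod_3 power_add)
qed

lemma Suc_le_two_power: "real (Suc n) \<le> 2 ^ n"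
  by (induction n) auto

text \<open>The factor \<open>\<alpha> i + 1\<close> produced by differentiation is absorbed by halving the radius.\<close>

lemma analytic_partial:
  assumes "r > 0" and f: "\<And>y. y \<in> ball x r \<Longrightarrow> ((\<lambda>\<alpha>. a \<alpha> * mono3 x y \<alpha>) has_sum f y) UNIV"
  obtains \<rho> F where "\<rho> > 0" "\<rho> \<le> r"
    "\<And>y. y \<in> ball x \<rho> \<Longrightarrow> (f has_derivative (\<lambda>u. \<Sum>i\<in>UNIV. u $ i * F i y)) (at y)"
    "\<And>i y. y \<in> ball x \<rho> \<Longrightarrow>
      ((\<lambda>\<alpha>. (real (Suc (\<alpha> i)) * a (upd i \<alpha>)) * mono3 x y \<alpha>) has_sum F i y) UNIV"
proof -
  \<comment> \<open>With every offset equal to 2 \<rho>, the point z below lies at distance sqrt 3 *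
    r / 2 < r from x. Absolute convergence there bounds all terms at radius \<rho> with a factor 2^N
    to spare.\<close>
  define \<rho> where "\<rho> = r / 4"
  have \<rho>: "\<rho> > 0" "\<rho> \<le> r" using assms(1) by (auto simp: \<rho>_def)
  define z :: R3 where "z = x + (\<chi> i. 2 * \<rho>)"
  define N where "N \<alpha> = \<alpha> 1 + \<alpha> 2 + \<alpha> 3" for \<alpha> :: "3 \<Rightarrow> nat"
  have "norm (z - x) < r"
  proof -
    have "norm (z - x) = sqrt (3 * (2 * \<rho>)\<^sup>2)"
      by (simp add: z_def norm_vec_def L2_set_def sum_3)
    also have "\<dots> < sqrt (r\<^sup>2)"
      using assms(1) by (intro real_sqrt_less_mono) (simp add: \<rho>_def power2_eq_square)
    finally show ?thesis using assms(1) by simp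
  qed
  then have "z \<in> ball x r" by (simp add: dist_norm norm_minus_commute)
  from f[OF this] have "(\<lambda>\<alpha>. a \<alpha> * mono3 x z \<alpha>) summable_on UNIV"
    by (rule has_sum_imp_summable)
  then have "(\<lambda>\<alpha>. norm (a \<alpha> * mono3 x z \<alpha>)) summable_on UNIV"
    by (rule summable_on_iff_abs_summable_on_real[THEN iffD1])
  moreover have "norm (a \<alpha> * mono3 x z \<alpha>) = \<bar>a \<alpha>\<bar> * (2 * \<rho>) ^ N \<alpha>" for \<alpha>
    using \<rho> by (simp add: z_def mono3_def N_def abs_mult prod_3 power_add)
  ultimately have S0: "(\<lambda>\<alpha>. \<bar>a \<alpha>\<bar> * (2 * \<rho>) ^ N \<alpha>) summable_on UNIV" by simp
  define B where "B i \<alpha> = real (Suc (\<alpha> i)) * \<bar>a (upd i \<alpha>)\<bar> * \<rho> ^ N \<alpha>" for i \<alpha>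
  have Bsum: "B i summable_on UNIV" for i
  proof (rule summable_on_comparison_test)
    have "(\<lambda>\<alpha>. \<bar>a \<alpha>\<bar> * (2 * \<rho>) ^ N \<alpha>) summable_on range (upd i)"
      by (rule summable_on_subset_banach[OF S0]) simp
    then have "(\<lambda>\<alpha>. \<bar>a (upd i \<alpha>)\<bar> * (2 * \<rho>) ^ N (upd i \<alpha>)) summable_on UNIV"
      using summable_on_reindex[OF upd_inj[of i], of "\<lambda>\<alpha>. \<bar>a \<alpha>\<bar> * (2 * \<rho>) ^ N \<alpha>"] by (simp add: o_def)
    then show "(\<lambda>\<alpha>. \<bar>a (upd i \<alpha>)\<bar> * (2 * \<rho>) ^ N (upd i \<alpha>) * (1 / \<rho>)) summable_on UNIV"
      by (rule summable_on_cmult_left)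
    fix \<alpha> :: "3 \<Rightarrow> nat"
    show "0 \<le> B i \<alpha>" using \<rho> by (simp add: B_def)
    have "N (upd i \<alpha>) = Suc (N \<alpha>)"
      using exhaust_3[of i] by (auto simp: N_def upd_def)
    moreover have "real (Suc (\<alpha> i)) \<le> 2 ^ Suc (N \<alpha>)"
    proof -
      have "\<alpha> i \<le> N \<alpha>" using exhaust_3[of i] by (auto simp: N_def)
      then have "(2::real) ^ \<alpha> i \<le> 2 ^ Suc (N \<alpha>)" by (intro power_increasing) auto
      then show ?thesis using Suc_le_two_power[of "\<alpha> i"] by linarith
    qed
    then have "real (Suc (\<alpha> i)) * (\<bar>a (upd i \<alpha>)\<bar> * \<rho> ^ N \<alpha>) \<le> 2 ^ Suc (N \<alpha>) * (\<bar>a (upd i \<alpha>)\<bar> * \<rho> ^ N \<alpha>)"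
      using \<rho> by (intro mult_right_mono) auto
    ultimately show "B i \<alpha> \<le> \<bar>a (upd i \<alpha>)\<bar> * (2 * \<rho>) ^ N (upd i \<alpha>) * (1 / \<rho>)"
      using \<rho> by (simp add: B_def power_mult_distrib mult_ac)
  qed
  define F where "F i y = infsum (\<lambda>\<alpha>. (real (Suc (\<alpha> i)) * a (upd i \<alpha>)) * mono3 x y \<alpha>) UNIV" for i y
  have near: "\<bar>y $ i - x $ i\<bar> \<le> \<rho>" if "y \<in> ball x \<rho>" for y i
    using component_le_norm_cart[of "y - x" i] that by (simp add: dist_norm norm_minus_commute)
  have Fb: "\<bar>(real (Suc (\<alpha> i)) * a (upd i \<alpha>)) * mono3 x y \<alpha>\<bar> \<le> B i \<alpha>" if "y \<in> ball x \<rho>" for i y \<alpha>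
    using abs_mono3_le[OF near[OF that]]
    by (simp add: B_def N_def abs_mult mult_left_mono mult.assoc)
  have Fs: "((\<lambda>\<alpha>. (real (Suc (\<alpha> i)) * a (upd i \<alpha>)) * mono3 x y \<alpha>) has_sum F i y) UNIV"
    if "y \<in> ball x \<rho>" for i y
  proof -
    have "(\<lambda>\<alpha>. norm ((real (Suc (\<alpha> i)) * a (upd i \<alpha>)) * mono3 x y \<alpha>)) summable_on UNIV"
      by (rule summable_on_comparison_test[OF Bsum[of i]]) (use Fb[OF that] in auto)
    then show ?thesis
      unfolding F_def by (intro has_sum_infsum) (rule abs_summable_summable)
  qed
  text \<open>Termwise differentiation along an enumeration of the multi-indices.\<close>
  define D where "D i \<alpha> y = a \<alpha> * (real (\<alpha> i) * mono3 x y (\<alpha>(i := \<alpha> i - 1)))" for i \<alpha> y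
  have D_upd: "D i (upd i \<alpha>) y = (real (Suc (\<alpha> i)) * a (upd i \<alpha>)) * mono3 x y \<alpha>" for i \<alpha> y
    by (simp add: D_def upd_def)
  have D0: "D i \<alpha> y = 0" if "\<alpha> \<notin> range (upd i)" for i \<alpha> y
    using that by (simp add: D_def range_upd)
  have Ds: "((\<lambda>\<alpha>. D i \<alpha> y) has_sum F i y) UNIV" if "y \<in> ball x \<rho>" for i y
  proof -
    have "((\<lambda>\<alpha>. D i \<alpha> y) has_sum F i y) (range (upd i))"
      using Fs[OF that, of i] has_sum_reindex[OF upd_inj[of i], of "\<lambda>\<alpha>. D i \<alpha> y"]
      by (simp add: o_def D_upd)
    then show ?thesis
      by (rule has_sum_cong_neutral[THEN iffD1, rotated -1]) (auto simp: D0)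
  qed
  \<comment> \<open>A majorant that is the same for all i and y makes the differentiated series
    converge uniformly, as \<open>has_derivative_series\<close> requires.\<close>
  obtain M where M: "M summable_on UNIV" "\<And>i \<alpha> y. y \<in> ball x \<rho> \<Longrightarrow> \<bar>D i \<alpha> y\<bar> \<le> M \<alpha>"
  proof -
    define M where "M \<alpha> = (\<Sum>i\<in>UNIV. if \<alpha> \<in> range (upd i) then B i (inv (upd i) \<alpha>) else 0)" for \<alpha>
    have Bn: "B i \<alpha> \<ge> 0" for i \<alpha> using \<rho> by (simp add: B_def)
    have "(\<lambda>\<alpha>. if \<alpha> \<in> range (upd i) then B i (inv (upd i) \<alpha>) else 0) summable_on UNIV" for i
    proof -
      have "(\<lambda>\<alpha>. B i (inv (upd i) \<alpha>)) summable_on range (upd i)"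
        using Bsum[of i] summable_on_reindex[OF upd_inj[of i], of "\<lambda>\<alpha>. B i (inv (upd i) \<alpha>)"]
        by (simp add: o_def upd_inj)
      then show ?thesis
        by (rule summable_on_cong_neutral[THEN iffD1, rotated -1]) auto
    qed
    then have 1: "M summable_on UNIV"
      unfolding M_def sum_3 by (intro summable_on_add)
    have 2: "\<bar>D i \<alpha> y\<bar> \<le> M \<alpha>" if "y \<in> ball x \<rho>" for i \<alpha> y
    proof (cases "\<alpha> \<in> range (upd i)")
      case True
      then obtain \<beta> where \<beta>: "\<alpha> = upd i \<beta>" by auto
      have "\<bar>D i \<alpha> y\<bar> \<le> (if \<alpha> \<in> range (upd i) then B i (inv (upd i) \<alpha>) else 0)"
        using Fb[OF that, of \<beta> i] by (simp add: \<beta> D_upd upd_inj)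
      also have "\<dots> \<le> M \<alpha>" unfolding M_def by (rule member_le_sum) (auto simp: Bn)
      finally show ?thesis .
    next
      case False
      then show ?thesis by (simp add: D0 M_def sum_nonneg Bn)
    qed
    show ?thesis using that 1 2 by blast
  qed
  \<comment> \<open>Infiniteness turns countability into a bijection with the naturals, through
    which unordered sums become ordinary series.\<close>
  have "infinite (UNIV :: (3 \<Rightarrow> nat) set)"
  proof
    assume "finite (UNIV :: (3 \<Rightarrow> nat) set)"
    then have "finite (range (\<lambda>n::nat. (\<lambda>_::3. n)))" by (rule finite_subset[rotated]) simp
    moreover have "inj (\<lambda>n::nat. (\<lambda>_::3. n))" by (auto simp: inj_def fun_eq_iff)
    ultimately show False using finite_imageD by blast
  qed
  then obtain e :: "nat \<Rightarrow> (3 \<Rightarrow> nat)" where e: "bij e"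
    using countableE_infinite[of "UNIV :: (3 \<Rightarrow> nat) set"]
    by (metis bij_betw_inv uncountable_def countableI_type)
  have tosums: "(\<lambda>n. g (e n)) sums l" if "(g has_sum l) UNIV" for g and l :: real
    using that has_sum_reindex_bij_betw[OF e, of g l] has_sum_imp_sums by blast
  have Msum: "summable (\<lambda>n. M (e n))"
    using tosums[OF has_sum_infsum[OF M(1)]] by (auto simp: summable_def)
  have "\<exists>g. \<forall>y\<in>ball x \<rho>. (\<lambda>n. a (e n) * mono3 x y (e n)) sums (g y) \<and>
      (g has_derivative (\<lambda>u. \<Sum>i\<in>UNIV. u $ i * F i y)) (at y within ball x \<rho>)"
  proof (rule has_derivative_series[where f'="\<lambda>n y u. \<Sum>i\<in>UNIV. u $ i * D i (e n) y" and x=x])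
    show "((\<lambda>y. a (e n) * mono3 x y (e n)) has_derivative (\<lambda>u. \<Sum>i\<in>UNIV. u $ i * D i (e n) y))
        (at y within ball x \<rho>)" for n y
      using has_derivative_mult_right[OF has_derivative_at_withinI[OF has_derivative_mono3], of "a (e n)" x "e n" y]
      by (simp add: D_def sum_distrib_left mult_ac)
    show "(\<lambda>n. a (e n) * mono3 x x (e n)) sums f x"
      by (rule tosums) (use f assms(1) in auto)
    fix \<epsilon> :: real assume "\<epsilon> > 0"
    then have "\<epsilon> / 3 > 0" by simp
    from summable_Cauchy[THEN iffD1, OF Msum, rule_format, OF this] obtain K where
      "\<And>m n. m \<ge> K \<Longrightarrow> norm (\<Sum>k=m..<n. M (e k)) < \<epsilon> / 3" by blast
    then have K: "(\<Sum>k=m..<n. M (e k)) < \<epsilon> / 3" if "m \<ge> K" for m n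
      using that by (metis abs_less_iff real_norm_def)
    have tail: "\<bar>(\<Sum>k<n. D i (e k) y) - F i y\<bar> \<le> \<epsilon> / 3" if n: "n \<ge> K" and y: "y \<in> ball x \<rho>" for n i y
    proof (rule LIMSEQ_le_const2)
      show "(\<lambda>m. \<bar>(\<Sum>k<n. D i (e k) y) - (\<Sum>k<m. D i (e k) y)\<bar>) \<longlonglongrightarrow> \<bar>(\<Sum>k<n. D i (e k) y) - F i y\<bar>"
        using tosums[OF Ds[OF y, of i]] unfolding sums_def by (intro tendsto_intros)
      show "\<exists>N. \<forall>m\<ge>N. \<bar>(\<Sum>k<n. D i (e k) y) - (\<Sum>k<m. D i (e k) y)\<bar> \<le> \<epsilon> / 3"
      proof (intro exI allI impI)
        fix m assume m: "m \<ge> n"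
        have "(\<Sum>k<m. D i (e k) y) = (\<Sum>k<n. D i (e k) y) + (\<Sum>k=n..<m. D i (e k) y)"
          using sum.atLeastLessThan_concat[of 0 n m "\<lambda>k. D i (e k) y"] m by (simp add: atLeast0LessThan)
        then have "\<bar>(\<Sum>k<n. D i (e k) y) - (\<Sum>k<m. D i (e k) y)\<bar> = \<bar>\<Sum>k=n..<m. D i (e k) y\<bar>" by simp
        also have "\<dots> \<le> (\<Sum>k=n..<m. M (e k))" by (rule order_trans[OF sum_abs]) (intro sum_mono M(2)[OF y])
        finally show "\<bar>(\<Sum>k<n. D i (e k) y) - (\<Sum>k<m. D i (e k) y)\<bar> \<le> \<epsilon> / 3" using K[OF n, of m] by linarith
      qed
    qed
    show "\<forall>\<^sub>F n in sequentially. \<forall>y\<in>ball x \<rho>. \<forall>u.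
       norm ((\<Sum>k<n. \<Sum>i\<in>UNIV. u $ i * D i (e k) y) - (\<Sum>i\<in>UNIV. u $ i * F i y)) \<le> \<epsilon> * norm u"
      unfolding eventually_sequentially
    proof (intro exI allI impI ballI)
      fix n y and u :: R3 assume n: "n \<ge> K" and y: "y \<in> ball x \<rho>"
      have "(\<Sum>k<n. \<Sum>i\<in>UNIV. u $ i * D i (e k) y) - (\<Sum>i\<in>UNIV. u $ i * F i y)
          = (\<Sum>i\<in>UNIV. u $ i * ((\<Sum>k<n. D i (e k) y) - F i y))"
        by (subst sum.swap) (simp add: sum_distrib_left right_diff_distrib sum_subtractf)
      moreover have "\<bar>\<Sum>i\<in>UNIV. u $ i * ((\<Sum>k<n. D i (e k) y) - F i y)\<bar> \<le> (\<Sum>i\<in>(UNIV::3 set). norm u * (\<epsilon> / 3))"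
      proof (rule order_trans[OF sum_abs], rule sum_mono)
        fix i :: 3
        show "\<bar>u $ i * ((\<Sum>k<n. D i (e k) y) - F i y)\<bar> \<le> norm u * (\<epsilon> / 3)"
          unfolding abs_mult by (intro mult_mono component_le_norm_cart tail[OF n y]) auto
      qed
      ultimately show "norm ((\<Sum>k<n. \<Sum>i\<in>UNIV. u $ i * D i (e k) y) - (\<Sum>i\<in>UNIV. u $ i * F i y)) \<le> \<epsilon> * norm u"
        by (simp add: mult_ac)
    qed
  qed (use \<rho> in auto)
  then obtain g where g: "\<And>y. y \<in> ball x \<rho> \<Longrightarrow> (\<lambda>n. a (e n) * mono3 x y (e n)) sums (g y)"
      "\<And>y. y \<in> ball x \<rho> \<Longrightarrow> (g has_derivative (\<lambda>u. \<Sum>i\<in>UNIV. u $ i * F i y)) (at y within ball x \<rho>)" by blast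
  have gf: "g y = f y" if "y \<in> ball x \<rho>" for y
    using sums_unique2[OF g(1)[OF that] tosums[OF f]] that \<rho> by auto
  show ?thesis
  proof (rule that[OF \<rho>])
    show "(f has_derivative (\<lambda>u. \<Sum>i\<in>UNIV. u $ i * F i y)) (at y)" if "y \<in> ball x \<rho>" for y
      by (rule has_derivative_transform_within_open[of g _ _ UNIV "ball x \<rho>"])
         (use g(2)[OF that] that gf at_within_open[OF that] in auto)
  qed (rule Fs)
qed

lemma real_analytic_on_alt: "real_analytic_on U f \<longleftrightarrow>
    (\<forall>x\<in>U. \<exists>a. \<exists>r>0. \<forall>y\<in>ball x r. ((\<lambda>\<alpha>. a \<alpha> * mono3 x y \<alpha>) has_sum f y) UNIV)"
  by (simp add: real_analytic_on_def mono3_def)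

lemma real_analytic_on_differentiable:
  assumes "real_analytic_on U f"
  shows "x \<in> U \<Longrightarrow> f differentiable at x" and "real_analytic_on U (partials [i] f)"
proof -
  have "f differentiable at x \<and> (\<exists>a. \<exists>r>0. \<forall>y\<in>ball x r. ((\<lambda>\<alpha>. a \<alpha> * mono3 x y \<alpha>) has_sum partials [i] f y) UNIV)"
    if "x \<in> U" for x
  proof -
    obtain a r where ar: "r > 0" "\<And>y. y \<in> ball x r \<Longrightarrow> ((\<lambda>\<alpha>. a \<alpha> * mono3 x y \<alpha>) has_sum f y) UNIV"
      using assms \<open>x \<in> U\<close> unfolding real_analytic_on_alt by blast
    obtain \<rho> F where F: "\<rho> > 0" "\<rho> \<le> r"
      "\<And>y. y \<in> ball x \<rho> \<Longrightarrow> (f has_derivative (\<lambda>u. \<Sum>i\<in>UNIV. u $ i * F i y)) (at y)"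
      "\<And>i y. y \<in> ball x \<rho> \<Longrightarrow>
        ((\<lambda>\<alpha>. (real (Suc (\<alpha> i)) * a (upd i \<alpha>)) * mono3 x y \<alpha>) has_sum F i y) UNIV"
      using analytic_partial[OF ar] by blast
    have "partials [i] f y = F i y" if "y \<in> ball x \<rho>" for y
      using partials_eqI[of "[]" f, simplified partials.simps(1), OF F(3)[OF that], of i]
      by (simp add: axis_def if_distrib[of "\<lambda>c. c * _"] cong: if_cong)
    with F show ?thesis
      by (intro conjI exI[of _ "\<lambda>\<alpha>. real (Suc (\<alpha> i)) * a (upd i \<alpha>)"] exI[of _ \<rho>])
         (auto intro!: differentiableI[OF F(3)])
  qed
  then show "x \<in> U \<Longrightarrow> f differentiable at x" "real_analytic_on U (partials [i] f)"
    unfolding real_analytic_on_alt by blast+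
qed

lemma real_analytic_on_partials:
  assumes "real_analytic_on U f"
  shows "real_analytic_on U (partials ks f)"
proof (induction ks)
  case (Cons k ks)
  then show ?case using real_analytic_on_differentiable(2)[OF Cons, of k] by simp
qed (use assms in simp)

lemma real_analytic_on_imp_smooth_on: "real_analytic_on U f \<Longrightarrow> smooth_on U f"
  unfolding smooth_on_def using real_analytic_on_differentiable(1) real_analytic_on_partials by metis

lemma real_analytic_on_const: "real_analytic_on U (\<lambda>x. c)"
  unfolding real_analytic_on_alt
proof (intro ballI exI[of _ "\<lambda>\<alpha>. if \<alpha> = (\<lambda>_. 0) then c else 0"] exI[of _ 1] conjI)
  fix x y :: R3
  have "((\<lambda>\<alpha>. (if \<alpha> = (\<lambda>_. 0) then c else 0) * mono3 x y \<alpha>) has_sum c) {\<lambda>_. 0}"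
    by (rule has_sum_finiteI) (auto simp: mono3_def)
  then show "((\<lambda>\<alpha>. (if \<alpha> = (\<lambda>_. 0) then c else 0) * mono3 x y \<alpha>) has_sum c) UNIV"
    by (rule has_sum_cong_neutral[THEN iffD1, rotated -1]) auto
qed simp

lemma real_analytic_on_add:
  assumes "real_analytic_on U f" "real_analytic_on U g"
  shows "real_analytic_on U (\<lambda>x. f x + g x)"
  unfolding real_analytic_on_alt
proof
  fix x assume x: "x \<in> U"
  obtain a r where a: "r > 0" "\<And>y. y \<in> ball x r \<Longrightarrow> ((\<lambda>\<alpha>. a \<alpha> * mono3 x y \<alpha>) has_sum f y) UNIV"
    using assms(1) x unfolding real_analytic_on_alt by blast
  obtain b s where b: "s > 0" "\<And>y. y \<in> ball x s \<Longrightarrow> ((\<lambda>\<alpha>. b \<alpha> * mono3 x y \<alpha>) has_sum g y) UNIV"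
    using assms(2) x unfolding real_analytic_on_alt by blast
  show "\<exists>a. \<exists>r>0. \<forall>y\<in>ball x r. ((\<lambda>\<alpha>. a \<alpha> * mono3 x y \<alpha>) has_sum f y + g y) UNIV"
    by (rule exI[of _ "\<lambda>\<alpha>. a \<alpha> + b \<alpha>"], rule exI[of _ "min r s"])
       (use a b in \<open>auto simp: distrib_right intro!: has_sum_add\<close>)
qed

lemma real_analytic_on_cmult:
  assumes "real_analytic_on U f"
  shows "real_analytic_on U (\<lambda>x. c * f x)"
  unfolding real_analytic_on_alt
proof
  fix x assume x: "x \<in> U"
  obtain a r where a: "r > 0" "\<And>y. y \<in> ball x r \<Longrightarrow> ((\<lambda>\<alpha>. a \<alpha> * mono3 x y \<alpha>) has_sum f y) UNIV"
    using assms(1) x unfolding real_analytic_on_alt by blast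
  show "\<exists>a. \<exists>r>0. \<forall>y\<in>ball x r. ((\<lambda>\<alpha>. a \<alpha> * mono3 x y \<alpha>) has_sum c * f y) UNIV"
    by (rule exI[of _ "\<lambda>\<alpha>. c * a \<alpha>"], rule exI[of _ r])
       (use a in \<open>auto simp: mult.assoc intro!: has_sum_cmult_right\<close>)
qed

text \<open>Write y_i = x_i + (y_i - x_i): the first summand rescales the coefficients, the second
  shifts them by \<open>upd i\<close>.\<close>

lemma real_analytic_on_component_mult:
  assumes "real_analytic_on U f"
  shows "real_analytic_on U (\<lambda>x. x $ i * f x)"
  unfolding real_analytic_on_alt
proof
  fix x assume x: "x \<in> U"
  obtain a r where a: "r > 0" "\<And>y. y \<in> ball x r \<Longrightarrow> ((\<lambda>\<alpha>. a \<alpha> * mono3 x y \<alpha>) has_sum f y) UNIV"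
    using assms(1) x unfolding real_analytic_on_alt by blast
  define b where "b \<alpha> = x $ i * a \<alpha> + (if \<alpha> \<in> range (upd i) then a (inv (upd i) \<alpha>) else 0)" for \<alpha>
  have "((\<lambda>\<alpha>. b \<alpha> * mono3 x y \<alpha>) has_sum y $ i * f y) UNIV" if y: "y \<in> ball x r" for y
  proof -
    let ?h = "\<lambda>\<alpha>. (if \<alpha> \<in> range (upd i) then a (inv (upd i) \<alpha>) else 0) * mono3 x y \<alpha>"
    have "((\<lambda>\<alpha>. (y $ i - x $ i) * (a \<alpha> * mono3 x y \<alpha>)) has_sum (y $ i - x $ i) * f y) UNIV"
      by (rule has_sum_cmult_right[OF a(2)[OF y]])
    then have "((\<lambda>\<alpha>. ?h (upd i \<alpha>)) has_sum (y $ i - x $ i) * f y) UNIV"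
      by (simp add: mono3_upd upd_inj mult_ac)
    then have "(?h has_sum (y $ i - x $ i) * f y) (range (upd i))"
      using has_sum_reindex[OF upd_inj[of i], of ?h] by (simp add: o_def)
    then have "(?h has_sum (y $ i - x $ i) * f y) UNIV"
      by (rule has_sum_cong_neutral[THEN iffD1, rotated -1]) auto
    from has_sum_add[OF has_sum_cmult_right[OF a(2)[OF y], of "x $ i"] this]
    show ?thesis by (simp add: b_def algebra_simps)
  qed
  with a(1) show "\<exists>a. \<exists>r>0. \<forall>y\<in>ball x r. ((\<lambda>\<alpha>. a \<alpha> * mono3 x y \<alpha>) has_sum y $ i * f y) UNIV"
    by blast
qed

text \<open>Powers of a linear form are built up one coordinate factor at a time, so multiplication
  by coordinates takes the place of a product of two power series.\<close>

lemma real_analytic_on_inner_power: "real_analytic_on U (\<lambda>x. (w \<bullet> x) ^ d)"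
proof (induction d)
  case (Suc d)
  have "(\<lambda>x. (w \<bullet> x) ^ Suc d) = (\<lambda>x. w $ 1 * (x $ 1 * (w \<bullet> x) ^ d) + w $ 2 * (x $ 2 * (w \<bullet> x) ^ d)
      + w $ 3 * (x $ 3 * (w \<bullet> x) ^ d))"
    by (simp add: fun_eq_iff inner_vec_def sum_3 algebra_simps)
  then show ?case
    by (auto intro!: real_analytic_on_add real_analytic_on_cmult real_analytic_on_component_mult Suc)
qed (simp add: real_analytic_on_const)

lemma real_analytic_on_sum_list:
  "(\<And>p. p \<in> set ps \<Longrightarrow> real_analytic_on U (f p)) \<Longrightarrow> real_analytic_on U (\<lambda>x. \<Sum>p\<leftarrow>ps. f p x)"
  by (induction ps) (auto intro!: real_analytic_on_add real_analytic_on_const)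

lemma real_analytic_on_subset: "real_analytic_on U f \<Longrightarrow> V \<subseteq> U \<Longrightarrow> real_analytic_on V f"
  by (auto simp: real_analytic_on_def)

section \<open>Expressions in the jet of a metric and a frame\<close>

text \<open>\<open>Jt [k\<^sub>1, \<dots>, k\<^sub>m] i j\<close> stands for \<open>\<partial>\<^bsub>k\<^sub>1\<^esub> \<dots> \<partial>\<^bsub>k\<^sub>m\<^esub> g\<^sub>i\<^sub>j\<close>, \<open>Iv i j\<close> for an entry of the inverse metric
  and \<open>Fr s k\<close> for the \<open>k\<close>-th coordinate of the \<open>s\<close>-th frame vector; the frame is \<open>(\<gamma>', X, Z)\<close> with
  \<open>Z\<close> the normal of the plane of \<open>\<gamma>'\<close> and \<open>X\<close>.\<close>

datatype expr = Cst real | Jt "3 list" 3 3 | Iv 3 3 | Fr 3 3 | Ad expr expr | Mu expr expr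

type_synonym jet = "3 list \<Rightarrow> 3 \<Rightarrow> 3 \<Rightarrow> real"
type_synonym frame = "real ^ 3 ^ 3"

definition jmat :: "jet \<Rightarrow> real ^ 3 ^ 3" where
  "jmat J = (\<chi> i j. J [] i j)"

primrec ev :: "jet \<Rightarrow> frame \<Rightarrow> expr \<Rightarrow> real" where
  "ev J \<theta> (Cst c) = c"
| "ev J \<theta> (Jt ks i j) = J ks i j"
| "ev J \<theta> (Iv i j) = matrix_inv (jmat J) $ i $ j"
| "ev J \<theta> (Fr s k) = \<theta> $ s $ k"
| "ev J \<theta> (Ad a b) = ev J \<theta> a + ev J \<theta> b"
| "ev J \<theta> (Mu a b) = ev J \<theta> a * ev J \<theta> b"

text \<open>The differential of \<open>ev\<close> at the jet J and frame \<theta> in the direction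
  (\<delta>, \<tau>). The clause for \<open>Iv\<close> is the derivative
  \<open>- B ** D ** B\<close> of a matrix inverse B.\<close>

primrec sev :: "jet \<Rightarrow> frame \<Rightarrow> jet \<Rightarrow> frame \<Rightarrow> expr \<Rightarrow> real" where
  "sev J \<theta> \<delta> \<tau> (Cst c) = 0"
| "sev J \<theta> \<delta> \<tau> (Jt ks i j) = \<delta> ks i j"
| "sev J \<theta> \<delta> \<tau> (Iv i j) = - (\<Sum>p\<in>UNIV. \<Sum>q\<in>UNIV.
     matrix_inv (jmat J) $ i $ p * \<delta> [] p q * matrix_inv (jmat J) $ q $ j)"
| "sev J \<theta> \<delta> \<tau> (Fr s k) = \<tau> $ s $ k"
| "sev J \<theta> \<delta> \<tau> (Ad a b) = sev J \<theta> \<delta> \<tau> a + sev J \<theta> \<delta> \<tau> b"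
| "sev J \<theta> \<delta> \<tau> (Mu a b) = sev J \<theta> \<delta> \<tau> a * ev J \<theta> b + ev J \<theta> a * sev J \<theta> \<delta> \<tau> b"

definition sm :: "(3 \<Rightarrow> expr) \<Rightarrow> expr" where
  "sm f = Ad (Ad (f 1) (f 2)) (f 3)"

lemma ev_sm [simp]: "ev J \<theta> (sm f) = (\<Sum>i\<in>UNIV. ev J \<theta> (f i))"
  by (simp add: sm_def sum_3)

lemma sev_sm [simp]: "sev J \<theta> \<delta> \<tau> (sm f) = (\<Sum>i\<in>UNIV. sev J \<theta> \<delta> \<tau> (f i))"
  by (simp add: sm_def sum_3)

text \<open>The derivation with \<open>x' = d\<close> and \<open>w s\<close> as derivative of the \<open>s\<close>-th frame vector.\<close>

primrec dr :: "(3 \<Rightarrow> expr) \<Rightarrow> (3 \<Rightarrow> 3 \<Rightarrow> expr) \<Rightarrow> expr \<Rightarrow> expr" where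
  "dr d w (Cst c) = Cst 0"
| "dr d w (Jt ks i j) = sm (\<lambda>l. Mu (d l) (Jt (l # ks) i j))"
| "dr d w (Iv i j) = Mu (Cst (- 1)) (sm (\<lambda>p. sm (\<lambda>q.
     Mu (Mu (Iv i p) (sm (\<lambda>l. Mu (d l) (Jt [l] p q)))) (Iv q j))))"
| "dr d w (Fr s k) = w s k"
| "dr d w (Ad a b) = Ad (dr d w a) (dr d w b)"
| "dr d w (Mu a b) = Ad (Mu (dr d w a) b) (Mu a (dr d w b))"

lemma dr_sm [simp]: "dr d w (sm f) = sm (\<lambda>i. dr d w (f i))"
  by (simp add: sm_def)

text \<open>Links the syntactic derivation to analysis: it evaluates to the differential of
  \<open>ev\<close> along the jet contracted once with d. The chain rules for \<open>der\<close> and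
  \<open>dx\<close> rest on this.\<close>

lemma ev_dr: "ev J \<theta> (dr d w e) = sev J \<theta> (\<lambda>ks i j. \<Sum>l\<in>UNIV. ev J \<theta> (d l) * J (l # ks) i j)
    (\<chi> s k. ev J \<theta> (w s k)) e"
  by (induction e) simp_all

text \<open>\<open>chE k i j\<close> is the Christoffel symbol with upper index \<open>k\<close> and lower indices \<open>i\<close>, \<open>j\<close>;
  \<open>rmE m i j k\<close> is the \<open>m\<close>-th coordinate of \<open>\<R>(e\<^sub>i, e\<^sub>j) e\<^sub>k\<close>.\<close>

definition chE :: "3 \<Rightarrow> 3 \<Rightarrow> 3 \<Rightarrow> expr" where
  "chE k i j = Mu (Cst (1 / 2)) (sm (\<lambda>l. Mu (Iv k l)
     (Ad (Ad (Jt [i] j l) (Jt [j] i l)) (Mu (Cst (- 1)) (Jt [l] i j)))))"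

text \<open>The derivation for motion of the base point along a coordinate axis with constant frame
  vectors.\<close>

definition dx :: "3 \<Rightarrow> expr \<Rightarrow> expr" where
  "dx l = dr (\<lambda>m. Cst (if m = l then 1 else 0)) (\<lambda>_ _. Cst 0)"

definition rmE :: "3 \<Rightarrow> 3 \<Rightarrow> 3 \<Rightarrow> 3 \<Rightarrow> expr" where
  "rmE m i j k = Ad (Ad (dx i (chE m j k)) (Mu (Cst (- 1)) (dx j (chE m i k))))
     (sm (\<lambda>p. Ad (Mu (chE m i p) (chE p j k)) (Mu (Cst (- 1)) (Mu (chE m j p) (chE p i k)))))"

definition ricE :: "3 \<Rightarrow> 3 \<Rightarrow> expr" where
  "ricE j k = sm (\<lambda>i. rmE i i j k)"

text \<open>The derivation of the flow of frames along geodesics: the base point moves with the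
  first frame vector, and each frame vector changes by the Christoffel term of parallel
  transport.\<close>

definition der :: "expr \<Rightarrow> expr" where
  "der = dr (Fr 1) (\<lambda>s k. Mu (Cst (- 1)) (sm (\<lambda>i. sm (\<lambda>j. Mu (chE k i j) (Mu (Fr 1 i) (Fr s j))))))"

text \<open>\<open>FE j\<close> is the \<open>j\<close>-th derivative of \<open>Ric(Z, X)\<close> along a geodesic with parallel \<open>X\<close> and \<open>Z\<close>.\<close>

definition FE :: "nat \<Rightarrow> expr" where
  "FE j = (der ^^ j) (sm (\<lambda>j. sm (\<lambda>k. Mu (Mu (Fr 3 j) (Fr 2 k)) (ricE j k))))"

lemma FE_0: "FE 0 = sm (\<lambda>j. sm (\<lambda>k. Mu (Mu (Fr 3 j) (Fr 2 k)) (ricE j k)))"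
  and FE_Suc: "FE (Suc j) = der (FE j)"
  by (simp_all add: FE_def)

definition jet :: "metric \<Rightarrow> R3 \<Rightarrow> jet" where
  "jet h x = (\<lambda>ks i j. partials ks (\<lambda>y. h y $ i $ j) x)"

lemma jmat_jet [simp]: "jmat (jet h x) = h x"
  by (simp add: jmat_def jet_def vec_eq_iff)

definition chr :: "jet \<Rightarrow> R3 \<Rightarrow> R3 \<Rightarrow> R3" where
  "chr J a b = (\<chi> k. \<Sum>i\<in>UNIV. \<Sum>j\<in>UNIV. ev J 0 (chE k i j) * a $ i * b $ j)"

lemma ev_chE: "ev J \<theta> (chE k i j) = 1 / 2 * (\<Sum>l\<in>UNIV. matrix_inv (jmat J) $ k $ l *
        (J [i] j l + J [j] i l - J [l] i j))"
  by (simp add: chE_def)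

lemma christoffel_chr: "christoffel h x a b = chr (jet h x) a b"
proof -
  have "metric_deriv h x l i j = jet h x [l] i j" for l i j
    by (simp only: metric_deriv_def jet_def)
  then show ?thesis by (simp add: christoffel_def chr_def ev_chE)
qed

subsection \<open>Inverse matrices\<close>

lemma det_nonzero_inverse:
  fixes A :: "real ^ 3 ^ 3"
  assumes "det A \<noteq> 0"
  shows "A ** matrix_inv A = mat 1" "matrix_inv A ** A = mat 1"
proof -
  have "\<exists>A'. A ** A' = mat 1 \<and> A' ** A = mat 1"
    using assms unfolding invertible_det_nz[symmetric] invertible_def .
  note * = someI_ex[OF this, folded matrix_inv_def]
  show "A ** matrix_inv A = mat 1" by (rule conjunct1[OF *])
  show "matrix_inv A ** A = mat 1" by (rule conjunct2[OF *])
qed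

text \<open>Cramer's rule: the entries of the inverse are quotients of polynomials in the entries,
  which provides continuity and differentiability below.\<close>

lemma matrix_inv_entry:
  fixes A :: "real ^ 3 ^ 3"
  assumes "det A \<noteq> 0"
  shows "matrix_inv A $ i $ j = det (\<chi> k l. if l = i then axis j 1 $ k else A $ k $ l) / det A"
proof -
  have "A *v (matrix_inv A *v axis j 1) = axis j 1"
    by (simp add: matrix_vector_mul_assoc det_nonzero_inverse[OF assms])
  then have "matrix_inv A *v axis j 1 = (\<chi> k. det (\<chi> m l. if l = k then axis j 1 $ m else A $ m $ l) / det A)"
    using cramer[OF assms] by blast
  moreover have "(matrix_inv A *v axis j 1) $ i = matrix_inv A $ i $ j"
    by (simp add: matrix_vector_mult_basis column_def)
  ultimately show ?thesis by simp
qed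

lemma tendsto_det_3:
  fixes A :: "'a \<Rightarrow> real ^ 3 ^ 3"
  assumes "\<And>i j. ((\<lambda>n. A n $ i $ j) \<longlongrightarrow> B $ i $ j) F"
  shows "((\<lambda>n. det (A n)) \<longlongrightarrow> det B) F"
  unfolding det_3 by (intro tendsto_add tendsto_diff tendsto_mult assms)

lemma differentiable_det_3:
  fixes A :: "'p::real_normed_vector \<Rightarrow> real ^ 3 ^ 3"
  assumes "\<And>i j. (\<lambda>p. A p $ i $ j) differentiable at p"
  shows "(\<lambda>p. det (A p)) differentiable at p"
  unfolding det_3 by (intro differentiable_add differentiable_diff differentiable_mult assms)

lemma tendsto_matrix_inv:
  fixes A :: "'a \<Rightarrow> real ^ 3 ^ 3"
  assumes A: "\<And>i j. ((\<lambda>n. A n $ i $ j) \<longlongrightarrow> B $ i $ j) F" and "det B \<noteq> 0"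
  shows "((\<lambda>n. matrix_inv (A n) $ i $ j) \<longlongrightarrow> matrix_inv B $ i $ j) F"
proof -
  have d: "((\<lambda>n. det (A n)) \<longlongrightarrow> det B) F" by (rule tendsto_det_3[OF A])
  then have ev: "\<forall>\<^sub>F n in F. det (A n) \<noteq> 0"
    using assms(2) tendsto_imp_eventually_ne by blast
  let ?C = "\<lambda>A :: real ^ 3 ^ 3. det (\<chi> k l. if l = i then axis j 1 $ k else A $ k $ l) / det A"
  have "((\<lambda>n. ?C (A n)) \<longlongrightarrow> ?C B) F"
    by (intro tendsto_divide tendsto_det_3 d assms(2)) (auto intro: A)
  then have "((\<lambda>n. ?C (A n)) \<longlongrightarrow> matrix_inv B $ i $ j) F"
    by (simp add: matrix_inv_entry[OF assms(2)])
  then show ?thesis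
    by (rule Lim_transform_eventually) (use ev in eventually_elim, simp add: matrix_inv_entry)
qed

text \<open>Differentiability comes from Cramer's rule; the formula then follows by differentiating
  the identity between A times its inverse and the unit matrix, and multiplying with the inverse
  from the left.\<close>

lemma matrix_entry_has_derivative:
  fixes A :: "'p::real_normed_vector \<Rightarrow> real ^ 3 ^ 3"
  assumes A: "\<And>i j. ((\<lambda>p. A p $ i $ j) has_derivative (\<lambda>q. A' q $ i $ j)) (at p)"
    and d: "det (A p) \<noteq> 0"
  shows "((\<lambda>p. matrix_inv (A p) $ i $ j) has_derivative (\<lambda>q. - (\<Sum>k\<in>UNIV. \<Sum>l\<in>UNIV.
     matrix_inv (A p) $ i $ k * A' q $ k $ l * matrix_inv (A p) $ l $ j))) (at p)"
proof -
  have Ad: "(\<lambda>p. A p $ i $ j) differentiable at p" for i j by (rule differentiableI[OF A])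
  have "((\<lambda>p. A p $ i $ j) \<longlongrightarrow> A p $ i $ j) (at p)" for i j
    using has_derivative_continuous[OF A] by (simp add: continuous_at)
  then have "((\<lambda>p. det (A p)) \<longlongrightarrow> det (A p)) (at p)" by (rule tendsto_det_3)
  then have "\<forall>\<^sub>F y in at p. det (A y) \<noteq> 0" using d tendsto_imp_eventually_ne by blast
  then obtain S where S: "open S" "p \<in> S" "\<And>y. y \<in> S \<Longrightarrow> det (A y) \<noteq> 0"
    unfolding eventually_at_topological using d by (metis UNIV_I)
  have diff: "(\<lambda>p. matrix_inv (A p) $ i $ j) differentiable at p" for i j
  proof -
    have "(\<lambda>p. det (\<chi> k l. if l = i then axis j 1 $ k else A p $ k $ l) / det (A p)) differentiable at p"
    proof (intro differentiable_divide differentiable_det_3 Ad d)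
      show "(\<lambda>p. (\<chi> k l. if l = i then axis j 1 $ k else A p $ k $ l) $ k $ l) differentiable at p" for k l
        by (cases "l = i") (simp_all add: Ad)
    qed
    then obtain D where "((\<lambda>p. det (\<chi> k l. if l = i then axis j 1 $ k else A p $ k $ l) / det (A p)) has_derivative D) (at p)"
      by (auto simp: differentiable_def)
    then have "((\<lambda>p. matrix_inv (A p) $ i $ j) has_derivative D) (at p)"
      by (rule has_derivative_transform_within_open[OF _ S(1,2)]) (simp add: matrix_inv_entry S(3))
    then show ?thesis by (rule differentiableI)
  qed
  define B where "B q = (\<chi> i j. frechet_derivative (\<lambda>p. matrix_inv (A p) $ i $ j) (at p) q)" for q
  have B: "((\<lambda>p. matrix_inv (A p) $ i $ j) has_derivative (\<lambda>q. B q $ i $ j)) (at p)" for i j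
    using diff[of i j] by (simp add: B_def frechet_derivative_works)
  have eq: "A' q ** matrix_inv (A p) + A p ** B q = 0" for q
  proof -
    have "(\<Sum>k\<in>UNIV. A p $ i $ k * B q $ k $ j + A' q $ i $ k * matrix_inv (A p) $ k $ j) = 0" for i j
    proof -
      have "((\<lambda>p. \<Sum>k\<in>UNIV. A p $ i $ k * matrix_inv (A p) $ k $ j) has_derivative
        (\<lambda>q. \<Sum>k\<in>UNIV. A p $ i $ k * B q $ k $ j + A' q $ i $ k * matrix_inv (A p) $ k $ j)) (at p)"
        by (intro has_derivative_sum has_derivative_mult A B)
      moreover have "((\<lambda>p. \<Sum>k\<in>UNIV. A p $ i $ k * matrix_inv (A p) $ k $ j) has_derivative (\<lambda>q. 0)) (at p)"
      proof (rule has_derivative_transform_within_open[OF has_derivative_const S(1,2)])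
        fix y assume "y \<in> S"
        then show "(mat 1 :: real^3^3) $ i $ j = (\<Sum>k\<in>UNIV. A y $ i $ k * matrix_inv (A y) $ k $ j)"
          using det_nonzero_inverse(1)[OF S(3), of y] by (simp add: matrix_matrix_mult_def vec_eq_iff)
      qed
      ultimately have "(\<lambda>q. \<Sum>k\<in>UNIV. A p $ i $ k * B q $ k $ j + A' q $ i $ k * matrix_inv (A p) $ k $ j) = (\<lambda>q. 0)"
        by (rule has_derivative_unique)
      then show ?thesis by (rule fun_cong)
    qed
    then show ?thesis by (simp add: vec_eq_iff matrix_matrix_mult_def sum.distrib add.commute)
  qed
  have "B q = - (matrix_inv (A p) ** A' q ** matrix_inv (A p))" for q
  proof -
    have "matrix_inv (A p) ** (A' q ** matrix_inv (A p) + A p ** B q) = 0" by (simp add: eq)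
    then have "matrix_inv (A p) ** (A' q ** matrix_inv (A p)) + B q = 0"
      by (simp add: matrix_add_ldistrib matrix_mul_assoc det_nonzero_inverse[OF d])
    then show ?thesis by (simp add: eq_neg_iff_add_eq_0 add.commute matrix_mul_assoc)
  qed
  then have "B q $ i $ j = - (\<Sum>k\<in>UNIV. \<Sum>l\<in>UNIV.
     matrix_inv (A p) $ i $ k * A' q $ k $ l * matrix_inv (A p) $ l $ j)" for q
    by (simp add: matrix_matrix_mult_def sum_distrib_right) (rule sum.swap)
  with B[of i j] show ?thesis by simp
qed

subsection \<open>Differentiation and continuity of expressions\<close>

lemma ev_has_derivative:
  fixes J :: "'p::real_normed_vector \<Rightarrow> jet"
  assumes J: "\<And>ks i j. ((\<lambda>p. J p ks i j) has_derivative (\<lambda>q. J' q ks i j)) (at p)"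
    and \<theta>: "\<And>s k. ((\<lambda>p. \<theta> p $ s $ k) has_derivative (\<lambda>q. \<theta>' q $ s $ k)) (at p)"
    and d: "det (jmat (J p)) \<noteq> 0"
  shows "((\<lambda>p. ev (J p) (\<theta> p) e) has_derivative (\<lambda>q. sev (J p) (\<theta> p) (J' q) (\<theta>' q) e)) (at p)"
proof (induction e)
  case (Iv i j)
  have "((\<lambda>p. jmat (J p) $ i $ j) has_derivative (\<lambda>q. jmat (J' q) $ i $ j)) (at p)" for i j
    by (simp add: jmat_def J)
  from matrix_entry_has_derivative[OF this d] show ?case by (simp add: jmat_def)
next
  case (Mu a b)
  then show ?case by (auto intro!: derivative_eq_intros simp: fun_eq_iff)
qed (auto intro!: J \<theta> derivative_intros)

lemma ev_differentiable:
  fixes J :: "'p::real_normed_vector \<Rightarrow> jet"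
  assumes "\<And>ks i j. (\<lambda>p. J p ks i j) differentiable at p"
    and "\<And>s k. (\<lambda>p. \<theta> p $ s $ k) differentiable at p" and "det (jmat (J p)) \<noteq> 0"
  shows "(\<lambda>p. ev (J p) (\<theta> p) e) differentiable at p"
proof -
  let ?J' = "\<lambda>q ks i j. frechet_derivative (\<lambda>p. J p ks i j) (at p) q"
  let ?\<theta>' = "\<lambda>q. \<chi> s k. frechet_derivative (\<lambda>p. \<theta> p $ s $ k) (at p) q"
  show ?thesis
    by (rule differentiableI, rule ev_has_derivative[where J'="?J'" and \<theta>'="?\<theta>'"])
       (use assms in \<open>simp_all add: frechet_derivative_works\<close>)
qed

lemma ev_tendsto:
  assumes "\<And>ks i j. ((\<lambda>n. J n ks i j) \<longlongrightarrow> L ks i j) F"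
    and "\<And>s k. ((\<lambda>n. \<theta> n $ s $ k) \<longlongrightarrow> \<theta>0 $ s $ k) F" and "det (jmat L) \<noteq> 0"
  shows "((\<lambda>n. ev (J n) (\<theta> n) e) \<longlongrightarrow> ev L \<theta>0 e) F"
proof (induction e)
  case (Iv i j)
  have "((\<lambda>n. jmat (J n) $ i $ j) \<longlongrightarrow> jmat L $ i $ j) F" for i j
    by (simp add: jmat_def assms(1))
  from tendsto_matrix_inv[OF this assms(3)] show ?case by simp
qed (auto intro!: assms tendsto_intros)

definition smooth_comps :: "R3 set \<Rightarrow> metric \<Rightarrow> bool" where
  "smooth_comps U h \<longleftrightarrow> (\<forall>i j. smooth_on U (\<lambda>x. h x $ i $ j))"

lemma smooth_metric_comps: "smooth_metric U h \<Longrightarrow> smooth_comps U h"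
  by (simp add: smooth_metric_def smooth_comps_def)

lemma jet_has_derivative:
  fixes x :: "'p::real_normed_vector \<Rightarrow> R3"
  assumes h: "smooth_comps U h" and x: "(x has_derivative x') (at p)" "x p \<in> U"
  shows "((\<lambda>p. jet h (x p) ks i j) has_derivative
    (\<lambda>q. \<Sum>l\<in>UNIV. x' q $ l * jet h (x p) (l # ks) i j)) (at p)"
  unfolding jet_def
  by (rule has_derivative_compose[where f=x and g="partials ks (\<lambda>y. h y $ i $ j)", OF x(1) has_derivative_partials])
     (use h x(2) in \<open>auto simp: smooth_comps_def\<close>)

lemma ev_jet_has_derivative:
  fixes x :: "'p::real_normed_vector \<Rightarrow> R3"
  assumes "smooth_comps U h" "(x has_derivative x') (at p)" "x p \<in> U"
    and "\<And>s k. ((\<lambda>p. \<theta> p $ s $ k) has_derivative (\<lambda>q. \<theta>' q $ s $ k)) (at p)"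
    and "det (h (x p)) \<noteq> 0"
  shows "((\<lambda>p. ev (jet h (x p)) (\<theta> p) e) has_derivative
    (\<lambda>q. sev (jet h (x p)) (\<theta> p) (\<lambda>ks i j. \<Sum>l\<in>UNIV. x' q $ l * jet h (x p) (l # ks) i j) (\<theta>' q) e)) (at p)"
  by (rule ev_has_derivative) (use assms in \<open>auto intro!: jet_has_derivative\<close>)

lemma ev_chE_frame: "ev J \<theta> (chE k i j) = ev J 0 (chE k i j)"
  by (simp add: ev_chE)

lemma ev_dx: "ev J \<theta> (dx l e) = sev J \<theta> (\<lambda>ks i j. J (l # ks) i j) 0 e"
  by (simp add: dx_def ev_dr if_distrib[of "\<lambda>c. c * _"] zero_vec_def cong: if_cong)

lemma sev_linear_jet:
  fixes u :: R3
  shows "sev J \<theta> (\<lambda>ks i j. \<Sum>l\<in>UNIV. u $ l * \<delta> l ks i j) 0 e = (\<Sum>l\<in>UNIV. u $ l * sev J \<theta> (\<delta> l) 0 e)"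
proof -
  have "sev J \<theta> (\<lambda>ks i j. a * \<delta>1 ks i j + b * \<delta>2 ks i j + c * \<delta>3 ks i j) 0 e
      = a * sev J \<theta> \<delta>1 0 e + b * sev J \<theta> \<delta>2 0 e + c * sev J \<theta> \<delta>3 0 e" for a b c \<delta>1 \<delta>2 \<delta>3
  proof (induction e)
    case (Iv i j)
    show ?case
      by (simp add: sum.distrib sum_distrib_left distrib_left distrib_right mult.left_commute mult.assoc)
  qed (simp_all add: algebra_simps)
  then show ?thesis unfolding sum_3 .
qed

lemma sum_rotate: "(\<Sum>l\<in>A. \<Sum>i\<in>B. \<Sum>j\<in>C. f l i j) = (\<Sum>i\<in>B. \<Sum>j\<in>C. \<Sum>l\<in>A. f l i j)"
proof -
  have "(\<Sum>l\<in>A. \<Sum>i\<in>B. \<Sum>j\<in>C. f l i j) = (\<Sum>i\<in>B. \<Sum>l\<in>A. \<Sum>j\<in>C. f l i j)" by (rule sum.swap)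
  also have "\<dots> = (\<Sum>i\<in>B. \<Sum>j\<in>C. \<Sum>l\<in>A. f l i j)" by (intro sum.cong refl sum.swap)
  finally show ?thesis .
qed

lemma chr_has_derivative:
  assumes h: "smooth_comps U h" and x: "x \<in> U" "det (h x) \<noteq> 0"
  shows "((\<lambda>y. chr (jet h y) v w) has_derivative (\<lambda>u. \<chi> m. \<Sum>l\<in>UNIV. \<Sum>i\<in>UNIV. \<Sum>j\<in>UNIV.
    u $ l * v $ i * w $ j * ev (jet h x) 0 (dx l (chE m i j)))) (at x)"
proof -
  have *: "((\<lambda>y. ev (jet h y) 0 (chE m i j)) has_derivative
      (\<lambda>u. \<Sum>l\<in>UNIV. u $ l * ev (jet h x) 0 (dx l (chE m i j)))) (at x)" for m i j
    using ev_jet_has_derivative[OF h has_derivative_ident x(1), of "\<lambda>_. 0" "\<lambda>_. 0" "chE m i j"] x(2)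
    by (simp add: sev_linear_jet ev_dx)
  have "((\<lambda>y. chr (jet h y) v w $ m) has_derivative (\<lambda>u. \<Sum>l\<in>UNIV. \<Sum>i\<in>UNIV. \<Sum>j\<in>UNIV.
      u $ l * v $ i * w $ j * ev (jet h x) 0 (dx l (chE m i j)))) (at x)" for m
  proof -
    have "((\<lambda>y. \<Sum>i\<in>UNIV. \<Sum>j\<in>UNIV. ev (jet h y) 0 (chE m i j) * v $ i * w $ j) has_derivative
      (\<lambda>u. \<Sum>i\<in>UNIV. \<Sum>j\<in>UNIV.
        (\<Sum>l\<in>UNIV. u $ l * ev (jet h x) 0 (dx l (chE m i j))) * v $ i * w $ j)) (at x)"
      by (intro has_derivative_sum has_derivative_mult_left *)
    moreover have "(\<Sum>i\<in>UNIV. \<Sum>j\<in>UNIV.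
        (\<Sum>l\<in>UNIV. u $ l * ev (jet h x) 0 (dx l (chE m i j))) * v $ i * w $ j) =
      (\<Sum>l\<in>UNIV. \<Sum>i\<in>UNIV. \<Sum>j\<in>UNIV. u $ l * v $ i * w $ j * ev (jet h x) 0 (dx l (chE m i j)))" for u
      by (subst sum_rotate) (simp add: sum_distrib_left sum_distrib_right mult_ac)
    ultimately show ?thesis by (simp add: chr_def)
  qed
  note c = this
  show ?thesis
  proof (subst has_derivative_componentwise_within, intro ballI)
    fix b :: R3 assume "b \<in> Basis"
    then obtain m where b: "b = axis m 1" by (auto simp: Basis_vec_def)
    show "((\<lambda>y. chr (jet h y) v w \<bullet> b) has_derivative (\<lambda>u. (\<chi> m. \<Sum>l\<in>UNIV. \<Sum>i\<in>UNIV. \<Sum>j\<in>UNIV.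
        u $ l * v $ i * w $ j * ev (jet h x) 0 (dx l (chE m i j))) \<bullet> b)) (at x)"
      using c[of m] by (simp add: b inner_axis)
  qed
qed

lemma riemann_rmE:
  assumes h: "smooth_comps U h" and x: "x \<in> U" "det (h x) \<noteq> 0"
  shows "riemann h x u v w $ m = (\<Sum>i\<in>UNIV. \<Sum>j\<in>UNIV. \<Sum>k\<in>UNIV.
    u $ i * v $ j * w $ k * ev (jet h x) 0 (rmE m i j k))"
proof -
  let ?J = "jet h x"
  have fd: "frechet_derivative (\<lambda>y. chr (jet h y) v w) (at x) u $ m =
    (\<Sum>i\<in>UNIV. \<Sum>j\<in>UNIV. \<Sum>k\<in>UNIV. u $ i * v $ j * w $ k * ev ?J 0 (dx i (chE m j k)))" for u v w
    using frechet_derivative_at[OF chr_has_derivative[OF assms, of v w], symmetric]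
    by simp
  have cc: "chr ?J u (chr ?J v w) $ m = (\<Sum>i\<in>UNIV. \<Sum>j\<in>UNIV. \<Sum>k\<in>UNIV. u $ i * v $ j * w $ k *
    (\<Sum>p\<in>UNIV. ev ?J 0 (chE m i p) * ev ?J 0 (chE p j k)))" for u v w
  proof -
    have "chr ?J u (chr ?J v w) $ m = (\<Sum>i\<in>UNIV. \<Sum>p\<in>UNIV. \<Sum>j\<in>UNIV. \<Sum>k\<in>UNIV.
      u $ i * v $ j * w $ k * (ev ?J 0 (chE m i p) * ev ?J 0 (chE p j k)))"
      by (simp add: chr_def sum_distrib_left sum_distrib_right mult_ac)
    also have "\<dots> = (\<Sum>i\<in>UNIV. \<Sum>j\<in>UNIV. \<Sum>k\<in>UNIV. \<Sum>p\<in>UNIV.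
      u $ i * v $ j * w $ k * (ev ?J 0 (chE m i p) * ev ?J 0 (chE p j k)))"
      by (rule sum.cong[OF refl]) (rule sum_rotate)
    finally show ?thesis by (simp only: sum_distrib_left)
  qed
  have swap: "(\<Sum>i\<in>UNIV. \<Sum>j\<in>UNIV. \<Sum>k\<in>UNIV. v $ i * u $ j * w $ k * f i j k)
    = (\<Sum>i\<in>UNIV. \<Sum>j\<in>UNIV. \<Sum>k\<in>UNIV. u $ i * v $ j * w $ k * f j i k)" for f
    by (subst sum.swap) (simp add: mult_ac)
  have "riemann h x u v w $ m = (\<Sum>i\<in>UNIV. \<Sum>j\<in>UNIV. \<Sum>k\<in>UNIV. u $ i * v $ j * w $ k *
      (ev ?J 0 (dx i (chE m j k)) - ev ?J 0 (dx j (chE m i k))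
       + (\<Sum>p\<in>UNIV. ev ?J 0 (chE m i p) * ev ?J 0 (chE p j k))
       - (\<Sum>p\<in>UNIV. ev ?J 0 (chE m j p) * ev ?J 0 (chE p i k))))"
    unfolding riemann_def vector_add_component vector_minus_component christoffel_chr fd cc
      swap[of "\<lambda>i j k. ev ?J 0 (dx i (chE m j k))"]
      swap[of "\<lambda>i j k. \<Sum>p\<in>UNIV. ev ?J 0 (chE m i p) * ev ?J 0 (chE p j k)"]
    by (simp only: sum.distrib sum_subtractf distrib_left right_diff_distrib)
  then show ?thesis
    by (simp add: rmE_def sum_subtractf add_diff_eq)
qed

lemma ricci_ricE:
  assumes "smooth_comps U h" "x \<in> U" "det (h x) \<noteq> 0"
  shows "ricci h x v w = (\<Sum>j\<in>UNIV. \<Sum>k\<in>UNIV. v $ j * w $ k * ev (jet h x) \<theta> (ricE j k))"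
proof -
  have "ev (jet h x) \<theta> (rmE m i j k) = ev (jet h x) 0 (rmE m i j k)" for m i j k
    by (simp add: rmE_def ev_chE dx_def ev_dr chE_def)
  then show ?thesis
    by (simp add: ricci_def riemann_rmE[OF assms] ricE_def sum_3 axis_def algebra_simps)
qed

lemma ev_FE_0:
  assumes "smooth_comps U h" "x \<in> U" "det (h x) \<noteq> 0"
  shows "ev (jet h x) \<theta> (FE 0) = ricci h x (\<theta> $ 3) (\<theta> $ 2)"
  by (simp add: FE_0 ricci_ricE[OF assms, of _ _ \<theta>])

lemma ev_along_geodesic:
  assumes h: "smooth_comps U h" "x t \<in> U" "det (h (x t)) \<noteq> 0"
    and x: "(x has_vector_derivative \<theta> t $ 1) (at t)"
    and \<theta>: "\<And>s. ((\<lambda>t. \<theta> t $ s) has_vector_derivative - christoffel h (x t) (\<theta> t $ 1) (\<theta> t $ s)) (at t)"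
  shows "((\<lambda>t. ev (jet h (x t)) (\<theta> t) e) has_real_derivative ev (jet h (x t)) (\<theta> t) (der e)) (at t)"
proof -
  have "((\<lambda>t. \<theta> t $ s $ k) has_derivative
      (\<lambda>r. (\<chi> s k. - r * christoffel h (x t) (\<theta> t $ 1) (\<theta> t $ s) $ k) $ s $ k)) (at t)" for s k
    using bounded_linear.has_derivative[OF bounded_linear_vec_nth \<theta>[of s, unfolded has_vector_derivative_def], of k]
    by simp
  from ev_jet_has_derivative[OF h(1) x[unfolded has_vector_derivative_def] h(2) this h(3), of e]
  have 1: "((\<lambda>t. ev (jet h (x t)) (\<theta> t) e) has_derivative
    (\<lambda>r. sev (jet h (x t)) (\<theta> t) (\<lambda>ks i j. \<Sum>l\<in>UNIV. (r *\<^sub>R \<theta> t $ 1) $ l * jet h (x t) (l # ks) i j)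
      (\<chi> s k. - r * christoffel h (x t) (\<theta> t $ 1) (\<theta> t $ s) $ k) e)) (at t)" .
  have 2: "(\<chi> s k. - christoffel h (x t) (\<theta> t $ 1) (\<theta> t $ s) $ k)
     = (\<chi> s k. ev (jet h (x t)) (\<theta> t) (Mu (Cst (- 1)) (sm (\<lambda>i. sm (\<lambda>j. Mu (chE k i j) (Mu (Fr 1 i) (Fr s j)))))))"
    by (simp add: vec_eq_iff christoffel_chr chr_def ev_chE_frame[of _ "\<theta> t"] mult_ac)
  \<comment> \<open>A derivative is linear in the increment r, so its value at r is r times its
    value at 1, and the value at 1 is the evaluation of \<open>der e\<close>.\<close>
  from has_derivative_bounded_linear[OF 1] interpret bounded_linear
    "\<lambda>r. sev (jet h (x t)) (\<theta> t) (\<lambda>ks i j. \<Sum>l\<in>UNIV. (r *\<^sub>R \<theta> t $ 1) $ l * jet h (x t) (l # ks) i j)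
      (\<chi> s k. - r * christoffel h (x t) (\<theta> t $ 1) (\<theta> t $ s) $ k) e" .
  have "ev (jet h (x t)) (\<theta> t) (der e) = sev (jet h (x t)) (\<theta> t)
      (\<lambda>ks i j. \<Sum>l\<in>UNIV. \<theta> t $ 1 $ l * jet h (x t) (l # ks) i j)
      (\<chi> s k. - christoffel h (x t) (\<theta> t $ 1) (\<theta> t $ s) $ k) e"
    unfolding der_def ev_dr ev.simps(4) 2 ..
  with scaleR[of _ 1] have "(\<lambda>r. sev (jet h (x t)) (\<theta> t)
      (\<lambda>ks i j. \<Sum>l\<in>UNIV. (r *\<^sub>R \<theta> t $ 1) $ l * jet h (x t) (l # ks) i j)
      (\<chi> s k. - r * christoffel h (x t) (\<theta> t $ 1) (\<theta> t $ s) $ k) e)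
      = (*) (ev (jet h (x t)) (\<theta> t) (der e))"
    by (simp add: fun_eq_iff mult.commute)
  with 1 show ?thesis
    unfolding has_field_derivative_def by (simp only:)
qed

section \<open>Dependence on the top order part of the jet\<close>

primrec ordle :: "nat \<Rightarrow> expr \<Rightarrow> bool" where
  "ordle m (Cst c) = True"
| "ordle m (Jt ks i j) = (length ks \<le> m)"
| "ordle m (Iv i j) = True"
| "ordle m (Fr s k) = True"
| "ordle m (Ad a b) = (ordle m a \<and> ordle m b)"
| "ordle m (Mu a b) = (ordle m a \<and> ordle m b)"

lemma ordle_sm [simp]: "ordle m (sm f) \<longleftrightarrow> (\<forall>i. ordle m (f i))"
  by (auto simp: sm_def) (metis exhaust_3)

lemma ordle_mono: "ordle m e \<Longrightarrow> m \<le> n \<Longrightarrow> ordle n e"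
  by (induction e) auto

definition supp_ord :: "nat \<Rightarrow> jet \<Rightarrow> bool" where
  "supp_ord n \<delta> \<longleftrightarrow> (\<forall>ks i j. length ks \<noteq> n \<longrightarrow> \<delta> ks i j = 0)"

definition jplus :: "jet \<Rightarrow> jet \<Rightarrow> jet" where
  "jplus J \<delta> = (\<lambda>ks i j. J ks i j + \<delta> ks i j)"

text \<open>Contraction of the leading derivative index with u: the perturbation that \<delta>
  induces on the derivative in direction u.\<close>

definition cntr :: "R3 \<Rightarrow> jet \<Rightarrow> jet" where
  "cntr u \<delta> = (\<lambda>ks i j. \<Sum>l\<in>UNIV. u $ l * \<delta> (l # ks) i j)"

lemma supp_ord_cntr: "supp_ord (Suc n) \<delta> \<Longrightarrow> supp_ord n (cntr u \<delta>)"
  by (simp add: supp_ord_def cntr_def)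

lemma supp_ordD: "supp_ord n \<delta> \<Longrightarrow> length ks \<noteq> n \<Longrightarrow> \<delta> ks i j = 0"
  by (simp add: supp_ord_def)

lemma jmat_jplus: "supp_ord n \<delta> \<Longrightarrow> n \<noteq> 0 \<Longrightarrow> jmat (jplus J \<delta>) = jmat J"
  by (simp add: jmat_def jplus_def supp_ord_def)

lemma ev_jplus_low: "ordle m e \<Longrightarrow> supp_ord (Suc m) \<delta> \<Longrightarrow> ev (jplus J \<delta>) \<theta> e = ev J \<theta> e"
proof (induction e)
  case (Jt ks i j)
  then show ?case by (simp add: jplus_def supp_ordD)
qed (simp_all add: jmat_jplus[of "Suc m"])

lemma sev_low: "ordle m e \<Longrightarrow> supp_ord (Suc m) \<delta> \<Longrightarrow> sev J \<theta> \<delta> 0 e = 0"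
  by (induction e) (simp_all add: supp_ordD)

text \<open>An expression of order at most m is blind to a perturbation of order m + 1, so only the
  newly created derivatives respond, and they do so linearly. The assumption 1 \<le> m keeps the
  perturbation away from the inverse metric and from the first derivatives that the
  \<open>Iv\<close> clause of \<open>dr\<close> produces.\<close>

lemma
  assumes "ordle m e" "1 \<le> m" "\<And>l. ordle m (d l)" "\<And>s k. ordle m (w s k)" "supp_ord (Suc m) \<delta>"
  shows ev_dr_top: "ev (jplus J \<delta>) \<theta> (dr d w e)
      = ev J \<theta> (dr d w e) + sev J \<theta> (cntr (\<chi> l. ev J \<theta> (d l)) \<delta>) 0 e"
    and sev_dr_top: "sev J \<theta> \<delta> 0 (dr d w e) = sev J \<theta> (cntr (\<chi> l. ev J \<theta> (d l)) \<delta>) 0 e"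
proof -
  have c0: "cntr u \<delta> [] i j = 0" for u i j
    using assms(2,5) by (simp add: cntr_def supp_ordD)
  note low = ev_jplus_low[where m=m, OF _ assms(5)] sev_low[where m=m, OF _ assms(5)]
  have \<delta>0: "\<delta> [l] p q = 0" "\<delta> [] p q = 0" for l p q
    using assms(2,5) by (simp_all add: supp_ordD)
  have "ev (jplus J \<delta>) \<theta> (dr d w e) = ev J \<theta> (dr d w e) + sev J \<theta> (cntr (\<chi> l. ev J \<theta> (d l)) \<delta>) 0 e \<and>
     sev J \<theta> \<delta> 0 (dr d w e) = sev J \<theta> (cntr (\<chi> l. ev J \<theta> (d l)) \<delta>) 0 e"
    using assms(1)
  proof (induction e)
    case (Jt ks i j)
    have "jplus J \<delta> ks i j = J ks i j + \<delta> ks i j" for ks by (simp add: jplus_def)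
    then show ?case
      by (simp add: low assms(3) cntr_def distrib_left sum.distrib)
  next
    case (Iv i j)
    have "jplus J \<delta> [l] p q = J [l] p q" for l p q by (simp add: jplus_def \<delta>0)
    then show ?case
      by (simp add: low assms(3) c0 \<delta>0 jmat_jplus[OF assms(5)])
  next
    case (Fr s k)
    then show ?case by (simp add: low assms(4))
  next
    case (Mu a b)
    then show ?case by (simp add: low algebra_simps)
  qed simp_all
  then show "ev (jplus J \<delta>) \<theta> (dr d w e) = ev J \<theta> (dr d w e) + sev J \<theta> (cntr (\<chi> l. ev J \<theta> (d l)) \<delta>) 0 e"
    "sev J \<theta> \<delta> 0 (dr d w e) = sev J \<theta> (cntr (\<chi> l. ev J \<theta> (d l)) \<delta>) 0 e" by auto
qed

lemma ordle_dr:
  assumes "ordle m e" "1 \<le> Suc m" "\<And>l. ordle (Suc m) (d l)" "\<And>s k. ordle (Suc m) (w s k)"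
  shows "ordle (Suc m) (dr d w e)"
  using assms(1) by (induction e) (auto simp: assms intro: ordle_mono)

lemma ordle_chE: "1 \<le> m \<Longrightarrow> ordle m (chE k i j)"
  by (simp add: chE_def)

lemma ordle_der: "ordle m e \<Longrightarrow> ordle (Suc m) (der e)"
  unfolding der_def by (rule ordle_dr) (simp_all add: ordle_chE)

lemma ordle_FE: "ordle (Suc (Suc j)) (FE j)"
proof (induction j)
  case 0
  have "ordle (Suc 1) (dx l (chE k i j))" for l k i j
    unfolding dx_def by (rule ordle_dr) (simp_all add: ordle_chE)
  then show ?case by (simp add: FE_0 ricE_def rmE_def ordle_chE)
next
  case (Suc j)
  then show ?case by (simp add: FE_Suc ordle_der)
qed

lemma der_top:
  assumes "ordle m e" "1 \<le> m" "supp_ord (Suc m) \<delta>"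
  shows "ev (jplus J \<delta>) \<theta> (der e) = ev J \<theta> (der e) + sev J \<theta> (cntr (\<theta> $ 1) \<delta>) 0 e"
    and "sev J \<theta> \<delta> 0 (der e) = sev J \<theta> (cntr (\<theta> $ 1) \<delta>) 0 e"
proof -
  have *: "(\<chi> l. ev J \<theta> (Fr 1 l)) = \<theta> $ 1" by (simp add: vec_eq_iff)
  show "ev (jplus J \<delta>) \<theta> (der e) = ev J \<theta> (der e) + sev J \<theta> (cntr (\<theta> $ 1) \<delta>) 0 e"
    unfolding der_def using ev_dr_top[OF assms(1,2) _ _ assms(3), of "Fr 1"] assms(2)
    by (simp add: * ordle_chE)
  show "sev J \<theta> \<delta> 0 (der e) = sev J \<theta> (cntr (\<theta> $ 1) \<delta>) 0 e"
    unfolding der_def using sev_dr_top[OF assms(1,2) _ _ assms(3), of "Fr 1"] assms(2)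
    by (simp add: * ordle_chE)
qed

text \<open>The part of the Ricci tensor that is linear in a pure second order perturbation: the two
  differentiated Christoffel terms respond, the products of Christoffel symbols do not.\<close>

definition linricci :: "jet \<Rightarrow> jet \<Rightarrow> 3 \<Rightarrow> 3 \<Rightarrow> real" where
  "linricci J \<delta> j k = (\<Sum>i\<in>UNIV. sev J 0 (\<lambda>ks. \<delta> (i # ks)) 0 (chE i j k) - sev J 0 (\<lambda>ks. \<delta> (j # ks)) 0 (chE i i k))"

lemma sev_chE: "sev J \<theta> \<delta> 0 (chE k i j) = sev J 0 \<delta> 0 (chE k i j)"
  by (simp add: chE_def)

lemma FE_0_top:
  assumes "supp_ord 2 \<delta>"
  shows "ev (jplus J \<delta>) \<theta> (FE 0) = ev J \<theta> (FE 0) + (\<Sum>j\<in>UNIV. \<Sum>k\<in>UNIV. \<theta> $ 3 $ j * \<theta> $ 2 $ k * linricci J \<delta> j k)"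
    and "sev J \<theta> \<delta> 0 (FE 0) = (\<Sum>j\<in>UNIV. \<Sum>k\<in>UNIV. \<theta> $ 3 $ j * \<theta> $ 2 $ k * linricci J \<delta> j k)"
proof -
  have s: "supp_ord (Suc 1) \<delta>" using assms by (simp add: numeral_2_eq_2)
  have c: "cntr (\<chi> m. if m = l then 1 else 0) \<delta> = (\<lambda>ks. \<delta> (l # ks))" for l
    by (simp add: cntr_def fun_eq_iff if_distrib[of "\<lambda>c. c * _"] cong: if_cong)
  have 1: "ev (jplus J \<delta>) \<theta> (dx l (chE k i j)) = ev J \<theta> (dx l (chE k i j)) + sev J 0 (\<lambda>ks. \<delta> (l # ks)) 0 (chE k i j)"
    for l k i j
    unfolding dx_def by (subst ev_dr_top[of 1, OF _ _ _ _ s]) (simp_all add: ordle_chE c sev_chE[of _ \<theta>])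
  have 2: "sev J \<theta> \<delta> 0 (dx l (chE k i j)) = sev J 0 (\<lambda>ks. \<delta> (l # ks)) 0 (chE k i j)" for l k i j
    unfolding dx_def by (subst sev_dr_top[of 1, OF _ _ _ _ s]) (simp_all add: ordle_chE c sev_chE[of _ \<theta>])
  have 3: "ev (jplus J \<delta>) \<theta> (chE k i j) = ev J \<theta> (chE k i j)" for k i j
    by (rule ev_jplus_low[OF _ s]) (simp add: ordle_chE)
  have 4: "sev J \<theta> \<delta> 0 (chE k i j) = 0" for k i j
    by (rule sev_low[OF _ s]) (simp add: ordle_chE)
  have r1: "ev (jplus J \<delta>) \<theta> (ricE j k) = ev J \<theta> (ricE j k) + linricci J \<delta> j k" for j k
    by (simp add: ricE_def rmE_def 1 3 linricci_def sum.distrib sum_subtractf sum_negf)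
  have r2: "sev J \<theta> \<delta> 0 (ricE j k) = linricci J \<delta> j k" for j k
    by (simp add: ricE_def rmE_def 2 4 linricci_def sum_subtractf sum_negf)
  show "ev (jplus J \<delta>) \<theta> (FE 0) = ev J \<theta> (FE 0) + (\<Sum>j\<in>UNIV. \<Sum>k\<in>UNIV. \<theta> $ 3 $ j * \<theta> $ 2 $ k * linricci J \<delta> j k)"
    by (simp add: FE_0 r1 distrib_left sum.distrib)
  show "sev J \<theta> \<delta> 0 (FE 0) = (\<Sum>j\<in>UNIV. \<Sum>k\<in>UNIV. \<theta> $ 3 $ j * \<theta> $ 2 $ k * linricci J \<delta> j k)"
    by (simp add: FE_0 r2)
qed

text \<open>Each \<open>der\<close> contracts the perturbation once with the first frame vector and
  lowers its order by one. After j contractions a second order perturbation is left, to which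
  \<open>FE_0_top\<close> applies.\<close>

lemma FE_top:
  assumes "supp_ord (Suc (Suc j)) \<delta>"
  shows "ev (jplus J \<delta>) \<theta> (FE j) = ev J \<theta> (FE j) +
    (\<Sum>i\<in>UNIV. \<Sum>k\<in>UNIV. \<theta> $ 3 $ i * \<theta> $ 2 $ k * linricci J ((cntr (\<theta> $ 1) ^^ j) \<delta>) i k)"
proof -
  have sev: "supp_ord (Suc (Suc j)) \<delta> \<Longrightarrow> sev J \<theta> \<delta> 0 (FE j) =
    (\<Sum>i\<in>UNIV. \<Sum>k\<in>UNIV. \<theta> $ 3 $ i * \<theta> $ 2 $ k * linricci J ((cntr (\<theta> $ 1) ^^ j) \<delta>) i k)" for j \<delta>
  proof (induction j arbitrary: \<delta>)
    case 0
    then show ?case using FE_0_top(2) by (simp add: numeral_2_eq_2)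
  next
    case (Suc j)
    then show ?case
      using der_top(2)[OF ordle_FE[of j], of \<delta>] supp_ord_cntr by (simp add: FE_Suc funpow_swap1)
  qed
  show ?thesis
  proof (cases j)
    case 0
    then show ?thesis using FE_0_top(1) assms by (simp add: numeral_2_eq_2)
  next
    case (Suc i)
    then show ?thesis
      using der_top(1)[OF ordle_FE[of i], of \<delta>] assms sev[OF supp_ord_cntr, of i \<delta>]
      by (simp add: FE_Suc funpow_swap1)
  qed
qed

subsection \<open>Conformal perturbations\<close>

text \<open>The jet at \<open>0\<close> of \<open>\<Sum> c (w \<bullet> x)\<^sup>d / d!\<close>, the sum ranging over the triples \<open>(d, c, w)\<close> of the list.\<close>

definition pjet :: "(nat \<times> real \<times> R3) list \<Rightarrow> 3 list \<Rightarrow> real" where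
  "pjet ps ks = (\<Sum>(d, c, w)\<leftarrow>ps. if length ks = d then c * prod_list (map (($) w) ks) else 0)"

text \<open>The jet of g + p g(0) with the constant matrix g(0): a term of degree d of the
  polynomial p then enters the jet at 0 in order d only.\<close>

definition conf :: "jet \<Rightarrow> (nat \<times> real \<times> R3) list \<Rightarrow> jet" where
  "conf J ps = (\<lambda>ks i j. J ks i j + pjet ps ks * jmat J $ i $ j)"

lemma pjet_simps [simp]: "pjet [] ks = 0"
  "pjet ((d, c, w) # ps) ks = (if length ks = d then c * prod_list (map (($) w) ks) else 0) + pjet ps ks"
  "pjet (ps @ qs) ks = pjet ps ks + pjet qs ks"
  by (simp_all add: pjet_def)

lemma pjet_Nil: "\<forall>(d, c, w)\<in>set ps. d \<noteq> 0 \<Longrightarrow> pjet ps [] = 0"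
  by (induction ps) auto

lemma jmat_conf: "\<forall>(d, c, w)\<in>set ps. d \<noteq> 0 \<Longrightarrow> jmat (conf J ps) = jmat J"
  by (simp add: jmat_def conf_def pjet_Nil)

lemma conf_append: "\<forall>(d, c, w)\<in>set ps. d \<noteq> 0 \<Longrightarrow> conf J (ps @ qs) = conf (conf J ps) qs"
  by (auto simp: conf_def jmat_conf[unfolded conf_def] fun_eq_iff distrib_right)

definition orthof :: "real ^ 3 ^ 3 \<Rightarrow> frame \<Rightarrow> bool" where
  "orthof H \<theta> \<longleftrightarrow> (\<forall>s t. \<theta> $ s \<bullet> (H *v \<theta> $ t) = (if s = t then 1 else 0))"

text \<open>To first order a conformal factor 1 + f changes the Ricci tensor by -(n - 2)/2 Hess f -
  (1/2) (Laplacian of f) g. Here n = 3 and the Hessian is c w w^T. The multiple T of the metric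
  stays anonymous because it vanishes on orthogonal vectors.\<close>

lemma linricci_conf:
  assumes sym: "\<And>i j. jmat J $ i $ j = jmat J $ j $ i" and d: "det (jmat J) \<noteq> 0"
    and \<delta>: "\<delta> = (\<lambda>ks i j. (if length ks = 2 then c * prod_list (map (($) w) ks) else 0) * jmat J $ i $ j)"
  obtains T where "\<And>j k. linricci J \<delta> j k = - (1 / 2) * (c * w $ j * w $ k) - T * jmat J $ j $ k"
proof -
  define g where "g = jmat J"
  define B where "B = matrix_inv g"
  have id: "(\<Sum>q\<in>UNIV. B $ m $ q * g $ q $ k) = (if m = k then 1 else 0)" for m k
    using det_nonzero_inverse(2)[OF d] by (simp add: B_def g_def matrix_matrix_mult_def mat_def vec_eq_iff)
  have gs: "g $ i $ j = g $ j $ i" for i j using sym by (simp add: g_def)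
  have id': "(\<Sum>q\<in>UNIV. B $ m $ q * g $ k $ q) = (if m = k then 1 else 0)" for m k
    using id[of m k] by (simp add: gs[of k])
  define S where "S m = (\<Sum>q\<in>UNIV. B $ m $ q * w $ q)" for m
  have sev: "sev J 0 (\<lambda>ks. \<delta> (l # ks)) 0 (chE m j k)
     = 1 / 2 * c * w $ l * (w $ j * (if m = k then 1 else 0) + w $ k * (if m = j then 1 else 0) - S m * g $ j $ k)" for l m j k
  proof -
    have "sev J 0 (\<lambda>ks. \<delta> (l # ks)) 0 (chE m j k)
      = 1 / 2 * (\<Sum>q\<in>UNIV. B $ m $ q * (c * w $ l * (w $ j * g $ k $ q + w $ k * g $ j $ q - w $ q * g $ j $ k)))"
      by (simp add: chE_def \<delta> g_def[symmetric] B_def[symmetric] algebra_simps)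
    also have "\<dots> = 1 / 2 * c * w $ l * (w $ j * (\<Sum>q\<in>UNIV. B $ m $ q * g $ k $ q)
       + w $ k * (\<Sum>q\<in>UNIV. B $ m $ q * g $ j $ q) - S m * g $ j $ k)"
      by (simp add: S_def sum_3 algebra_simps)
    finally show ?thesis by (simp only: id')
  qed
  have S: "(\<Sum>i\<in>UNIV. S i * g $ i $ k) = w $ k" for k
  proof -
    have Bs: "(\<Sum>i\<in>UNIV. B $ i $ q * g $ i $ k) = (if q = k then 1 else 0)" for q
    proof -
      have "g ** B = mat 1" using det_nonzero_inverse(1)[OF d] by (simp add: B_def g_def)
      then have "(\<Sum>i\<in>UNIV. g $ k $ i * B $ i $ q) = (if k = q then 1 else 0)"
        by (simp add: matrix_matrix_mult_def mat_def vec_eq_iff)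
      then show ?thesis by (simp add: gs[of _ k] mult.commute eq_commute)
    qed
    have "(\<Sum>i\<in>UNIV. S i * g $ i $ k) = (\<Sum>q\<in>UNIV. w $ q * (\<Sum>i\<in>UNIV. B $ i $ q * g $ i $ k))"
      by (simp add: S_def sum_3 algebra_simps)
    then show ?thesis by (simp add: Bs if_distrib[of "\<lambda>c. _ * c"] cong: if_cong)
  qed
  show ?thesis
  proof (rule that[of "1 / 2 * c * (\<Sum>i\<in>UNIV. w $ i * S i)"])
    fix j k
    \<comment> \<open>The coefficients of c w_j w_k add up to 1/2 + 1/2 - 1/2 - 3/2 + 1/2 = -1/2;
      the 3 is the dimension, coming from the trace over i.\<close>
    have "linricci J \<delta> j k = (\<Sum>i\<in>UNIV. 1 / 2 * c * w $ i * w $ j * (if i = k then 1 else 0))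
      + (\<Sum>i\<in>UNIV. 1 / 2 * c * w $ i * w $ k * (if i = j then 1 else 0))
      - (\<Sum>i\<in>UNIV. 1 / 2 * c * (w $ i * S i) * g $ j $ k)
      - (\<Sum>i\<in>UNIV. 1 / 2 * c * w $ j * w $ i * (if i = k then 1 else 0))
      - (\<Sum>i\<in>(UNIV::3 set). 1 / 2 * c * w $ j * w $ k)
      + (\<Sum>i\<in>UNIV. 1 / 2 * c * w $ j * (S i * g $ i $ k))"
      unfolding linricci_def sev sum.distrib[symmetric] sum_subtractf[symmetric]
      by (rule sum.cong) (auto simp: algebra_simps)
    moreover have "(\<Sum>i\<in>UNIV. 1 / 2 * c * (w $ i * S i) * g $ j $ k) = 1 / 2 * c * (\<Sum>i\<in>UNIV. w $ i * S i) * g $ j $ k"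
      by (simp only: sum_distrib_left sum_distrib_right)
    moreover have "(\<Sum>i\<in>UNIV. 1 / 2 * c * w $ j * (S i * g $ i $ k)) = 1 / 2 * c * w $ j * w $ k"
      by (simp only: sum_distrib_left[symmetric] S)
    ultimately have "linricci J \<delta> j k = - (1 / 2) * (c * w $ j * w $ k) - 1 / 2 * c * (\<Sum>i\<in>UNIV. w $ i * S i) * g $ j $ k"
      by (simp add: if_distrib[of "\<lambda>c. _ * c"] cong: if_cong)
    then show "linricci J \<delta> j k = - (1 / 2) * (c * w $ j * w $ k) - 1 / 2 * c * (\<Sum>i\<in>UNIV. w $ i * S i) * jmat J $ j $ k"
      by (simp add: g_def)
  qed
qed

text \<open>The j contractions multiply the remaining second order part by the j-th power of
  \<open>w \<bullet> \<theta> $ 1\<close>. The metric multiple of \<open>linricci_conf\<close> drops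
  out since the second and third frame vectors are orthogonal.\<close>

lemma FE_conf_top:
  assumes sym: "transpose (jmat J) = jmat J" and d: "det (jmat J) \<noteq> 0" and \<theta>: "orthof (jmat J) \<theta>"
  shows "ev (conf J [(Suc (Suc j), c, w)]) \<theta> (FE j)
    = ev J \<theta> (FE j) - 1 / 2 * c * (w \<bullet> \<theta> $ 1) ^ j * (w \<bullet> \<theta> $ 2) * (w \<bullet> \<theta> $ 3)"
proof -
  let ?\<delta> = "\<lambda>d c. (\<lambda>ks i j. (if length ks = d then c * prod_list (map (($) w) ks) else 0) * jmat J $ i $ j)"
  have s: "jmat J $ i $ j = jmat J $ j $ i" for i j
    using arg_cong[OF sym, of "\<lambda>A. A $ i $ j"] by (simp add: transpose_def)
  have c1: "cntr u (?\<delta> (Suc d) c) = ?\<delta> d (c * (w \<bullet> u))" for u d c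
    by (auto simp: cntr_def fun_eq_iff inner_vec_def sum_3 algebra_simps)
  have cj: "(cntr u ^^ j) (?\<delta> (Suc (Suc j)) c) = ?\<delta> 2 (c * (w \<bullet> u) ^ j)" for u c
  proof (induction j arbitrary: c)
    case 0
    show ?case by (simp only: funpow_0 power_0 mult_1_right numeral_2_eq_2)
  next
    case (Suc j)
    have "(cntr u ^^ Suc j) (?\<delta> (Suc (Suc (Suc j))) c) = (cntr u ^^ j) (?\<delta> (Suc (Suc j)) (c * (w \<bullet> u)))"
      by (simp only: funpow_Suc_right o_apply c1)
    also have "\<dots> = ?\<delta> 2 (c * (w \<bullet> u) * (w \<bullet> u) ^ j)" by (rule Suc)
    finally show ?case by (simp only: power_Suc mult.assoc)
  qed
  have "conf J [(Suc (Suc j), c, w)] = jplus J (?\<delta> (Suc (Suc j)) c)"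
    by (simp add: conf_def jplus_def fun_eq_iff)
  moreover have "supp_ord (Suc (Suc j)) (?\<delta> (Suc (Suc j)) c)" by (simp add: supp_ord_def)
  ultimately have 1: "ev (conf J [(Suc (Suc j), c, w)]) \<theta> (FE j) = ev J \<theta> (FE j) +
    (\<Sum>i\<in>UNIV. \<Sum>k\<in>UNIV. \<theta> $ 3 $ i * \<theta> $ 2 $ k * linricci J (?\<delta> 2 (c * (w \<bullet> \<theta> $ 1) ^ j)) i k)"
    using FE_top cj by simp
  obtain T where T: "\<And>i k. linricci J (?\<delta> 2 (c * (w \<bullet> \<theta> $ 1) ^ j)) i k
      = - (1 / 2) * (c * (w \<bullet> \<theta> $ 1) ^ j * w $ i * w $ k) - T * jmat J $ i $ k"
    using linricci_conf[OF s d refl] by blast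
  have "(\<Sum>i\<in>UNIV. \<Sum>k\<in>UNIV. \<theta> $ 3 $ i * \<theta> $ 2 $ k * linricci J (?\<delta> 2 (c * (w \<bullet> \<theta> $ 1) ^ j)) i k)
    = - (1 / 2) * (c * (w \<bullet> \<theta> $ 1) ^ j) * (w \<bullet> \<theta> $ 3) * (w \<bullet> \<theta> $ 2) - T * (\<theta> $ 3 \<bullet> (jmat J *v \<theta> $ 2))"
    unfolding T by (simp add: inner_vec_def matrix_vector_mult_def sum_3 algebra_simps)
  moreover have "\<theta> $ 3 \<bullet> (jmat J *v \<theta> $ 2) = 0" using \<theta> by (simp add: orthof_def)
  ultimately show ?thesis using 1 by simp
qed

lemma FE_conf_high:
  assumes "\<forall>(d, c, w)\<in>set ps. d > Suc (Suc j)"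
  shows "ev (conf J ps) \<theta> (FE j) = ev J \<theta> (FE j)"
proof -
  have "ordle m e \<Longrightarrow> \<forall>(d, c, w)\<in>set ps. d > m \<Longrightarrow> ev (conf J ps) \<theta> e = ev J \<theta> e" for m e
  proof (induction e)
    case (Jt ks i j)
    then have "pjet ps ks = 0" by (induction ps) auto
    then show ?case by (simp add: conf_def)
  next
    case (Iv i j)
    then have "jmat (conf J ps) = jmat J" by (intro jmat_conf) auto
    then show ?case by simp
  qed simp_all
  from this[OF ordle_FE assms] show ?thesis .
qed

subsection \<open>Weights\<close>

text \<open>The weight counts derivatives of the metric. The zero constant has every weight, since
  \<open>dr\<close> produces it from constants of weight 0.\<close>

primrec hom :: "nat \<Rightarrow> expr \<Rightarrow> bool" where
  "hom n (Cst c) = (n = 0 \<or> c = 0)"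
| "hom n (Jt ks i j) = (length ks = n)"
| "hom n (Iv i j) = (n = 0)"
| "hom n (Fr s k) = (n = 0)"
| "hom n (Ad a b) = (hom n a \<and> hom n b)"
| "hom n (Mu a b) = (\<exists>p q. p + q = n \<and> hom p a \<and> hom q b)"

lemma hom_MuI: "hom p a \<Longrightarrow> hom q b \<Longrightarrow> p + q = n \<Longrightarrow> hom n (Mu a b)"
  by auto

lemma hom_sm [simp]: "hom n (sm f) \<longleftrightarrow> (\<forall>i. hom n (f i))"
  by (auto simp: sm_def) (metis exhaust_3)

lemma hom_dr:
  assumes "hom n e" "\<And>l. hom 0 (d l)" "\<And>s k. hom 1 (w s k)"
  shows "hom (Suc n) (dr d w e)"
  using assms(1)
proof (induction e arbitrary: n)
  case (Jt ks i j)
  show ?case using Jt by (auto simp del: hom.simps(6) intro!: hom_MuI[OF assms(2)])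
next
  case (Iv i j)
  then have n: "n = 0" by simp
  have h1: "hom 1 (Mu (d l) (Jt [l] p q))" for l p q
    by (rule hom_MuI[OF assms(2)]) auto
  have h2: "hom 1 (Mu (Iv i p) (sm (\<lambda>l. Mu (d l) (Jt [l] p q))))" for p q
    by (rule hom_MuI[of 0 _ 1]) (use h1 in \<open>simp_all del: hom.simps(6)\<close>)
  have h3: "hom 1 (Mu (Mu (Iv i p) (sm (\<lambda>l. Mu (d l) (Jt [l] p q)))) (Iv q j))" for p q
    by (rule hom_MuI[OF h2, of 0]) simp_all
  show ?case
    unfolding n dr.simps by (rule hom_MuI[of 0 _ 1]) (use h3 in \<open>simp_all del: hom.simps(6)\<close>)
next
  case (Fr s k)
  then show ?case using assms(3)[of s k] by simp
next
  case (Mu a b)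
  then obtain p q where "p + q = n" "hom p a" "hom q b" by auto
  with Mu.IH have "hom (Suc n) (Mu (dr d w a) b)" "hom (Suc n) (Mu a (dr d w b))"
    by (auto simp del: hom.simps(6) intro: hom_MuI[of "Suc p" _ q] hom_MuI[of p _ "Suc q"])
  then show ?case by (simp del: hom.simps(6))
qed simp_all

lemma hom_chE: "hom 1 (chE k i j)"
  unfolding chE_def by (auto simp del: hom.simps(6) intro!: hom_MuI[of 0 _ 1])

lemma hom_FE: "hom (Suc (Suc j)) (FE j)"
proof (induction j)
  case 0
  have 1: "hom (Suc (Suc 0)) (dx l (chE k i j))" for l k i j
    unfolding dx_def using hom_dr[OF hom_chE, of "\<lambda>m. Cst (if m = l then 1 else 0)"] by simp
  have "hom (Suc (Suc 0)) (ricE j k)" for j k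
    unfolding ricE_def rmE_def
    by (auto simp del: hom.simps(6) simp: 1 intro!: hom_MuI[of 0 _ 2] hom_MuI[OF hom_chE hom_chE])
      (auto simp: numeral_2_eq_2 1 intro!: hom_chE exI[of _ 1] simp del: One_nat_def)
  moreover have "hom 0 (Mu (Fr 3 j) (Fr 2 k))" for j k
    by (rule hom_MuI[of 0 _ 0]) auto
  ultimately show ?case
    unfolding FE_0 hom_sm by (auto simp del: hom.simps(6) intro: hom_MuI[of 0 _ "Suc (Suc 0)"])
next
  case (Suc j)
  have "hom 0 (Mu (Fr 1 i) (Fr s j))" for i s j
    by (rule hom_MuI[of 0 _ 0]) auto
  then have "hom 1 (Mu (chE k i j) (Mu (Fr 1 i) (Fr s j)))" for k i s j
    by (intro hom_MuI[OF hom_chE, of 0]) auto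
  then show ?case
    unfolding FE_Suc der_def by (intro hom_dr[OF Suc] hom_MuI[of 0 _ 1]) (simp_all del: hom.simps(6))
qed

text \<open>A product whose weight is not divisible by q has a factor with the same property;
  descending this way ends at the zero constant or at a jet variable that vanishes.\<close>

lemma ev_hom_zero:
  assumes "hom n e" "\<And>ks i j. \<not> q dvd length ks \<Longrightarrow> J ks i j = 0" "\<not> q dvd n"
  shows "ev J \<theta> e = 0"
  using assms(1,3)
proof (induction e arbitrary: n)
  case (Mu a b)
  then obtain p r where pr: "p + r = n" "hom p a" "hom r b" by auto
  then have "\<not> q dvd p \<or> \<not> q dvd r" using Mu.prems(2) dvd_add by blast
  then show ?case using Mu.IH pr by auto
qed (use assms(2) in auto)

section \<open>Orthonormal frames\<close>

definition posdef :: "real ^ 3 ^ 3 \<Rightarrow> bool" where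
  "posdef H \<longleftrightarrow> transpose H = H \<and> (\<forall>v. v \<noteq> 0 \<longrightarrow> v \<bullet> (H *v v) > 0)"

lemma riemannian_metric_posdef: "riemannian_metric U g \<longleftrightarrow> (\<forall>x\<in>U. posdef (g x))"
  by (auto simp: riemannian_metric_def posdef_def)

lemma posdef_det: assumes "posdef H" shows "det H \<noteq> 0"
proof -
  have "\<forall>x. H *v x = 0 \<longrightarrow> x = 0"
    using assms by (metis inner_zero_right less_irrefl posdef_def)
  then show ?thesis
    using matrix_left_invertible_ker[of H] invertible_det_nz[of H] invertible_left_inverse[of H] by blast
qed

lemma posdef_mat_1: "posdef (mat 1)"
  by (simp add: posdef_def transpose_mat)

lemma inner_matrix_commute:
  assumes "transpose H = (H :: real^3^3)"
  shows "u \<bullet> (H *v v) = v \<bullet> (H *v u)"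
  using assms dot_lmul_matrix[of u H v] by (metis inner_commute transpose_matrix_vector)

lemma inner_matrix_expand: "u \<bullet> (H *v v) = (\<Sum>i\<in>UNIV. \<Sum>j\<in>UNIV. u $ i * H $ i $ j * v $ j)" for H :: "real^3^3"
  by (simp add: inner_vec_def matrix_vector_mult_def sum_distrib_left mult.assoc)

lemma tendsto_inner_matrix:
  fixes H :: "'a \<Rightarrow> real^3^3"
  assumes "\<And>i. ((\<lambda>n. u n $ i) \<longlongrightarrow> u' $ i) F" "\<And>i. ((\<lambda>n. v n $ i) \<longlongrightarrow> v' $ i) F"
    "\<And>i j. ((\<lambda>n. H n $ i $ j) \<longlongrightarrow> H' $ i $ j) F"
  shows "((\<lambda>n. u n \<bullet> (H n *v v n)) \<longlongrightarrow> u' \<bullet> (H' *v v')) F"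
  unfolding inner_matrix_expand by (intro tendsto_sum tendsto_mult assms)

lemma posdef_lower_bound:
  assumes "posdef H"
  obtains m where "m > 0" "\<And>v. m * (norm v)\<^sup>2 \<le> v \<bullet> (H *v v)"
proof -
  have c: "continuous_on (sphere (0::R3) 1) (\<lambda>v. v \<bullet> (H *v v))"
    by (intro continuous_intros linear_continuous_on_compose matrix_vector_mul_linear)
  have ne: "sphere (0::R3) 1 \<noteq> {}" by simp
  obtain a where a: "a \<in> sphere 0 1" "\<And>v. v \<in> sphere 0 1 \<Longrightarrow> a \<bullet> (H *v a) \<le> v \<bullet> (H *v v)"
    using continuous_attains_inf[OF compact_sphere ne c] by blast
  show ?thesis
  proof (rule that[of "a \<bullet> (H *v a)"])
    have "a \<noteq> 0" using a(1) by auto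
    then show "a \<bullet> (H *v a) > 0" using assms by (simp add: posdef_def)
    show "a \<bullet> (H *v a) * (norm v)\<^sup>2 \<le> v \<bullet> (H *v v)" for v :: R3
    proof (cases "v = 0")
      case False
      define u where "u = (1 / norm v) *\<^sub>R v"
      have v: "v = norm v *\<^sub>R u" using False by (simp add: u_def)
      have "a \<bullet> (H *v a) \<le> u \<bullet> (H *v u)" using a(2)[of u] False by (simp add: u_def)
      then have "a \<bullet> (H *v a) * (norm v)\<^sup>2 \<le> u \<bullet> (H *v u) * (norm v)\<^sup>2" by (intro mult_right_mono) auto
      also have "\<dots> = v \<bullet> (H *v v)"
        by (subst (2 3) v) (simp add: matrix_vector_mult_scaleR power2_eq_square)
      finally show ?thesis .
    qed simp
  qed
qed

lemma inner_matrix_diff_bound: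
  fixes A B :: "real^3^3"
  assumes "\<And>i j. \<bar>A $ i $ j - B $ i $ j\<bar> \<le> e"
  shows "\<bar>v \<bullet> (A *v v) - v \<bullet> (B *v v)\<bar> \<le> 9 * e * (norm v)\<^sup>2"
proof -
  have "v \<bullet> (A *v v) - v \<bullet> (B *v v) = (\<Sum>i\<in>UNIV. \<Sum>j\<in>UNIV. v $ i * (A $ i $ j - B $ i $ j) * v $ j)"
    unfolding inner_matrix_expand by (simp add: sum_subtractf[symmetric] algebra_simps)
  also have "\<bar>\<dots>\<bar> \<le> (\<Sum>i\<in>(UNIV::3 set). \<Sum>j\<in>(UNIV::3 set). norm v * e * norm v)"
  proof (intro order_trans[OF sum_abs] sum_mono)
    fix i j :: 3
    show "\<bar>v $ i * (A $ i $ j - B $ i $ j) * v $ j\<bar> \<le> norm v * e * norm v"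
      unfolding abs_mult by (intro mult_mono component_le_norm_cart assms mult_nonneg_nonneg) (use assms[of i j] in auto)
  qed
  finally show ?thesis by (simp add: power2_eq_square mult_ac)
qed

lemma posdef_nearby:
  assumes "posdef H"
  obtains e where "e > 0" "\<And>A. transpose A = A \<Longrightarrow> (\<And>i j. \<bar>A $ i $ j - H $ i $ j\<bar> \<le> e) \<Longrightarrow> posdef A"
    "\<And>A v. (\<And>i j. \<bar>A $ i $ j - H $ i $ j\<bar> \<le> e) \<Longrightarrow> e * (norm v)\<^sup>2 \<le> v \<bullet> (A *v v)"
proof -
  obtain m where m: "m > 0" "\<And>v. m * (norm v)\<^sup>2 \<le> v \<bullet> (H *v v)" using posdef_lower_bound[OF assms] by blast
  \<comment> \<open>Nine entries, each off by at most m/10, change the form by at most 9 m/10 of the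
    squared norm. The remaining m/10 lets one constant serve both conclusions.\<close>
  have *: "m / 10 * (norm v)\<^sup>2 \<le> v \<bullet> (A *v v)" if "\<And>i j. \<bar>A $ i $ j - H $ i $ j\<bar> \<le> m / 10" for A v
    using inner_matrix_diff_bound[OF that, of v] m(2)[of v] by linarith
  show ?thesis
  proof (rule that[of "m / 10"])
    fix A assume A: "transpose A = A" "\<And>i j. \<bar>A $ i $ j - H $ i $ j\<bar> \<le> m / 10"
    have "0 < v \<bullet> (A *v v)" if "v \<noteq> 0" for v
    proof -
      have "0 < m / 10 * (norm v)\<^sup>2" using m(1) that by simp
      then show ?thesis by (rule less_le_trans) (rule *[OF A(2)])
    qed
    with A(1) show "posdef A" by (simp add: posdef_def)
  qed (use m * in auto)
qed

lemma matrix_tendsto_iff: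
  fixes A :: "'a \<Rightarrow> real^3^3"
  shows "(A \<longlongrightarrow> B) F \<longleftrightarrow> (\<forall>i j. ((\<lambda>n. A n $ i $ j) \<longlongrightarrow> B $ i $ j) F)"
proof
  assume "(A \<longlongrightarrow> B) F"
  then show "\<forall>i j. ((\<lambda>n. A n $ i $ j) \<longlongrightarrow> B $ i $ j) F"
    by (intro allI tendsto_vec_nth)
next
  assume *: "\<forall>i j. ((\<lambda>n. A n $ i $ j) \<longlongrightarrow> B $ i $ j) F"
  show "(A \<longlongrightarrow> B) F"
    by (rule vec_tendstoI, rule vec_tendstoI) (use * in blast)
qed

lemma orthof_matrix: "orthof H \<theta> \<longleftrightarrow> \<theta> ** H ** transpose \<theta> = mat 1"
proof -
  have "(\<theta> ** H ** transpose \<theta>) $ s $ t = \<theta> $ s \<bullet> (H *v \<theta> $ t)" for s t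
    by (simp add: inner_matrix_expand matrix_matrix_mult_def transpose_def sum_distrib_right) (rule sum.swap)
  then show ?thesis by (simp add: orthof_def vec_eq_iff mat_def)
qed

text \<open>Close to a positive definite limit the forms are bounded below uniformly, so orthonormal
  frames stay in a bounded set and a subsequence converges.\<close>

lemma orthof_limit:
  assumes H: "\<And>i j. (\<lambda>n. H n $ i $ j) \<longlonglongrightarrow> H' $ i $ j" and pd: "posdef H'" and o: "\<And>n. orthof (H n) (\<theta> n)"
  obtains r \<theta>' where "strict_mono r" "(\<theta> \<circ> r) \<longlonglongrightarrow> \<theta>'" "orthof H' \<theta>'"
proof -
  obtain e where e: "e > 0" "\<And>A v. (\<And>i j. \<bar>A $ i $ j - H' $ i $ j\<bar> \<le> e) \<Longrightarrow> e * (norm v)\<^sup>2 \<le> v \<bullet> (A *v v)"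
    using posdef_nearby[OF pd] by metis
  have "\<forall>\<^sub>F n in sequentially. \<bar>H n $ i $ j - H' $ i $ j\<bar> \<le> e" for i j
    using tendstoD[OF H e(1), of i j] by eventually_elim (simp add: dist_real_def)
  then have "\<forall>\<^sub>F n in sequentially. \<forall>i j. \<bar>H n $ i $ j - H' $ i $ j\<bar> \<le> e"
    by (intro eventually_all_finite)
  then obtain N where N: "\<And>n i j. n \<ge> N \<Longrightarrow> \<bar>H n $ i $ j - H' $ i $ j\<bar> \<le> e"
    unfolding eventually_sequentially by blast
  have "norm (\<theta> (n + N)) \<le> 3 * (1 / sqrt e)" for n
  proof -
    have "norm (\<theta> (n + N) $ s) \<le> 1 / sqrt e" for s
    proof -
      have "e * (norm (\<theta> (n + N) $ s))\<^sup>2 \<le> 1"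
        using e(2)[OF N, of "n + N" "\<theta> (n + N) $ s"] o[of "n + N"] by (simp add: orthof_def)
      then have "(norm (\<theta> (n + N) $ s))\<^sup>2 \<le> (1 / sqrt e)\<^sup>2"
        using e(1) by (simp add: field_simps power_divide)
      then show ?thesis using e(1) by (simp add: power2_le_iff_abs_le)
    qed
    then have "(\<Sum>s\<in>UNIV. norm (\<theta> (n + N) $ s)) \<le> (\<Sum>s\<in>(UNIV::3 set). 1 / sqrt e)" by (intro sum_mono)
    then show ?thesis using L2_set_le_sum[of UNIV "\<lambda>s. norm (\<theta> (n + N) $ s)"]
      by (simp add: norm_vec_def)
  qed
  then have "bounded (range (\<lambda>n. \<theta> (n + N)))" by (auto simp: bounded_iff)
  then obtain \<theta>' r where r: "strict_mono r" "((\<lambda>n. \<theta> (n + N)) \<circ> r) \<longlonglongrightarrow> \<theta>'"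
    using bounded_imp_convergent_subsequence by blast
  show ?thesis
  proof (rule that[of "\<lambda>n. r n + N"])
    show s: "strict_mono (\<lambda>n. r n + N)" using r(1) by (auto simp: strict_mono_def)
    show lim: "(\<theta> \<circ> (\<lambda>n. r n + N)) \<longlonglongrightarrow> \<theta>'" using r(2) by (simp add: o_def)
    show "orthof H' \<theta>'"
      unfolding orthof_def
    proof (intro allI)
      fix s t
      have "(\<lambda>n. \<theta> (r n + N) $ s \<bullet> (H (r n + N) *v \<theta> (r n + N) $ t)) \<longlonglongrightarrow> \<theta>' $ s \<bullet> (H' *v \<theta>' $ t)"
        using lim LIMSEQ_subseq_LIMSEQ[OF H s]
        by (intro tendsto_inner_matrix) (auto simp: o_def matrix_tendsto_iff)
      moreover have "(\<lambda>n. \<theta> (r n + N) $ s \<bullet> (H (r n + N) *v \<theta> (r n + N) $ t)) = (\<lambda>n. if s = t then 1 else 0)"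
        using o by (auto simp: orthof_def)
      ultimately show "\<theta>' $ s \<bullet> (H' *v \<theta>' $ t) = (if s = t then 1 else 0)"
        by (simp only: LIMSEQ_const_iff)
    qed
  qed
qed

definition zero_frame :: "nat \<Rightarrow> jet \<Rightarrow> frame \<Rightarrow> bool" where
  "zero_frame k J \<theta> \<longleftrightarrow> orthof (jmat J) \<theta> \<and> (\<forall>j\<le>k. ev J \<theta> (FE j) = 0)"

text \<open>The compactness principle behind \<open>conf_open\<close>,
  \<open>no_zero_frame_small\<close>, \<open>zero_free_ball\<close> and
  \<open>stably_chaotic\<close>. Entrywise convergence of the jets is enough because each
  \<open>FE j\<close> is a finite expression.\<close>

lemma zero_frame_limit:
  assumes J: "\<And>ks i j. (\<lambda>n. J n ks i j) \<longlonglongrightarrow> L ks i j" and pd: "posdef (jmat L)"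
    and z: "\<And>n. zero_frame k (J n) (\<theta> n)"
  obtains r \<theta>' where "strict_mono r" "(\<theta> \<circ> r) \<longlonglongrightarrow> \<theta>'" "zero_frame k L \<theta>'"
proof -
  have "(\<lambda>n. jmat (J n) $ i $ j) \<longlonglongrightarrow> jmat L $ i $ j" for i j by (simp add: jmat_def J)
  then obtain r \<theta>' where r: "strict_mono r" "(\<theta> \<circ> r) \<longlonglongrightarrow> \<theta>'" "orthof (jmat L) \<theta>'"
    using orthof_limit[OF _ pd, of "\<lambda>n. jmat (J n)" \<theta>] z unfolding zero_frame_def by blast
  have "ev L \<theta>' (FE j) = 0" if "j \<le> k" for j
  proof -
    have "(\<lambda>n. ev (J (r n)) (\<theta> (r n)) (FE j)) \<longlonglongrightarrow> ev L \<theta>' (FE j)"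
      using r LIMSEQ_subseq_LIMSEQ[OF J r(1)] posdef_det[OF pd]
      by (intro ev_tendsto) (auto simp: o_def matrix_tendsto_iff)
    moreover have "(\<lambda>n. ev (J (r n)) (\<theta> (r n)) (FE j)) = (\<lambda>n. 0)" using z that by (auto simp: zero_frame_def)
    ultimately show ?thesis by (simp only: LIMSEQ_const_iff)
  qed
  then show ?thesis using that r by (auto simp: zero_frame_def)
qed

subsection \<open>Parametrisation of orthonormal frames\<close>

text \<open>Euler angles on O(3): longitude p_1 and latitude p_2 of the first vector, rotation p_3
  of the other two about it, and the orientation s = 1 or s = -1. At s = 1, p = 0 the frame is the
  identity.\<close>

definition eul :: "real \<Rightarrow> R3 \<Rightarrow> frame" where
  "eul s p = vector [vector [cos (p $ 1) * cos (p $ 2), sin (p $ 1) * cos (p $ 2), sin (p $ 2)],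
     vector [- cos (p $ 3) * sin (p $ 1) - sin (p $ 3) * cos (p $ 1) * sin (p $ 2),
             cos (p $ 3) * cos (p $ 1) - sin (p $ 3) * sin (p $ 1) * sin (p $ 2), sin (p $ 3) * cos (p $ 2)],
     vector [s * (sin (p $ 3) * sin (p $ 1) - cos (p $ 3) * cos (p $ 1) * sin (p $ 2)),
             s * (- sin (p $ 3) * cos (p $ 1) - cos (p $ 3) * sin (p $ 1) * sin (p $ 2)), s * (cos (p $ 3) * cos (p $ 2))]]"

lemma eul_differentiable: "(\<lambda>p. eul s p $ i $ j) differentiable at p"
proof -
  have p: "(\<lambda>p::R3. p $ k) differentiable at p" for k
    by (rule bounded_linear_imp_differentiable) (rule bounded_linear_vec_nth)
  have sc: "(\<lambda>p::R3. sin (p $ k)) differentiable at p" "(\<lambda>p::R3. cos (p $ k)) differentiable at p" for k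
    using differentiable_compose[OF _ p, of sin k] differentiable_compose[OF _ p, of cos k]
    by (simp_all add: field_differentiable_imp_differentiable field_differentiable_at_sin field_differentiable_at_cos)
  have "\<forall>i j. (\<lambda>p. eul s p $ i $ j) differentiable at p"
    unfolding forall_3 eul_def
    by (simp, intro conjI disjI2 differentiable_add differentiable_diff differentiable_mult differentiable_minus
        differentiable_const sc)
  then show ?thesis by blast
qed

lemma orthof_1_iff: "orthof (mat 1) \<theta> \<longleftrightarrow> (\<forall>s t. \<theta> $ s \<bullet> \<theta> $ t = (if s = t then 1 else 0))"
  by (simp add: orthof_def)

lemma orthof_eul:
  assumes "s * s = 1" shows "orthof (mat 1) (eul s p)"
proof -
  have c: "(cos x) * cos x = 1 - sin x * sin x" for x :: real
    using sin_cos_squared_add[of x] by (simp add: power2_eq_square)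
  show ?thesis
    unfolding orthof_1_iff forall_3
    apply (simp add: eul_def inner_vec_def sum_3)
    apply (intro conjI)
    using assms c[of "p $ 1"] c[of "p $ 2"] c[of "p $ 3"]
    apply algebra+
    done
qed

lemma eul_surj:
  assumes "orthof (mat 1) \<theta>"
  obtains s p where "s = 1 \<or> s = -1" "\<theta> = eul s p"
proof -
  have o: "\<theta> $ i $ 1 * \<theta> $ j $ 1 + \<theta> $ i $ 2 * \<theta> $ j $ 2 + \<theta> $ i $ 3 * \<theta> $ j $ 3 = (if i = j then 1 else 0)" for i j
    using assms by (simp add: orthof_1_iff inner_vec_def sum_3)
  obtain x y z where v: "x = \<theta> $ 1 $ 1" "y = \<theta> $ 1 $ 2" "z = \<theta> $ 1 $ 3" by simp
  have vn: "x\<^sup>2 + y\<^sup>2 + z\<^sup>2 = 1" using o[of 1 1] by (simp add: v power2_eq_square)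
  obtain b where b: "z = sin b" "sqrt (x\<^sup>2 + y\<^sup>2) = cos b"
    using sincos_total_pi[of "sqrt (x\<^sup>2 + y\<^sup>2)" z] vn sincos_total_2pi[of "sqrt (x\<^sup>2 + y\<^sup>2)" z] by auto
  obtain a where a: "x = cos a * cos b" "y = sin a * cos b"
  proof (cases "cos b = 0")
    case True
    then have "x = 0" "y = 0" using b(2) by (simp_all add: sum_power2_eq_zero_iff)
    then show ?thesis using that[of 0] True by simp
  next
    case False
    have "x\<^sup>2 + y\<^sup>2 = (cos b)\<^sup>2" using b(2) by (metis real_sqrt_pow2 sum_power2_ge_zero)
    then have "(x / cos b)\<^sup>2 + (y / cos b)\<^sup>2 = 1" using False by (simp add: power_divide add_divide_distrib[symmetric])
    then obtain t where "x / cos b = cos t" "y / cos b = sin t" using sincos_total_2pi by metis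
    then show ?thesis using that[of t] False by (simp add: field_simps)
  qed
  \<comment> \<open>Coordinates of the second and third vectors in the basis (east, north) of the
    plane orthogonal to the first, with east = (- sin a, cos a, 0).\<close>
  define A where "A = - sin a * \<theta> $ 2 $ 1 + cos a * \<theta> $ 2 $ 2"
  define B where "B = - cos a * sin b * \<theta> $ 2 $ 1 - sin a * sin b * \<theta> $ 2 $ 2 + cos b * \<theta> $ 2 $ 3"
  define A' where "A' = - sin a * \<theta> $ 3 $ 1 + cos a * \<theta> $ 3 $ 2"
  define B' where "B' = - cos a * sin b * \<theta> $ 3 $ 1 - sin a * sin b * \<theta> $ 3 $ 2 + cos b * \<theta> $ 3 $ 3"
  have ca: "cos a * cos a = 1 - sin a * sin a" and cb: "cos b * cos b = 1 - sin b * sin b"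
    using sin_cos_squared_add[of a] sin_cos_squared_add[of b] by (simp_all add: power2_eq_square)
  have e2: "cos a * cos b * \<theta> $ 2 $ 1 + sin a * cos b * \<theta> $ 2 $ 2 + sin b * \<theta> $ 2 $ 3 = 0"
    using o[of 1 2] v a b(1) by simp
  have e3: "cos a * cos b * \<theta> $ 3 $ 1 + sin a * cos b * \<theta> $ 3 $ 2 + sin b * \<theta> $ 3 $ 3 = 0"
    using o[of 1 3] v a b(1) by simp
  have X: "\<theta> $ 2 $ 1 = - sin a * A - cos a * sin b * B" "\<theta> $ 2 $ 2 = cos a * A - sin a * sin b * B" "\<theta> $ 2 $ 3 = cos b * B"
    unfolding A_def B_def using ca cb e2 by algebra+
  have Z: "\<theta> $ 3 $ 1 = - sin a * A' - cos a * sin b * B'" "\<theta> $ 3 $ 2 = cos a * A' - sin a * sin b * B'" "\<theta> $ 3 $ 3 = cos b * B'"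
    unfolding A'_def B'_def using ca cb e3 by algebra+
  have n2: "A * A + B * B = 1" using o[of 2 2] ca cb unfolding X by simp algebra
  have n3: "A' * A' + B' * B' = 1" using o[of 3 3] ca cb unfolding Z by simp algebra
  have n23: "A * A' + B * B' = 0" using o[of 2 3] ca cb unfolding X Z by simp algebra
  obtain c where c: "A = cos c" "B = sin c" using sincos_total_2pi[of A B] n2 by (auto simp: power2_eq_square)
  \<comment> \<open>The determinant of the two coordinate vectors, which are orthonormal in the
    plane. Hence s is 1 or -1, and (A', B') is s times the quarter turn of (A, B).\<close>
  define s where "s = A * B' - B * A'"
  have s2: "s * s = 1" unfolding s_def using n2 n3 n23 by algebra
  have A': "A' = - s * B" "B' = s * A" unfolding s_def using n2 n3 n23 by algebra+
  show ?thesis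
  proof (rule that[of s "vector [a, b, c]"])
    show "s = 1 \<or> s = -1" using s2 by (simp add: square_eq_1_iff)
    show "\<theta> = eul s (vector [a, b, c])"
      unfolding vec_eq_iff forall_3
      using v a b(1) X Z by (simp add: eul_def A' c algebra_simps)
  qed
qed

lemma orthof_mult:
  assumes "orthof H T" "orthof (mat 1) \<phi>"
  shows "orthof H (\<phi> ** T)"
proof -
  have "\<phi> ** T ** H ** transpose (\<phi> ** T) = \<phi> ** (T ** H ** transpose T) ** transpose \<phi>"
    by (simp add: matrix_transpose_mul matrix_mul_assoc)
  then show ?thesis using assms by (simp add: orthof_matrix)
qed

lemma orthof_factor:
  assumes "orthof H T" "orthof H \<theta>"
  obtains \<phi> where "orthof (mat 1) \<phi>" "\<theta> = \<phi> ** T"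
proof -
  have 1: "T ** H ** transpose T = mat 1" and 2: "\<theta> ** H ** transpose \<theta> = mat 1"
    using assms by (simp_all add: orthof_matrix)
  have "T ** (H ** transpose T) = mat 1" using 1 by (simp add: matrix_mul_assoc)
  then have 3: "(H ** transpose T) ** T = mat 1" by (simp add: matrix_left_right_inverse)
  define \<phi> where "\<phi> = \<theta> ** (H ** transpose T)"
  have \<theta>: "\<theta> = \<phi> ** T" using 3 by (simp add: \<phi>_def matrix_mul_assoc[symmetric])
  have "\<phi> ** transpose \<phi> = \<phi> ** (T ** H ** transpose T) ** transpose \<phi>" by (simp add: 1)
  also have "\<dots> = \<theta> ** H ** transpose \<theta>" by (simp add: \<theta> matrix_transpose_mul matrix_mul_assoc)
  finally have "orthof (mat 1) \<phi>" using 2 by (simp add: orthof_matrix)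
  then show ?thesis using that \<theta> by blast
qed

subsection \<open>Gram-Schmidt\<close>

definition nrmz :: "real^3^3 \<Rightarrow> R3 \<Rightarrow> R3" where
  "nrmz H u = (1 / sqrt (u \<bullet> (H *v u))) *\<^sub>R u"

definition gs1 :: "real^3^3 \<Rightarrow> R3" where "gs1 H = nrmz H (axis 1 1)"
definition gs2 :: "real^3^3 \<Rightarrow> R3" where
  "gs2 H = nrmz H (axis 2 1 - (gs1 H \<bullet> (H *v axis 2 1)) *\<^sub>R gs1 H)"
definition gs3 :: "real^3^3 \<Rightarrow> R3" where
  "gs3 H = nrmz H (axis 3 1 - (gs1 H \<bullet> (H *v axis 3 1)) *\<^sub>R gs1 H - (gs2 H \<bullet> (H *v axis 3 1)) *\<^sub>R gs2 H)"
text \<open>A frame that depends continuously on the metric and is the identity at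
  \<open>mat 1\<close>. Through the products \<open>eul s p ** gs H\<close> the frames orthonormal
  for H are parametrised by angles.\<close>

definition gs :: "real^3^3 \<Rightarrow> frame" where "gs H = vector [gs1 H, gs2 H, gs3 H]"

lemma nrmz_unit: "posdef H \<Longrightarrow> u \<noteq> 0 \<Longrightarrow> nrmz H u \<bullet> (H *v nrmz H u) = 1"
proof -
  assume "posdef H" "u \<noteq> 0"
  then have "0 < u \<bullet> (H *v u)" by (simp add: posdef_def)
  then show ?thesis by (simp add: nrmz_def matrix_vector_mult_scaleR)
qed

lemma nrmz_orth: "w \<bullet> (H *v u) = 0 \<Longrightarrow> w \<bullet> (H *v nrmz H u) = 0"
  by (simp add: nrmz_def matrix_vector_mult_scaleR)

lemma gs_nonzero:
  "axis 1 (1::real) \<noteq> (0 :: R3)"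
  "axis 2 1 - (gs1 H \<bullet> (H *v axis 2 1)) *\<^sub>R gs1 H \<noteq> 0"
  "axis 3 1 - (gs1 H \<bullet> (H *v axis 3 1)) *\<^sub>R gs1 H - (gs2 H \<bullet> (H *v axis 3 1)) *\<^sub>R gs2 H \<noteq> 0"
proof -
  have 1: "gs1 H $ 2 = 0" "gs1 H $ 3 = 0" "gs2 H $ 3 = 0"
    by (simp_all add: gs1_def gs2_def nrmz_def axis_def)
  show "axis 1 (1::real) \<noteq> (0 :: R3)" by (simp add: vec_eq_iff axis_def)
  have "(axis 2 1 - (gs1 H \<bullet> (H *v axis 2 1)) *\<^sub>R gs1 H) $ 2 = 1" using 1 by (simp add: axis_def)
  then show "axis 2 1 - (gs1 H \<bullet> (H *v axis 2 1)) *\<^sub>R gs1 H \<noteq> 0" by (metis zero_index zero_neq_one)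
  have "(axis 3 1 - (gs1 H \<bullet> (H *v axis 3 1)) *\<^sub>R gs1 H - (gs2 H \<bullet> (H *v axis 3 1)) *\<^sub>R gs2 H) $ 3 = 1"
    using 1 by (simp add: axis_def)
  then show "axis 3 1 - (gs1 H \<bullet> (H *v axis 3 1)) *\<^sub>R gs1 H - (gs2 H \<bullet> (H *v axis 3 1)) *\<^sub>R gs2 H \<noteq> 0"
    by (metis zero_index zero_neq_one)
qed

lemma orthof_gs:
  assumes "posdef H" shows "orthof H (gs H)"
proof -
  have sym: "u \<bullet> (H *v v) = v \<bullet> (H *v u)" for u v
    using assms inner_matrix_commute by (auto simp: posdef_def)
  have 11: "gs1 H \<bullet> (H *v gs1 H) = 1"
    unfolding gs1_def by (rule nrmz_unit[OF assms gs_nonzero(1)])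
  have 22: "gs2 H \<bullet> (H *v gs2 H) = 1"
    unfolding gs2_def by (rule nrmz_unit[OF assms gs_nonzero(2)])
  have 33: "gs3 H \<bullet> (H *v gs3 H) = 1"
    unfolding gs3_def by (rule nrmz_unit[OF assms gs_nonzero(3)])
  have 12: "gs1 H \<bullet> (H *v gs2 H) = 0"
    unfolding gs2_def by (rule nrmz_orth) (simp add: matrix_vector_mult_diff_distrib matrix_vector_mult_scaleR inner_diff_right 11)
  have 13: "gs1 H \<bullet> (H *v gs3 H) = 0"
    unfolding gs3_def by (rule nrmz_orth)
      (simp add: matrix_vector_mult_diff_distrib matrix_vector_mult_scaleR inner_diff_right 11 12)
  have 23: "gs2 H \<bullet> (H *v gs3 H) = 0"
    unfolding gs3_def by (rule nrmz_orth)
      (simp add: matrix_vector_mult_diff_distrib matrix_vector_mult_scaleR inner_diff_right 22 12 sym[of "gs2 H" "gs1 H"])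
  show ?thesis
    unfolding orthof_def forall_3 by (simp add: gs_def 11 22 33 12 13 23 sym[of "gs2 H" "gs1 H"] sym[of "gs3 H" "gs1 H"] sym[of "gs3 H" "gs2 H"])
qed

lemma gs_mat_1: "gs (mat 1) = mat 1"
proof -
  have 1: "gs1 (mat 1) = axis 1 1" by (simp add: gs1_def nrmz_def inner_axis_axis)
  have 2: "gs2 (mat 1) = axis 2 1" by (simp add: gs2_def nrmz_def inner_axis_axis 1)
  have 3: "gs3 (mat 1) = axis 3 1" by (simp add: gs3_def nrmz_def inner_axis_axis 1 2)
  show ?thesis unfolding vec_eq_iff forall_3 by (simp add: gs_def 1 2 3) (simp add: axis_def mat_def)
qed

lemma tendsto_gs:
  fixes H :: "nat \<Rightarrow> real^3^3"
  assumes H: "H \<longlonglongrightarrow> H'" and pd: "posdef H'"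
  shows "(\<lambda>n. gs (H n)) \<longlonglongrightarrow> gs H'"
proof -
  have Hc: "(\<lambda>n. H n $ i $ j) \<longlonglongrightarrow> H' $ i $ j" for i j using H by (simp add: matrix_tendsto_iff)
  have ip: "(\<lambda>n. u n \<bullet> (H n *v v n)) \<longlonglongrightarrow> u' \<bullet> (H' *v v')" if "u \<longlonglongrightarrow> u'" "v \<longlonglongrightarrow> v'" for u v u' v'
    by (intro tendsto_inner_matrix tendsto_vec_nth that Hc)
  have nz: "(\<lambda>n. nrmz (H n) (u n)) \<longlonglongrightarrow> nrmz H' u'" if "u \<longlonglongrightarrow> u'" "u' \<noteq> 0" for u u'
    unfolding nrmz_def using pd that
    by (intro tendsto_scaleR tendsto_divide tendsto_const tendsto_real_sqrt ip) (auto simp: posdef_def dest: spec[of _ u'])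
  have 1: "(\<lambda>n. gs1 (H n)) \<longlonglongrightarrow> gs1 H'" unfolding gs1_def by (intro nz tendsto_const gs_nonzero)
  have 2: "(\<lambda>n. gs2 (H n)) \<longlonglongrightarrow> gs2 H'" unfolding gs2_def
    by (intro nz tendsto_diff tendsto_scaleR ip tendsto_const 1 gs_nonzero)
  have 3: "(\<lambda>n. gs3 (H n)) \<longlonglongrightarrow> gs3 H'" unfolding gs3_def
    by (intro nz tendsto_diff tendsto_scaleR ip tendsto_const 1 2 gs_nonzero)
  show ?thesis
  proof (rule vec_tendstoI)
    fix i :: 3
    show "(\<lambda>n. gs (H n) $ i) \<longlonglongrightarrow> gs H' $ i"
      using exhaust_3[of i] 1 2 3 by (auto simp: gs_def)
  qed
qed

section \<open>Generic conformal perturbations\<close>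

text \<open>Bounds the jet at 0 and, on the unit ball, all partial derivatives of the polynomial
  whatever their order (\<open>abs_partials_pf_le\<close>).\<close>

definition psize :: "(nat \<times> real \<times> R3) list \<Rightarrow> real" where
  "psize ps = (\<Sum>(d, c, w)\<leftarrow>ps. \<bar>c\<bar> * (1 + norm w) ^ d)"

definition degs :: "nat set \<Rightarrow> (nat \<times> real \<times> R3) list \<Rightarrow> bool" where
  "degs D ps \<longleftrightarrow> (\<forall>(d, c, w)\<in>set ps. d \<in> D)"

lemma degs_simps [simp]: "degs D []" "degs D ((d, c, w) # ps) \<longleftrightarrow> d \<in> D \<and> degs D ps"
  "degs D (ps @ qs) \<longleftrightarrow> degs D ps \<and> degs D qs"
  by (auto simp: degs_def)

lemma degs_mono: "degs D ps \<Longrightarrow> D \<subseteq> E \<Longrightarrow> degs E ps"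
  by (auto simp: degs_def)

lemma psize_simps [simp]: "psize [] = 0" "psize ((d, c, w) # ps) = \<bar>c\<bar> * (1 + norm w) ^ d + psize ps"
  "psize (ps @ qs) = psize ps + psize qs"
  by (simp_all add: psize_def)

lemma psize_nonneg: "psize ps \<ge> 0"
  by (induction ps) auto

lemma abs_prod_list_nth_le: "\<bar>prod_list (map (($) w) ks)\<bar> \<le> (1 + norm w) ^ length ks" for w :: R3
proof (induction ks)
  case (Cons k ks)
  have "\<bar>w $ k\<bar> \<le> 1 + norm w" using component_le_norm_cart[of w k] by simp
  then show ?case using Cons by (simp add: abs_mult mult_mono)
qed simp

lemma abs_pjet_le: "\<bar>pjet ps ks\<bar> \<le> psize ps"
proof (induction ps)
  case (Cons p ps)
  obtain d c w where p: "p = (d, c, w)" by (cases p)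
  have "\<bar>if length ks = d then c * prod_list (map (($) w) ks) else 0\<bar> \<le> \<bar>c\<bar> * (1 + norm w) ^ d"
    using abs_prod_list_nth_le[of w ks] by (auto simp: abs_mult intro!: mult_left_mono)
  then show ?case using Cons by (simp add: p)
qed simp

lemma tendsto_conf:
  assumes "(\<lambda>n. psize (qs n)) \<longlonglongrightarrow> 0"
  shows "(\<lambda>n. conf J (qs n) ks i j) \<longlonglongrightarrow> J ks i j"
proof -
  have "(\<lambda>n. pjet (qs n) ks) \<longlonglongrightarrow> 0"
    by (rule tendsto_rabs_zero_cancel, rule tendsto_sandwich[OF _ _ tendsto_const assms]) (auto simp: abs_pjet_le)
  from tendsto_add[OF tendsto_const tendsto_mult_right[OF this, of "jmat J $ i $ j"], of "J ks i j"]
  show ?thesis by (simp add: conf_def)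
qed

lemma degs_nonzero: "degs D ps \<Longrightarrow> 0 \<notin> D \<Longrightarrow> \<forall>(d, c, w)\<in>set ps. d \<noteq> 0"
  by (induction ps) (auto simp: degs_def intro!: gr0I)

lemma degs_jmat: "degs D ps \<Longrightarrow> 0 \<notin> D \<Longrightarrow> jmat (conf J ps) = jmat J"
  by (rule jmat_conf[OF degs_nonzero])

lemma degs_append: "degs D ps \<Longrightarrow> 0 \<notin> D \<Longrightarrow> conf J (ps @ qs) = conf (conf J ps) qs"
  by (rule conf_append[OF degs_nonzero])

lemma degs_high: "degs D ps \<Longrightarrow> D \<subseteq> {j + 3..} \<Longrightarrow> ev (conf J ps) \<theta> (FE j) = ev J \<theta> (FE j)"
  by (rule FE_conf_high) (fastforce simp: degs_def)

text \<open>Zero frames in C for perturbations of size tending to 0 would accumulate at a zero frame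
  in C. The closed set C stands for the frames already dealt with, which later perturbations must
  leave intact.\<close>

lemma conf_open:
  assumes C: "closed C" and pd: "posdef (jmat J)" and nz: "\<And>\<theta>. \<theta> \<in> C \<Longrightarrow> \<not> zero_frame k J \<theta>"
  obtains \<eta> where "\<eta> > 0" "\<And>qs \<theta>. psize qs < \<eta> \<Longrightarrow> \<theta> \<in> C \<Longrightarrow> \<not> zero_frame k (conf J qs) \<theta>"
proof (rule ccontr)
  assume neg: "\<not> thesis"
  have "\<exists>qs \<theta>. psize qs < 1 / real (Suc n) \<and> \<theta> \<in> C \<and> zero_frame k (conf J qs) \<theta>" for n
    using neg that[of "1 / real (Suc n)"] by (metis of_nat_0_less_iff zero_less_Suc zero_less_divide_1_iff)
  then obtain qs \<theta> where q: "\<And>n. psize (qs n) < 1 / real (Suc n)" "\<And>n. \<theta> n \<in> C" "\<And>n. zero_frame k (conf J (qs n)) (\<theta> n)"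
    by metis
  have "(\<lambda>n. psize (qs n)) \<longlonglongrightarrow> 0"
    by (rule tendsto_sandwich[OF _ _ tendsto_const lim_1_over_real_power[of 1, THEN LIMSEQ_Suc, simplified]])
       (use q(1) psize_nonneg in \<open>auto intro!: always_eventually less_imp_le simp: inverse_eq_divide\<close>)
  from zero_frame_limit[OF tendsto_conf[OF this] pd q(3)]
  obtain r \<theta>' where r: "strict_mono r" "(\<theta> \<circ> r) \<longlonglongrightarrow> \<theta>'" "zero_frame k J \<theta>'" by metis
  have "\<theta>' \<in> C" by (rule closed_sequentially[OF C _ r(2)]) (simp add: q(2))
  then show False using nz r(3) by blast
qed

text \<open>For fixed \<open>w\<close> the four conditions on a frame determine the coefficients of the four powers of
  \<open>w \<bullet> x\<close> successively, so the bad coefficients form the image of a three-dimensional set.\<close>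

primrec bad :: "jet \<Rightarrow> R3 \<Rightarrow> frame \<Rightarrow> nat \<Rightarrow> (nat \<times> real \<times> R3) list" where
  "bad J w \<theta> 0 = []"
| "bad J w \<theta> (Suc j) = bad J w \<theta> j @ [(Suc (Suc j), 2 * ev (conf J (bad J w \<theta> j)) \<theta> (FE j) /
     ((w \<bullet> \<theta> $ 1) ^ j * (w \<bullet> \<theta> $ 2) * (w \<bullet> \<theta> $ 3)), w)]"

lemma degs_bad: "degs {2..} (bad J w \<theta> j)"
  by (induction j) auto

lemma bad_unique:
  assumes pd: "posdef (jmat J)" and z: "zero_frame k (conf J (map (\<lambda>j. (Suc (Suc j), y j, w)) [0..<Suc k])) \<theta>"
    and nz: "(w \<bullet> \<theta> $ 1) * (w \<bullet> \<theta> $ 2) * (w \<bullet> \<theta> $ 3) \<noteq> 0"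
  shows "j \<le> Suc k \<Longrightarrow> bad J w \<theta> j = map (\<lambda>j. (Suc (Suc j), y j, w)) [0..<j]"
proof (induction j)
  case (Suc j)
  let ?P = "\<lambda>a b. map (\<lambda>j. (Suc (Suc j), y j, w)) [a..<b]"
  have dP: "degs {a + 2..} (?P a b)" for a b by (auto simp: degs_def)
  have dP2: "degs {2..} (?P a b)" for a b by (auto simp: degs_def)
  have split: "?P 0 (Suc k) = ?P 0 j @ ?P j (Suc j) @ ?P (Suc j) (Suc k)"
  proof -
    obtain m where m: "Suc k = Suc j + m" using Suc.prems le_Suc_ex by blast
    have "[0..<Suc k] = [0..<Suc j] @ [Suc j..<Suc k]"
      unfolding m by (rule upt_add_eq_append) simp
    then show ?thesis by simp
  qed
  have "ev (conf J (?P 0 (Suc k))) \<theta> (FE j) = ev (conf (conf J (?P 0 j)) (?P j (Suc j))) \<theta> (FE j)"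
    unfolding split degs_append[OF dP2, simplified] by (rule degs_high[OF dP[of "Suc j"]]) auto
  also have "\<dots> = ev (conf J (?P 0 j)) \<theta> (FE j) - 1 / 2 * y j * (w \<bullet> \<theta> $ 1) ^ j * (w \<bullet> \<theta> $ 2) * (w \<bullet> \<theta> $ 3)"
  proof -
    have jm: "jmat (conf J (?P 0 j)) = jmat J" by (rule degs_jmat[OF dP2]) simp
    have "orthof (jmat J) \<theta>" using z degs_jmat[OF dP2[of 0 "Suc k"], of J] by (simp add: zero_frame_def)
    then show ?thesis
      using FE_conf_top[of "conf J (?P 0 j)" \<theta> j "y j" w] pd posdef_det[OF pd] jm by (simp add: posdef_def)
  qed
  finally have "1 / 2 * y j * (w \<bullet> \<theta> $ 1) ^ j * (w \<bullet> \<theta> $ 2) * (w \<bullet> \<theta> $ 3) = ev (conf J (?P 0 j)) \<theta> (FE j)"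
    using z Suc.prems by (simp add: zero_frame_def)
  then have "y j = 2 * ev (conf J (?P 0 j)) \<theta> (FE j) / ((w \<bullet> \<theta> $ 1) ^ j * (w \<bullet> \<theta> $ 2) * (w \<bullet> \<theta> $ 3))"
    using nz by (simp add: field_simps)
  then show ?case using Suc by simp
qed simp

lemma bad_differentiable:
  fixes \<theta> :: "R3 \<Rightarrow> frame"
  assumes pd: "det (jmat J) \<noteq> 0" and \<theta>: "\<And>i k. (\<lambda>p. \<theta> p $ i $ k) differentiable at p"
    and nz: "(w \<bullet> \<theta> p $ 1) * (w \<bullet> \<theta> p $ 2) * (w \<bullet> \<theta> p $ 3) \<noteq> 0"
  shows "(\<lambda>p. pjet (bad J w (\<theta> p) j) ks) differentiable at p"
    and "(\<lambda>p. 2 * ev (conf J (bad J w (\<theta> p) j)) (\<theta> p) (FE j) /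
     ((w \<bullet> \<theta> p $ 1) ^ j * (w \<bullet> \<theta> p $ 2) * (w \<bullet> \<theta> p $ 3))) differentiable at p"
proof -
  have ip: "(\<lambda>p. w \<bullet> \<theta> p $ s) differentiable at p" for s
    unfolding inner_vec_def by (simp add: sum_3) (intro differentiable_add differentiable_mult differentiable_const \<theta>)
  have ipn: "(\<lambda>p. (w \<bullet> \<theta> p $ s) ^ n) differentiable at p" for s n
    by (induction n) (simp_all add: differentiable_mult[OF ip])
  have step: "(\<lambda>p. 2 * ev (conf J (bad J w (\<theta> p) j)) (\<theta> p) (FE j) /
     ((w \<bullet> \<theta> p $ 1) ^ j * (w \<bullet> \<theta> p $ 2) * (w \<bullet> \<theta> p $ 3))) differentiable at p"
    if "\<And>ks. (\<lambda>p. pjet (bad J w (\<theta> p) j) ks) differentiable at p" for j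
  proof -
    have "(\<lambda>p. ev (conf J (bad J w (\<theta> p) j)) (\<theta> p) (FE j)) differentiable at p"
    proof (rule ev_differentiable[OF _ \<theta>])
      show "(\<lambda>p. conf J (bad J w (\<theta> p) j) ks a b) differentiable at p" for ks a b
        unfolding conf_def by (intro differentiable_add differentiable_mult differentiable_const that)
      show "det (jmat (conf J (bad J w (\<theta> p) j))) \<noteq> 0"
        using degs_jmat[OF degs_bad] pd by simp
    qed
    then show ?thesis
      using nz by (intro differentiable_divide differentiable_mult differentiable_const ip ipn) auto
  qed
  have P: "\<forall>ks. (\<lambda>p. pjet (bad J w (\<theta> p) j) ks) differentiable at p" for j
  proof (induction j)
    case (Suc j)
    show ?case
    proof
      fix ks
      show "(\<lambda>p. pjet (bad J w (\<theta> p) (Suc j)) ks) differentiable at p"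
      proof (cases "length ks = Suc (Suc j)")
        case True
        then have "pjet (bad J w (\<theta> p) (Suc j)) ks = 2 * ev (conf J (bad J w (\<theta> p) j)) (\<theta> p) (FE j) /
            ((w \<bullet> \<theta> p $ 1) ^ j * (w \<bullet> \<theta> p $ 2) * (w \<bullet> \<theta> p $ 3)) * prod_list (map (($) w) ks)
            + pjet (bad J w (\<theta> p) j) ks" for p by simp
        then show ?thesis
          using Suc by (simp only:) (intro differentiable_add differentiable_mult differentiable_const step; blast)
      qed (use Suc in simp)
    qed
  qed simp
  then show "(\<lambda>p. pjet (bad J w (\<theta> p) j) ks) differentiable at p" by blast
  show "(\<lambda>p. 2 * ev (conf J (bad J w (\<theta> p) j)) (\<theta> p) (FE j) /
     ((w \<bullet> \<theta> p $ 1) ^ j * (w \<bullet> \<theta> p $ 2) * (w \<bullet> \<theta> p $ 3))) differentiable at p"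
    using step P by blast
qed

text \<open>The bad coefficient vectors in R^4 lie in the images of subsets of R^3 under two
  differentiable maps, one for each orientation. Such images are negligible, so some arbitrarily
  small vector avoids them.\<close>

lemma kill_direction:
  assumes pd: "posdef (jmat J)" and e: "e > 0"
  obtains ps where "degs {2..} ps" "psize ps < e"
    "\<And>\<theta>. (w \<bullet> \<theta> $ 1) * (w \<bullet> \<theta> $ 2) * (w \<bullet> \<theta> $ 3) \<noteq> 0 \<Longrightarrow> \<not> zero_frame 3 (conf J ps) \<theta>"
proof -
  define T where "T = gs (jmat J)"
  have T: "orthof (jmat J) T" unfolding T_def by (rule orthof_gs[OF pd])
  define \<theta> where "\<theta> s p = eul s p ** T" for s p
  define Y where "Y s j p = 2 * ev (conf J (bad J w (\<theta> s p) j)) (\<theta> s p) (FE j) /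
     ((w \<bullet> \<theta> s p $ 1) ^ j * (w \<bullet> \<theta> s p $ 2) * (w \<bullet> \<theta> s p $ 3))" for s j p
  define S where "S s = {p. (w \<bullet> \<theta> s p $ 1) * (w \<bullet> \<theta> s p $ 2) * (w \<bullet> \<theta> s p $ 3) \<noteq> 0}" for s
  have \<theta>d: "(\<lambda>p. \<theta> s p $ i $ k) differentiable at p" for s i k p
    unfolding \<theta>_def matrix_matrix_mult_def
    by (simp add: sum_3) (intro differentiable_add differentiable_mult differentiable_const eul_differentiable)
  define \<Psi> where "\<Psi> s p = (Y s 0 p, Y s 1 p, Y s 2 p, Y s 3 p)" for s p
  have "\<Psi> s differentiable_on S s" for s
    unfolding \<Psi>_def differentiable_on_def
  proof
    fix p assume "p \<in> S s"
    then have "Y s j differentiable at p" for j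
      unfolding Y_def S_def by (intro bad_differentiable(2) posdef_det[OF pd] \<theta>d) simp
    then have "(\<lambda>p. (Y s 0 p, Y s 1 p, Y s 2 p, Y s 3 p)) differentiable at p"
      by (intro differentiable_Pair) auto
    then show "(\<lambda>p. (Y s 0 p, Y s 1 p, Y s 2 p, Y s 3 p)) differentiable at p within S s"
      by (rule differentiable_at_withinI)
  qed
  then have "negligible (\<Psi> 1 ` S 1 \<union> \<Psi> (-1) ` S (-1))"
    by (intro negligible_Un negligible_differentiable_image_lowdim) auto
  \<comment> \<open>Each of the four terms of \<open>psize ps\<close> is at most \<eta> (1 + norm
    w)^5 = e / 5, so their sum stays below e.\<close>
  moreover define \<eta> where "\<eta> = e / (5 * (1 + norm w) ^ 5)"
  have \<eta>: "\<eta> > 0" using e norm_ge_zero[of w] by (auto simp: \<eta>_def intro!: divide_pos_pos mult_pos_pos zero_less_power simp del: norm_ge_zero)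
  moreover have "\<not> negligible (ball (0 :: real \<times> real \<times> real \<times> real) \<eta>)"
    using \<eta> by (intro open_not_negligible) auto
  ultimately obtain z where z: "z \<in> ball 0 \<eta>" "z \<notin> \<Psi> 1 ` S 1 \<union> \<Psi> (-1) ` S (-1)"
    using negligible_subset by blast
  obtain a b c d where zz: "z = (a, b, c, d)" by (metis surj_pair)
  define y where "y = (!) [a, b, c, d]"
  have y: "y 0 = a" "y 1 = b" "y 2 = c" "y 3 = d" by (simp_all add: y_def)
  define ps where "ps = map (\<lambda>j. (Suc (Suc j), y j, w)) [0..<Suc 3]"
  have ps: "ps = [(2, a, w), (3, b, w), (4, c, w), (5, d, w)]"
    by (simp add: ps_def y_def upt_rec numeral_eq_Suc)
  show ?thesis
  proof (rule that[of ps])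
    show "degs {2..} ps" by (simp add: ps)
    have nz: "norm z < \<eta>" using z(1) by simp
    have "\<bar>a\<bar> < \<eta>" "\<bar>b\<bar> < \<eta>" "\<bar>c\<bar> < \<eta>" "\<bar>d\<bar> < \<eta>"
    proof -
      have "\<bar>a\<bar> \<le> norm z" using norm_fst_le[of a "(b, c, d)"] by (simp add: zz)
      moreover have 1: "norm (b, c, d) \<le> norm z" using norm_snd_le[of "(b, c, d)" a] by (simp add: zz)
      moreover have "\<bar>b\<bar> \<le> norm (b, c, d)" using norm_fst_le[of b "(c, d)"] by simp
      moreover have 2: "norm (c, d) \<le> norm (b, c, d)" using norm_snd_le[of "(c, d)" b] by simp
      moreover have "\<bar>c\<bar> \<le> norm (c, d)" "\<bar>d\<bar> \<le> norm (c, d)" using norm_fst_le[of c d] norm_snd_le[of d c] by simp_all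
      ultimately show "\<bar>a\<bar> < \<eta>" "\<bar>b\<bar> < \<eta>" "\<bar>c\<bar> < \<eta>" "\<bar>d\<bar> < \<eta>" using nz by linarith+
    qed
    moreover have "(1 + norm w) ^ n \<le> (1 + norm w) ^ 5" if "n \<le> 5" for n using that by (intro power_increasing) auto
    ultimately have "\<bar>a\<bar> * (1 + norm w) ^ 2 \<le> \<eta> * (1 + norm w) ^ 5" "\<bar>b\<bar> * (1 + norm w) ^ 3 \<le> \<eta> * (1 + norm w) ^ 5"
      "\<bar>c\<bar> * (1 + norm w) ^ 4 \<le> \<eta> * (1 + norm w) ^ 5" "\<bar>d\<bar> * (1 + norm w) ^ 5 \<le> \<eta> * (1 + norm w) ^ 5"
      by (intro mult_mono; simp)+
    moreover have "5 * (\<eta> * (1 + norm w) ^ 5) = e"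
    proof -
      have "(1 + norm w) ^ 5 \<noteq> 0" using norm_ge_zero[of w] by (simp del: norm_ge_zero)
      then show ?thesis by (simp add: \<eta>_def)
    qed
    ultimately show "psize ps < e" using e by (simp add: ps)
  next
    fix \<theta>' :: frame assume nz: "(w \<bullet> \<theta>' $ 1) * (w \<bullet> \<theta>' $ 2) * (w \<bullet> \<theta>' $ 3) \<noteq> 0"
    show "\<not> zero_frame 3 (conf J ps) \<theta>'"
    proof
      assume zf: "zero_frame 3 (conf J ps) \<theta>'"
      have "jmat (conf J ps) = jmat J" by (rule degs_jmat[of "{2..}"]) (simp_all add: ps)
      then have "orthof (jmat J) \<theta>'" using zf by (simp add: zero_frame_def)
      then obtain \<phi> where \<phi>: "orthof (mat 1) \<phi>" "\<theta>' = \<phi> ** T" using orthof_factor[OF T] by blast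
      obtain s p where sp: "s = 1 \<or> s = -1" "\<phi> = eul s p" using eul_surj[OF \<phi>(1)] by blast
      have \<theta>': "\<theta>' = \<theta> s p" using \<phi>(2) sp(2) by (simp add: \<theta>_def)
      have bad: "bad J w \<theta>' j = map (\<lambda>j. (Suc (Suc j), y j, w)) [0..<j]" if "j \<le> Suc 3" for j
        by (rule bad_unique[OF pd zf[unfolded ps_def] nz that])
      have "Y s j p = y j" if "j \<le> 3" for j
      proof -
        have "last (bad J w \<theta>' (Suc j)) = last (map (\<lambda>j. (Suc (Suc j), y j, w)) [0..<Suc j])"
          by (rule arg_cong[OF bad]) (use that in simp)
        then show ?thesis by (simp add: Y_def \<theta>')
      qed
      from this[of 0] this[of 1] this[of 2] this[of 3] have "\<Psi> s p = z" by (simp add: \<Psi>_def zz y[simplified])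
      moreover have "p \<in> S s" using nz by (simp add: S_def \<theta>')
      ultimately show False using z(2) sp(1) by blast
    qed
  qed
qed

section \<open>Directions in general position on the moment curve\<close>

definition moment_pt :: "nat \<Rightarrow> R3" where
  "moment_pt t = vector [1, real t, (real t)\<^sup>2]"

text \<open>As a function of t the inner product is a nonzero polynomial of degree at most two with
  coefficient vector u, so it has at most two roots.\<close>

lemma card_moment_zeros:
  assumes "u \<noteq> 0" shows "card {t. t < 7 \<and> moment_pt t \<bullet> u = 0} \<le> 2"
proof (rule ccontr)
  assume "\<not> ?thesis"
  then have "3 \<le> card {t. t < 7 \<and> moment_pt t \<bullet> u = 0}" by simp
  then obtain A where A: "A \<subseteq> {t. t < 7 \<and> moment_pt t \<bullet> u = 0}" "card A = 3"
    by (rule obtain_subset_with_card_n)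
  then obtain a b c where abc: "A = {a, b, c}" "a \<noteq> b" "b \<noteq> c" "a \<noteq> c"
    by (auto simp: card_3_iff)
  have e: "u $ 1 + real t * u $ 2 + real t * real t * u $ 3 = 0" if "t \<in> A" for t
    using A(1) that by (auto simp: moment_pt_def inner_vec_def sum_3 power2_eq_square)
  have "(real a - real b) * (u $ 2 + (real a + real b) * u $ 3) = 0" "(real a - real c) * (u $ 2 + (real a + real c) * u $ 3) = 0"
    using e[of a] e[of b] e[of c] abc(1) by (simp_all add: algebra_simps)
  then have 1: "u $ 2 + (real a + real b) * u $ 3 = 0" "u $ 2 + (real a + real c) * u $ 3 = 0" using abc by simp_all
  then have "(real b - real c) * u $ 3 = 0" by algebra
  then have "u $ 3 = 0" using abc by simp
  then have "u $ 2 = 0" "u $ 1 = 0" using 1 e[of a] abc(1) by simp_all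
  then have "u = 0" using \<open>u $ 3 = 0\<close> by (simp add: vec_eq_iff forall_3)
  with assms show False by simp
qed

lemma orthof_nonzero: "orthof H \<theta> \<Longrightarrow> \<theta> $ s \<noteq> 0"
  unfolding orthof_def by (metis inner_zero_left zero_neq_one)

definition dots :: "R3 \<Rightarrow> frame \<Rightarrow> real" where
  "dots w \<theta> = (w \<bullet> \<theta> $ 1) * (w \<bullet> \<theta> $ 2) * (w \<bullet> \<theta> $ 3)"

text \<open>Each of the three frame vectors is orthogonal to at most two of the points, and seven
  points are more than 3 * 2.\<close>

lemma moment_pt_generic:
  assumes "orthof H \<theta>" shows "\<exists>t<7. dots (moment_pt t) \<theta> \<noteq> 0"
proof (rule ccontr)
  assume neg: "\<not> ?thesis"
  let ?A = "\<lambda>s. {t. t < (7::nat) \<and> moment_pt t \<bullet> \<theta> $ s = 0}"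
  have "{..<7::nat} \<subseteq> ?A 1 \<union> ?A 2 \<union> ?A 3" using neg by (auto simp: dots_def)
  then have "card {..<7::nat} \<le> card (?A 1 \<union> ?A 2 \<union> ?A 3)" by (intro card_mono) auto
  also have "\<dots> \<le> card (?A 1) + card (?A 2) + card (?A 3)"
    using card_Un_le[of "?A 1 \<union> ?A 2" "?A 3"] card_Un_le[of "?A 1" "?A 2"] by linarith
  also have "\<dots> \<le> 6"
    using card_moment_zeros[OF orthof_nonzero[OF assms, of 1]] card_moment_zeros[OF orthof_nonzero[OF assms, of 2]]
      card_moment_zeros[OF orthof_nonzero[OF assms, of 3]] by linarith
  finally show False by simp
qed

lemma continuous_dots: "continuous_on UNIV (dots w)"
  unfolding dots_def by (intro continuous_intros)

text \<open>Induction over the seven directions; \<open>conf_open\<close> tells how small the next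
  perturbation must be so that the frames settled before stay settled. The uniform bound \<kappa>,
  found by compactness of the frames, replaces the open condition
  \<open>dots w \<theta> \<noteq> 0\<close> by a closed one.\<close>

lemma generic_perturbation:
  assumes pd: "posdef (jmat J)" and e: "e > 0"
  obtains ps where "degs {2..} ps" "psize ps < e" "\<And>\<theta>. \<not> zero_frame 3 (conf J ps) \<theta>"
proof -
  obtain \<kappa> where \<kappa>: "\<kappa> > 0" "\<And>\<theta>. orthof (jmat J) \<theta> \<Longrightarrow> \<exists>t<7. \<kappa> \<le> \<bar>dots (moment_pt t) \<theta>\<bar>"
  proof (rule ccontr)
    assume neg: "\<not> thesis"
    have "\<exists>\<theta>. orthof (jmat J) \<theta> \<and> (\<forall>t<7. \<bar>dots (moment_pt t) \<theta>\<bar> < 1 / real (Suc n))" for n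
      using neg that[of "1 / real (Suc n)"] by (metis not_le of_nat_0_less_iff zero_less_Suc zero_less_divide_1_iff)
    then obtain \<theta> where \<theta>: "\<And>n. orthof (jmat J) (\<theta> n)" "\<And>n t. t < 7 \<Longrightarrow> \<bar>dots (moment_pt t) (\<theta> n)\<bar> < 1 / real (Suc n)"
      by metis
    obtain r \<theta>' where r: "strict_mono r" "(\<theta> \<circ> r) \<longlonglongrightarrow> \<theta>'" "orthof (jmat J) \<theta>'"
      by (rule orthof_limit[of "\<lambda>_. jmat J" "jmat J" \<theta>, OF tendsto_const pd \<theta>(1)])
    obtain t where t: "t < 7" "dots (moment_pt t) \<theta>' \<noteq> 0" using moment_pt_generic[OF r(3)] by blast
    have "(\<lambda>n. dots (moment_pt t) ((\<theta> \<circ> r) n)) \<longlonglongrightarrow> dots (moment_pt t) \<theta>'"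
      using continuous_on_tendsto_compose[OF continuous_dots r(2)] by simp
    moreover have "(\<lambda>n. dots (moment_pt t) ((\<theta> \<circ> r) n)) \<longlonglongrightarrow> 0"
    proof (rule tendsto_rabs_zero_cancel, rule tendsto_sandwich[OF _ _ tendsto_const])
      show "(\<lambda>n. 1 / real (Suc (r n))) \<longlonglongrightarrow> 0"
        using LIMSEQ_subseq_LIMSEQ[OF lim_1_over_real_power[of 1, THEN LIMSEQ_Suc] r(1)] by (simp add: o_def)
      show "\<forall>\<^sub>F n in sequentially. \<bar>dots (moment_pt t) ((\<theta> \<circ> r) n)\<bar> \<le> 1 / real (Suc (r n))"
        using \<theta>(2)[OF t(1)] by (auto intro!: always_eventually less_imp_le)
    qed auto
    ultimately show False using t(2) LIMSEQ_unique by blast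
  qed
  have "\<exists>ps. degs {2..} ps \<and> psize ps < e \<and> (\<forall>\<theta>. (\<exists>t<m. \<kappa> \<le> \<bar>dots (moment_pt t) \<theta>\<bar>) \<longrightarrow> \<not> zero_frame 3 (conf J ps) \<theta>)" for m
  proof (induction m)
    case 0
    show ?case using e by (intro exI[of _ "[]"]) auto
  next
    case (Suc m)
    then obtain ps where ps: "degs {2..} ps" "psize ps < e"
      "\<And>\<theta>. (\<exists>t<m. \<kappa> \<le> \<bar>dots (moment_pt t) \<theta>\<bar>) \<Longrightarrow> \<not> zero_frame 3 (conf J ps) \<theta>" by blast
    have jm: "jmat (conf J ps) = jmat J" by (rule degs_jmat[OF ps(1)]) simp
    have "{\<theta>. \<exists>t<m. \<kappa> \<le> \<bar>dots (moment_pt t) \<theta>\<bar>} = (\<Union>t<m. {\<theta>. \<kappa> \<le> \<bar>dots (moment_pt t) \<theta>\<bar>})" by auto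
    then have cl: "closed {\<theta>. \<exists>t<m. \<kappa> \<le> \<bar>dots (moment_pt t) \<theta>\<bar>}"
      by (auto intro!: closed_UN closed_Collect_le continuous_on_const continuous_on_rabs continuous_dots)
    obtain \<eta> where \<eta>: "\<eta> > 0" "\<And>qs \<theta>. psize qs < \<eta> \<Longrightarrow> \<exists>t<m. \<kappa> \<le> \<bar>dots (moment_pt t) \<theta>\<bar> \<Longrightarrow> \<not> zero_frame 3 (conf (conf J ps) qs) \<theta>"
      using conf_open[OF cl, of "conf J ps" 3] ps(3) pd jm by auto
    obtain qs where qs: "degs {2..} qs" "psize qs < min \<eta> (e - psize ps)"
      "\<And>\<theta>. dots (moment_pt m) \<theta> \<noteq> 0 \<Longrightarrow> \<not> zero_frame 3 (conf (conf J ps) qs) \<theta>"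
      using kill_direction[of "conf J ps" "min \<eta> (e - psize ps)" "moment_pt m"] pd jm \<eta>(1) ps(2)
      unfolding dots_def by (metis diff_gt_0_iff_gt min_less_iff_conj)
    have "conf J (ps @ qs) = conf (conf J ps) qs" by (rule degs_append[OF ps(1)]) simp
    moreover have "\<not> zero_frame 3 (conf (conf J ps) qs) \<theta>" if t: "t < Suc m" "\<kappa> \<le> \<bar>dots (moment_pt t) \<theta>\<bar>" for \<theta> t
    proof (cases "t = m")
      case True
      then show ?thesis using qs(3) t(2) \<kappa>(1) by force
    next
      case False
      then show ?thesis using \<eta>(2) qs(2) t by (metis less_Suc_eq min_less_iff_conj)
    qed
    ultimately show ?case using ps qs by (intro exI[of _ "ps @ qs"]) auto
  qed
  from this[of 7] obtain ps where ps: "degs {2..} ps" "psize ps < e"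
    "\<And>\<theta>. (\<exists>t<7. \<kappa> \<le> \<bar>dots (moment_pt t) \<theta>\<bar>) \<Longrightarrow> \<not> zero_frame 3 (conf J ps) \<theta>" by blast
  have "jmat (conf J ps) = jmat J" by (rule degs_jmat[OF ps(1)]) simp
  then have "\<not> zero_frame 3 (conf J ps) \<theta>" for \<theta>
    using \<kappa>(2)[of \<theta>] ps(3)[of \<theta>] by (auto simp: zero_frame_def)
  with ps that show ?thesis by blast
qed

section \<open>Conformally flat examples\<close>

definition flat_jet :: jet where
  "flat_jet ks i j = (if ks = [] \<and> i = j then 1 else 0)"

lemma jmat_flat [simp]: "jmat flat_jet = mat 1"
  by (simp add: jmat_def flat_jet_def mat_def vec_eq_iff)

text \<open>For terms of degree j + 2 this is the polarisation of the polynomial with terms c (w .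
  x)^(j + 2): the symmetric multilinear form evaluated at j copies of the first frame vector, the
  second and the third.\<close>

definition tens :: "nat \<Rightarrow> (nat \<times> real \<times> R3) list \<Rightarrow> frame \<Rightarrow> real" where
  "tens j ps \<theta> = (\<Sum>(d, c, w)\<leftarrow>ps. c * (w \<bullet> \<theta> $ 1) ^ j * (w \<bullet> \<theta> $ 2) * (w \<bullet> \<theta> $ 3))"

lemma tens_simps [simp]: "tens j [] \<theta> = 0"
  "tens j ((d, c, w) # ps) \<theta> = c * (w \<bullet> \<theta> $ 1) ^ j * (w \<bullet> \<theta> $ 2) * (w \<bullet> \<theta> $ 3) + tens j ps \<theta>"
  by (simp_all add: tens_def)

lemma tens_tendsto:
  assumes "(\<lambda>n. \<theta> n) \<longlonglongrightarrow> \<theta>'"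
  shows "(\<lambda>n. tens j ps (\<theta> n)) \<longlonglongrightarrow> tens j ps \<theta>'"
proof (induction ps)
  case (Cons p ps)
  obtain d c w where "p = (d, c, w)" by (cases p)
  then show ?case using Cons
    by simp (intro tendsto_add tendsto_mult tendsto_const tendsto_power tendsto_inner tendsto_vec_nth assms)
qed simp

lemma FE_conf_tens:
  assumes "degs {Suc (Suc j)} ps" "posdef (jmat J)" "orthof (jmat J) \<theta>"
  shows "ev (conf J ps) \<theta> (FE j) = ev J \<theta> (FE j) - 1 / 2 * tens j ps \<theta>"
  using assms
proof (induction ps arbitrary: J)
  case Nil
  then show ?case by (simp add: conf_def)
next
  case (Cons p ps)
  obtain c w where p: "p = (Suc (Suc j), c, w)" using Cons.prems(1) by (cases p) auto
  have d: "degs {Suc (Suc j)} [p]" "degs {Suc (Suc j)} ps" using Cons.prems(1) by (simp_all add: p)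
  have jm: "jmat (conf J [p]) = jmat J" by (rule degs_jmat[OF d(1)]) simp
  have "conf J (p # ps) = conf (conf J [p]) ps" using degs_append[OF d(1), of J ps] by simp
  then show ?case
    using Cons.IH[OF d(2), of "conf J [p]"] Cons.prems jm FE_conf_top[of J \<theta> j c w] posdef_det[OF Cons.prems(2)]
    by (simp add: p posdef_def algebra_simps)
qed

lemma ev_FE_hom_zero:
  assumes "degs {d. q dvd d} ps" "\<not> q dvd Suc (Suc j)"
  shows "ev (conf flat_jet ps) \<theta> (FE j) = 0"
proof (rule ev_hom_zero[OF hom_FE _ assms(2)])
  fix ks i k assume ks: "\<not> q dvd length (ks :: 3 list)"
  have "pjet ps ks = 0" using assms(1) ks by (induction ps) auto
  moreover have "ks \<noteq> []" using ks by auto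
  ultimately show "conf flat_jet ps ks i k = 0" by (simp add: conf_def flat_jet_def)
qed

text \<open>Weights eliminate the nonlinear terms: \<open>FE 1\<close> has weight 3, which no
  product of second order entries reaches, and \<open>FE 2\<close> has weight 4, which no product of
  third order entries reaches. The third identity leaves out \<open>ps2\<close>, since a product of
  two second order entries does have weight 4.\<close>

lemma FE_flat:
  assumes d: "degs {2} ps2" "degs {3} ps3" "degs {4} ps4" and \<theta>: "orthof (mat 1) \<theta>"
  shows "ev (conf flat_jet (ps2 @ ps3 @ ps4)) \<theta> (FE 0) = - (1 / 2) * tens 0 ps2 \<theta>"
    "ev (conf flat_jet (ps2 @ ps3 @ ps4)) \<theta> (FE 1) = - (1 / 2) * tens 1 ps3 \<theta>"
    "ev (conf flat_jet (ps3 @ ps4)) \<theta> (FE 2) = - (1 / 2) * tens 2 ps4 \<theta>"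
proof -
  have ap: "conf flat_jet (ps2 @ ps3 @ ps4) = conf (conf flat_jet ps2) (ps3 @ ps4)"
    "conf flat_jet (ps2 @ ps3 @ ps4) = conf (conf (conf flat_jet ps2) ps3) ps4"
    "conf flat_jet (ps3 @ ps4) = conf (conf flat_jet ps3) ps4"
    using degs_append[OF d(1)] degs_append[OF d(2)] by auto
  have jm: "jmat (conf flat_jet ps2) = mat 1" "jmat (conf flat_jet ps3) = mat 1"
    using degs_jmat[OF d(1)] degs_jmat[OF d(2)] by auto
  have "ev (conf flat_jet (ps2 @ ps3 @ ps4)) \<theta> (FE 0) = ev (conf flat_jet ps2) \<theta> (FE 0)"
    unfolding ap(1) by (rule degs_high[of "{3, 4}"]) (use d in \<open>auto simp: degs_def\<close>)
  also have "\<dots> = ev flat_jet \<theta> (FE 0) - 1 / 2 * tens 0 ps2 \<theta>"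
    by (rule FE_conf_tens) (use d \<theta> posdef_mat_1 in \<open>simp_all add: numeral_2_eq_2\<close>)
  also have "ev flat_jet \<theta> (FE 0) = 0"
  proof -
    \<comment> \<open>Any q that does not divide the weight 2 serves here: for the empty list all
      jet entries of positive order vanish.\<close>
    have "\<not> (3::nat) dvd Suc (Suc 0)" by presburger
    from ev_FE_hom_zero[OF _ this, of "[]" \<theta>] show ?thesis by (simp add: conf_def)
  qed
  finally show "ev (conf flat_jet (ps2 @ ps3 @ ps4)) \<theta> (FE 0) = - (1 / 2) * tens 0 ps2 \<theta>" by simp
  have "ev (conf flat_jet (ps2 @ ps3 @ ps4)) \<theta> (FE 1) = ev (conf (conf flat_jet ps2) ps3) \<theta> (FE 1)"
    unfolding ap(2) by (rule degs_high[OF d(3)]) auto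
  also have "\<dots> = ev (conf flat_jet ps2) \<theta> (FE 1) - 1 / 2 * tens 1 ps3 \<theta>"
    by (rule FE_conf_tens) (use d \<theta> posdef_mat_1 jm in \<open>simp_all add: numeral_3_eq_3\<close>)
  also have "ev (conf flat_jet ps2) \<theta> (FE 1) = 0"
    by (rule ev_FE_hom_zero[of 2]) (use d in \<open>auto simp: degs_def\<close>)
  finally show "ev (conf flat_jet (ps2 @ ps3 @ ps4)) \<theta> (FE 1) = - (1 / 2) * tens 1 ps3 \<theta>" by simp
  have "ev (conf flat_jet (ps3 @ ps4)) \<theta> (FE 2) = ev (conf flat_jet ps3) \<theta> (FE 2) - 1 / 2 * tens 2 ps4 \<theta>"
    unfolding ap(3) by (rule FE_conf_tens) (use d \<theta> posdef_mat_1 jm in \<open>simp_all add: numeral_eq_Suc\<close>)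
  also have "ev (conf flat_jet ps3) \<theta> (FE 2) = 0"
    by (rule ev_FE_hom_zero[of 3]) (use d in \<open>auto simp: degs_def\<close>)
  finally show "ev (conf flat_jet (ps3 @ ps4)) \<theta> (FE 2) = - (1 / 2) * tens 2 ps4 \<theta>" by simp
qed

definition scal :: "real \<Rightarrow> (nat \<times> real \<times> R3) list \<Rightarrow> (nat \<times> real \<times> R3) list" where
  "scal \<epsilon> ps = map (\<lambda>(d, c, w). (d, \<epsilon> * c, w)) ps"

lemma tens_scal: "tens j (scal \<epsilon> ps) \<theta> = \<epsilon> * tens j ps \<theta>"
  by (induction ps) (auto simp: scal_def algebra_simps)

lemma degs_scal [simp]: "degs D (scal \<epsilon> ps) = degs D ps"
  by (auto simp: degs_def scal_def)

lemma pjet_scal: "pjet (scal \<epsilon> ps) ks = \<epsilon> * pjet ps ks"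
  by (induction ps) (auto simp: scal_def algebra_simps)

lemma conf_scal_tendsto:
  assumes "\<epsilon> \<longlonglongrightarrow> 0"
  shows "(\<lambda>n. conf flat_jet (scal (\<epsilon> n) ps @ qs) ks i j) \<longlonglongrightarrow> conf flat_jet qs ks i j"
proof -
  have "(\<lambda>n. flat_jet ks i j + (\<epsilon> n * pjet ps ks + pjet qs ks) * mat 1 $ i $ j)
     \<longlonglongrightarrow> flat_jet ks i j + (0 * pjet ps ks + pjet qs ks) * mat 1 $ i $ j"
    by (intro tendsto_add tendsto_mult tendsto_const assms)
  then show ?thesis by (simp add: conf_def pjet_scal)
qed

text \<open>If the three forms have no common zero frame, neither has the metric with small second order part:
  for vanishing second order part the nonlinear terms of \<open>FE 2\<close> drop out by homogeneity.\<close>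

lemma no_zero_frame_small:
  assumes d: "degs {2} ps2" "degs {3} ps3" "degs {4} ps4"
    and nz: "\<And>\<theta>. orthof (mat 1) \<theta> \<Longrightarrow> tens 0 ps2 \<theta> = 0 \<Longrightarrow> tens 1 ps3 \<theta> = 0 \<Longrightarrow> tens 2 ps4 \<theta> \<noteq> 0"
  obtains \<epsilon> where "\<And>\<theta>. \<not> zero_frame 2 (conf flat_jet (scal \<epsilon> ps2 @ ps3 @ ps4)) \<theta>"
proof (rule ccontr)
  assume neg: "\<not> thesis"
  define \<epsilon> where "\<epsilon> n = 1 / real (Suc n)" for n
  have \<epsilon>: "\<epsilon> \<longlonglongrightarrow> 0" "\<And>n. \<epsilon> n \<noteq> 0"
    using lim_1_over_real_power[of 1, THEN LIMSEQ_Suc] by (auto simp: \<epsilon>_def[abs_def])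
  define J where "J n = conf flat_jet (scal (\<epsilon> n) ps2 @ ps3 @ ps4)" for n
  have "\<exists>\<theta>. zero_frame 2 (J n) \<theta>" for n using neg that unfolding J_def by blast
  then obtain \<theta> where \<theta>: "\<And>n. zero_frame 2 (J n) (\<theta> n)" by metis
  have jm: "jmat (conf flat_jet (scal e ps2 @ ps3 @ ps4)) = mat 1" "jmat (conf flat_jet (ps3 @ ps4)) = mat 1" for e
    by (subst degs_jmat[of "{2, 3, 4}"]; use d in \<open>auto simp: degs_def scal_def\<close>)+
  have o: "orthof (mat 1) (\<theta> n)" for n using \<theta>[of n] jm by (simp add: zero_frame_def J_def)
  \<comment> \<open>Since the factor \<open>\<epsilon> n\<close> is nonzero, the first equation
    holds for the unscaled form. In this version it survives the limit, where the scaled form itself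
    disappears.\<close>
  have "tens 0 ps2 (\<theta> n) = 0" "tens 1 ps3 (\<theta> n) = 0" for n
    using \<theta>[of n] FE_flat(1,2)[OF _ d(2,3) o, of "scal (\<epsilon> n) ps2" n] d(1) \<epsilon>(2)
    by (auto simp: zero_frame_def J_def tens_scal)
  note t = this
  obtain r \<theta>' where r: "strict_mono r" "(\<theta> \<circ> r) \<longlonglongrightarrow> \<theta>'" "zero_frame 2 (conf flat_jet (ps3 @ ps4)) \<theta>'"
  proof (rule zero_frame_limit[of J "conf flat_jet (ps3 @ ps4)" 2 \<theta>])
    show "(\<lambda>n. J n ks i j) \<longlonglongrightarrow> conf flat_jet (ps3 @ ps4) ks i j" for ks i j
      unfolding J_def by (rule conf_scal_tendsto[OF \<epsilon>(1)])
  qed (use posdef_mat_1 jm \<theta> in auto)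
  have o': "orthof (mat 1) \<theta>'" using r(3) jm by (simp add: zero_frame_def)
  have "tens 0 ps2 \<theta>' = 0" "tens 1 ps3 \<theta>' = 0"
    using tens_tendsto[OF r(2), of 0 ps2] tens_tendsto[OF r(2), of 1 ps3] t by (simp_all add: o_def LIMSEQ_const_iff)
  moreover have "tens 2 ps4 \<theta>' = 0"
    using FE_flat(3)[OF d o'] r(3) by (simp add: zero_frame_def)
  ultimately show False using nz[OF o'] by blast
qed

subsection \<open>Three forms without common zero frame\<close>

text \<open>A sum of squares certificate: the quadratics multiplied by t^6 and t^4 have negative
  discriminant, the square takes up the middle terms, and the quadratic that remains has negative
  discriminant too.\<close>

lemma octic_positive: "44 - 68 * t + 10 * t ^ 2 + 22 * t ^ 3 + 74 * t ^ 4 + 56 * t ^ 5 + 48 * t ^ 6 + 14 * t ^ 7 + 4 * t ^ 8 > (0::real)"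
proof -
  have a: "2 * t\<^sup>2 + 7 * t + 7 \<ge> 0"
    using sum_squares_ge_zero[of "4 * t + 7" 0] by (simp add: power2_eq_square algebra_simps)
  have b: "17 * t\<^sup>2 + 28 * t + 12 \<ge> 0"
    using sum_squares_ge_zero[of "17 * t + 14" 0] by (simp add: power2_eq_square algebra_simps)
  have c: "(5 * t\<^sup>2 + 11 / 10 * t - 2)\<^sup>2 \<ge> 0" by simp
  have d: "2379 / 100 * t\<^sup>2 - 296 / 10 * t + 18 > 0"
    using sum_squares_ge_zero[of "2379 / 100 * t - 148 / 10" 0] by (simp add: power2_eq_square algebra_simps)
  have "44 - 68 * t + 10 * t ^ 2 + 22 * t ^ 3 + 74 * t ^ 4 + 56 * t ^ 5 + 48 * t ^ 6 + 14 * t ^ 7 + 4 * t ^ 8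
     = 2 * (t ^ 6 * (2 * t\<^sup>2 + 7 * t + 7) + t ^ 4 * (17 * t\<^sup>2 + 28 * t + 12) + (5 * t\<^sup>2 + 11 / 10 * t - 2)\<^sup>2
       + (2379 / 100 * t\<^sup>2 - 296 / 10 * t + 18))"
    by (simp add: power2_eq_square power_numeral_reduce algebra_simps)
  moreover have "t ^ 6 * (2 * t\<^sup>2 + 7 * t + 7) \<ge> 0" "t ^ 4 * (17 * t\<^sup>2 + 28 * t + 12) \<ge> 0"
    using a b by (simp_all add: zero_le_even_power)
  moreover have "0 < 2 * (A + B + C + D)" if "A \<ge> 0" "B \<ge> 0" "C \<ge> 0" "D > 0" for A B C D :: real
    using that by simp
  ultimately show ?thesis using c d by (simp only:)
qed

text \<open>The three lists write the polynomials u_3^2 - u_1^2, 6 u_1 u_2 u_3 + 6 u_2^2 u_3 and 12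
  u_1 u_2^2 u_3 - 4 u_2 u_3^3 as combinations of powers of linear forms, the shape that
  \<open>FE_conf_top\<close> handles.\<close>

definition forms2 :: "(nat \<times> real \<times> R3) list" where
  "forms2 = [(2, -1, vector [1, 0, 0]), (2, 1, vector [0, 0, 1])]"
definition forms3 :: "(nat \<times> real \<times> R3) list" where
  "forms3 = [(3, 1/4, vector [1, 1, 1]), (3, -1/4, vector [1, 1, -1]), (3, -1/4, vector [1, -1, 1]),
     (3, 1/4, vector [1, -1, -1]), (3, 1, vector [0, 1, 1]), (3, -1, vector [0, 1, -1]), (3, -2, vector [0, 0, 1])]"
definition forms4 :: "(nat \<times> real \<times> R3) list" where
  "forms4 = [(4, 1/4, vector [1, 1, 1]), (4, 1/4, vector [-1, 1, -1]), (4, -1/2, vector [1, 0, 1]),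
     (4, -1/4, vector [1, 1, -1]), (4, -1/4, vector [-1, 1, 1]), (4, 1/2, vector [1, 0, -1]),
     (4, -1/12, vector [0, 1, 2]), (4, 1/12, vector [0, 1, -2]), (4, 1/6, vector [0, 1, 1]), (4, -1/6, vector [0, 1, -1])]"

text \<open>The vanishing of \<open>A(X, Z) = X\<^sub>3 Z\<^sub>3 - X\<^sub>1 Z\<^sub>1\<close> forces the diagonal of \<open>X Z\<^sup>T + Z X\<^sup>T\<close> to be proportional
  to \<open>(-1, 2, -1)\<close>; this matrix annihilates \<open>v\<close>, which determines its other entries \<open>p, q, r\<close> in terms
  of \<open>v\<close>. What remains are two polynomials in \<open>v\<^sub>1 / v\<^sub>2\<close> and \<open>(v\<^sub>3 / v\<^sub>2)\<^sup>2\<close> whose resultant is the octic above.\<close>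

lemma two_equations_inconsistent:
  fixes v1 v2 v3 p q r s :: real
  assumes e1: "- 2 * s * v1 + r * v2 + q * v3 = 0" and e2: "r * v1 + 4 * s * v2 + p * v3 = 0"
    and e3: "q * v1 + p * v2 - 2 * s * v3 = 0" and n: "12 * s * s + p * p + q * q + r * r = 1"
    and v: "v1 * v1 + v2 * v2 + v3 * v3 = 1"
    and B: "v1 * p + v2 * q + v3 * r + 2 * (2 * s * v3 + v2 * p) = 0"
    and C: "v2 * v2 * q + 2 * v2 * v3 * r + 2 * v1 * v2 * p + 4 * s * v1 * v3 - (v3 * v3 * p - 2 * s * v2 * v3) = 0"
  shows False
proof -
  \<comment> \<open>If all v_i are nonzero, the linear equations express p, q, r as s times rational
    functions of v. Where some v_i vanishes this breaks down, and the equations are contradictory in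
    a more direct way.\<close>
  consider "v1 = 0" | "v2 = 0" "v1 \<noteq> 0" | "v3 = 0" "v1 \<noteq> 0" "v2 \<noteq> 0" | "v1 \<noteq> 0" "v2 \<noteq> 0" "v3 \<noteq> 0" by blast
  then show False
  proof cases
    case 1
    have "(8 * s * s + p * p) * v2 = 0" "(8 * s * s + p * p) * v3 = 0" using e2 e3 1 by algebra+
    moreover have "v2 \<noteq> 0 \<or> v3 \<noteq> 0" using v 1 by auto
    ultimately have "8 * s * s + p * p = 0" by auto
    then have sp: "s = 0" "p = 0" by (simp_all add: add_nonneg_eq_0_iff)
    have rq: "r * v2 + q * v3 = 0" "v2 * q + v3 * r = 0" "v2 * v2 * q + 2 * v2 * v3 * r = 0" "q * q + r * r = 1"
      using e1 B C n 1 sp by simp_all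
    then have "r * (v2 * v2 - v3 * v3) = 0" "q * (v2 * v2 - v3 * v3) = 0" by algebra+
    then have "v2 * v2 = v3 * v3" using rq(4) by auto
    then have h: "v2 * v2 = 1 / 2" "v3 * v3 = 1 / 2" using v 1 by auto
    have "r * (v2 * v2 * v3) = 0" "q * (v2 * v2 * v2) = 0" using rq(2,3) h by algebra+
    moreover have "v2 * v2 * v3 \<noteq> 0" "v2 * v2 * v2 \<noteq> 0" using h by auto
    ultimately show False using rq(4) by simp
  next
    case 2
    have v13: "v1 * v1 + v3 * v3 = 1" using v 2 by simp
    show False
    proof (cases "s = 0")
      case True
      have "q * v3 = 0" "q * v1 = 0" "r * v1 + p * v3 = 0" "v1 * p + v3 * r = 0" "v3 * v3 * p = 0" "p * p + q * q + r * r = 1"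
        using e1 e2 e3 B C n 2 True by simp_all
      moreover from this 2 have "q = 0" by simp
      moreover have "p = 0 \<or> v3 = 0" using calculation by auto
      ultimately show False using 2 v13 by auto
    next
      case False
      have "(v3 * v3 - v1 * v1) * s = 0" using e1 e3 2 by algebra
      then have h: "v3 * v3 = 1 / 2" "v1 * v1 = 1 / 2" using v13 False by auto
      have v3: "v3 \<noteq> 0" using h by auto
      have "v3 * (p * v3 - 4 * s * v1) = 0" using C 2 by algebra
      then have "p * v3 = 4 * s * v1" using v3 by simp
      moreover have "r * v1 = - (p * v3)" "v1 * p + v3 * r + 4 * s * v3 = 0" using e2 B 2 by simp_all
      ultimately have "4 * s * v1 * v1 = 0" using 2 h by algebra
      then show False using False h by simp
    qed
  next
    case 3
    have "(8 * s * s + r * r) * v1 = 0" using e1 e2 3 by algebra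
    then have "8 * s * s + r * r = 0" using 3 by simp
    then have sr: "s = 0" "r = 0" by (simp_all add: add_nonneg_eq_0_iff)
    have k: "q * v1 + p * v2 = 0" "v1 * p + v2 * q + 2 * (v2 * p) = 0" "v2 * v2 * q + 2 * v1 * v2 * p = 0" "p * p + q * q = 1"
      using e3 B C n sr 3 by simp_all
    have "v2 * (v2 * q + 2 * v1 * p) = 0" using k(3) by algebra
    then have k3: "v2 * q + 2 * v1 * p = 0" using 3 by simp
    have "p \<noteq> 0" using k 3 by auto
    have "p * (2 * v2 - v1) = 0" using k(2) k3 by algebra
    then have "v1 = 2 * v2" using \<open>p \<noteq> 0\<close> by simp
    then have "p * v2 * 7 = 0" using k(1) k3 3 by algebra
    then show False using \<open>p \<noteq> 0\<close> 3 by simp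
  next
    case 4
    have P: "v2 * v3 * p = s * (v3 * v3 - v1 * v1 - 2 * v2 * v2)"
      and Q: "v1 * v3 * q = s * (2 * v2 * v2 + v1 * v1 + v3 * v3)"
      and R: "v1 * v2 * r = s * (v1 * v1 - 2 * v2 * v2 - v3 * v3)"
      using e1 e2 e3 by algebra+
    have s: "s \<noteq> 0"
    proof
      assume "s = 0"
      then have "p = 0" "q = 0" "r = 0" using P Q R 4 by simp_all
      then show False using n \<open>s = 0\<close> by simp
    qed
    \<comment> \<open>By homogeneity only ratios matter, and after multiplication by v_1 v_2 v_3
      both equations contain v_3 only through its square.\<close>
    define t where "t = v1 / v2"
    define u where "u = (v3 / v2) * (v3 / v2)"
    have t: "v1 = t * v2" and u: "v3 * v3 = u * v2 * v2" using 4 by (simp_all add: t_def u_def)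
    \<comment> \<open>This is B multiplied by v_1 v_2 v_3, so that P, Q, R can be inserted; the same
      is done with C below.\<close>
    have "v1 * v1 * (v2 * v3 * p) + v2 * v2 * (v1 * v3 * q) + v3 * v3 * (v1 * v2 * r)
        + 2 * (2 * s * v1 * v2 * (v3 * v3) + v1 * v2 * (v2 * v3 * p)) = 0"
      using B by algebra
    then have "s * v2 ^ 4 * (- u * u + (2 * t * t + 6 * t - 1) * u + (2 - 4 * t - t * t - 2 * t ^ 3 - t ^ 4)) = 0"
      unfolding P Q R unfolding u unfolding t by algebra
    then have N1: "- u * u + (2 * t * t + 6 * t - 1) * u + (2 - 4 * t - t * t - 2 * t ^ 3 - t ^ 4) = 0"
      using s 4 by simp
    have "v2 * v2 * v2 * (v1 * v3 * q) + 2 * v2 * (v3 * v3) * (v1 * v2 * r) + 2 * v1 * v1 * v2 * (v2 * v3 * p)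
        + 4 * s * v1 * v1 * v2 * (v3 * v3) - (v1 * (v3 * v3) * (v2 * v3 * p) - 2 * s * v1 * v2 * v2 * (v3 * v3)) = 0"
      using C by algebra
    then have "s * v2 ^ 5 * (- (2 + t) * u * u + (t ^ 3 + 8 * t * t + 4 * t - 3) * u + (2 - 3 * t * t - 2 * t ^ 4)) = 0"
      unfolding P Q R unfolding u unfolding t by algebra
    then have N2: "- (2 + t) * u * u + (t ^ 3 + 8 * t * t + 4 * t - 3) * u + (2 - 3 * t * t - 2 * t ^ 4) = 0"
      using s 4 by simp
    \<comment> \<open>Subtracting the polynomial of N2 from 2 + t times that of N1 eliminates u^2
      and leaves L u = -M. Inserting this into L^2 times N1 eliminates u and leads to t times the
      octic.\<close>
    define L where "L = 1 + 7 * t + 2 * t ^ 2 + t ^ 3"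
    define M where "M = 2 - 6 * t - 3 * t ^ 2 - 5 * t ^ 3 - 2 * t ^ 4 - t ^ 5"
    have "L * u + M = (2 + t) * (- u * u + (2 * t * t + 6 * t - 1) * u + (2 - 4 * t - t * t - 2 * t ^ 3 - t ^ 4))
      - (- (2 + t) * u * u + (t ^ 3 + 8 * t * t + 4 * t - 3) * u + (2 - 3 * t * t - 2 * t ^ 4))"
      unfolding L_def M_def by algebra
    then have LM: "L * u = - M" using N1 N2 by simp
    have "- (L * u) * (L * u) + (2 * t * t + 6 * t - 1) * (L * u) * L + (2 - 4 * t - t * t - 2 * t ^ 3 - t ^ 4) * L * L
      = L * L * (- u * u + (2 * t * t + 6 * t - 1) * u + (2 - 4 * t - t * t - 2 * t ^ 3 - t ^ 4))"
      by algebra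
    then have "- M * M - (2 * t * t + 6 * t - 1) * M * L + (2 - 4 * t - t * t - 2 * t ^ 3 - t ^ 4) * L * L = 0"
      unfolding LM N1 by simp
    then have "t * (44 - 68 * t + 10 * t ^ 2 + 22 * t ^ 3 + 74 * t ^ 4 + 56 * t ^ 5 + 48 * t ^ 6 + 14 * t ^ 7 + 4 * t ^ 8) = 0"
      unfolding L_def M_def by algebra
    moreover have "t \<noteq> 0" using 4 by (simp add: t_def)
    ultimately show False using octic_positive[of t] by simp
  qed
qed

lemma forms_no_common_zero:
  assumes "orthof (mat 1) \<theta>" "tens 0 forms2 \<theta> = 0" "tens 1 forms3 \<theta> = 0"
  shows "tens 2 forms4 \<theta> \<noteq> 0"
proof
  assume C: "tens 2 forms4 \<theta> = 0"
  obtain v1 v2 v3 x1 x2 x3 z1 z2 z3 where c: "\<theta> $ 1 $ 1 = v1" "\<theta> $ 1 $ 2 = v2" "\<theta> $ 1 $ 3 = v3"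
    "\<theta> $ 2 $ 1 = x1" "\<theta> $ 2 $ 2 = x2" "\<theta> $ 2 $ 3 = x3" "\<theta> $ 3 $ 1 = z1" "\<theta> $ 3 $ 2 = z2" "\<theta> $ 3 $ 3 = z3" by simp
  have o: "\<theta> $ i $ 1 * \<theta> $ j $ 1 + \<theta> $ i $ 2 * \<theta> $ j $ 2 + \<theta> $ i $ 3 * \<theta> $ j $ 3 = (if i = j then 1 else 0)" for i j
    using assms(1) by (simp add: orthof_1_iff inner_vec_def sum_3)
  have vv: "v1 * v1 + v2 * v2 + v3 * v3 = 1" and xx: "x1 * x1 + x2 * x2 + x3 * x3 = 1" and zz: "z1 * z1 + z2 * z2 + z3 * z3 = 1"
    and vx: "v1 * x1 + v2 * x2 + v3 * x3 = 0" and vz: "v1 * z1 + v2 * z2 + v3 * z3 = 0" and xz: "x1 * z1 + x2 * z2 + x3 * z3 = 0"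
    using o[of 1 1] o[of 2 2] o[of 3 3] o[of 1 2] o[of 1 3] o[of 2 3] by (simp_all add: c)
  have A': "x3 * z3 = x1 * z1"
    using assms(2) by (simp add: forms2_def inner_vec_def sum_3 c)
  have B': "v1 * (x2 * z3 + x3 * z2) + v2 * (x1 * z3 + x3 * z1) + v3 * (x1 * z2 + x2 * z1)
      + 2 * (v3 * (x2 * z2) + v2 * (x2 * z3 + x3 * z2)) = 0"
  proof -
    have "tens 1 forms3 \<theta> = v1 * (x2 * z3 + x3 * z2) + v2 * (x1 * z3 + x3 * z1) + v3 * (x1 * z2 + x2 * z1)
      + 2 * (v3 * (x2 * z2) + v2 * (x2 * z3 + x3 * z2))"
      unfolding forms3_def tens_simps inner_vec_def sum_3 vector_3 c inner_real_def by algebra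
    then show ?thesis using assms(3) by simp
  qed
  have C': "v2 * v2 * (x1 * z3 + x3 * z1) + 2 * v2 * v3 * (x1 * z2 + x2 * z1) + 2 * v1 * v2 * (x2 * z3 + x3 * z2)
      + 2 * v1 * v3 * (x2 * z2) - (v3 * v3 * (x2 * z3 + x3 * z2) + 2 * v2 * v3 * (x3 * z3)) = 0"
  proof -
    have "tens 2 forms4 \<theta> = v2 * v2 * (x1 * z3 + x3 * z1) + 2 * v2 * v3 * (x1 * z2 + x2 * z1) + 2 * v1 * v2 * (x2 * z3 + x3 * z2)
      + 2 * v1 * v3 * (x2 * z2) - (v3 * v3 * (x2 * z3 + x3 * z2) + 2 * v2 * v3 * (x3 * z3))"
      unfolding forms4_def tens_simps inner_vec_def sum_3 vector_3 c inner_real_def by algebra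
    then show ?thesis using C by simp
  qed
  define p where "p = x2 * z3 + x3 * z2"
  define q where "q = x1 * z3 + x3 * z1"
  define r where "r = x1 * z2 + x2 * z1"
  define s where "s = - (x1 * z1)"
  have d: "x1 * z1 = - s" "x2 * z2 = 2 * s" "x3 * z3 = - s" using A' xz by (simp_all add: s_def)
  show False
  proof (rule two_equations_inconsistent[of s v1 r v2 q v3 p])
    show "- 2 * s * v1 + r * v2 + q * v3 = 0" unfolding q_def r_def s_def using vx vz by algebra
    show "r * v1 + 4 * s * v2 + p * v3 = 0" unfolding p_def r_def using vx vz d(2) by algebra
    show "q * v1 + p * v2 - 2 * s * v3 = 0" unfolding p_def q_def using vx vz d(3) by algebra
    show "12 * s * s + p * p + q * q + r * r = 1"
    proof -
      \<comment> \<open>Both sides are the squared Frobenius norm of X Z^T + Z X^T.\<close>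
      have "2 * (x1 * z1) * (2 * (x1 * z1)) + 2 * (x2 * z2) * (2 * (x2 * z2)) + 2 * (x3 * z3) * (2 * (x3 * z3)) + 2 * (p * p + q * q + r * r)
        = 2 * (x1 * x1 + x2 * x2 + x3 * x3) * (z1 * z1 + z2 * z2 + z3 * z3) + 2 * (x1 * z1 + x2 * z2 + x3 * z3) * (x1 * z1 + x2 * z2 + x3 * z3)"
        unfolding p_def q_def r_def by algebra
      then show ?thesis unfolding xx zz xz d by simp
    qed
    show "v1 * p + v2 * q + v3 * r + 2 * (2 * s * v3 + v2 * p) = 0" using B'[unfolded d] by (simp add: p_def q_def r_def algebra_simps)
    show "v2 * v2 * q + 2 * v2 * v3 * r + 2 * v1 * v2 * p + 4 * s * v1 * v3 - (v3 * v3 * p - 2 * s * v2 * v3) = 0"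
      using C'[unfolded d] by (simp add: p_def q_def r_def algebra_simps)
  qed (rule vv)
qed

lemma conf_flat_without_zero_frame:
  obtains ps where "degs {2..} ps" "\<And>\<theta>. \<not> zero_frame 2 (conf flat_jet ps) \<theta>"
proof -
  have d: "degs {2} forms2" "degs {3} forms3" "degs {4} forms4" by (simp_all add: forms2_def forms3_def forms4_def)
  obtain \<epsilon> where "\<And>\<theta>. \<not> zero_frame 2 (conf flat_jet (scal \<epsilon> forms2 @ forms3 @ forms4)) \<theta>"
    using no_zero_frame_small[OF d forms_no_common_zero] by blast
  moreover have "degs {2..} (scal \<epsilon> forms2 @ forms3 @ forms4)"
    using d by (auto intro: degs_mono)
  ultimately show ?thesis using that by blast
qed

subsection \<open>A stable common zero\<close>

lemma brouwer_zero:
  fixes f :: "R3 \<Rightarrow> R3"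
  assumes "\<rho> > 0" "continuous_on (cball 0 \<rho>) f" "\<And>p. p \<in> cball 0 \<rho> \<Longrightarrow> norm (f p - p) \<le> \<rho>"
  shows "\<exists>p\<in>cball 0 \<rho>. f p = 0"
proof -
  have "continuous_on (cball 0 \<rho>) (\<lambda>p. p - f p)" by (intro continuous_intros assms)
  moreover have "(\<lambda>p. p - f p) \<in> cball 0 \<rho> \<rightarrow> cball 0 \<rho>"
    using assms(3) by (auto simp: norm_minus_commute)
  ultimately obtain p where "p \<in> cball 0 \<rho>" "p - f p = p" using brouwer_ball[OF assms(1)] by blast
  then show ?thesis by auto
qed

text \<open>Convergence along convergent arguments is uniform on a compact ball: points violating
  the bound would accumulate at a point where the limit violates it.\<close>

lemma eventually_close_on_cball:
  fixes f :: "nat \<Rightarrow> R3 \<Rightarrow> R3"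
  assumes f: "\<And>r q p. strict_mono r \<Longrightarrow> q \<longlonglongrightarrow> p \<Longrightarrow> (\<lambda>n. f (r n) (q n)) \<longlonglongrightarrow> g p"
    and g: "\<And>p. p \<in> cball 0 \<rho> \<Longrightarrow> norm (g p - p) < c"
  shows "\<exists>n. \<forall>p\<in>cball 0 \<rho>. norm (f n p - p) < c"
proof (rule ccontr)
  assume "\<not> ?thesis"
  then obtain q where q: "\<And>n. q n \<in> cball 0 \<rho>" "\<And>n. c \<le> norm (f n (q n) - q n)" by (metis not_less)
  obtain p r where r: "p \<in> cball 0 \<rho>" "strict_mono r" "(q \<circ> r) \<longlonglongrightarrow> p"
    using compact_cball[of 0 \<rho>] q(1) unfolding compact_def by blast
  have "(\<lambda>n. norm (f (r n) ((q \<circ> r) n) - (q \<circ> r) n)) \<longlonglongrightarrow> norm (g p - p)"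
    by (intro tendsto_norm tendsto_diff f r)
  then have "c \<le> norm (g p - p)"
    by (rule LIMSEQ_le_const) (use q(2) in \<open>auto simp: o_def\<close>)
  with g[OF r(1)] show False by simp
qed

text \<open>The inverse of the differential (q_3, -q_2 - q_3, -q_1 + q_3) of the three equations at
  the origin of the angle coordinates; composed with it the system has the identity as differential
  (\<open>stab_derivative\<close>).\<close>

definition tri :: "real \<Rightarrow> real \<Rightarrow> real \<Rightarrow> R3" where
  "tri a b c = vector [a - c, - b - a, a]"

lemma tri_tendsto:
  assumes "(a \<longlongrightarrow> a') F" "(b \<longlongrightarrow> b') F" "(c \<longlongrightarrow> c') F"
  shows "((\<lambda>n. tri (a n) (b n) (c n)) \<longlongrightarrow> tri a' b' c') F"
proof -
  have "\<forall>i. ((\<lambda>n. tri (a n) (b n) (c n) $ i) \<longlongrightarrow> tri a' b' c' $ i) F"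
    unfolding forall_3 tri_def vector_3 by (intro conjI tendsto_diff tendsto_minus assms)
  then show ?thesis by (intro vec_tendstoI) blast
qed

lemma tri_eq_0: "tri a b c = 0 \<Longrightarrow> a = 0 \<and> b = 0 \<and> c = 0"
  by (auto simp: tri_def vec_eq_iff forall_3)

lemma eul_tendsto:
  assumes "q \<longlonglongrightarrow> p" shows "(\<lambda>n. eul s (q n)) \<longlonglongrightarrow> eul s p"
  unfolding matrix_tendsto_iff
proof (intro allI)
  fix i j
  have "isCont (\<lambda>p. eul s p $ i $ j) p"
    by (rule differentiable_imp_continuous_within[OF eul_differentiable])
  from isCont_tendsto_compose[OF this assms] show "(\<lambda>n. eul s (q n) $ i $ j) \<longlonglongrightarrow> eul s p $ i $ j" .
qed

text \<open>Single powers for which the standard frame is a zero of all three forms and the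
  differential with respect to the Euler angles is invertible there.\<close>

definition stab2 :: "(nat \<times> real \<times> R3) list" where "stab2 = [(2, 1, vector [0, 0, 1])]"
definition stab3 :: "(nat \<times> real \<times> R3) list" where "stab3 = [(3, 1, vector [1, 1, 0])]"
definition stab4 :: "(nat \<times> real \<times> R3) list" where "stab4 = [(4, 1, vector [1, 0, 1])]"

lemma stab_derivative:
  "((\<lambda>p. tri (tens 0 stab2 (eul 1 p)) (tens 1 stab3 (eul 1 p)) (tens 2 stab4 (eul 1 p))) has_derivative (\<lambda>q. q)) (at 0)"
proof -
  have d: "((\<lambda>p::R3. p $ k) has_derivative (\<lambda>q. q $ k)) (at 0)" for k
    by (rule bounded_linear.has_derivative[OF bounded_linear_vec_nth has_derivative_ident])
  have s: "((\<lambda>p::R3. sin (p $ k)) has_derivative (\<lambda>q. q $ k)) (at 0)" for k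
    using has_derivative_sin[OF d] by simp
  have c: "((\<lambda>p::R3. cos (p $ k)) has_derivative (\<lambda>q. 0)) (at 0)" for k
    using has_derivative_cos[OF d] by simp
  have A: "((\<lambda>p. tens 0 stab2 (eul 1 p)) has_derivative (\<lambda>q. q $ 3)) (at 0)"
    unfolding stab2_def tens_simps eul_def inner_vec_def sum_3 vector_3 inner_real_def
    by (rule derivative_eq_intros s c refl)+ simp
  have B: "((\<lambda>p. tens 1 stab3 (eul 1 p)) has_derivative (\<lambda>q. - (q $ 2) - q $ 3)) (at 0)"
    unfolding stab3_def tens_simps eul_def inner_vec_def sum_3 vector_3 inner_real_def power_one_right
    by (rule derivative_eq_intros s c refl)+ simp
  have C: "((\<lambda>p. tens 2 stab4 (eul 1 p)) has_derivative (\<lambda>q. - (q $ 1) + q $ 3)) (at 0)"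
    unfolding stab4_def tens_simps eul_def inner_vec_def sum_3 vector_3 inner_real_def power2_eq_square
    by (rule derivative_eq_intros s c refl)+ simp
  show ?thesis
  proof (subst has_derivative_componentwise_within, intro ballI)
    fix b :: R3 assume "b \<in> Basis"
    then obtain m where b: "b = axis m 1" by (auto simp: Basis_vec_def)
    show "((\<lambda>p. tri (tens 0 stab2 (eul 1 p)) (tens 1 stab3 (eul 1 p)) (tens 2 stab4 (eul 1 p)) \<bullet> b)
        has_derivative (\<lambda>q. q \<bullet> b)) (at 0)"
      using exhaust_3[of m] has_derivative_diff[OF A C] has_derivative_diff[OF has_derivative_minus[OF B] A] A
      by (auto simp: b inner_axis tri_def)
  qed
qed

lemma eul_0: "eul 1 0 = mat 1"
  unfolding vec_eq_iff forall_3 by (simp add: eul_def mat_def)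

text \<open>Brouwer's theorem is applied on a ball where the normalised system differs from the
  identity by at most the radius. Stability is phrased with sequences of jets, so that the smallness
  of the errors can be drawn from convergence.\<close>

lemma conf_flat_stable_zero_frame:
  obtains ps where "degs {2..} ps"
    "\<And>J. (\<And>n. posdef (jmat (J n))) \<Longrightarrow> (\<And>ks i j. (\<lambda>n. J n ks i j) \<longlonglongrightarrow> conf flat_jet ps ks i j)
       \<Longrightarrow> \<exists>n \<theta>. zero_frame 2 (J n) \<theta>"
proof -
  define f where "f p = tri (tens 0 stab2 (eul 1 p)) (tens 1 stab3 (eul 1 p)) (tens 2 stab4 (eul 1 p))" for p
  have d: "degs {2} stab2" "degs {3} stab3" "degs {4} stab4" by (simp_all add: stab2_def stab3_def stab4_def)
  have o: "orthof (mat 1) (eul 1 p)" for p by (rule orthof_eul) simp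
  have f0: "f 0 = 0"
    unfolding f_def eul_0 by (simp add: stab2_def stab3_def stab4_def inner_vec_def sum_3 mat_def tri_def vec_eq_iff forall_3)
  have "(f has_derivative (\<lambda>q. q)) (at 0)" using stab_derivative unfolding f_def[abs_def] .
  then obtain \<rho>0 where \<rho>0: "\<rho>0 > 0" "\<And>p. norm p < \<rho>0 \<Longrightarrow> norm (f p - p) \<le> 1 / 4 * norm p"
    unfolding has_derivative_at_alt using f0 by (metis diff_zero zero_less_divide_1_iff zero_less_numeral)
  \<comment> \<open>On this ball the linearisation error is at most \<rho> / 4. The bounds \<rho> /
    2 and then \<rho> used below leave room for the scaling by \<epsilon> and for the passage to
    nearby jets.\<close>
  define \<rho> where "\<rho> = \<rho>0 / 2"
  have \<rho>: "\<rho> > 0" "\<And>p. p \<in> cball 0 \<rho> \<Longrightarrow> norm (f p - p) < \<rho> / 2"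
  proof -
    show "\<rho> > 0" using \<rho>0 by (simp add: \<rho>_def)
    fix p :: R3 assume "p \<in> cball 0 \<rho>"
    then have "norm p \<le> \<rho>" by simp
    then show "norm (f p - p) < \<rho> / 2" using \<rho>0(2)[of p] \<open>\<rho> > 0\<close> by (simp add: \<rho>_def)
  qed
  \<comment> \<open>The factor -2 undoes the -1/2 in front of the forms and 1 / \<epsilon> undoes
    the scaling of the second order part, so that g, evaluated at the scaled jet, tends to f as
    \<epsilon> tends to 0.\<close>
  define g where "g \<epsilon> J \<theta> = tri (- 2 / \<epsilon> * ev J \<theta> (FE 0)) (- 2 * ev J \<theta> (FE 1)) (- 2 * ev J \<theta> (FE 2))" for \<epsilon> :: real and J \<theta>
  define P where "P \<epsilon> = scal \<epsilon> stab2 @ stab3 @ stab4" for \<epsilon>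
  have dP: "degs {2, 3, 4} (P \<epsilon>)" for \<epsilon> using d by (auto simp: P_def intro: degs_mono)
  have jmP: "jmat (conf flat_jet (P \<epsilon>)) = mat 1" for \<epsilon> using degs_jmat[OF dP] by simp
  obtain \<epsilon> where \<epsilon>: "\<epsilon> \<noteq> 0" "\<And>p. p \<in> cball 0 \<rho> \<Longrightarrow> norm (g \<epsilon> (conf flat_jet (P \<epsilon>)) (eul 1 p) - p) < \<rho> / 2"
  proof -
    define \<epsilon>s where "\<epsilon>s n = 1 / real (Suc n)" for n
    have \<epsilon>s: "\<epsilon>s \<longlonglongrightarrow> 0" "\<And>n. \<epsilon>s n \<noteq> 0"
      using lim_1_over_real_power[of 1, THEN LIMSEQ_Suc] by (auto simp: \<epsilon>s_def[abs_def])
    have g: "g (\<epsilon>s n) (conf flat_jet (P (\<epsilon>s n))) (eul 1 p)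
      = tri (tens 0 stab2 (eul 1 p)) (tens 1 stab3 (eul 1 p)) (- 2 * ev (conf flat_jet (P (\<epsilon>s n))) (eul 1 p) (FE 2))" for n p
      unfolding g_def P_def FE_flat(1,2)[OF _ d(2,3) o, of "scal (\<epsilon>s n) stab2", unfolded degs_scal, OF d(1)]
      using \<epsilon>s(2)[of n] by (simp add: tens_scal)
    have "\<exists>n. \<forall>p\<in>cball 0 \<rho>. norm (g (\<epsilon>s n) (conf flat_jet (P (\<epsilon>s n))) (eul 1 p) - p) < \<rho> / 2"
    proof (rule eventually_close_on_cball[OF _ \<rho>(2)])
      fix r :: "nat \<Rightarrow> nat" and q :: "nat \<Rightarrow> R3" and p assume r: "strict_mono r" "q \<longlonglongrightarrow> p"
      have e: "(\<lambda>n. \<epsilon>s (r n)) \<longlonglongrightarrow> 0" using LIMSEQ_subseq_LIMSEQ[OF \<epsilon>s(1) r(1)] by (simp add: o_def)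
      have jm: "jmat (conf flat_jet (stab3 @ stab4)) = mat 1"
        using degs_jmat[of "{3, 4}" "stab3 @ stab4" flat_jet] d by (auto intro: degs_mono)
      have "(\<lambda>n. ev (conf flat_jet (P (\<epsilon>s (r n)))) (eul 1 (q n)) (FE 2)) \<longlonglongrightarrow> ev (conf flat_jet (stab3 @ stab4)) (eul 1 p) (FE 2)"
        unfolding P_def using eul_tendsto[OF r(2), of 1]
        by (intro ev_tendsto conf_scal_tendsto[OF e]) (simp_all add: jm matrix_tendsto_iff)
      from tendsto_mult[OF tendsto_const this, of "- 2"]
      have "(\<lambda>n. - 2 * ev (conf flat_jet (P (\<epsilon>s (r n)))) (eul 1 (q n)) (FE 2)) \<longlonglongrightarrow> tens 2 stab4 (eul 1 p)"
        unfolding FE_flat(3)[OF d o] by simp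
      then show "(\<lambda>n. g (\<epsilon>s (r n)) (conf flat_jet (P (\<epsilon>s (r n)))) (eul 1 (q n))) \<longlonglongrightarrow> f p"
        unfolding g f_def by (intro tri_tendsto tens_tendsto eul_tendsto r)
    qed
    then show ?thesis using that \<epsilon>s(2) by blast
  qed
  show ?thesis
  proof (rule that[of "P \<epsilon>"])
    show "degs {2..} (P \<epsilon>)" using dP by (rule degs_mono) auto
    fix J assume pd: "\<And>n. posdef (jmat (J n))" and J: "\<And>ks i j. (\<lambda>n. J n ks i j) \<longlonglongrightarrow> conf flat_jet (P \<epsilon>) ks i j"
    have jJ: "(\<lambda>n. jmat (J n)) \<longlonglongrightarrow> mat 1"
    proof -
      have "(\<lambda>n. jmat (J n)) \<longlonglongrightarrow> jmat (conf flat_jet (P \<epsilon>))" by (simp add: matrix_tendsto_iff jmat_def J)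
      then show ?thesis by (simp only: jmP)
    qed
    \<comment> \<open>The frame with given angles is transported to the metric of
      \<open>J n\<close>. As these metrics tend to the identity, so do their Gram-Schmidt frames,
      and the transported frames converge to \<open>eul 1 p\<close>.\<close>
    define \<theta> where "\<theta> n p = eul 1 p ** gs (jmat (J n))" for n p
    have "\<exists>n. \<forall>p\<in>cball 0 \<rho>. norm (g \<epsilon> (J n) (\<theta> n p) - p) < \<rho>"
    proof (rule eventually_close_on_cball)
      fix r :: "nat \<Rightarrow> nat" and q :: "nat \<Rightarrow> R3" and p assume r: "strict_mono r" "q \<longlonglongrightarrow> p"
      have 1: "(\<lambda>n. jmat (J (r n))) \<longlonglongrightarrow> mat 1" using LIMSEQ_subseq_LIMSEQ[OF jJ r(1)] by (simp add: o_def)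
      have "(\<lambda>n. gs (jmat (J (r n)))) \<longlonglongrightarrow> mat 1" using tendsto_gs[OF 1 posdef_mat_1] by (simp add: gs_mat_1)
      then have "(\<lambda>n. (eul 1 (q n) ** gs (jmat (J (r n)))) $ i $ j) \<longlonglongrightarrow> (eul 1 p ** mat 1) $ i $ j" for i j
        using eul_tendsto[OF r(2), of 1]
        unfolding matrix_matrix_mult_def matrix_tendsto_iff by (simp, intro tendsto_sum tendsto_mult) auto
      then have 2: "(\<lambda>n. \<theta> (r n) (q n) $ i $ j) \<longlonglongrightarrow> eul 1 p $ i $ j" for i j by (simp add: \<theta>_def)
      have "(\<lambda>n. ev (J (r n)) (\<theta> (r n) (q n)) e) \<longlonglongrightarrow> ev (conf flat_jet (P \<epsilon>)) (eul 1 p) e" for e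
        using LIMSEQ_subseq_LIMSEQ[OF J r(1)] by (intro ev_tendsto 2) (simp_all add: jmP o_def)
      then show "(\<lambda>n. g \<epsilon> (J (r n)) (\<theta> (r n) (q n))) \<longlonglongrightarrow> g \<epsilon> (conf flat_jet (P \<epsilon>)) (eul 1 p)"
        unfolding g_def by (intro tri_tendsto tendsto_mult tendsto_const)
    next
      fix p :: R3 assume "p \<in> cball 0 \<rho>"
      then show "norm (g \<epsilon> (conf flat_jet (P \<epsilon>)) (eul 1 p) - p) < \<rho>" using \<epsilon>(2)[of p] \<rho>(1) by linarith
    qed
    then obtain n where n: "\<And>p. p \<in> cball 0 \<rho> \<Longrightarrow> norm (g \<epsilon> (J n) (\<theta> n p) - p) < \<rho>" by blast
    have "\<exists>p\<in>cball 0 \<rho>. g \<epsilon> (J n) (\<theta> n p) = 0"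
    proof (rule brouwer_zero[OF \<rho>(1)])
      have "(\<lambda>p. \<theta> n p $ i $ j) differentiable at p" for i j p
        unfolding \<theta>_def matrix_matrix_mult_def
        by (simp add: sum_3) (intro differentiable_add differentiable_mult differentiable_const eul_differentiable)
      then have "(\<lambda>p. ev (J n) (\<theta> n p) e) differentiable at p" for e p
        by (intro ev_differentiable differentiable_const posdef_det[OF pd])
      then have c: "isCont (\<lambda>p. ev (J n) (\<theta> n p) e) p" for e p by (rule differentiable_imp_continuous_within)
      have "isCont (\<lambda>p. g \<epsilon> (J n) (\<theta> n p)) p" for p
        unfolding g_def isCont_def by (intro tri_tendsto tendsto_mult tendsto_const c[unfolded isCont_def])
      then show "continuous_on (cball 0 \<rho>) (\<lambda>p. g \<epsilon> (J n) (\<theta> n p))" by (simp add: continuous_at_imp_continuous_on)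
    qed (use n in \<open>force simp: less_imp_le\<close>)
    then obtain p where p: "g \<epsilon> (J n) (\<theta> n p) = 0" by blast
    from tri_eq_0[OF this[unfolded g_def]] have z: "ev (J n) (\<theta> n p) (FE 0) = 0" "ev (J n) (\<theta> n p) (FE 1) = 0" "ev (J n) (\<theta> n p) (FE 2) = 0"
      using \<epsilon>(1) by auto
    have "orthof (jmat (J n)) (\<theta> n p)" unfolding \<theta>_def by (rule orthof_mult[OF orthof_gs[OF pd] o])
    moreover have "j \<le> 2 \<Longrightarrow> j = 0 \<or> j = 1 \<or> j = 2" for j :: nat by auto
    ultimately have "zero_frame 2 (J n) (\<theta> n p)" using z unfolding zero_frame_def by metis
    then show "\<exists>n \<theta>. zero_frame 2 (J n) \<theta>" by blast
  qed
qed

section \<open>Local solutions of differential equations\<close>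

text \<open>Picard iteration, arranged to run on all of R: the vector field is composed with the
  projection onto the ball and time is clamped to [-e, e], so the contraction principle applies in
  the complete space of bounded continuous functions. The solution stays in the ball, where the
  modified field agrees with F.\<close>

lemma local_ode_solution:
  fixes F :: "'a::euclidean_space \<Rightarrow> 'a"
  assumes r: "r > 0" and lip: "\<And>x y. x \<in> cball z0 r \<Longrightarrow> y \<in> cball z0 r \<Longrightarrow> norm (F x - F y) \<le> L * norm (x - y)"
  obtains e z where "e > 0" "z 0 = z0"
    "\<And>t. t \<in> {-e<..<e} \<Longrightarrow> z t \<in> cball z0 r \<and> (z has_vector_derivative F (z t)) (at t)"
proof -
  define K where "K = max L 0"
  have K: "K \<ge> 0" "\<And>x y. x \<in> cball z0 r \<Longrightarrow> y \<in> cball z0 r \<Longrightarrow> norm (F x - F y) \<le> K * norm (x - y)"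
  proof -
    show "K \<ge> 0" by (simp add: K_def)
    fix x y assume "x \<in> cball z0 r" "y \<in> cball z0 r"
    then have "norm (F x - F y) \<le> L * norm (x - y)" by (rule lip)
    also have "\<dots> \<le> K * norm (x - y)" by (rule mult_right_mono) (simp_all add: K_def)
    finally show "norm (F x - F y) \<le> K * norm (x - y)" .
  qed
  define G where "G x = F (closest_point (cball z0 r) x)" for x
  have cp: "closest_point (cball z0 r) x \<in> cball z0 r" for x
    using r by (intro closest_point_in_set) auto
  have Glip: "norm (G x - G y) \<le> K * norm (x - y)" for x y
  proof -
    have "norm (G x - G y) \<le> K * norm (closest_point (cball z0 r) x - closest_point (cball z0 r) y)"
      unfolding G_def by (intro K cp)
    also have "\<dots> \<le> K * norm (x - y)"
      using closest_point_lipschitz[of "cball z0 r" x y] r K(1) by (intro mult_left_mono) (auto simp: dist_norm)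
    finally show ?thesis .
  qed
  have Gc: "continuous_on S G" for S
    by (rule continuous_on_subset[OF _ subset_UNIV])
      (use Glip K(1) in \<open>auto intro!: lipschitz_on_continuous_on[of K] lipschitz_onI simp: dist_norm\<close>)
  define M where "M = norm (F z0) + K * r"
  have M: "norm (G x) \<le> M" for x
  proof -
    have "norm (G x - F z0) \<le> K * norm (closest_point (cball z0 r) x - z0)"
      unfolding G_def using r by (intro K cp) auto
    also have "\<dots> \<le> K * r" using cp[of x] K(1) by (intro mult_left_mono) (auto simp: dist_norm norm_minus_commute)
    finally show ?thesis unfolding M_def using norm_triangle_sub[of "G x" "F z0"] by linarith
  qed
  \<comment> \<open>The integrals from -e to t and from -e to 0 run over lengths at most 2 e and e.
    Together they give the contraction factor 3 e K \<le> 1/2 and the displacement 3 e M \<le>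
    r.\<close>
  define e where "e = min (1 / (6 * (K + 1))) (r / (3 * (M + 1)))"
  have M0: "M \<ge> 0" using r K(1) by (simp add: M_def)
  have e: "e > 0" "3 * e * K \<le> 1 / 2" "3 * e * M \<le> r"
  proof -
    show "e > 0" using r K(1) M0 by (simp add: e_def)
    have "e \<le> 1 / (6 * (K + 1))" by (simp add: e_def)
    then have "e * (6 * (K + 1)) \<le> 1" using K(1) by (simp add: pos_le_divide_eq)
    then show "3 * e * K \<le> 1 / 2" using \<open>e > 0\<close> by (simp add: algebra_simps)
    have "e \<le> r / (3 * (M + 1))" by (simp add: e_def)
    then have "e * (3 * (M + 1)) \<le> r" using M0 by (simp add: pos_le_divide_eq)
    then show "3 * e * M \<le> r" using \<open>e > 0\<close> by (simp add: algebra_simps)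
  qed
  define cl where "cl t = max (- e) (min e t)" for t
  have cl: "cl t \<in> {-e..e}" "t \<in> {-e..e} \<Longrightarrow> cl t = t" for t using e by (auto simp: cl_def)
  \<comment> \<open>The integral from 0 to t is written as a difference of integrals starting at -e,
    which covers both signs of t.\<close>
  define T where "T u t = z0 + (integral {-e..cl t} (\<lambda>s. G (u s)) - integral {-e..0} (\<lambda>s. G (u s)))" for u t
  have ii: "(\<lambda>s. G (u s)) integrable_on {-e..t}" if "continuous_on UNIV u" for u :: "real \<Rightarrow> 'a" and t
    by (intro integrable_continuous_real continuous_on_compose2[OF Gc[of UNIV] continuous_on_subset[OF that]]) auto
  have bnd: "norm (integral {-e..t} h) \<le> B * (2 * e)" "norm (integral {-e..0} h) \<le> B * e"
    if "\<And>s. norm (h s) \<le> B" "t \<in> {-e..e}" "\<And>t. h integrable_on {-e..t}" for h :: "real \<Rightarrow> 'a" and B t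
  proof -
    have B: "B \<ge> 0" using that(1)[of 0] norm_ge_zero order_trans by blast
    have "norm (integral {-e..t} h) \<le> B * (t - (-e))"
      using has_integral_bound_real[OF B finite.emptyI integrable_integral[OF that(3)], of t] that by auto
    also have "\<dots> \<le> B * (2 * e)" using that B by (intro mult_left_mono) auto
    finally show "norm (integral {-e..t} h) \<le> B * (2 * e)" .
    show "norm (integral {-e..0} h) \<le> B * e"
      using has_integral_bound_real[OF B finite.emptyI integrable_integral[OF that(3)], of 0] that e by auto
  qed
  have Tdist: "norm (T u t - T v t) \<le> 1 / 2 * B"
    if "continuous_on UNIV u" "continuous_on UNIV v" "\<And>s. norm (u s - v s) \<le> B" for u v t B
  proof -
    have B: "B \<ge> 0" using that(3)[of 0] norm_ge_zero order_trans by blast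
    have h: "norm (G (u s) - G (v s)) \<le> K * B" for s
      using Glip[of "u s" "v s"] mult_left_mono[OF that(3)[of s] K(1)] by linarith
    have hi: "(\<lambda>s. G (u s) - G (v s)) integrable_on {-e..t}" for t by (intro integrable_diff ii that)
    have "T u t - T v t = integral {-e..cl t} (\<lambda>s. G (u s) - G (v s)) - integral {-e..0} (\<lambda>s. G (u s) - G (v s))"
      unfolding T_def by (simp add: integral_diff ii that)
    then have "norm (T u t - T v t) \<le> K * B * (2 * e) + K * B * e"
      using bnd[OF h cl(1)[of t] hi] norm_triangle_ineq4 by (smt (verit))
    also have "\<dots> = (3 * e * K) * B" by (simp add: algebra_simps)
    also have "\<dots> \<le> 1 / 2 * B" using e(2) B by (rule mult_right_mono)
    finally show ?thesis .
  qed
  have Tr: "norm (T u t - z0) \<le> r" if "continuous_on UNIV u" for u t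
  proof -
    have "norm (T u t - z0) \<le> M * (2 * e) + M * e"
      unfolding T_def using bnd[of "\<lambda>s. G (u s)" M "cl t", OF M cl(1) ii[OF that]] norm_triangle_ineq4 by (smt (verit) add_diff_cancel_left')
    also have "\<dots> = 3 * e * M" by (simp add: algebra_simps)
    finally show ?thesis using e(3) by linarith
  qed
  have Tb: "T u \<in> bcontfun" if "continuous_on UNIV u" for u
    unfolding bcontfun_def
  proof (safe)
    have "continuous_on UNIV (\<lambda>t. integral {-e..cl t} (\<lambda>s. G (u s)))"
    proof (rule continuous_on_compose2[OF indefinite_integral_continuous_1[OF ii[OF that, of e]]])
      show "continuous_on UNIV cl" unfolding cl_def by (intro continuous_intros)
    qed (use cl in auto)
    then show "continuous_on UNIV (T u)" unfolding T_def by (intro continuous_intros)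
    have "norm (T u t) \<le> norm z0 + r" for t using Tr[OF that, of t] norm_triangle_sub[of "T u t" z0] by linarith
    then show "bounded (range (T u))" by (auto simp: bounded_iff)
  qed
  define \<T> where "\<T> u = Bcontfun (T (apply_bcontfun u))" for u
  have \<T>: "apply_bcontfun (\<T> u) = T (apply_bcontfun u)" for u
    unfolding \<T>_def by (rule Bcontfun_inverse) (rule Tb, simp)
  have "\<exists>!u. \<T> u = u"
  proof (rule banach_fix_type[of "1 / 2"])
    show "\<forall>u v. dist (\<T> u) (\<T> v) \<le> 1 / 2 * dist u v"
    proof (intro allI dist_bound)
      fix u v :: "real \<Rightarrow>\<^sub>C 'a" and t
      show "dist (apply_bcontfun (\<T> u) t) (apply_bcontfun (\<T> v) t) \<le> 1 / 2 * dist u v"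
        unfolding \<T> dist_norm by (rule Tdist) (simp_all add: dist_norm[symmetric] dist_bounded)
    qed
  qed auto
  then obtain u where "\<T> u = u" by blast
  define z where "z = apply_bcontfun u"
  have zc: "continuous_on S z" for S by (simp add: z_def)
  have z: "z t = T z t" for t using \<T>[of u] \<open>\<T> u = u\<close> by (simp add: z_def)
  have zr: "z t \<in> cball z0 r" for t using Tr[OF zc, of t] z[of t] by (simp add: dist_norm norm_minus_commute)
  show ?thesis
  proof (rule that[OF e(1), of z])
    show "z 0 = z0" using z[of 0] cl(2)[of 0] e(1) by (simp add: T_def)
    fix t assume t: "t \<in> {-e<..<e}"
    have "((\<lambda>t. integral {-e..t} (\<lambda>s. G (z s))) has_vector_derivative G (z t)) (at t within {-e..e})"
      by (rule integral_has_vector_derivative) (use t in \<open>auto intro!: continuous_on_compose2[OF Gc[of UNIV] zc]\<close>)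
    then have "((\<lambda>t. integral {-e..t} (\<lambda>s. G (z s))) has_vector_derivative G (z t)) (at t)"
      using t at_within_interior[of t "{-e..e}"] by auto
    from has_vector_derivative_add[OF has_vector_derivative_const[of z0] has_vector_derivative_diff[OF this has_vector_derivative_const]]
    have "((\<lambda>t. z0 + (integral {-e..t} (\<lambda>s. G (z s)) - integral {-e..0} (\<lambda>s. G (z s)))) has_vector_derivative G (z t)) (at t)"
      by simp
    then have "(z has_vector_derivative G (z t)) (at t)"
    proof (rule has_vector_derivative_transform_within_open[of _ _ _ "{-e<..<e}"])
      fix s assume "s \<in> {-e<..<e}"
      then have "cl s = s" by (intro cl(2)) auto
      then show "z0 + (integral {-e..s} (\<lambda>s. G (z s)) - integral {-e..0} (\<lambda>s. G (z s))) = z s"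
        using z[of s] unfolding T_def by simp
    qed (use t in auto)
    moreover have "G (z t) = F (z t)" using zr[of t] by (simp add: G_def closest_point_self)
    ultimately show "z t \<in> cball z0 r \<and> (z has_vector_derivative F (z t)) (at t)" using zr by simp
  qed
qed

section \<open>Parallel frames along geodesics in a chart\<close>

definition sym_jet :: "jet \<Rightarrow> bool" where
  "sym_jet J \<longleftrightarrow> (\<forall>ks i j. J ks i j = J ks j i)"

lemma sym_jet_jet:
  assumes "open U" "x \<in> U" "\<And>y. y \<in> U \<Longrightarrow> transpose (h y) = h y"
  shows "sym_jet (jet h x)"
  unfolding sym_jet_def jet_def
proof (intro allI)
  fix ks i j
  show "partials ks (\<lambda>y. h y $ i $ j) x = partials ks (\<lambda>y. h y $ j $ i) x"
  proof (rule partials_cong[OF assms(1,2)])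
    fix y assume "y \<in> U"
    have "h y $ i $ j = transpose (h y) $ j $ i" by (simp add: transpose_def)
    with assms(3)[OF \<open>y \<in> U\<close>] show "h y $ i $ j = h y $ j $ i" by simp
  qed
qed

text \<open>Lowering the index cancels the inverse metric and leaves the Koszul formula, linear in
  the first derivatives.\<close>

lemma koszul:
  assumes "det (jmat J) \<noteq> 0"
  shows "c \<bullet> (jmat J *v chr J a b) = (\<Sum>i\<in>UNIV. \<Sum>j\<in>UNIV. \<Sum>k\<in>UNIV.
    1 / 2 * (J [i] j k + J [j] i k - J [k] i j) * a $ i * b $ j * c $ k)"
proof -
  have "jmat J *v chr J a b = (\<chi> k. \<Sum>i\<in>UNIV. \<Sum>j\<in>UNIV. 1 / 2 * (J [i] j k + J [j] i k - J [k] i j) * a $ i * b $ j)"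
  proof -
    define y :: R3 where "y = (\<chi> k. \<Sum>i\<in>UNIV. \<Sum>j\<in>UNIV. 1 / 2 * (J [i] j k + J [j] i k - J [k] i j) * a $ i * b $ j)"
    have "chr J a b = matrix_inv (jmat J) *v y"
    proof -
      have "chr J a b $ k = (matrix_inv (jmat J) *v y) $ k" for k
      proof -
        have "(matrix_inv (jmat J) *v y) $ k = (\<Sum>l\<in>UNIV. \<Sum>i\<in>UNIV. \<Sum>j\<in>UNIV.
          1 / 2 * (matrix_inv (jmat J) $ k $ l * (J [i] j l + J [j] i l - J [l] i j)) * a $ i * b $ j)"
          by (simp add: matrix_vector_mult_def y_def sum_distrib_left mult_ac)
        also have "\<dots> = (\<Sum>i\<in>UNIV. \<Sum>j\<in>UNIV. \<Sum>l\<in>UNIV.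
          1 / 2 * (matrix_inv (jmat J) $ k $ l * (J [i] j l + J [j] i l - J [l] i j)) * a $ i * b $ j)"
          by (rule sum_rotate)
        finally show ?thesis by (simp add: chr_def ev_chE sum_distrib_left sum_distrib_right sum_divide_distrib mult_ac)
      qed
      then show ?thesis by (simp add: vec_eq_iff)
    qed
    then have "jmat J *v chr J a b = y"
      by (simp add: matrix_vector_mul_assoc det_nonzero_inverse[OF assms])
    then show ?thesis by (simp add: y_def)
  qed
  then have "c \<bullet> (jmat J *v chr J a b) = (\<Sum>k\<in>UNIV. \<Sum>i\<in>UNIV. \<Sum>j\<in>UNIV.
      1 / 2 * (J [i] j k + J [j] i k - J [k] i j) * a $ i * b $ j * c $ k)"
    by (simp add: inner_vec_def sum_distrib_left mult_ac)
  then show ?thesis by (rule trans) (rule sum_rotate)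
qed

lemma chr_sym: "sym_jet J \<Longrightarrow> chr J a b = chr J b a"
proof -
  assume s: "sym_jet J"
  then have "ev J 0 (chE k i j) = ev J 0 (chE k j i)" for k i j
    unfolding ev_chE sym_jet_def by (simp add: add.commute)
  then show ?thesis
    unfolding chr_def vec_eq_iff by (subst sum.swap) (simp add: mult_ac)
qed

text \<open>In the sum of the two Koszul formulas all derivatives of the metric cancel except the
  one in direction u.\<close>

lemma metric_compatible:
  assumes s: "sym_jet J" and d: "det (jmat J) \<noteq> 0"
  shows "b \<bullet> (jmat J *v chr J u a) + a \<bullet> (jmat J *v chr J u b)
    = (\<Sum>i\<in>UNIV. \<Sum>j\<in>UNIV. \<Sum>k\<in>UNIV. u $ i * a $ j * b $ k * J [i] j k)"
proof -
  have e: "a \<bullet> (jmat J *v chr J u b) = (\<Sum>i\<in>UNIV. \<Sum>j\<in>UNIV. \<Sum>k\<in>UNIV.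
    1 / 2 * (J [i] k j + J [k] i j - J [j] i k) * u $ i * b $ k * a $ j)"
    unfolding koszul[OF d] by (rule sum.cong[OF refl]) (rule sum.swap)
  have sy: "J [i] k j = J [i] j k" for i j k using s by (simp add: sym_jet_def)
  have "1 / 2 * (J [i] j k + J [j] i k - J [k] i j) * u $ i * a $ j * b $ k
      + 1 / 2 * (J [i] k j + J [k] i j - J [j] i k) * u $ i * b $ k * a $ j
    = u $ i * a $ j * b $ k * J [i] j k" for i j k
    unfolding sy[of i k j] by (simp add: algebra_simps)
  then show ?thesis
    unfolding koszul[OF d, of b] e sum.distrib[symmetric] by simp
qed

text \<open>Product rule; the derivative of the matrix h along the curve is absorbed into the two
  covariant derivatives by \<open>metric_compatible\<close>.\<close>

lemma inner_along_curve:
  assumes h: "smooth_comps U h" "x t \<in> U" and J: "sym_jet (jet h (x t))" "det (h (x t)) \<noteq> 0"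
    and x: "(x has_vector_derivative x') (at t)"
    and A: "(A has_vector_derivative A') (at t)" and B: "(B has_vector_derivative B') (at t)"
  shows "((\<lambda>t. A t \<bullet> (h (x t) *v B t)) has_real_derivative
     (A' + christoffel h (x t) x' (A t)) \<bullet> (h (x t) *v B t)
     + A t \<bullet> (h (x t) *v (B' + christoffel h (x t) x' (B t)))) (at t)"
proof -
  let ?J = "jet h (x t)"
  have hd: "((\<lambda>t. h (x t) $ i $ j) has_derivative (\<lambda>r. \<Sum>l\<in>UNIV. (r *\<^sub>R x') $ l * ?J [l] i j)) (at t)" for i j
    using jet_has_derivative[OF h(1) x[unfolded has_vector_derivative_def] h(2), of "[]" i j] by (simp add: jet_def)
  have c: "((\<lambda>t. A t $ i) has_derivative (\<lambda>r. (r *\<^sub>R A') $ i)) (at t)" "((\<lambda>t. B t $ i) has_derivative (\<lambda>r. (r *\<^sub>R B') $ i)) (at t)" for i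
    using bounded_linear.has_derivative[OF bounded_linear_vec_nth A[unfolded has_vector_derivative_def], of i]
      bounded_linear.has_derivative[OF bounded_linear_vec_nth B[unfolded has_vector_derivative_def], of i] by auto
  have D: "((\<lambda>t. A t \<bullet> (h (x t) *v B t)) has_derivative (\<lambda>r. \<Sum>i\<in>UNIV. \<Sum>j\<in>UNIV.
     A t $ i * h (x t) $ i $ j * (r *\<^sub>R B') $ j + (A t $ i * (\<Sum>l\<in>UNIV. (r *\<^sub>R x') $ l * ?J [l] i j) + (r *\<^sub>R A') $ i * h (x t) $ i $ j) * B t $ j)) (at t)"
    unfolding inner_matrix_expand by (intro has_derivative_sum has_derivative_mult hd c)
  have "(\<Sum>i\<in>UNIV. \<Sum>j\<in>UNIV. \<Sum>k\<in>UNIV. x' $ i * A t $ j * B t $ k * ?J [i] j k)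
     = (\<Sum>j\<in>UNIV. \<Sum>k\<in>UNIV. \<Sum>i\<in>UNIV. x' $ i * A t $ j * B t $ k * ?J [i] j k)" by (rule sum_rotate)
  then have compat: "B t \<bullet> (h (x t) *v christoffel h (x t) x' (A t)) + A t \<bullet> (h (x t) *v christoffel h (x t) x' (B t))
     = (\<Sum>i\<in>UNIV. \<Sum>j\<in>UNIV. A t $ i * (\<Sum>l\<in>UNIV. x' $ l * ?J [l] i j) * B t $ j)"
    using metric_compatible[OF J(1), of "B t" x' "A t"] J(2)
    by (simp add: christoffel_chr sum_distrib_left sum_distrib_right mult_ac)
  have sy: "u \<bullet> (h (x t) *v v) = v \<bullet> (h (x t) *v u)" for u v
  proof (rule inner_matrix_commute)
    have "jet h (x t) [] i j = jet h (x t) [] j i" for i j using J(1) by (simp add: sym_jet_def)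
    then show "transpose (h (x t)) = h (x t)" by (simp add: jet_def transpose_def vec_eq_iff)
  qed
  have "(A' + christoffel h (x t) x' (A t)) \<bullet> (h (x t) *v B t) + A t \<bullet> (h (x t) *v (B' + christoffel h (x t) x' (B t)))
    = A' \<bullet> (h (x t) *v B t) + A t \<bullet> (h (x t) *v B')
      + (B t \<bullet> (h (x t) *v christoffel h (x t) x' (A t)) + A t \<bullet> (h (x t) *v christoffel h (x t) x' (B t)))"
    by (simp add: inner_add_left matrix_vector_right_distrib inner_add_right sy[of "christoffel h (x t) x' (A t)"])
  also have "\<dots> = (\<Sum>i\<in>UNIV. \<Sum>j\<in>UNIV. A t $ i * h (x t) $ i $ j * B' $ j
      + (A t $ i * (\<Sum>l\<in>UNIV. x' $ l * ?J [l] i j) + A' $ i * h (x t) $ i $ j) * B t $ j)"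
    unfolding compat unfolding inner_matrix_expand by (simp add: sum.distrib distrib_right)
  finally have eq: "(A' + christoffel h (x t) x' (A t)) \<bullet> (h (x t) *v B t) + A t \<bullet> (h (x t) *v (B' + christoffel h (x t) x' (B t)))
    = (\<Sum>i\<in>UNIV. \<Sum>j\<in>UNIV. A t $ i * h (x t) $ i $ j * B' $ j
      + (A t $ i * (\<Sum>l\<in>UNIV. x' $ l * ?J [l] i j) + A' $ i * h (x t) $ i $ j) * B t $ j)" .
  show ?thesis
    unfolding has_field_derivative_def eq
    by (rule has_derivative_eq_rhs[OF D]) (simp add: fun_eq_iff sum_distrib_left sum_distrib_right algebra_simps)
qed

lemma orthof_expand:
  assumes "orthof H \<theta>"
  shows "u = (\<Sum>s\<in>UNIV. (\<theta> $ s \<bullet> (H *v u)) *\<^sub>R \<theta> $ s)"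
proof -
  have "\<theta> ** (H ** transpose \<theta>) = mat 1" using assms by (simp add: orthof_matrix matrix_mul_assoc)
  then have "(H ** transpose \<theta>) ** \<theta> = mat 1" by (simp add: matrix_left_right_inverse)
  then have "transpose ((H ** transpose \<theta>) ** \<theta>) = mat 1" by (simp add: transpose_mat)
  then have t: "transpose \<theta> ** (\<theta> ** transpose H) = mat 1" by (simp add: matrix_transpose_mul)
  have "\<theta> ** transpose H ** transpose \<theta> = transpose (\<theta> ** H ** transpose \<theta>)"
    by (simp add: matrix_transpose_mul matrix_mul_assoc)
  then have "(\<theta> ** transpose H) ** transpose \<theta> = mat 1" using assms by (simp add: orthof_matrix transpose_mat)
  moreover have "(\<theta> ** H) ** transpose \<theta> = mat 1" using assms by (simp add: orthof_matrix)
  \<comment> \<open>Both products are inverses of \<open>transpose \<theta>\<close>, so the symmetry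
    of H follows from the existence of an orthonormal frame.\<close>
  ultimately have "\<theta> ** transpose H = \<theta> ** H"
    using t by (metis matrix_mul_assoc matrix_mul_lid matrix_mul_rid)
  then have "transpose \<theta> *v (\<theta> *v (H *v u)) = u"
    using t by (simp add: matrix_vector_mul_assoc matrix_mul_assoc)
  moreover have "(transpose \<theta> *v w) $ i = (\<Sum>s\<in>UNIV. \<theta> $ s $ i * w $ s)" for w i
    by (simp add: matrix_vector_mult_def transpose_def)
  ultimately have "u $ i = (\<Sum>s\<in>UNIV. \<theta> $ s $ i * (\<theta> *v (H *v u)) $ s)" for i by metis
  then show ?thesis
    unfolding matrix_vector_mul_component by (simp add: vec_eq_iff mult.commute)
qed

lemma orthof_eqI:
  assumes "orthof H \<theta>" "\<And>s. \<theta> $ s \<bullet> (H *v u) = \<theta> $ s \<bullet> (H *v v)"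
  shows "u = v"
  using orthof_expand[OF assms(1), of u] orthof_expand[OF assms(1), of v] assms(2) by simp

text \<open>H maps the normalised vector to a multiple of the Euclidean cross product, so it is
  H-orthogonal to v and w; \<sigma> selects one of the two unit normals. The explicit formula makes
  the third frame vector differentiable along a curve.\<close>

definition normal3 :: "real \<Rightarrow> real^3^3 \<Rightarrow> R3 \<Rightarrow> R3 \<Rightarrow> R3" where
  "normal3 \<sigma> H v w = \<sigma> *\<^sub>R nrmz H (matrix_inv H *v cross3 v w)"

lemma normal3_orthof:
  assumes pd: "posdef H" and o: "v \<bullet> (H *v v) = 1" "w \<bullet> (H *v w) = 1" "v \<bullet> (H *v w) = 0" and \<sigma>: "\<sigma> * \<sigma> = 1"
  shows "orthof H (vector [v, w, normal3 \<sigma> H v w])" "matrix_inv H *v cross3 v w \<noteq> 0"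
proof -
  define N where "N = matrix_inv H *v cross3 v w"
  have HN: "H *v N = cross3 v w"
    by (simp add: N_def matrix_vector_mul_assoc det_nonzero_inverse[OF posdef_det[OF pd]])
  have sy: "a \<bullet> (H *v b) = b \<bullet> (H *v a)" for a b
    using pd inner_matrix_commute by (auto simp: posdef_def)
  have "cross3 v w \<noteq> 0"
  proof
    assume "cross3 v w = 0"
    then have "collinear {0, v, w}" by (simp add: cross_eq_0)
    then consider "v = 0" | "w = 0" | c where "w = c *\<^sub>R v" by (auto simp: collinear_lemma)
    then show False
    proof cases
      case 3
      then have "c = 0" using o(1,3) by (simp add: matrix_vector_mult_scaleR)
      then show False using 3 o(2) by simp
    qed (use o in simp_all)
  qed
  then show N0: "matrix_inv H *v cross3 v w \<noteq> 0" using HN by (auto simp: N_def[symmetric])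
  have 1: "v \<bullet> (H *v N) = 0" "w \<bullet> (H *v N) = 0" by (simp_all add: HN dot_cross_self)
  have 2: "v \<bullet> (H *v nrmz H N) = 0" "w \<bullet> (H *v nrmz H N) = 0" using 1 by (simp_all add: nrmz_orth)
  have 3: "nrmz H N \<bullet> (H *v nrmz H N) = 1" using nrmz_unit[OF pd] N0 by (simp add: N_def)
  show "orthof H (vector [v, w, normal3 \<sigma> H v w])"
    unfolding orthof_def forall_3 normal3_def N_def[symmetric] vector_3
    using o 2 3 \<sigma> sy[of w v] sy[of "nrmz H N" v] sy[of "nrmz H N" w] by (simp add: matrix_vector_mult_scaleR)
qed

lemma normal3_differentiable:
  fixes v w :: "real \<Rightarrow> R3"
  assumes H: "\<And>i j. (\<lambda>t. H t $ i $ j) differentiable at t" and pd: "posdef (H t)"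
    and v: "v differentiable at t" "w differentiable at t" and nz: "matrix_inv (H t) *v cross3 (v t) (w t) \<noteq> 0"
  shows "(\<lambda>t. normal3 \<sigma> (H t) (v t) (w t)) differentiable at t"
proof -
  have vc: "(\<lambda>t. v t $ i) differentiable at t" "(\<lambda>t. w t $ i) differentiable at t" for i
    using v by (auto intro: differentiable_compose[OF bounded_linear_imp_differentiable[OF bounded_linear_vec_nth]])
  have inv: "(\<lambda>t. matrix_inv (H t) $ i $ j) differentiable at t" for i j
  proof (rule differentiableI, rule matrix_entry_has_derivative[where A'="\<lambda>q. \<chi> i j. frechet_derivative (\<lambda>t. H t $ i $ j) (at t) q"])
    show "((\<lambda>p. H p $ i $ j) has_derivative (\<lambda>q. (\<chi> i j. frechet_derivative (\<lambda>t. H t $ i $ j) (at t) q) $ i $ j)) (at t)" for i j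
      using H[of i j] by (simp add: frechet_derivative_works)
  qed (rule posdef_det[OF pd])
  have vecI: "f differentiable at t" if "\<And>i. (\<lambda>t. f t $ i) differentiable at t" for f :: "real \<Rightarrow> R3"
    by (subst differentiable_componentwise_within) (auto simp: Basis_vec_def inner_axis that)
  define N where "N t = matrix_inv (H t) *v cross3 (v t) (w t)" for t
  have cr: "(\<lambda>t. cross3 (v t) (w t) $ i) differentiable at t" for i
  proof -
    have "\<forall>i. (\<lambda>t. cross3 (v t) (w t) $ i) differentiable at t"
      unfolding forall_3 by (simp add: cross3_simps) (intro conjI differentiable_diff differentiable_mult vc)
    then show ?thesis by blast
  qed
  have Nc: "(\<lambda>t. N t $ i) differentiable at t" for i
    unfolding N_def matrix_vector_mult_def by (simp add: sum_3) (intro differentiable_add differentiable_mult inv cr)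
  define q where "q t = N t \<bullet> (H t *v N t)" for t
  have qd: "q differentiable at t"
    unfolding q_def inner_matrix_expand by (simp add: sum_3) (intro differentiable_add differentiable_mult Nc H)
  have q0: "q t > 0" using pd nz by (simp add: q_def N_def posdef_def)
  have "(\<lambda>t. 1 / sqrt (q t)) differentiable at t"
  proof -
    have "sqrt differentiable at (q t)"
      using DERIV_real_sqrt[OF q0] real_differentiable_def by blast
    from differentiable_compose[OF this qd] show ?thesis
      using q0 by (intro differentiable_divide differentiable_const) auto
  qed
  then have "(\<lambda>t. \<sigma> * ((1 / sqrt (q t)) * N t $ i)) differentiable at t" for i
    by (intro differentiable_mult Nc differentiable_const)
  then show ?thesis
    unfolding normal3_def nrmz_def N_def[symmetric] q_def[symmetric] by (intro vecI) simp
qed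

text \<open>A geodesic with velocity \<open>V\<close> and a parallel field \<open>X\<close>, in the coordinates of a chart.\<close>

locale chart_geodesic =
  fixes U :: "R3 set" and h :: metric and I :: "real set" and x V X :: "real \<Rightarrow> R3" and \<sigma> :: real
  assumes U: "open U" and h: "smooth_metric U h" and I: "open I" "is_interval I" "0 \<in> I"
    and xU: "\<And>t. t \<in> I \<Longrightarrow> x t \<in> U"
    and x: "\<And>t. t \<in> I \<Longrightarrow> (x has_vector_derivative V t) (at t)"
    and V: "\<And>t. t \<in> I \<Longrightarrow> (V has_vector_derivative - christoffel h (x t) (V t) (V t)) (at t)"
    and X: "\<And>t. t \<in> I \<Longrightarrow> (X has_vector_derivative - christoffel h (x t) (V t) (X t)) (at t)"
    and \<sigma>: "\<sigma> * \<sigma> = 1" and o0: "V 0 \<bullet> (h (x 0) *v V 0) = 1" "X 0 \<bullet> (h (x 0) *v X 0) = 1" "V 0 \<bullet> (h (x 0) *v X 0) = 0"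
begin

lemma pd: "t \<in> I \<Longrightarrow> posdef (h (x t))"
  using h xU by (simp add: smooth_metric_def riemannian_metric_posdef)

lemma comps: "smooth_comps U h" by (rule smooth_metric_comps[OF h])

lemma sym: "t \<in> I \<Longrightarrow> sym_jet (jet h (x t))"
  by (rule sym_jet_jet[OF U xU]) (use h in \<open>auto simp: smooth_metric_def riemannian_metric_def\<close>)

lemma inner_const:
  assumes "\<And>t. t \<in> I \<Longrightarrow> (A has_vector_derivative - christoffel h (x t) (V t) (A t)) (at t)"
    "\<And>t. t \<in> I \<Longrightarrow> (B has_vector_derivative - christoffel h (x t) (V t) (B t)) (at t)" "t \<in> I"
  shows "A t \<bullet> (h (x t) *v B t) = A 0 \<bullet> (h (x 0) *v B 0)"
proof -
  have "((\<lambda>t. A t \<bullet> (h (x t) *v B t)) has_real_derivative 0) (at t)" if "t \<in> I" for t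
    using inner_along_curve[OF comps xU[OF that] sym[OF that] posdef_det[OF pd[OF that]] x[OF that] assms(1)[OF that] assms(2)[OF that]]
    by simp
  then have "((\<lambda>t. A t \<bullet> (h (x t) *v B t)) has_derivative (\<lambda>_. 0)) (at t within I)" if "t \<in> I" for t
    using that has_derivative_at_withinI unfolding has_field_derivative_def by (metis (no_types, lifting) ext mult_zero_left)
  from has_derivative_zero_unique[OF is_interval_convex[OF I(2)] this assms(3) I(3)] show ?thesis by simp
qed

definition Z :: "real \<Rightarrow> R3" where "Z t = normal3 \<sigma> (h (x t)) (V t) (X t)"

definition \<theta> :: "real \<Rightarrow> frame" where "\<theta> t = vector [V t, X t, Z t]"

lemma orth:
  assumes "t \<in> I"
  shows "orthof (h (x t)) (\<theta> t)" "matrix_inv (h (x t)) *v cross3 (V t) (X t) \<noteq> 0"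
  using normal3_orthof[OF pd[OF assms], of "V t" "X t"]
    inner_const[OF V V assms] inner_const[OF X X assms] inner_const[OF V X assms] o0 \<sigma>
  by (simp_all add: \<theta>_def Z_def)

text \<open>Z is given by a formula and not as the solution of an equation. It is parallel because
  the constant inner products of V, X and Z with Z force its covariant derivative to be orthogonal
  to the whole frame.\<close>

lemma Zderiv:
  assumes "t \<in> I"
  shows "(Z has_vector_derivative - christoffel h (x t) (V t) (Z t)) (at t)"
proof -
  have "(\<lambda>t. h (x t) $ i $ j) differentiable at t" for i j
    using jet_has_derivative[OF comps x[OF assms, unfolded has_vector_derivative_def] xU[OF assms], of "[]" i j]
    by (auto simp: jet_def intro: differentiableI)
  then have "Z differentiable at t"
    unfolding Z_def[abs_def] using V[OF assms] X[OF assms]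
    by (intro normal3_differentiable pd assms orth(2)) (auto simp: has_vector_derivative_def intro: differentiableI)
  then obtain Z' where Z': "(Z has_vector_derivative Z') (at t)" using vector_derivative_works by blast
  note ic = inner_along_curve[OF comps xU[OF assms] sym[OF assms] posdef_det[OF pd[OF assms]] x[OF assms]]
  define E where "E = Z' + christoffel h (x t) (V t) (Z t)"
  have const: "((\<lambda>t. f t) has_real_derivative c) (at t) \<Longrightarrow> (\<And>t. t \<in> I \<Longrightarrow> f t = d) \<Longrightarrow> c = 0" for f :: "real \<Rightarrow> real" and c d
  proof -
    assume f: "((\<lambda>t. f t) has_real_derivative c) (at t)" "\<And>t. t \<in> I \<Longrightarrow> f t = d"
    have "((\<lambda>t. d) has_real_derivative c) (at t)"
      by (rule has_field_derivative_transform_within_open[OF f(1) I(1) assms f(2)])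
    then show "c = 0" using DERIV_const[of d] DERIV_unique by blast
  qed
  have o: "V t \<bullet> (h (x t) *v Z t) = 0" "X t \<bullet> (h (x t) *v Z t) = 0" "Z t \<bullet> (h (x t) *v Z t) = 1" if "t \<in> I" for t
  proof -
    have "\<theta> t $ 1 \<bullet> (h (x t) *v \<theta> t $ 3) = 0" "\<theta> t $ 2 \<bullet> (h (x t) *v \<theta> t $ 3) = 0" "\<theta> t $ 3 \<bullet> (h (x t) *v \<theta> t $ 3) = 1"
      using orth(1)[OF that] by (simp_all add: orthof_def)
    then show "V t \<bullet> (h (x t) *v Z t) = 0" "X t \<bullet> (h (x t) *v Z t) = 0" "Z t \<bullet> (h (x t) *v Z t) = 1"
      by (simp_all add: \<theta>_def)
  qed
  have "V t \<bullet> (h (x t) *v E) = 0" using const[OF ic[OF V[OF assms] Z'] o(1)] by (simp add: E_def)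
  moreover have "X t \<bullet> (h (x t) *v E) = 0" using const[OF ic[OF X[OF assms] Z'] o(2)] by (simp add: E_def)
  moreover have "Z t \<bullet> (h (x t) *v E) = 0"
  proof -
    have "E \<bullet> (h (x t) *v Z t) = Z t \<bullet> (h (x t) *v E)"
      using pd[OF assms] inner_matrix_commute by (auto simp: posdef_def)
    then show ?thesis using const[OF ic[OF Z' Z'] o(3)] by (simp add: E_def[symmetric])
  qed
  ultimately have "\<forall>s. \<theta> t $ s \<bullet> (h (x t) *v E) = \<theta> t $ s \<bullet> (h (x t) *v 0)"
    unfolding forall_3 by (simp add: \<theta>_def)
  then have "E = 0" using orthof_eqI[OF orth(1)[OF assms]] by blast
  then have "Z' = - christoffel h (x t) (V t) (Z t)" by (simp add: E_def eq_neg_iff_add_eq_0)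
  with Z' show ?thesis by simp
qed

definition \<phi> :: "nat \<Rightarrow> real \<Rightarrow> real" where "\<phi> j t = ev (jet h (x t)) (\<theta> t) (FE j)"

lemma \<phi>_deriv:
  assumes "t \<in> I" shows "(\<phi> j has_real_derivative \<phi> (Suc j) t) (at t)"
proof -
  have "\<forall>s. ((\<lambda>t. \<theta> t $ s) has_vector_derivative - christoffel h (x t) (\<theta> t $ 1) (\<theta> t $ s)) (at t)"
    unfolding forall_3 using V[OF assms] X[OF assms] Zderiv[OF assms] by (simp add: \<theta>_def)
  then show ?thesis
    unfolding \<phi>_def[abs_def] FE_Suc
    by (intro ev_along_geodesic[where x=x and \<theta>=\<theta> and t=t, OF comps xU[OF assms] posdef_det[OF pd[OF assms]]]) (use x[OF assms] in \<open>auto simp: \<theta>_def\<close>)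
qed

end

section \<open>Change of coordinates\<close>

lemma vec_has_derivativeI:
  fixes f :: "'p::real_normed_vector \<Rightarrow> R3"
  assumes "\<And>a. ((\<lambda>y. f y $ a) has_derivative (\<lambda>u. f' u $ a)) (at x)"
  shows "(f has_derivative f') (at x)"
  by (subst has_derivative_componentwise_within) (auto simp: Basis_vec_def inner_axis assms)

lemma vec_has_vector_derivativeI:
  fixes f :: "real \<Rightarrow> R3"
  assumes "\<And>a. ((\<lambda>y. f y $ a) has_derivative (\<lambda>r. r * f' $ a)) (at x)"
  shows "(f has_vector_derivative f') (at x)"
  unfolding has_vector_derivative_def by (rule vec_has_derivativeI) (simp add: assms)

lemma vec_nth_has_derivative:
  fixes f :: "real \<Rightarrow> R3"
  assumes "(f has_vector_derivative f') (at x)"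
  shows "((\<lambda>y. f y $ a) has_derivative (\<lambda>r. r * f' $ a)) (at x)"
  using bounded_linear.has_derivative[OF bounded_linear_vec_nth assms[unfolded has_vector_derivative_def], of a] by simp

section \<open>Differentials of smooth maps up to order three\<close>

definition smooth_map :: "R3 set \<Rightarrow> (R3 \<Rightarrow> R3) \<Rightarrow> bool" where
  "smooth_map W f \<longleftrightarrow> (\<forall>i. smooth_on W (\<lambda>x. f x $ i))"

definition d1 :: "(R3 \<Rightarrow> R3) \<Rightarrow> R3 \<Rightarrow> R3 \<Rightarrow> R3" where
  "d1 f x u = (\<chi> a. \<Sum>i\<in>UNIV. u $ i * partials [i] (\<lambda>y. f y $ a) x)"
definition d2 :: "(R3 \<Rightarrow> R3) \<Rightarrow> R3 \<Rightarrow> R3 \<Rightarrow> R3 \<Rightarrow> R3" where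
  "d2 f x u v = (\<chi> a. \<Sum>i\<in>UNIV. \<Sum>j\<in>UNIV. u $ i * (v $ j * partials [i, j] (\<lambda>y. f y $ a) x))"
definition d3 :: "(R3 \<Rightarrow> R3) \<Rightarrow> R3 \<Rightarrow> R3 \<Rightarrow> R3 \<Rightarrow> R3 \<Rightarrow> R3" where
  "d3 f x u v w = (\<chi> a. \<Sum>i\<in>UNIV. \<Sum>j\<in>UNIV. \<Sum>k\<in>UNIV.
     u $ i * (v $ j * (w $ k * partials [i, j, k] (\<lambda>y. f y $ a) x)))"

lemma d1_has_derivative:
  assumes "smooth_map W f" "x \<in> W" shows "(f has_derivative d1 f x) (at x)"
proof (rule vec_has_derivativeI)
  fix a
  have "(partials [] (\<lambda>y. f y $ a) has_derivative (\<lambda>u. \<Sum>l\<in>UNIV. u $ l * partials [l] (\<lambda>y. f y $ a) x)) (at x)"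
    by (rule has_derivative_partials) (use assms in \<open>auto simp: smooth_map_def\<close>)
  then show "((\<lambda>y. f y $ a) has_derivative (\<lambda>u. d1 f x u $ a)) (at x)" by (simp add: d1_def)
qed

lemma frechet_derivative_d1:
  "smooth_map W f \<Longrightarrow> x \<in> W \<Longrightarrow> frechet_derivative f (at x) = d1 f x"
  by (rule frechet_derivative_at[OF d1_has_derivative, symmetric])

lemma d2_has_derivative:
  assumes "smooth_map W f" "x \<in> W" shows "((\<lambda>y. d1 f y v) has_derivative (\<lambda>u. d2 f x u v)) (at x)"
proof (rule vec_has_derivativeI)
  fix a
  have "(partials [j] (\<lambda>y. f y $ a) has_derivative (\<lambda>u. \<Sum>l\<in>UNIV. u $ l * partials [l, j] (\<lambda>y. f y $ a) x)) (at x)" for j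
    by (rule has_derivative_partials) (use assms in \<open>auto simp: smooth_map_def\<close>)
  then have "((\<lambda>y. d1 f y v $ a) has_derivative (\<lambda>u. \<Sum>j\<in>UNIV. v $ j * (\<Sum>l\<in>UNIV. u $ l * partials [l, j] (\<lambda>y. f y $ a) x))) (at x)"
    unfolding d1_def vec_lambda_beta by (intro has_derivative_sum has_derivative_mult_right)
  moreover have "(\<Sum>j\<in>UNIV. v $ j * (\<Sum>l\<in>UNIV. u $ l * partials [l, j] (\<lambda>y. f y $ a) x)) = d2 f x u v $ a" for u
    unfolding d2_def vec_lambda_beta sum_distrib_left by (subst sum.swap) (simp add: mult.left_commute)
  ultimately show "((\<lambda>y. d1 f y v $ a) has_derivative (\<lambda>u. d2 f x u v $ a)) (at x)" by simp
qed

lemma d3_has_derivative: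
  assumes "smooth_map W f" "x \<in> W" shows "((\<lambda>y. d2 f y v w) has_derivative (\<lambda>u. d3 f x u v w)) (at x)"
proof (rule vec_has_derivativeI)
  fix a
  have "(partials [i, j] (\<lambda>y. f y $ a) has_derivative (\<lambda>u. \<Sum>l\<in>UNIV. u $ l * partials [l, i, j] (\<lambda>y. f y $ a) x)) (at x)" for i j
    by (rule has_derivative_partials) (use assms in \<open>auto simp: smooth_map_def\<close>)
  then have "((\<lambda>y. d2 f y v w $ a) has_derivative (\<lambda>u. \<Sum>i\<in>UNIV. \<Sum>j\<in>UNIV.
      v $ i * (w $ j * (\<Sum>l\<in>UNIV. u $ l * partials [l, i, j] (\<lambda>y. f y $ a) x)))) (at x)"
    unfolding d2_def vec_lambda_beta by (intro has_derivative_sum has_derivative_mult_right)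
  moreover have "(\<Sum>i\<in>UNIV. \<Sum>j\<in>UNIV. v $ i * (w $ j * (\<Sum>l\<in>UNIV. u $ l * partials [l, i, j] (\<lambda>y. f y $ a) x))) = d3 f x u v w $ a" for u
    unfolding d3_def vec_lambda_beta sum_distrib_left by (rule trans[OF sum_rotate[symmetric]]) (simp add: mult.left_commute)
  ultimately show "((\<lambda>y. d2 f y v w $ a) has_derivative (\<lambda>u. d3 f x u v w $ a)) (at x)" by simp
qed

lemma d2_sym: "smooth_map W f \<Longrightarrow> open W \<Longrightarrow> x \<in> W \<Longrightarrow> d2 f x u v = d2 f x v u"
proof -
  assume a: "smooth_map W f" "open W" "x \<in> W"
  then have "partials [i, j] (\<lambda>y. f y $ a) x = partials [j, i] (\<lambda>y. f y $ a) x" for i j a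
    by (intro partials_2_commute) (auto simp: smooth_map_def)
  then show ?thesis unfolding d2_def vec_eq_iff vec_lambda_beta
    by (subst sum.swap) (simp add: mult.left_commute)
qed

lemma d3_sym: "smooth_map W f \<Longrightarrow> open W \<Longrightarrow> x \<in> W \<Longrightarrow> d3 f x u v w = d3 f x v u w"
proof -
  assume a: "smooth_map W f" "open W" "x \<in> W"
  then have sw: "partials [i, j, k] (\<lambda>y. f y $ a) x = partials [j, i, k] (\<lambda>y. f y $ a) x" for i j k a
    by (intro partials_swap) (auto simp: smooth_map_def)
  show ?thesis unfolding d3_def vec_eq_iff vec_lambda_beta
  proof (intro allI, rule trans[OF sum.swap], intro sum.cong refl)
    fix a i j k
    show "u $ j * (v $ i * (w $ k * partials [j, i, k] (\<lambda>y. f y $ a) x)) = v $ i * (u $ j * (w $ k * partials [i, j, k] (\<lambda>y. f y $ a) x))"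
      unfolding sw[of j i] by (rule mult.left_commute)
  qed
qed

lemma linear_d1: "linear (d1 f x)"
  by (rule linearI) (simp_all add: d1_def vec_eq_iff sum.distrib distrib_right sum_distrib_left mult.assoc)

lemma d1_along_curve:
  assumes f: "smooth_map W f" and x: "(x has_vector_derivative x') (at t)" "x t \<in> W"
    and A: "(A has_vector_derivative A') (at t)"
  shows "((\<lambda>t. d1 f (x t) (A t)) has_vector_derivative d2 f (x t) x' (A t) + d1 f (x t) A') (at t)"
proof (rule vec_has_vector_derivativeI)
  fix a
  have "((\<lambda>t. partials [j] (\<lambda>y. f y $ a) (x t)) has_derivative (\<lambda>r. \<Sum>l\<in>UNIV. (r *\<^sub>R x') $ l * partials [l, j] (\<lambda>y. f y $ a) (x t))) (at t)" for j
    by (rule has_derivative_compose[where f=x and g="partials [j] (\<lambda>y. f y $ a)", OF x(1)[unfolded has_vector_derivative_def] has_derivative_partials])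
      (use f x(2) in \<open>auto simp: smooth_map_def\<close>)
  then have "((\<lambda>t. d1 f (x t) (A t) $ a) has_derivative (\<lambda>r. \<Sum>j\<in>UNIV.
      A t $ j * (\<Sum>l\<in>UNIV. (r *\<^sub>R x') $ l * partials [l, j] (\<lambda>y. f y $ a) (x t)) + (r * A' $ j) * partials [j] (\<lambda>y. f y $ a) (x t))) (at t)"
    unfolding d1_def vec_lambda_beta by (intro has_derivative_sum has_derivative_mult vec_nth_has_derivative A)
  moreover have "(\<Sum>j\<in>UNIV. A t $ j * (\<Sum>l\<in>UNIV. (r *\<^sub>R x') $ l * partials [l, j] (\<lambda>y. f y $ a) (x t)) + (r * A' $ j) * partials [j] (\<lambda>y. f y $ a) (x t))
     = r * (d2 f (x t) x' (A t) + d1 f (x t) A') $ a" for r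
    unfolding d1_def d2_def vector_add_component vec_lambda_beta sum_3 vector_scaleR_component by (simp add: algebra_simps)
  ultimately show "((\<lambda>t. d1 f (x t) (A t) $ a) has_derivative (\<lambda>r. r * (d2 f (x t) x' (A t) + d1 f (x t) A') $ a)) (at t)" by simp
qed

lemma bilinear_chr: "bilinear (chr J)"
  unfolding bilinear_def
  by (auto intro!: linearI simp: chr_def vec_eq_iff sum.distrib distrib_right distrib_left sum_distrib_left mult_ac)

lemma christoffel_along_curve:
  assumes h: "smooth_comps U h" and x: "(x has_vector_derivative x') (at t)" "x t \<in> U" "det (h (x t)) \<noteq> 0"
    and A: "(A has_vector_derivative A') (at t)" and B: "(B has_vector_derivative B') (at t)"
  shows "((\<lambda>t. christoffel h (x t) (A t) (B t)) has_vector_derivative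
    frechet_derivative (\<lambda>y. christoffel h y (A t) (B t)) (at (x t)) x'
    + christoffel h (x t) A' (B t) + christoffel h (x t) (A t) B') (at t)"
proof (rule vec_has_vector_derivativeI)
  fix m
  let ?c = "\<lambda>l i j. ev (jet h (x t)) 0 (dx l (chE m i j))" and ?e = "\<lambda>t i j. ev (jet h (x t)) 0 (chE m i j)"
  define K where "K i j = (\<Sum>l\<in>UNIV. x' $ l * ?c l i j)" for i j
  have c: "((\<lambda>t. ?e t i j) has_derivative (\<lambda>r. r * K i j)) (at t)" for i j
  proof -
    have "((\<lambda>t. ?e t i j) has_derivative (\<lambda>r. \<Sum>l\<in>UNIV. (r *\<^sub>R x') $ l * ?c l i j)) (at t)"
      using ev_jet_has_derivative[OF h x(1)[unfolded has_vector_derivative_def] x(2), of "\<lambda>_. 0" "\<lambda>_. 0" "chE m i j"] x(3)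
      unfolding sev_linear_jet ev_dx zero_index by simp
    then show ?thesis by (simp add: K_def sum_distrib_left mult.assoc)
  qed
  have D: "((\<lambda>t. christoffel h (x t) (A t) (B t) $ m) has_derivative (\<lambda>r. \<Sum>i\<in>UNIV. \<Sum>j\<in>UNIV.
      ?e t i j * A t $ i * (r * B' $ j) + (?e t i j * (r * A' $ i) + r * K i j * A t $ i) * B t $ j)) (at t)"
    unfolding christoffel_chr chr_def vec_lambda_beta
    by (intro has_derivative_sum has_derivative_mult c vec_nth_has_derivative A B)
  have fd: "frechet_derivative (\<lambda>y. christoffel h y (A t) (B t)) (at (x t)) x' $ m =
      (\<Sum>i\<in>UNIV. \<Sum>j\<in>UNIV. K i j * A t $ i * B t $ j)"
    unfolding christoffel_chr frechet_derivative_at[OF chr_has_derivative[OF h x(2,3)], symmetric] vec_lambda_beta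
      K_def
    by (rule trans[OF sum_rotate]) (simp add: sum_distrib_left mult_ac)
  have "(\<Sum>i\<in>UNIV. \<Sum>j\<in>UNIV. ?e t i j * A t $ i * (r * B' $ j) + (?e t i j * (r * A' $ i) + r * K i j * A t $ i) * B t $ j)
    = r * (frechet_derivative (\<lambda>y. christoffel h y (A t) (B t)) (at (x t)) x'
      + christoffel h (x t) A' (B t) + christoffel h (x t) (A t) B') $ m" for r
    unfolding vector_add_component fd unfolding christoffel_chr chr_def vec_lambda_beta
      sum.distrib[symmetric] sum_distrib_left by (intro sum.cong refl) (simp add: algebra_simps)
  with D show "((\<lambda>t. christoffel h (x t) (A t) (B t) $ m) has_derivative (\<lambda>r. r * (frechet_derivative (\<lambda>y. christoffel h y (A t) (B t)) (at (x t)) x'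
      + christoffel h (x t) A' (B t) + christoffel h (x t) (A t) B') $ m)) (at t)" by simp
qed

lemma riemann_linear:
  assumes "smooth_comps U h" "x \<in> U" "det (h x) \<noteq> 0"
  shows "linear (\<lambda>u. riemann h x u v w)" "linear (\<lambda>v. riemann h x u v w)" "linear (\<lambda>w. riemann h x u v w)"
  by (auto intro!: linearI simp: vec_eq_iff riemann_rmE[OF assms] sum.distrib distrib_left distrib_right sum_distrib_left mult_ac)

text \<open>The trace may be taken in any orthonormal frame instead of the coordinate basis, which
  makes the invariance of the Ricci form visible.\<close>

lemma ricci_frame:
  assumes "smooth_comps U h" "x \<in> U" "det (h x) \<noteq> 0" and o: "orthof (h x) \<theta>"
  shows "ricci h x v w = (\<Sum>s\<in>UNIV. \<theta> $ s \<bullet> (h x *v riemann h x (\<theta> $ s) v w))"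
proof -
  let ?A = "\<lambda>u. riemann h x u v w"
  have L: "linear (\<lambda>u. \<theta> $ s \<bullet> (h x *v ?A u))" for s
    by (intro linearI) (simp_all add: linear_add[OF riemann_linear(1)[OF assms(1-3)]]
      linear_cmul[OF riemann_linear(1)[OF assms(1-3)]] matrix_vector_right_distrib inner_add_right matrix_vector_mult_scaleR)
  have "?A (axis i 1) $ i = (\<Sum>s\<in>UNIV. (\<theta> $ s \<bullet> (h x *v ?A (axis i 1))) * \<theta> $ s $ i)" for i
    by (subst orthof_expand[OF o, of "?A (axis i 1)"]) simp
  then have "ricci h x v w = (\<Sum>s\<in>UNIV. \<Sum>i\<in>UNIV. \<theta> $ s $ i *\<^sub>R (\<theta> $ s \<bullet> (h x *v ?A (axis i 1))))"
    unfolding ricci_def by (simp add: mult.commute) (rule sum.swap)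
  also have "\<dots> = (\<Sum>s\<in>UNIV. \<theta> $ s \<bullet> (h x *v ?A (\<theta> $ s)))"
    by (rule sum.cong[OF refl]) (rule linear_R3_sum[OF L, symmetric])
  finally show ?thesis .
qed

lemma ricci_endo_inner:
  assumes "smooth_comps U h" "x \<in> U" "det (h x) \<noteq> 0"
  shows "u \<bullet> (h x *v ricci_endo h x v) = ricci h x u v"
proof -
  have "h x *v ricci_endo h x v = (\<chi> i. ricci h x (axis i 1) v)"
    by (simp add: ricci_endo_def matrix_vector_mul_assoc det_nonzero_inverse[OF assms(3)])
  moreover have "linear (\<lambda>u. ricci h x u v)"
    by (rule linearI) (simp_all add: ricci_ricE[OF assms, of _ _ 0] sum.distrib distrib_right distrib_left sum_distrib_left mult_ac)
  from linear_R3_sum[OF this, of u] have "ricci h x u v = (\<Sum>i\<in>UNIV. u $ i * ricci h x (axis i 1) v)" by simp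
  ultimately show ?thesis by (simp add: inner_vec_def)
qed

section \<open>Transformation laws under a local isometry\<close>

locale coord_change =
  fixes W W' :: "R3 set" and f :: "R3 \<Rightarrow> R3" and g h :: metric
  assumes W: "open W" "open W'" and f: "smooth_map W f" "\<And>y. y \<in> W \<Longrightarrow> f y \<in> W'"
    and g: "smooth_metric W g" and h: "smooth_metric W' h"
    and iso: "\<And>y u v. y \<in> W \<Longrightarrow> u \<bullet> (g y *v v) = d1 f y u \<bullet> (h (f y) *v d1 f y v)"
begin

lemma gpd: "y \<in> W \<Longrightarrow> posdef (g y)" and hpd: "z \<in> W' \<Longrightarrow> posdef (h z)"
  using g h by (simp_all add: smooth_metric_def riemannian_metric_posdef)

lemma gsym: "y \<in> W \<Longrightarrow> sym_jet (jet g y)"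
  by (rule sym_jet_jet[OF W(1)]) (use g in \<open>auto simp: smooth_metric_def riemannian_metric_def\<close>)

lemma hsym: "z \<in> W' \<Longrightarrow> sym_jet (jet h z)"
  by (rule sym_jet_jet[OF W(2)]) (use h in \<open>auto simp: smooth_metric_def riemannian_metric_def\<close>)

lemmas gc = smooth_metric_comps[OF g] and hc = smooth_metric_comps[OF h]

lemma d1_surj: assumes "y \<in> W" obtains u where "d1 f y u = b"
proof -
  have "u = 0" if "d1 f y u = 0" for u
    using iso[OF assms, of u u] that gpd[OF assms] by (metis inner_zero_left less_irrefl posdef_def)
  then have "inj (d1 f y)" by (simp add: linear_injective_0[OF linear_d1])
  then have "surj (d1 f y)" by (rule linear_injective_imp_surjective[OF linear_d1]) (rule refl)
  then show ?thesis using that by (metis surjD)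
qed

lemma d1_eqI:
  assumes "y \<in> W" "\<And>u. d1 f y u \<bullet> (h (f y) *v a) = d1 f y u \<bullet> (h (f y) *v b)"
  shows "a = b"
proof -
  obtain u where u: "d1 f y u = a - b" using d1_surj[OF assms(1)] by metis
  have "(a - b) \<bullet> (h (f y) *v (a - b)) = 0"
    using assms(2)[of u] by (simp add: u matrix_vector_mult_diff_distrib inner_diff_right)
  then show ?thesis using hpd[OF f(2)[OF assms(1)]] by (metis eq_iff_diff_eq_0 less_irrefl posdef_def)
qed

text \<open>The defect \<open>E\<close> of the transformation law is symmetric in its arguments, while the derivative of \<open>iso\<close>
  makes \<open>E(u, a) \<bullet> h Df(b)\<close> antisymmetric in \<open>a, b\<close>; a trilinear form with both properties vanishes.\<close>

lemma christoffel_transform: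
  assumes x: "x \<in> W"
  shows "d1 f x (christoffel g x u a) = d2 f x u a + christoffel h (f x) (d1 f x u) (d1 f x a)"
proof -
  define E where "E u a = d2 f x u a + christoffel h (f x) (d1 f x u) (d1 f x a) - d1 f x (christoffel g x u a)" for u a
  have fx: "f x \<in> W'" by (rule f(2)[OF x])
  have sy: "p \<bullet> (h (f x) *v q) = q \<bullet> (h (f x) *v p)" for p q
    using hpd[OF fx] inner_matrix_commute by (auto simp: posdef_def)
  have E_sym: "E u a = E a u" for u a
    unfolding E_def christoffel_chr d2_sym[OF f(1) W(1) x, of u] chr_sym[OF gsym[OF x], of u]
      chr_sym[OF hsym[OF fx], of "d1 f x u"] ..
  have anti: "E u a \<bullet> (h (f x) *v d1 f x b) + d1 f x a \<bullet> (h (f x) *v E u b) = 0" for u a b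
  proof -
    define c where "c t = x + t *\<^sub>R u" for t :: real
    have c: "(c has_vector_derivative u) (at 0)" unfolding c_def by (auto intro!: derivative_eq_intros)
    have c0: "c 0 = x" by (simp add: c_def)
    have fc: "((\<lambda>t. f (c t)) has_vector_derivative d1 f x u) (at 0)"
      using has_derivative_compose[where f=c and g=f, OF c[unfolded has_vector_derivative_def], of "d1 f x"] d1_has_derivative[OF f(1) x]
      by (simp add: c0 has_vector_derivative_def linear_cmul[OF linear_d1])
    have D: "((\<lambda>t. d1 f (c t) a) has_vector_derivative d2 f x u a) (at 0)" for a
      using d1_along_curve[OF f(1) c, of "\<lambda>_. a" 0] x by (simp add: c0 linear_0[OF linear_d1])
    have 1: "((\<lambda>t. a \<bullet> (g (c t) *v b)) has_real_derivative
        christoffel g x u a \<bullet> (g x *v b) + a \<bullet> (g x *v christoffel g x u b)) (at 0)"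
      using inner_along_curve[OF gc, of c 0 u "\<lambda>_. a" 0 "\<lambda>_. b" 0] x gsym[OF x] posdef_det[OF gpd[OF x]] c by (simp add: c0)
    have 2: "((\<lambda>t. d1 f (c t) a \<bullet> (h (f (c t)) *v d1 f (c t) b)) has_real_derivative
        (d2 f x u a + christoffel h (f x) (d1 f x u) (d1 f x a)) \<bullet> (h (f x) *v d1 f x b)
         + d1 f x a \<bullet> (h (f x) *v (d2 f x u b + christoffel h (f x) (d1 f x u) (d1 f x b)))) (at 0)"
      using inner_along_curve[OF hc, of "\<lambda>t. f (c t)" 0 "d1 f x u", OF _ _ _ fc D D] fx hsym[OF fx] posdef_det[OF hpd[OF fx]] by (simp add: c0)
    have "open (c -` W)" unfolding c_def by (rule open_vimage[OF W(1)]) (intro continuous_intros)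
    from has_field_derivative_transform_within_open[OF 1 this, of "\<lambda>t. d1 f (c t) a \<bullet> (h (f (c t)) *v d1 f (c t) b)"]
    have "((\<lambda>t. d1 f (c t) a \<bullet> (h (f (c t)) *v d1 f (c t) b)) has_real_derivative
        christoffel g x u a \<bullet> (g x *v b) + a \<bullet> (g x *v christoffel g x u b)) (at 0)"
      using x by (simp add: c0 iso)
    from DERIV_unique[OF this 2] show ?thesis
      unfolding iso[OF x] E_def
      by (simp add: inner_diff_left inner_diff_right inner_add_left inner_add_right matrix_vector_right_distrib matrix_vector_mult_diff_distrib)
  qed
  have "E u a \<bullet> (h (f x) *v d1 f x b) = 0" for b
  proof -
    define T where "T u a b = E u a \<bullet> (h (f x) *v d1 f x b)" for u a b
    have t: "T u a b = - T u b a" "T u a b = T a u b" for u a b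
      using anti[of u a b] sy[of "d1 f x a" "E u b"] E_sym[of u a] by (simp_all add: T_def)
    show ?thesis using t(1)[of u a b] t(2)[of u b a] t(1)[of b u a] t(2)[of b a u] t(1)[of a b u] t(2)[of u a b] by (simp add: T_def)
  qed
  then have "E u a = 0" by (intro d1_eqI[OF x]) (simp add: sy)
  then show ?thesis by (simp add: E_def)
qed

lemma cov_transform:
  assumes x: "x t \<in> W" "(x has_vector_derivative x') (at t)" and A: "(A has_vector_derivative A') (at t)"
  shows "((\<lambda>t. d1 f (x t) (A t)) has_vector_derivative
    d1 f (x t) (A' + christoffel g (x t) x' (A t)) - christoffel h (f (x t)) (d1 f (x t) x') (d1 f (x t) (A t))) (at t)"
  using d1_along_curve[OF f(1) x(2,1) A] by (simp add: linear_add[OF linear_d1] christoffel_transform[OF x(1)] algebra_simps)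

text \<open>Differentiating the law of the Christoffel symbols once more gives \<open>key\<close>.
  Antisymmetrising in u and v cancels the third derivatives of f, by their symmetry, and the
  remaining terms with second derivatives.\<close>

lemma riemann_transform:
  assumes x: "x \<in> W"
  shows "d1 f x (riemann g x u v w) = riemann h (f x) (d1 f x u) (d1 f x v) (d1 f x w)"
proof -
  let ?D = "d1 f x" and ?G = "christoffel h (f x)"
  let ?P = "\<lambda>v w y. christoffel g y v w"
  have fx: "f x \<in> W'" by (rule f(2)[OF x])
  have bil: "?G a (b + c) = ?G a b + ?G a c" "?G a (b - c) = ?G a b - ?G a c" for a b c
    using bilinear_radd[OF bilinear_chr] bilinear_rsub[OF bilinear_chr] by (simp_all add: christoffel_chr)
  have key: "?D (frechet_derivative (?P v w) (at x) u + christoffel g x u (christoffel g x v w))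
     = d3 f x u v w + (frechet_derivative (\<lambda>y. christoffel h y (?D v) (?D w)) (at (f x)) (?D u)
        + ?G (d2 f x u v) (?D w) + ?G (?D v) (d2 f x u w)) + ?G (?D u) (d2 f x v w + ?G (?D v) (?D w))" for u v w
  proof -
    define c where "c t = x + t *\<^sub>R u" for t :: real
    have c: "(c has_vector_derivative u) (at 0)" unfolding c_def by (auto intro!: derivative_eq_intros)
    have c0: "c 0 = x" by (simp add: c_def)
    have fc: "((\<lambda>t. f (c t)) has_vector_derivative ?D u) (at 0)"
      using has_derivative_compose[where f=c and g=f, OF c[unfolded has_vector_derivative_def], of "d1 f x"] d1_has_derivative[OF f(1) x]
      by (simp add: c0 has_vector_derivative_def linear_cmul[OF linear_d1])
    have Dv: "((\<lambda>t. d1 f (c t) a) has_vector_derivative d2 f x u a) (at 0)" for a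
      using d1_along_curve[OF f(1) c, of "\<lambda>_. a" 0] x by (simp add: c0 linear_0[OF linear_d1])
    have P: "((\<lambda>t. ?P v w (c t)) has_vector_derivative frechet_derivative (?P v w) (at x) u) (at 0)"
      using christoffel_along_curve[OF gc c, of "\<lambda>_. v" 0 "\<lambda>_. w" 0] x posdef_det[OF gpd[OF x]]
      by (simp add: c0 christoffel_chr bilinear_lzero[OF bilinear_chr] bilinear_rzero[OF bilinear_chr])
    have 1: "((\<lambda>t. d1 f (c t) (?P v w (c t))) has_vector_derivative
       ?D (frechet_derivative (?P v w) (at x) u + christoffel g x u (christoffel g x v w))
         - ?G (?D u) (?D (christoffel g x v w))) (at 0)"
      using cov_transform[of c 0, OF _ c P] x by (simp add: c0)
    have d2: "((\<lambda>t. d2 f (c t) v w) has_vector_derivative d3 f x u v w) (at 0)"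
    proof -
      have "((\<lambda>t. d2 f (c t) v w) has_derivative (\<lambda>r. d3 f x (r *\<^sub>R u) v w)) (at 0)"
        using has_derivative_compose[where f=c and g="\<lambda>y. d2 f y v w", OF c[unfolded has_vector_derivative_def], of "\<lambda>u. d3 f x u v w"]
          d3_has_derivative[OF f(1) x] by (simp add: c0)
      moreover have "d3 f x (r *\<^sub>R u) v w = r *\<^sub>R d3 f x u v w" for r
        by (simp add: d3_def vec_eq_iff sum_distrib_left mult.assoc)
      ultimately show ?thesis by (simp add: has_vector_derivative_def)
    qed
    have G: "((\<lambda>t. christoffel h (f (c t)) (d1 f (c t) v) (d1 f (c t) w)) has_vector_derivative
        frechet_derivative (\<lambda>y. christoffel h y (?D v) (?D w)) (at (f x)) (?D u)
        + ?G (d2 f x u v) (?D w) + ?G (?D v) (d2 f x u w)) (at 0)"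
      using christoffel_along_curve[OF hc fc _ _ Dv[of v] Dv[of w]] fx posdef_det[OF hpd[OF fx]] by (simp add: c0)
    have eq: "d2 f (c t) v w + christoffel h (f (c t)) (d1 f (c t) v) (d1 f (c t) w) = d1 f (c t) (?P v w (c t))"
      if "t \<in> c -` W" for t using christoffel_transform[of "c t"] that by simp
    have op: "open (c -` W)" unfolding c_def by (rule open_vimage[OF W(1)]) (intro continuous_intros)
    have "0 \<in> c -` W" using x by (simp add: c0)
    from has_vector_derivative_transform_within_open[OF has_vector_derivative_add[OF d2 G] op this eq]
    have "?D (frechet_derivative (?P v w) (at x) u + christoffel g x u (christoffel g x v w)) - ?G (?D u) (?D (christoffel g x v w))
      = d3 f x u v w + (frechet_derivative (\<lambda>y. christoffel h y (?D v) (?D w)) (at (f x)) (?D u)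
        + ?G (d2 f x u v) (?D w) + ?G (?D v) (d2 f x u w))"
      using 1 vector_derivative_unique_at by blast
    then show ?thesis unfolding christoffel_transform[OF x, of v w] by (simp only: diff_eq_eq)
  qed
  have alg: "a + (b + c + d) + (e + p) - (a + (b' + c + e) + (d + p')) = b - b' + p - p'" for a b c d e p b' p' :: R3
    by simp
  have "riemann g x u v w = (frechet_derivative (?P v w) (at x) u + christoffel g x u (christoffel g x v w))
     - (frechet_derivative (?P u w) (at x) v + christoffel g x v (christoffel g x u w))"
    by (simp add: riemann_def)
  then have "?D (riemann g x u v w) = ?D (frechet_derivative (?P v w) (at x) u + christoffel g x u (christoffel g x v w))
     - ?D (frechet_derivative (?P u w) (at x) v + christoffel g x v (christoffel g x u w))"
    by (simp only: linear_diff[OF linear_d1])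
  also have "\<dots> = riemann h (f x) (?D u) (?D v) (?D w)"
    unfolding key riemann_def bil d3_sym[OF f(1) W(1) x, of v u w] d2_sym[OF f(1) W(1) x, of v u]
    by (rule alg)
  finally show ?thesis .
qed

lemma ricci_transform:
  assumes x: "x \<in> W"
  shows "ricci g x v w = ricci h (f x) (d1 f x v) (d1 f x w)"
proof -
  have fx: "f x \<in> W'" by (rule f(2)[OF x])
  note o = orthof_gs[OF gpd[OF x]]
  have o': "orthof (h (f x)) (\<chi> s. d1 f x (gs (g x) $ s))"
    using o by (simp add: orthof_def iso[OF x])
  show ?thesis
    unfolding ricci_frame[OF gc x posdef_det[OF gpd[OF x]] o] ricci_frame[OF hc fx posdef_det[OF hpd[OF fx]] o']
    by (simp add: iso[OF x] riemann_transform[OF x])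
qed

lemma ricci_endo_transform:
  assumes x: "x \<in> W"
  shows "d1 f x (ricci_endo g x v) = ricci_endo h (f x) (d1 f x v)"
proof (rule d1_eqI[OF x])
  fix u
  have fx: "f x \<in> W'" by (rule f(2)[OF x])
  show "d1 f x u \<bullet> (h (f x) *v d1 f x (ricci_endo g x v)) = d1 f x u \<bullet> (h (f x) *v ricci_endo h (f x) (d1 f x v))"
    unfolding iso[OF x, symmetric] ricci_endo_inner[OF gc x posdef_det[OF gpd[OF x]]]
      ricci_endo_inner[OF hc fx posdef_det[OF hpd[OF fx]]] by (rule ricci_transform[OF x])
qed

end

section \<open>Manifolds\<close>

text \<open>Only smoothness is kept, so that the analytic manifolds of (1) and the smoothly
  perturbed regions of (2) are treated together.\<close>

locale smooth_riem =
  fixes M :: "'a riem_manifold"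
  assumes cover: "\<Union> (chart_dom ` atlas M) = topspace (mtop M)"
    and op: "\<And>c. c \<in> atlas M \<Longrightarrow> openin (mtop M) (chart_dom c)"
    and oi: "\<And>c. c \<in> atlas M \<Longrightarrow> open (chart_map c ` chart_dom c)"
    and hm: "\<And>c. c \<in> atlas M \<Longrightarrow> homeomorphic_map (subtopology (mtop M) (chart_dom c))
          (top_of_set (chart_map c ` chart_dom c)) (chart_map c)"
    and sm: "\<And>c. c \<in> atlas M \<Longrightarrow> smooth_metric (chart_map c ` chart_dom c) (met M c)"
    and tr: "\<And>c d. c \<in> atlas M \<Longrightarrow> d \<in> atlas M \<Longrightarrow> smooth_map (overlap c d) (transition c d)"
    and iso: "\<And>c d x u v. c \<in> atlas M \<Longrightarrow> d \<in> atlas M \<Longrightarrow> x \<in> overlap c d \<Longrightarrow> u \<bullet> (met M c x *v v) =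
      d1 (transition c d) x u \<bullet> (met M d (transition c d x) *v d1 (transition c d) x v)"

lemma analytic_imp_smooth_metric: "analytic_metric U g \<Longrightarrow> smooth_metric U g"
  by (simp add: analytic_metric_def smooth_metric_def real_analytic_on_imp_smooth_on)

lemma analytic_imp_smooth_riem:
  assumes M: "analytic_riemannian_manifold M" shows "smooth_riem M"
proof -
  have tr: "smooth_map (overlap c d) (transition c d)" if "c \<in> atlas M" "d \<in> atlas M" for c d
    using M that unfolding analytic_riemannian_manifold_def smooth_map_def
    by (intro allI real_analytic_on_imp_smooth_on) blast
  show ?thesis
  proof
    fix c d x u v assume a: "c \<in> atlas M" "d \<in> atlas M" "x \<in> overlap c d"
    have "u \<bullet> (met M c x *v v) = frechet_derivative (transition c d) (at x) u
             \<bullet> (met M d (transition c d x) *v frechet_derivative (transition c d) (at x) v)"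
      using M a unfolding analytic_riemannian_manifold_def by blast
    then show "u \<bullet> (met M c x *v v) =
      d1 (transition c d) x u \<bullet> (met M d (transition c d x) *v d1 (transition c d) x v)"
      by (simp add: frechet_derivative_d1[OF tr[OF a(1,2)] a(3)])
  qed (use M tr in \<open>auto simp: analytic_riemannian_manifold_def analytic_imp_smooth_metric\<close>)
qed

lemma smooth_riem_region:
  assumes "open U" "smooth_metric U h" shows "smooth_riem (region U h)"
proof -
  let ?c = "(U, \<lambda>x::R3. x)"
  have tr: "transition ?c ?c x = x" if "x \<in> U" for x
    using that by (simp add: transition_def inv_into_f_f[of "\<lambda>x. x", simplified])
  have sm: "smooth_map U (transition ?c ?c)"
    unfolding smooth_map_def
  proof
    fix i
    have "smooth_on U (\<lambda>x. x $ i)" by (rule real_analytic_on_imp_smooth_on[OF real_analytic_on_component])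
    then show "smooth_on U (\<lambda>x. transition ?c ?c x $ i)"
      by (rule smooth_on_cong[OF assms(1)]) (simp add: tr)
  qed
  have fd: "d1 (transition ?c ?c) x = (\<lambda>v. v)" if "x \<in> U" for x
  proof -
    have "((\<lambda>x. x) has_derivative (\<lambda>v::R3. v)) (at x)" by (rule has_derivative_ident)
    then have "(transition ?c ?c has_derivative (\<lambda>v. v)) (at x)"
      by (rule has_derivative_transform_within_open[OF _ assms(1) that]) (simp add: tr)
    then show ?thesis using d1_has_derivative[OF sm that] has_derivative_unique by blast
  qed
  show ?thesis
    by standard (use assms sm in \<open>auto simp: region_def overlap_def fd tr homeomorphic_map_id[unfolded id_def] subtopology_subtopology\<close>)
qed

lemma openin_imp_open_image: "open U \<Longrightarrow> openin (top_of_set U) S \<Longrightarrow> open S"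
  by (simp add: openin_open_eq)

lemma span_pair: "s \<in> span {a, b} \<longleftrightarrow> (\<exists>x y. s = x *\<^sub>R a + y *\<^sub>R b)" for s :: "'v::real_vector"
  unfolding span_insert span_singleton by (auto simp: algebra_simps image_def)

context smooth_riem
begin

abbreviation img :: "'a chart \<Rightarrow> R3 set" where "img c \<equiv> chart_map c ` chart_dom c"

lemma charts_atD: "c \<in> charts_at M p \<Longrightarrow> c \<in> atlas M \<and> p \<in> chart_dom c"
  by (simp add: charts_at_def)

lemma topspace_chart: "c \<in> atlas M \<Longrightarrow> topspace (subtopology (mtop M) (chart_dom c)) = chart_dom c"
  unfolding topspace_subtopology by (rule Int_absorb1[OF openin_subset[OF op]])

lemma inj_chart: "c \<in> atlas M \<Longrightarrow> inj_on (chart_map c) (chart_dom c)"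
  using homeomorphic_imp_injective_map[OF hm] by (simp only: topspace_chart)

lemma transition_chart: "c \<in> atlas M \<Longrightarrow> p \<in> chart_dom c \<Longrightarrow> transition c d (chart_map c p) = chart_map d p"
  by (simp add: transition_def inv_into_f_f[OF inj_chart])

lemma open_chart_image:
  assumes c: "c \<in> atlas M" and S: "openin (mtop M) S" "S \<subseteq> chart_dom c"
  shows "open (chart_map c ` S)"
proof -
  have "openin (subtopology (mtop M) (chart_dom c)) S"
    using S openin_open_subtopology[OF op[OF c]] by blast
  then have "openin (top_of_set (img c)) (chart_map c ` S)"
    using homeomorphic_imp_open_map[OF hm[OF c]] by (simp add: open_map_def)
  then show ?thesis by (rule openin_imp_open_image[OF oi[OF c]])
qed

lemma coord_change: "c \<in> atlas M \<Longrightarrow> d \<in> atlas M \<Longrightarrow>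
    coord_change (overlap c d) (img d) (transition c d) (met M c) (met M d)"
proof
  assume a: "c \<in> atlas M" "d \<in> atlas M"
  show "open (overlap c d)"
    unfolding overlap_def by (rule open_chart_image[OF a(1) openin_Int[OF op[OF a(1)] op[OF a(2)]]]) simp
  show "transition c d y \<in> img d" if "y \<in> overlap c d" for y
    using that by (auto simp: overlap_def transition_chart[OF a(1)])
  have "overlap c d \<subseteq> img c" by (auto simp: overlap_def)
  then show "smooth_metric (overlap c d) (met M c)"
    using sm[OF a(1)] smooth_on_subset unfolding smooth_metric_def riemannian_metric_def by blast
  show "y \<in> overlap c d \<Longrightarrow> u \<bullet> (met M c y *v v) =
      d1 (transition c d) y u \<bullet> (met M d (transition c d y) *v d1 (transition c d) y v)" for y u v by (rule iso[OF a])
qed (simp_all add: oi sm tr)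

lemma overlap_charts_at: "c \<in> charts_at M p \<Longrightarrow> d \<in> charts_at M p \<Longrightarrow> chart_map c p \<in> overlap c d"
  by (auto simp: overlap_def charts_at_def)

lemma d1_cocycle:
  assumes c: "c \<in> charts_at M p" and d: "d \<in> charts_at M p" and e: "e \<in> charts_at M p"
  shows "d1 (transition d e) (chart_map d p) (d1 (transition c d) (chart_map c p) u) = d1 (transition c e) (chart_map c p) u"
proof -
  have a: "c \<in> atlas M" "d \<in> atlas M" "e \<in> atlas M" "p \<in> chart_dom c" using assms by (auto simp: charts_at_def)
  define S where "S = chart_map c ` (chart_dom c \<inter> chart_dom d \<inter> chart_dom e)"
  have S: "open S" unfolding S_def
    by (rule open_chart_image[OF a(1) openin_Int[OF openin_Int[OF op[OF a(1)] op[OF a(2)]] op[OF a(3)]]]) auto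
  have pS: "chart_map c p \<in> S" using assms by (auto simp: S_def charts_at_def)
  have "((\<lambda>y. transition d e (transition c d y)) has_derivative
      (\<lambda>u. d1 (transition d e) (chart_map d p) (d1 (transition c d) (chart_map c p) u))) (at (chart_map c p))"
    by (rule has_derivative_compose[OF d1_has_derivative[OF tr[OF a(1,2)] overlap_charts_at[OF c d]]])
      (simp add: transition_chart[OF a(1,4)], rule d1_has_derivative[OF tr[OF a(2,3)] overlap_charts_at[OF d e]])
  then have "(transition c e has_derivative
      (\<lambda>u. d1 (transition d e) (chart_map d p) (d1 (transition c d) (chart_map c p) u))) (at (chart_map c p))"
    by (rule has_derivative_transform_within_open[OF _ S pS])
      (auto simp: S_def transition_chart[OF a(1)] transition_chart[OF a(2)])
  from has_derivative_unique[OF this d1_has_derivative[OF tr[OF a(1,3)] overlap_charts_at[OF c e]]]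
  show ?thesis by metis
qed

lemma d1_self: assumes c: "c \<in> charts_at M p" shows "d1 (transition c c) (chart_map c p) u = u"
proof -
  have a: "c \<in> atlas M" "p \<in> chart_dom c" using assms by (auto simp: charts_at_def)
  have "((\<lambda>x. x) has_derivative (\<lambda>v::R3. v)) (at (chart_map c p))" by (rule has_derivative_ident)
  then have "(transition c c has_derivative (\<lambda>v. v)) (at (chart_map c p))"
    by (rule has_derivative_transform_within_open[OF _ oi[OF a(1)]]) (use a in \<open>auto simp: transition_chart[OF a(1)]\<close>)
  from has_derivative_unique[OF this d1_has_derivative[OF tr[OF a(1,1)] overlap_charts_at[OF c c]]]
  show ?thesis by metis
qed

text \<open>Identifies R^3 with the tangent space at p through the chart c; the transition maps
  determine all other components of the family.\<close>

definition lift :: "'a chart \<Rightarrow> 'a \<Rightarrow> R3 \<Rightarrow> 'a tvec" where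
  "lift c p u = (\<lambda>d. if d \<in> charts_at M p then d1 (transition c d) (chart_map c p) u else 0)"

lemma lift_tangent: "c \<in> charts_at M p \<Longrightarrow> lift c p u \<in> tangent_space M p"
  by (auto simp: tangent_space_def lift_def d1_cocycle
      frechet_derivative_d1[OF tr overlap_charts_at] charts_atD)

lemma tangent_lift:
  assumes "c \<in> charts_at M p" "v \<in> tangent_space M p" shows "v = lift c p (v c)"
proof
  fix d show "v d = lift c p (v c) d"
  proof (cases "d \<in> charts_at M p")
    case True
    then have "v d = frechet_derivative (transition c d) (at (chart_map c p)) (v c)"
      using assms unfolding tangent_space_def by blast
    then show ?thesis
      using True assms(1) by (simp add: lift_def frechet_derivative_d1[OF tr overlap_charts_at] charts_atD)
  next
    case False
    then have "v d = 0" using assms(2) unfolding tangent_space_def by blast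
    then show ?thesis using False by (simp add: lift_def)
  qed
qed

lemma lift_self: "c \<in> charts_at M p \<Longrightarrow> lift c p u c = u"
  by (simp add: lift_def d1_self)

lemma lift_linear: "lift c p (a *\<^sub>R u + b *\<^sub>R v) = a *\<^sub>R lift c p u + b *\<^sub>R lift c p v"
  by (simp add: lift_def fun_eq_iff scaleR_fun_def linear_add[OF linear_d1] linear_cmul[OF linear_d1])

lemma lift_diff: "lift c p (u - v) = lift c p u - lift c p v"
  by (simp add: lift_def fun_eq_iff linear_diff[OF linear_d1])

lemma lift_0: "lift c p 0 = 0"
  by (simp add: lift_def fun_eq_iff linear_0[OF linear_d1])

lemma tinner_lift:
  assumes c: "c \<in> charts_at M p"
  shows "tinner M p (lift c p u) (lift c p v) = u \<bullet> (met M c (chart_map c p) *v v)"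
proof -
  define e where "e = (SOME c. c \<in> charts_at M p)"
  have e: "e \<in> charts_at M p" unfolding e_def by (rule someI[of _ c]) (rule c)
  have "tinner M p (lift c p u) (lift c p v) = lift c p u e \<bullet> (met M e (chart_map e p) *v lift c p v e)"
    unfolding tinner_def Let_def e_def ..
  then show ?thesis
    using iso[OF _ _ overlap_charts_at[OF c e], of u v] c e transition_chart[of c p e] by (simp add: lift_def charts_atD)
qed

lemma tricci_lift:
  assumes c: "c \<in> charts_at M p"
  shows "tricci M p (lift c p u) = lift c p (ricci_endo (met M c) (chart_map c p) u)"
proof
  fix d show "tricci M p (lift c p u) d = lift c p (ricci_endo (met M c) (chart_map c p) u) d"
  proof (cases "d \<in> charts_at M p")
    case True
    have a: "c \<in> atlas M" "d \<in> atlas M" "p \<in> chart_dom c" using True c by (auto simp: charts_at_def)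
    show ?thesis
      using coord_change.ricci_endo_transform[OF coord_change[OF a(1,2)] overlap_charts_at[OF c True], of u] True
      by (simp add: tricci_def lift_def transition_chart[OF a(1,3)])
  qed (simp add: tricci_def lift_def)
qed

text \<open>The orthogonal complement of the first two frame vectors is the line of the third, so
  the projection is the component along it.\<close>

lemma perp_lift:
  assumes c: "c \<in> charts_at M p" and o: "orthof (met M c (chart_map c p)) \<theta>"
  shows "perp_part M p {lift c p (\<theta> $ 1), lift c p (\<theta> $ 2)} (lift c p y)
     = lift c p ((\<theta> $ 3 \<bullet> (met M c (chart_map c p) *v y)) *\<^sub>R \<theta> $ 3)"
  unfolding perp_part_def
proof (rule the_equality)
  let ?H = "met M c (chart_map c p)"
  let ?w = "(\<theta> $ 3 \<bullet> (?H *v y)) *\<^sub>R \<theta> $ 3"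
  have oo: "\<theta> $ s \<bullet> (?H *v \<theta> $ t) = (if s = t then 1 else 0)" for s t using o by (simp add: orthof_def)
  have dec: "y - ?w = (\<theta> $ 1 \<bullet> (?H *v y)) *\<^sub>R \<theta> $ 1 + (\<theta> $ 2 \<bullet> (?H *v y)) *\<^sub>R \<theta> $ 2"
    using orthof_expand[OF o, of y] by (simp add: sum_3 algebra_simps)
  show "lift c p ?w \<in> tangent_space M p \<and> lift c p y - lift c p ?w \<in> span {lift c p (\<theta> $ 1), lift c p (\<theta> $ 2)} \<and>
    (\<forall>s\<in>span {lift c p (\<theta> $ 1), lift c p (\<theta> $ 2)}. tinner M p (lift c p ?w) s = 0)"
  proof (intro conjI ballI)
    show "lift c p y - lift c p ?w \<in> span {lift c p (\<theta> $ 1), lift c p (\<theta> $ 2)}"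
      unfolding lift_diff[symmetric] dec lift_linear span_pair by blast
    fix s assume "s \<in> span {lift c p (\<theta> $ 1), lift c p (\<theta> $ 2)}"
    then obtain a b where "s = lift c p (a *\<^sub>R \<theta> $ 1 + b *\<^sub>R \<theta> $ 2)" unfolding span_pair lift_linear by blast
    then show "tinner M p (lift c p ?w) s = 0"
      by (simp add: tinner_lift[OF c] oo matrix_vector_right_distrib matrix_vector_mult_scaleR inner_add_right)
  qed (rule lift_tangent[OF c])
  fix w assume w: "w \<in> tangent_space M p \<and> lift c p y - w \<in> span {lift c p (\<theta> $ 1), lift c p (\<theta> $ 2)} \<and>
    (\<forall>s\<in>span {lift c p (\<theta> $ 1), lift c p (\<theta> $ 2)}. tinner M p w s = 0)"
  then have wl: "w = lift c p (w c)" using tangent_lift[OF c] by blast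
  obtain a b where "lift c p y - w = lift c p (a *\<^sub>R \<theta> $ 1 + b *\<^sub>R \<theta> $ 2)"
    using w unfolding span_pair lift_linear by blast
  from arg_cong[OF this, of "\<lambda>v. v c"] have "y - w c = a *\<^sub>R \<theta> $ 1 + b *\<^sub>R \<theta> $ 2" by (simp add: lift_self[OF c])
  then have y: "y = w c + (a *\<^sub>R \<theta> $ 1 + b *\<^sub>R \<theta> $ 2)" by (simp add: algebra_simps)
  have wo: "w c \<bullet> (?H *v \<theta> $ s) = 0" if "s = 1 \<or> s = 2" for s
  proof -
    have "lift c p (\<theta> $ s) \<in> span {lift c p (\<theta> $ 1), lift c p (\<theta> $ 2)}" using that by (auto intro: span_base)
    then have "tinner M p w (lift c p (\<theta> $ s)) = 0" using w by blast
    then have "tinner M p (lift c p (w c)) (lift c p (\<theta> $ s)) = 0" unfolding wl[symmetric] .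
    then show ?thesis by (simp add: tinner_lift[OF c])
  qed
  have sy: "u \<bullet> (?H *v v) = v \<bullet> (?H *v u)" for u v
  proof (rule inner_matrix_commute)
    have "c \<in> atlas M" "p \<in> chart_dom c" using c charts_atD by blast+
    with sm[OF this(1)] show "transpose ?H = ?H" unfolding smooth_metric_def riemannian_metric_def by blast
  qed
  have "\<theta> $ 1 \<bullet> (?H *v w c) = 0" "\<theta> $ 2 \<bullet> (?H *v w c) = 0"
    using wo[of 1] wo[of 2] sy[of "\<theta> $ 1" "w c"] sy[of "\<theta> $ 2" "w c"] by simp_all
  then have "w c = (\<theta> $ 3 \<bullet> (?H *v w c)) *\<^sub>R \<theta> $ 3" using orthof_expand[OF o, of "w c"] by (simp add: sum_3)
  moreover have "\<theta> $ 3 \<bullet> (?H *v y) = \<theta> $ 3 \<bullet> (?H *v w c)"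
    unfolding y by (simp add: oo matrix_vector_right_distrib matrix_vector_mult_scaleR inner_add_right)
  ultimately have e: "w c = ?w" by simp
  show "w = lift c p ?w" by (rule trans[OF wl]) (simp only: e)
qed

end

section \<open>Curves and fields along them inside one chart\<close>

locale chart_curve = smooth_riem M for M :: "'a riem_manifold" +
  fixes c :: "'a chart" and I :: "real set" and \<gamma> :: "real \<Rightarrow> 'a" and x V :: "real \<Rightarrow> R3"
  assumes c: "c \<in> atlas M" and oI: "open I" and cont: "continuous_map (top_of_set I) (mtop M) \<gamma>"
    and dom: "\<And>t. t \<in> I \<Longrightarrow> \<gamma> t \<in> chart_dom c"
    and x: "\<And>t. t \<in> I \<Longrightarrow> x t = chart_map c (\<gamma> t)"
    and dx: "\<And>t. t \<in> I \<Longrightarrow> (x has_vector_derivative V t) (at t)"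
begin

lemma c_at: "t \<in> I \<Longrightarrow> c \<in> charts_at M (\<gamma> t)"
  using c dom by (simp add: charts_at_def)

text \<open>A chart at one point of the curve remains a chart for nearby parameters, so the
  components of a field in that chart can be compared on an open set of parameters before they are
  differentiated.\<close>

lemma near:
  assumes t: "t \<in> I" and d: "d \<in> charts_at M (\<gamma> t)"
  obtains S where "open S" "t \<in> S" "S \<subseteq> I" "\<And>s. s \<in> S \<Longrightarrow> d \<in> charts_at M (\<gamma> s)"
proof -
  have "openin (top_of_set I) {s \<in> topspace (top_of_set I). \<gamma> s \<in> chart_dom d}"
    by (rule openin_continuous_map_preimage[OF cont op]) (use d charts_atD in blast)
  then have "open {s \<in> I. \<gamma> s \<in> chart_dom d}" by (simp add: openin_open_eq[OF oI])
  then show thesis using t d by (intro that[of "{s \<in> I. \<gamma> s \<in> chart_dom d}"]) (auto simp: charts_at_def)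
qed

lemma chart_has_vector_derivative:
  assumes t: "t \<in> I" and d: "d \<in> charts_at M (\<gamma> t)"
  shows "((\<lambda>s. chart_map d (\<gamma> s)) has_vector_derivative d1 (transition c d) (x t) (V t)) (at t)"
proof -
  obtain S where S: "open S" "t \<in> S" "S \<subseteq> I" "\<And>s. s \<in> S \<Longrightarrow> d \<in> charts_at M (\<gamma> s)" using near[OF t d] by blast
  have da: "d \<in> atlas M" using d charts_atD by blast
  have "x t \<in> overlap c d" using overlap_charts_at[OF c_at[OF t] d] x[OF t] by simp
  from has_derivative_compose[where f=x and g="transition c d", OF dx[OF t, unfolded has_vector_derivative_def] d1_has_derivative[OF tr[OF c da] this]]
  have "((\<lambda>s. transition c d (x s)) has_vector_derivative d1 (transition c d) (x t) (V t)) (at t)"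
    by (simp add: has_vector_derivative_def linear_cmul[OF linear_d1])
  then show ?thesis
    by (rule has_vector_derivative_transform_within_open[OF _ S(1,2)]) (use S(3) in \<open>simp add: subset_iff x transition_chart[OF c dom]\<close>)
qed

lemma velocity_lift: assumes t: "t \<in> I" shows "velocity M \<gamma> t = lift c (\<gamma> t) (V t)"
proof
  fix d show "velocity M \<gamma> t d = lift c (\<gamma> t) (V t) d"
    using vector_derivative_at[OF chart_has_vector_derivative[OF t, of d]]
    by (cases "d \<in> charts_at M (\<gamma> t)") (simp_all add: velocity_def lift_def x[OF t])
qed

text \<open>Computing in the chart c suffices: \<open>cov_transform\<close> carries the covariant
  derivative to every other chart of the family.\<close>

lemma field_lift:
  assumes t: "t \<in> I" and F: "\<And>s. s \<in> I \<Longrightarrow> F s = lift c (\<gamma> s) (A s)" and A: "(A has_vector_derivative A') (at t)"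
  shows "\<forall>d\<in>charts_at M (\<gamma> t). (\<lambda>s. F s d) differentiable at t"
    and "cov_deriv M \<gamma> F t = lift c (\<gamma> t) (A' + christoffel (met M c) (x t) (V t) (A t))"
proof -
  have *: "((\<lambda>s. F s d) has_vector_derivative d1 (transition c d) (x t) (A' + christoffel (met M c) (x t) (V t) (A t))
     - christoffel (met M d) (chart_map d (\<gamma> t)) (d1 (transition c d) (x t) (V t)) (d1 (transition c d) (x t) (A t))) (at t)"
    if d: "d \<in> charts_at M (\<gamma> t)" for d
  proof -
    obtain S where S: "open S" "t \<in> S" "S \<subseteq> I" "\<And>s. s \<in> S \<Longrightarrow> d \<in> charts_at M (\<gamma> s)" using near[OF t d] by blast
    have da: "d \<in> atlas M" using d charts_atD by blast
    have "x t \<in> overlap c d" using overlap_charts_at[OF c_at[OF t] d] x[OF t] by simp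
    from coord_change.cov_transform[OF coord_change[OF c da] this dx[OF t] A]
    have 1: "((\<lambda>s. d1 (transition c d) (x s) (A s)) has_vector_derivative d1 (transition c d) (x t) (A' + christoffel (met M c) (x t) (V t) (A t))
     - christoffel (met M d) (chart_map d (\<gamma> t)) (d1 (transition c d) (x t) (V t)) (d1 (transition c d) (x t) (A t))) (at t)"
      by (simp add: x[OF t] transition_chart[OF c dom[OF t]])
    have 2: "d1 (transition c d) (x s) (A s) = F s d" if "s \<in> S" for s
      using S(3) that F[of s] S(4)[OF that] x[of s] by (auto simp: lift_def)
    show ?thesis by (rule has_vector_derivative_transform_within_open[OF 1 S(1,2) 2])
  qed
  then show "\<forall>d\<in>charts_at M (\<gamma> t). (\<lambda>s. F s d) differentiable at t"
    by (auto simp: has_vector_derivative_def intro: differentiableI)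
  show "cov_deriv M \<gamma> F t = lift c (\<gamma> t) (A' + christoffel (met M c) (x t) (V t) (A t))"
  proof
    fix d show "cov_deriv M \<gamma> F t d = lift c (\<gamma> t) (A' + christoffel (met M c) (x t) (V t) (A t)) d"
      using vector_derivative_at[OF *, of d] F[OF t]
      by (cases "d \<in> charts_at M (\<gamma> t)") (simp_all add: cov_deriv_def velocity_lift[OF t] lift_def x[OF t])
  qed
qed

context
  fixes X :: "real \<Rightarrow> R3" and \<sigma> :: real and Xf :: "real \<Rightarrow> 'a tvec"
  assumes cg: "chart_geodesic (chart_map c ` chart_dom c) (met M c) I x V X \<sigma>"
    and Xf: "\<And>t. t \<in> I \<Longrightarrow> Xf t = lift c (\<gamma> t) (X t)"
begin

interpretation G: chart_geodesic "chart_map c ` chart_dom c" "met M c" I x V X \<sigma> by (rule cg)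

lemma cov_Yperp: "t \<in> I \<Longrightarrow> (cov_deriv M \<gamma> ^^ j) (Yperp M \<gamma> Xf) t = lift c (\<gamma> t) (G.\<phi> j t *\<^sub>R G.Z t)"
proof (induction j arbitrary: t)
  case 0
  have th: "G.\<theta> t $ 1 = V t" "G.\<theta> t $ 2 = X t" "G.\<theta> t $ 3 = G.Z t" by (simp_all add: G.\<theta>_def)
  note dt = posdef_det[OF G.pd[OF 0]]
  have "orthof (met M c (chart_map c (\<gamma> t))) (G.\<theta> t)" using G.orth(1)[OF 0] x[OF 0] by simp
  from perp_lift[OF c_at[OF 0] this, of "ricci_endo (met M c) (x t) (X t)"]
  show ?case
    by (simp add: Yperp_def velocity_lift[OF 0] Xf[OF 0] tricci_lift[OF c_at[OF 0]] x[OF 0, symmetric] th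
        ricci_endo_inner[OF G.comps G.xU[OF 0] dt] G.\<phi>_def ev_FE_0[OF G.comps G.xU[OF 0] dt])
next
  case (Suc j)
  have "((\<lambda>t. G.\<phi> j t *\<^sub>R G.Z t) has_vector_derivative
      G.\<phi> j t *\<^sub>R (- christoffel (met M c) (x t) (V t) (G.Z t)) + G.\<phi> (Suc j) t *\<^sub>R G.Z t) (at t)"
    by (rule has_vector_derivative_scaleR[OF G.\<phi>_deriv[OF Suc.prems] G.Zderiv[OF Suc.prems]])
  from field_lift(2)[OF Suc.prems Suc.IH this]
  show ?case by (simp add: christoffel_chr bilinear_rmul[OF bilinear_chr])
qed

lemma chaotic_sum_zero:
  "(\<Sum>j\<le>k. tnorm M (\<gamma> 0) ((cov_deriv M \<gamma> ^^ j) (Yperp M \<gamma> Xf) 0)) = 0 \<longleftrightarrow> zero_frame k (jet (met M c) (x 0)) (G.\<theta> 0)"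
proof -
  have "G.\<theta> 0 $ 3 \<bullet> (met M c (x 0) *v G.\<theta> 0 $ 3) = 1"
    using G.orth(1)[OF G.I(3)] by (simp add: orthof_def)
  then have "G.Z 0 \<bullet> (met M c (x 0) *v G.Z 0) = 1" by (simp add: G.\<theta>_def)
  then have "tnorm M (\<gamma> 0) ((cov_deriv M \<gamma> ^^ j) (Yperp M \<gamma> Xf) 0) = \<bar>G.\<phi> j 0\<bar>" for j
    by (simp add: cov_Yperp[OF G.I(3)] tnorm_def tinner_lift[OF c_at[OF G.I(3)]] x[OF G.I(3), symmetric] matrix_vector_mult_scaleR)
  then show ?thesis
    using G.orth(1)[OF G.I(3)] by (auto simp add: sum_nonneg_eq_0_iff zero_frame_def G.\<phi>_def)
qed

lemma geodesic_and_parallel: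
  shows "unit_speed_geodesic M I \<gamma>" "parallel_field M \<gamma> I Xf" "tnorm M (\<gamma> 0) (Xf 0) = 1"
    "tinner M (\<gamma> 0) (Xf 0) (velocity M \<gamma> 0) = 0"
proof -
  have par: "parallel_field M \<gamma> I F" if F: "\<And>t. t \<in> I \<Longrightarrow> F t = lift c (\<gamma> t) (A t)"
    and A: "\<And>t. t \<in> I \<Longrightarrow> (A has_vector_derivative - christoffel (met M c) (x t) (V t) (A t)) (at t)" for F A
    unfolding parallel_field_def differentiable_field_def
    using field_lift[OF _ F A] F lift_tangent[OF c_at] by (simp add: lift_0)
  show "parallel_field M \<gamma> I Xf" by (rule par[OF Xf G.X])
  have n: "V t \<bullet> (met M c (x t) *v V t) = 1" if "t \<in> I" for t
    using G.inner_const[OF G.V G.V that] G.o0 by simp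
  show "unit_speed_geodesic M I \<gamma>"
    unfolding unit_speed_geodesic_def
  proof (intro conjI ballI)
    show "(\<lambda>s. chart_map d (\<gamma> s)) differentiable at t" if "t \<in> I" "d \<in> charts_at M (\<gamma> t)" for t d
      by (rule differentiableI[OF chart_has_vector_derivative[OF that, unfolded has_vector_derivative_def]])
    show "tnorm M (\<gamma> t) (velocity M \<gamma> t) = 1" if "t \<in> I" for t
      using n[OF that] by (simp add: tnorm_def velocity_lift[OF that] tinner_lift[OF c_at[OF that]] x[OF that])
  qed (use G.I cont par[OF velocity_lift G.V] in auto)
  have sy: "X 0 \<bullet> (met M c (x 0) *v V 0) = V 0 \<bullet> (met M c (x 0) *v X 0)"
    using G.pd[OF G.I(3)] inner_matrix_commute by (auto simp: posdef_def)
  show "tnorm M (\<gamma> 0) (Xf 0) = 1" "tinner M (\<gamma> 0) (Xf 0) (velocity M \<gamma> 0) = 0"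
    using G.o0 sy by (simp_all add: tnorm_def velocity_lift[OF G.I(3)] Xf[OF G.I(3)] tinner_lift[OF c_at[OF G.I(3)]] x[OF G.I(3), symmetric])
qed

end

end

section \<open>Existence of geodesics and parallel fields\<close>

text \<open>Boundedness is part of the notion so that products of such functions are again
  Lipschitz.\<close>

definition lipb :: "'a::real_normed_vector set \<Rightarrow> ('a \<Rightarrow> 'b::real_normed_vector) \<Rightarrow> bool" where
  "lipb S f \<longleftrightarrow> (\<exists>B L. 0 \<le> B \<and> 0 \<le> L \<and> (\<forall>z\<in>S. norm (f z) \<le> B) \<and> (\<forall>z\<in>S. \<forall>y\<in>S. norm (f z - f y) \<le> L * norm (z - y)))"

lemma lipbI:
  assumes "0 \<le> B" "0 \<le> L" "\<And>z. z \<in> S \<Longrightarrow> norm (f z) \<le> B" "\<And>z y. z \<in> S \<Longrightarrow> y \<in> S \<Longrightarrow> norm (f z - f y) \<le> L * norm (z - y)"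
  shows "lipb S f"
  using assms unfolding lipb_def by blast

lemma lipbE:
  assumes "lipb S f"
  obtains B L where "0 \<le> B" "0 \<le> L" "\<And>z. z \<in> S \<Longrightarrow> norm (f z) \<le> B" "\<And>z y. z \<in> S \<Longrightarrow> y \<in> S \<Longrightarrow> norm (f z - f y) \<le> L * norm (z - y)"
  using assms unfolding lipb_def by blast

lemma lipb_add: assumes "lipb S f" "lipb S g" shows "lipb S (\<lambda>z. f z + g z)"
proof -
  obtain B L where f: "0 \<le> B" "0 \<le> L" "\<And>z. z \<in> S \<Longrightarrow> norm (f z) \<le> B" "\<And>z y. z \<in> S \<Longrightarrow> y \<in> S \<Longrightarrow> norm (f z - f y) \<le> L * norm (z - y)"
    using lipbE[OF assms(1)] by metis
  obtain B' L' where g: "0 \<le> B'" "0 \<le> L'" "\<And>z. z \<in> S \<Longrightarrow> norm (g z) \<le> B'" "\<And>z y. z \<in> S \<Longrightarrow> y \<in> S \<Longrightarrow> norm (g z - g y) \<le> L' * norm (z - y)"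
    using lipbE[OF assms(2)] by metis
  show ?thesis
  proof (rule lipbI[of "B + B'" "L + L'"])
    show "norm (f z + g z) \<le> B + B'" if "z \<in> S" for z
      using norm_triangle_mono[OF f(3)[OF that] g(3)[OF that]] .
    show "norm (f z + g z - (f y + g y)) \<le> (L + L') * norm (z - y)" if "z \<in> S" "y \<in> S" for z y
      using norm_triangle_mono[OF f(4)[OF that] g(4)[OF that]] by (simp add: algebra_simps)
  qed (use f g in auto)
qed

lemma lipb_mult:
  fixes f g :: "'a::real_normed_vector \<Rightarrow> real"
  assumes "lipb S f" "lipb S g" shows "lipb S (\<lambda>z. f z * g z)"
proof -
  obtain B L where f: "0 \<le> B" "0 \<le> L" "\<And>z. z \<in> S \<Longrightarrow> norm (f z) \<le> B" "\<And>z y. z \<in> S \<Longrightarrow> y \<in> S \<Longrightarrow> norm (f z - f y) \<le> L * norm (z - y)"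
    using lipbE[OF assms(1)] by metis
  obtain B' L' where g: "0 \<le> B'" "0 \<le> L'" "\<And>z. z \<in> S \<Longrightarrow> norm (g z) \<le> B'" "\<And>z y. z \<in> S \<Longrightarrow> y \<in> S \<Longrightarrow> norm (g z - g y) \<le> L' * norm (z - y)"
    using lipbE[OF assms(2)] by metis
  show ?thesis
  proof (rule lipbI[of "B * B'" "B * L' + B' * L"])
    show "norm (f z * g z) \<le> B * B'" if "z \<in> S" for z
      unfolding norm_mult using f g that by (intro mult_mono) auto
    show "norm (f z * g z - f y * g y) \<le> (B * L' + B' * L) * norm (z - y)" if "z \<in> S" "y \<in> S" for z y
    proof -
      have "f z * g z - f y * g y = f z * (g z - g y) + g y * (f z - f y)" by (simp add: algebra_simps)
      then have "norm (f z * g z - f y * g y) \<le> norm (f z) * norm (g z - g y) + norm (g y) * norm (f z - f y)"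
        using norm_triangle_ineq[of "f z * (g z - g y)" "g y * (f z - f y)"] by (simp only: norm_mult)
      also have "\<dots> \<le> B * (L' * norm (z - y)) + B' * (L * norm (z - y))"
        using f g that by (intro add_mono mult_mono) auto
      finally show ?thesis by (simp add: algebra_simps)
    qed
  qed (use f g in auto)
qed

lemma lipb_sum:
  assumes "finite A" "\<And>i. i \<in> A \<Longrightarrow> lipb S (f i)" shows "lipb S (\<lambda>z. \<Sum>i\<in>A. f i z)"
  using assms
proof (induction A)
  case empty
  show ?case by (rule lipbI[of 0 0]) auto
qed (simp add: lipb_add)

lemma lipb_component:
  fixes f :: "'a::real_normed_vector \<Rightarrow> R3"
  assumes "lipb S f" shows "lipb S (\<lambda>z. f z $ a)"
proof -
  obtain B L where f: "0 \<le> B" "0 \<le> L" "\<And>z. z \<in> S \<Longrightarrow> norm (f z) \<le> B" "\<And>z y. z \<in> S \<Longrightarrow> y \<in> S \<Longrightarrow> norm (f z - f y) \<le> L * norm (z - y)"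
    using lipbE[OF assms] by metis
  show ?thesis
  proof (rule lipbI[OF f(1,2)])
    show "norm (f z $ a) \<le> B" if "z \<in> S" for z
      using component_le_norm_cart[of "f z" a] f(3)[OF that] by simp
    show "norm (f z $ a - f y $ a) \<le> L * norm (z - y)" if "z \<in> S" "y \<in> S" for z y
      using component_le_norm_cart[of "f z - f y" a] f(4)[OF that] by simp
  qed
qed

lemma lipb_scaleR: fixes g :: "'a::real_normed_vector \<Rightarrow> real" assumes "lipb S g" shows "lipb S (\<lambda>z. g z *\<^sub>R e)"
proof -
  obtain B L where f: "0 \<le> B" "0 \<le> L" "\<And>z. z \<in> S \<Longrightarrow> norm (g z) \<le> B" "\<And>z y. z \<in> S \<Longrightarrow> y \<in> S \<Longrightarrow> norm (g z - g y) \<le> L * norm (z - y)"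
    using lipbE[OF assms] by metis
  show ?thesis
  proof (rule lipbI[of "B * norm e" "L * norm e"])
    show "norm (g z *\<^sub>R e) \<le> B * norm e" if "z \<in> S" for z
      using mult_right_mono[OF f(3)[OF that] norm_ge_zero[of e]] by simp
    show "norm (g z *\<^sub>R e - g y *\<^sub>R e) \<le> L * norm e * norm (z - y)" if "z \<in> S" "y \<in> S" for z y
      using mult_right_mono[OF f(4)[OF that] norm_ge_zero[of e]] by (simp add: scaleR_left_diff_distrib[symmetric] mult_ac)
  qed (use f in auto)
qed

lemma lipb_vec:
  fixes f :: "'a::real_normed_vector \<Rightarrow> R3"
  assumes "\<And>a. lipb S (\<lambda>z. f z $ a)" shows "lipb S f"
proof -
  have "lipb S (\<lambda>z. \<Sum>a\<in>UNIV. f z $ a *\<^sub>R (axis a 1 :: R3))" by (intro lipb_sum lipb_scaleR assms) simp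
  moreover have "(\<Sum>a\<in>UNIV. f z $ a *\<^sub>R axis a 1) = f z" for z
    using linear_R3_sum[OF linear_id, of "f z"] by simp
  ultimately show ?thesis by simp
qed

lemma lipb_Pair: assumes "lipb S f" "lipb S g" shows "lipb S (\<lambda>z. (f z, g z))"
proof -
  obtain B L where f: "0 \<le> B" "0 \<le> L" "\<And>z. z \<in> S \<Longrightarrow> norm (f z) \<le> B" "\<And>z y. z \<in> S \<Longrightarrow> y \<in> S \<Longrightarrow> norm (f z - f y) \<le> L * norm (z - y)"
    using lipbE[OF assms(1)] by metis
  obtain B' L' where g: "0 \<le> B'" "0 \<le> L'" "\<And>z. z \<in> S \<Longrightarrow> norm (g z) \<le> B'" "\<And>z y. z \<in> S \<Longrightarrow> y \<in> S \<Longrightarrow> norm (g z - g y) \<le> L' * norm (z - y)"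
    using lipbE[OF assms(2)] by metis
  show ?thesis
  proof (rule lipbI[of "B + B'" "L + L'"])
    show "norm (f z, g z) \<le> B + B'" if "z \<in> S" for z
      using norm_Pair_le[of "f z" "g z"] add_mono[OF f(3)[OF that] g(3)[OF that]] by linarith
    show "norm ((f z, g z) - (f y, g y)) \<le> (L + L') * norm (z - y)" if "z \<in> S" "y \<in> S" for z y
      using norm_Pair_le[of "f z - f y" "g z - g y"] add_mono[OF f(4)[OF that] g(4)[OF that]] by (simp add: algebra_simps)
  qed (use f g in auto)
qed

lemma lipb_nonexpansive:
  assumes f: "lipb S f" and p: "\<And>z. z \<in> T \<Longrightarrow> p z \<in> S" "\<And>z y. norm (p z - p y) \<le> norm (z - y)"
  shows "lipb T (\<lambda>z. f (p z))"
proof -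
  obtain B L where f: "0 \<le> B" "0 \<le> L" "\<And>z. z \<in> S \<Longrightarrow> norm (f z) \<le> B" "\<And>z y. z \<in> S \<Longrightarrow> y \<in> S \<Longrightarrow> norm (f z - f y) \<le> L * norm (z - y)"
    using lipbE[OF f] by metis
  show ?thesis
    by (rule lipbI[OF f(1,2)]) (use f(3) p(1) order_trans[OF f(4) mult_left_mono[OF p(2) f(2)]] in auto)
qed

lemma lipb_ident: "lipb (cball z0 r) (\<lambda>z. z)"
proof (rule lipbI[of "norm z0 + \<bar>r\<bar>" 1])
  show "norm z \<le> norm z0 + \<bar>r\<bar>" if "z \<in> cball z0 r" for z
    using that norm_triangle_sub[of z z0] by (simp add: dist_norm norm_minus_commute)
qed auto

lemma ev_jet_derivative_at:
  assumes h: "smooth_comps U h" and x: "x \<in> U" "det (h x) \<noteq> 0"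
  shows "((\<lambda>y. ev (jet h y) 0 e) has_derivative (\<lambda>u. \<Sum>l\<in>UNIV. u $ l * ev (jet h x) 0 (dx l e))) (at x)"
  using ev_jet_has_derivative[OF h has_derivative_ident x(1), of "\<lambda>_. 0" "\<lambda>_. 0" e] x(2)
  by (simp add: sev_linear_jet ev_dx)

text \<open>The partial derivatives of an evaluated expression are evaluations of
  \<open>dx l e\<close>, hence continuous and bounded on the compact ball, and the mean value
  inequality applies.\<close>

lemma lipb_ev:
  assumes h: "smooth_comps U h" and d: "\<And>x. x \<in> U \<Longrightarrow> det (h x) \<noteq> 0" and r: "cball x0 r \<subseteq> U"
  shows "lipb (cball x0 r) (\<lambda>x. ev (jet h x) 0 e)"
proof -
  have D: "((\<lambda>y. ev (jet h y) 0 e) has_derivative (\<lambda>u. \<Sum>l\<in>UNIV. u $ l * ev (jet h x) 0 (dx l e))) (at x)" if "x \<in> cball x0 r" for x e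
    using ev_jet_derivative_at[OF h _ d] that r by blast
  have "continuous_on (cball x0 r) (\<lambda>x. ev (jet h x) 0 e)" for e
    using D has_derivative_continuous continuous_at_imp_continuous_on by blast
  then have "bounded ((\<lambda>x. ev (jet h x) 0 e) ` cball x0 r)" for e
    by (rule compact_imp_bounded[OF compact_continuous_image[OF _ compact_cball]])
  then have "\<exists>B. \<forall>x\<in>cball x0 r. norm (ev (jet h x) 0 e) \<le> B" for e
    unfolding bounded_iff by blast
  then obtain B where B: "\<And>e x. x \<in> cball x0 r \<Longrightarrow> norm (ev (jet h x) 0 e) \<le> B e" by metis
  show ?thesis
  proof (cases "r < 0")
    case False
    then have x0: "x0 \<in> cball x0 r" by simp
    have B0: "0 \<le> B e" for e by (rule order_trans[OF norm_ge_zero B[OF x0]])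
    show ?thesis
    proof (rule lipbI[of "B e" "\<Sum>l\<in>UNIV. B (dx l e)"])
      show "norm (ev (jet h x) 0 e - ev (jet h y) 0 e) \<le> (\<Sum>l\<in>UNIV. B (dx l e)) * norm (x - y)"
        if "x \<in> cball x0 r" "y \<in> cball x0 r" for x y
      proof (rule differentiable_bound[OF convex_cball _ _ that])
        fix x assume x: "x \<in> cball x0 r"
        show "((\<lambda>y. ev (jet h y) 0 e) has_derivative (\<lambda>u. \<Sum>l\<in>UNIV. u $ l * ev (jet h x) 0 (dx l e))) (at x within cball x0 r)"
          by (rule has_derivative_at_withinI[OF D[OF x]])
        show "onorm (\<lambda>u. \<Sum>l\<in>UNIV. u $ l * ev (jet h x) 0 (dx l e)) \<le> (\<Sum>l\<in>UNIV. B (dx l e))"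
        proof (rule onorm_le)
          fix u :: R3
          have "norm (\<Sum>l\<in>UNIV. u $ l * ev (jet h x) 0 (dx l e)) \<le> (\<Sum>l\<in>UNIV. norm u * B (dx l e))"
            by (rule order_trans[OF norm_sum], rule sum_mono, unfold norm_mult, rule mult_mono)
              (use B[OF x] component_le_norm_cart[of u] in auto)
          then show "norm (\<Sum>l\<in>UNIV. u $ l * ev (jet h x) 0 (dx l e)) \<le> (\<Sum>l\<in>UNIV. B (dx l e)) * norm u"
            by (simp add: sum_distrib_left[symmetric] mult.commute)
        qed
      qed
    qed (use B B0 in \<open>auto intro: sum_nonneg\<close>)
  qed (rule lipbI[of 0 0], auto)
qed

lemma lipb_christoffel:
  assumes h: "smooth_comps U h" and d: "\<And>x. x \<in> U \<Longrightarrow> det (h x) \<noteq> 0" and r: "cball x0 r \<subseteq> U"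
    and p: "\<And>z. z \<in> S \<Longrightarrow> p z \<in> cball x0 r" "\<And>z y. norm (p z - p y) \<le> norm (z - y)"
    and A: "lipb S A" and B: "lipb S B"
  shows "lipb S (\<lambda>z. - christoffel h (p z) (A z) (B z))"
proof (rule lipb_vec)
  fix m
  have c: "lipb S (\<lambda>z. - 1 :: real)" by (rule lipbI[of 1 0]) auto
  have "lipb S (\<lambda>z. - 1 * (\<Sum>i\<in>UNIV. \<Sum>j\<in>UNIV. ev (jet h (p z)) 0 (chE m i j) * A z $ i * B z $ j))"
    by (intro lipb_mult[OF c] lipb_sum lipb_mult lipb_component A B lipb_nonexpansive[OF lipb_ev[OF h d r]] p) auto
  then show "lipb S (\<lambda>z. (- christoffel h (p z) (A z) (B z)) $ m)" by (simp add: christoffel_chr chr_def)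
qed

text \<open>The third vector of an orthonormal frame is determined by the other two up to sign.
  Recording the sign as \<sigma> allows every frame to be the initial frame of a
  \<open>chart_geodesic\<close>.\<close>

lemma normal3_unique:
  assumes pd: "posdef H" and o: "orthof H \<theta>"
  obtains \<sigma> where "\<sigma> * \<sigma> = 1" "normal3 \<sigma> H (\<theta> $ 1) (\<theta> $ 2) = \<theta> $ 3"
proof -
  have oo: "\<theta> $ s \<bullet> (H *v \<theta> $ t) = (if s = t then 1 else 0)" for s t using o by (simp add: orthof_def)
  define N where "N = normal3 1 H (\<theta> $ 1) (\<theta> $ 2)"
  have N: "orthof H (vector [\<theta> $ 1, \<theta> $ 2, N])"
    unfolding N_def by (rule normal3_orthof[OF pd]) (simp_all add: oo)
  define \<sigma> where "\<sigma> = N \<bullet> (H *v \<theta> $ 3)"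
  have e: "\<theta> $ 3 = \<sigma> *\<^sub>R N"
    using orthof_expand[OF N, of "\<theta> $ 3"] by (simp add: sum_3 oo \<sigma>_def)
  have "(vector [\<theta> $ 1, \<theta> $ 2, N] :: frame) $ 3 \<bullet> (H *v (vector [\<theta> $ 1, \<theta> $ 2, N] :: frame) $ 3) = 1" using N by (simp only: orthof_def) simp
  then have "N \<bullet> (H *v N) = 1" by simp
  then have "\<sigma> * \<sigma> = 1" using oo[of 3 3] unfolding e by (simp add: matrix_vector_mult_scaleR)
  moreover have "normal3 \<sigma> H (\<theta> $ 1) (\<theta> $ 2) = \<theta> $ 3" unfolding e by (simp add: N_def normal3_def)
  ultimately show ?thesis by (rule that)
qed

context smooth_riem
begin

text \<open>Brings an abstract geodesic with a parallel field into the form of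
  \<open>chart_geodesic\<close>; the interval is shrunk so that the curve stays in the chart
  c.\<close>

lemma geodesic_in_chart:
  assumes geo: "unit_speed_geodesic M I \<gamma>" and par: "parallel_field M \<gamma> I X"
    and n: "tnorm M (\<gamma> 0) (X 0) = 1" "tinner M (\<gamma> 0) (X 0) (velocity M \<gamma> 0) = 0" and c: "c \<in> charts_at M (\<gamma> 0)"
  obtains e where "e > 0" "chart_curve M c {-e<..<e} \<gamma> (\<lambda>t. chart_map c (\<gamma> t)) (\<lambda>t. velocity M \<gamma> t c)"
    "chart_geodesic (img c) (met M c) {-e<..<e} (\<lambda>t. chart_map c (\<gamma> t)) (\<lambda>t. velocity M \<gamma> t c) (\<lambda>t. X t c) 1"
    "\<And>t. t \<in> {-e<..<e} \<Longrightarrow> X t = lift c (\<gamma> t) (X t c)"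
proof -
  have I: "open I" "0 \<in> I" and cont: "continuous_map (top_of_set I) (mtop M) \<gamma>"
    and dif: "\<And>t d. t \<in> I \<Longrightarrow> d \<in> charts_at M (\<gamma> t) \<Longrightarrow> (\<lambda>s. chart_map d (\<gamma> s)) differentiable at t"
    and vpar: "parallel_field M \<gamma> I (velocity M \<gamma>)" and sp: "tnorm M (\<gamma> 0) (velocity M \<gamma> 0) = 1"
    using geo unfolding unit_speed_geodesic_def by blast+
  have ca: "c \<in> atlas M" "\<gamma> 0 \<in> chart_dom c" using c charts_atD by blast+
  have "openin (top_of_set I) {s \<in> topspace (top_of_set I). \<gamma> s \<in> chart_dom c}"
    by (rule openin_continuous_map_preimage[OF cont op[OF ca(1)]])
  then have "open {s \<in> I. \<gamma> s \<in> chart_dom c}" by (simp add: openin_open_eq[OF I(1)])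
  then obtain e where e: "e > 0" "ball 0 e \<subseteq> {s \<in> I. \<gamma> s \<in> chart_dom c}"
    using I(2) ca(2) open_contains_ball by (metis (no_types, lifting) mem_Collect_eq)
  have b: "t \<in> I" "\<gamma> t \<in> chart_dom c" "c \<in> charts_at M (\<gamma> t)" if "t \<in> {-e<..<e}" for t
  proof -
    have "t \<in> ball 0 e" using that by (simp add: ball_eq_greaterThanLessThan)
    then show "t \<in> I" "\<gamma> t \<in> chart_dom c" using e(2) by blast+
    then show "c \<in> charts_at M (\<gamma> t)" using ca by (simp add: charts_at_def)
  qed
  have dx: "((\<lambda>s. chart_map c (\<gamma> s)) has_vector_derivative velocity M \<gamma> t c) (at t)" if "t \<in> {-e<..<e}" for t
    using dif[OF b(1,3)[OF that]] b(3)[OF that] vector_derivative_works by (simp add: velocity_def) blast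
  have pf: "((\<lambda>s. F s c) has_vector_derivative - christoffel (met M c) (chart_map c (\<gamma> t)) (velocity M \<gamma> t c) (F t c)) (at t)"
    "F t = lift c (\<gamma> t) (F t c)"
    if F: "parallel_field M \<gamma> I F" and t: "t \<in> {-e<..<e}" for F t
  proof -
    have 1: "(\<lambda>s. F s c) differentiable at t" "F t \<in> tangent_space M (\<gamma> t)" and 2: "cov_deriv M \<gamma> F t = 0"
      using F b(1,3)[OF t] unfolding parallel_field_def differentiable_field_def by blast+
    have "cov_deriv M \<gamma> F t c = 0" by (simp add: 2)
    then have "vector_derivative (\<lambda>s. F s c) (at t) = - christoffel (met M c) (chart_map c (\<gamma> t)) (velocity M \<gamma> t c) (F t c)"
      using b(3)[OF t] by (simp add: cov_deriv_def eq_neg_iff_add_eq_0)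
    then show "((\<lambda>s. F s c) has_vector_derivative - christoffel (met M c) (chart_map c (\<gamma> t)) (velocity M \<gamma> t c) (F t c)) (at t)"
      using 1(1) vector_derivative_works by metis
    show "F t = lift c (\<gamma> t) (F t c)" by (rule tangent_lift[OF b(3)[OF t] 1(2)])
  qed
  have e0: "0 \<in> {-e<..<e}" using e(1) by simp
  define v0 where "v0 = velocity M \<gamma> 0 c"
  define w0 where "w0 = X 0 c"
  have vX: "velocity M \<gamma> 0 = lift c (\<gamma> 0) v0" "X 0 = lift c (\<gamma> 0) w0"
    unfolding v0_def w0_def by (rule pf(2)[OF vpar e0], rule pf(2)[OF par e0])
  let ?H = "met M c (chart_map c (\<gamma> 0))"
  have o: "v0 \<bullet> (?H *v v0) = 1" "w0 \<bullet> (?H *v w0) = 1" "w0 \<bullet> (?H *v v0) = 0"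
    using n sp unfolding tnorm_def vX tinner_lift[OF c] by simp_all
  have sy: "transpose ?H = ?H" using sm[OF ca(1)] ca(2) unfolding smooth_metric_def riemannian_metric_def by blast
  show thesis
  proof (rule that[OF e(1)])
    show "chart_curve M c {-e<..<e} \<gamma> (\<lambda>t. chart_map c (\<gamma> t)) (\<lambda>t. velocity M \<gamma> t c)"
    proof (intro chart_curve.intro chart_curve_axioms.intro)
      show "smooth_riem M" by (rule smooth_riem_axioms)
      show "continuous_map (top_of_set {-e<..<e}) (mtop M) \<gamma>"
        by (rule continuous_map_from_subtopology_mono[OF cont]) (use b in blast)
    qed (use ca b dx in auto)
    show "chart_geodesic (img c) (met M c) {-e<..<e} (\<lambda>t. chart_map c (\<gamma> t)) (\<lambda>t. velocity M \<gamma> t c) (\<lambda>t. X t c) 1"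
      by unfold_locales
        (use oi[OF ca(1)] sm[OF ca(1)] e(1) b(2) dx pf(1)[OF vpar] pf(1)[OF par] o inner_matrix_commute[OF sy, of v0 w0]
          in \<open>auto simp: is_interval_oo v0_def[symmetric] w0_def[symmetric]\<close>)
  qed (rule pf(2)[OF par])
qed

text \<open>Position, velocity and parallel field are solved for together, as one autonomous first
  order system of nine equations.\<close>

lemma geodesic_exists:
  assumes c: "c \<in> atlas M" and x0: "x0 \<in> img c" and s: "\<sigma> * \<sigma> = 1"
    and o: "v \<bullet> (met M c x0 *v v) = 1" "w \<bullet> (met M c x0 *v w) = 1" "v \<bullet> (met M c x0 *v w) = 0"
  obtains e \<gamma> x V X where "e > 0" "chart_curve M c {-e<..<e} \<gamma> x V"
    "chart_geodesic (img c) (met M c) {-e<..<e} x V X \<sigma>" "x 0 = x0" "V 0 = v" "X 0 = w"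
proof -
  let ?U = "img c" and ?h = "met M c"
  have pd: "posdef (?h x)" if "x \<in> ?U" for x
    using sm[OF c] that unfolding smooth_metric_def riemannian_metric_posdef by blast
  obtain r where r: "r > 0" "cball x0 r \<subseteq> ?U" using oi[OF c] x0 open_contains_cball by metis
  define F where "F z = (fst (snd z), - christoffel ?h (fst z) (fst (snd z)) (fst (snd z)),
    - christoffel ?h (fst z) (fst (snd z)) (snd (snd z)))" for z :: "R3 \<times> R3 \<times> R3"
  define z0 where "z0 = (x0, v, w)"
  have fst_le: "norm (fst a - fst b) \<le> norm (a - b)" for a b :: "'x::real_normed_vector \<times> 'y::real_normed_vector"
    using norm_fst_le[of "fst (a - b)" "snd (a - b)"] by (simp only: prod.collapse fst_diff[symmetric])
  have snd_le: "norm (snd a - snd b) \<le> norm (a - b)" for a b :: "'x::real_normed_vector \<times> 'y::real_normed_vector"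
    using norm_snd_le[of "snd (a - b)" "fst (a - b)"] by (simp only: prod.collapse snd_diff[symmetric])
  let ?S = "cball z0 r"
  have S: "fst z \<in> cball x0 r" if "z \<in> ?S" for z
    using that fst_le[of z0 z] by (simp add: dist_norm z0_def)
  have L1: "lipb ?S (\<lambda>z. fst (snd z))" "lipb ?S (\<lambda>z. snd (snd z))"
  proof -
    have p: "lipb ?S (\<lambda>z. p z)" if "\<And>z y. norm (p z - p y) \<le> norm (z - y)" for p :: "R3 \<times> R3 \<times> R3 \<Rightarrow> R3"
    proof -
      have "p z \<in> cball (p z0) r" if "z \<in> ?S" for z
        using that \<open>\<And>z y. norm (p z - p y) \<le> norm (z - y)\<close>[of z0 z] by (simp add: dist_norm)
      from lipb_nonexpansive[OF lipb_ident this that] show ?thesis .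
    qed
    show "lipb ?S (\<lambda>z. fst (snd z))" by (rule p) (rule order_trans[OF fst_le snd_le])
    show "lipb ?S (\<lambda>z. snd (snd z))" by (rule p) (rule order_trans[OF snd_le snd_le])
  qed
  have "lipb ?S F"
    unfolding F_def
    by (intro lipb_Pair L1 lipb_christoffel[OF smooth_metric_comps[OF sm[OF c]] posdef_det[OF pd] r(2)] S fst_le)
  then obtain L where L: "\<And>z y. z \<in> ?S \<Longrightarrow> y \<in> ?S \<Longrightarrow> norm (F z - F y) \<le> L * norm (z - y)"
    using lipbE by metis
  obtain e z where e: "e > 0" "z 0 = z0" "\<And>t. t \<in> {-e<..<e} \<Longrightarrow> z t \<in> ?S \<and> (z has_vector_derivative F (z t)) (at t)"
    using local_ode_solution[OF r(1) L] by metis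
  define x where "x t = fst (z t)" for t
  define V where "V t = fst (snd (z t))" for t
  define X where "X t = snd (snd (z t))" for t
  have D: "(x has_vector_derivative V t) (at t)" "(V has_vector_derivative - christoffel ?h (x t) (V t) (V t)) (at t)"
    "(X has_vector_derivative - christoffel ?h (x t) (V t) (X t)) (at t)" if "t \<in> {-e<..<e}" for t
  proof -
    have z: "(z has_vector_derivative F (z t)) (at t)" using e(3)[OF that] by simp
    note z2 = bounded_linear.has_vector_derivative[OF bounded_linear_snd z]
    show "(x has_vector_derivative V t) (at t)"
      using bounded_linear.has_vector_derivative[OF bounded_linear_fst z] unfolding x_def[abs_def] V_def F_def by simp
    show "(V has_vector_derivative - christoffel ?h (x t) (V t) (V t)) (at t)"
      using bounded_linear.has_vector_derivative[OF bounded_linear_fst z2] unfolding x_def V_def[abs_def] F_def by simp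
    show "(X has_vector_derivative - christoffel ?h (x t) (V t) (X t)) (at t)"
      using bounded_linear.has_vector_derivative[OF bounded_linear_snd z2] unfolding x_def V_def X_def[abs_def] F_def by simp
  qed
  have xU: "x t \<in> ?U" if "t \<in> {-e<..<e}" for t
    using S e(3)[OF that] r(2) unfolding x_def by blast
  obtain g where g: "homeomorphic_maps (subtopology (mtop M) (chart_dom c)) (top_of_set ?U) (chart_map c) g"
    using hm[OF c] homeomorphic_map_maps by blast
  have gc: "continuous_map (top_of_set ?U) (subtopology (mtop M) (chart_dom c)) g"
    and gi: "\<And>y. y \<in> ?U \<Longrightarrow> chart_map c (g y) = y"
    using g by (auto simp: homeomorphic_maps_def)
  have gd: "g y \<in> chart_dom c" if "y \<in> ?U" for y
    using continuous_map_funspace[OF gc] that topspace_chart[OF c] by auto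
  show thesis
  proof (rule that[OF e(1), of "\<lambda>t. g (x t)" x V X])
    have xc: "continuous_map (top_of_set {-e<..<e}) (top_of_set ?U) x"
    proof -
      have "continuous_on {-e<..<e} x"
        using D(1) has_vector_derivative_continuous continuous_at_imp_continuous_on by blast
      then show ?thesis using xU by auto
    qed
    show "chart_curve M c {-e<..<e} (\<lambda>t. g (x t)) x V"
    proof (intro chart_curve.intro chart_curve_axioms.intro)
      show "smooth_riem M" by (rule smooth_riem_axioms)
      show "continuous_map (top_of_set {-e<..<e}) (mtop M) (\<lambda>t. g (x t))"
        using continuous_map_compose[OF xc continuous_map_into_fulltopology[OF gc]] by (simp add: comp_def)
    qed (use c xU gd gi D in auto)
    have i: "x 0 = x0" "V 0 = v" "X 0 = w" by (simp_all add: x_def V_def X_def e(2) z0_def)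
    then show "x 0 = x0" "V 0 = v" "X 0 = w" .
    show "chart_geodesic ?U ?h {-e<..<e} x V X \<sigma>"
      by unfold_locales (use oi[OF c] sm[OF c] e(1) xU D s o i in \<open>auto simp: is_interval_oo\<close>)
  qed
qed

text \<open>From left to right a zero frame is realised as the initial frame of a geodesic with a
  parallel field; from right to left a given geodesic is restricted to a chart. From here on the
  condition concerns only jets and frames.\<close>

lemma chaotic_curvature_iff:
  "chaotic_curvature M k \<longleftrightarrow> (\<forall>c\<in>atlas M. \<forall>x\<in>img c. \<forall>\<theta>. \<not> zero_frame k (jet (met M c) x) \<theta>)"
proof
  assume ch: "chaotic_curvature M k"
  show "\<forall>c\<in>atlas M. \<forall>x\<in>img c. \<forall>\<theta>. \<not> zero_frame k (jet (met M c) x) \<theta>"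
  proof (intro ballI allI notI)
    fix c x0 \<theta> assume c: "c \<in> atlas M" and x0: "x0 \<in> img c" and z: "zero_frame k (jet (met M c) x0) \<theta>"
    have o: "orthof (met M c x0) \<theta>" using z by (simp add: zero_frame_def)
    have pd: "posdef (met M c x0)" using sm[OF c] x0 unfolding smooth_metric_def riemannian_metric_posdef by blast
    obtain \<sigma> where s: "\<sigma> * \<sigma> = 1" "normal3 \<sigma> (met M c x0) (\<theta> $ 1) (\<theta> $ 2) = \<theta> $ 3" using normal3_unique[OF pd o] by blast
    have oo: "\<theta> $ s \<bullet> (met M c x0 *v \<theta> $ t) = (if s = t then 1 else 0)" for s t using o by (simp add: orthof_def)
    obtain e \<gamma> x V X where e: "e > 0" and cc: "chart_curve M c {-e<..<e} \<gamma> x V"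
      and cg: "chart_geodesic (img c) (met M c) {-e<..<e} x V X \<sigma>" and i: "x 0 = x0" "V 0 = \<theta> $ 1" "X 0 = \<theta> $ 2"
      by (rule geodesic_exists[OF c x0 s(1), of "\<theta> $ 1" "\<theta> $ 2"]) (simp_all add: oo)
    interpret C: chart_curve M c "{-e<..<e}" \<gamma> x V by (rule cc)
    define Xf where "Xf t = lift c (\<gamma> t) (X t)" for t
    have th: "chart_geodesic.\<theta> (met M c) x V X \<sigma> 0 = \<theta>"
      unfolding chart_geodesic.\<theta>_def[OF cg] chart_geodesic.Z_def[OF cg] i s(2) by (simp add: vec_eq_iff forall_3)
    have "(\<Sum>j\<le>k. tnorm M (\<gamma> 0) ((cov_deriv M \<gamma> ^^ j) (Yperp M \<gamma> Xf) 0)) = 0"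
      by (subst C.chaotic_sum_zero[OF cg Xf_def]) (simp add: th i z)
    moreover have "\<gamma> 0 \<in> topspace (mtop M)" using C.dom[of 0] e openin_subset[OF op[OF c]] by auto
    ultimately show False
      using ch C.geodesic_and_parallel[OF cg Xf_def] unfolding chaotic_curvature_def by blast
  qed
next
  assume nz: "\<forall>c\<in>atlas M. \<forall>x\<in>img c. \<forall>\<theta>. \<not> zero_frame k (jet (met M c) x) \<theta>"
  show "chaotic_curvature M k"
    unfolding chaotic_curvature_def
  proof (intro ballI allI impI notI)
    fix p I \<gamma> X
    assume p: "p \<in> topspace (mtop M)" and a: "unit_speed_geodesic M I \<gamma> \<and> \<gamma> 0 = p \<and> parallel_field M \<gamma> I X \<and>
        tnorm M p (X 0) = 1 \<and> tinner M p (X 0) (velocity M \<gamma> 0) = 0"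
      and z: "(\<Sum>j\<le>k. tnorm M p ((cov_deriv M \<gamma> ^^ j) (Yperp M \<gamma> X) 0)) = 0"
    from p cover obtain c where "c \<in> atlas M" "\<gamma> 0 \<in> chart_dom c" using a by blast
    then have c: "c \<in> charts_at M (\<gamma> 0)" by (simp add: charts_at_def)
    obtain e where e: "e > 0" and cc: "chart_curve M c {-e<..<e} \<gamma> (\<lambda>t. chart_map c (\<gamma> t)) (\<lambda>t. velocity M \<gamma> t c)"
      and cg: "chart_geodesic (img c) (met M c) {-e<..<e} (\<lambda>t. chart_map c (\<gamma> t)) (\<lambda>t. velocity M \<gamma> t c) (\<lambda>t. X t c) 1"
      and Xl: "\<And>t. t \<in> {-e<..<e} \<Longrightarrow> X t = lift c (\<gamma> t) (X t c)"
      by (rule geodesic_in_chart[of I \<gamma> X c]) (use a c in auto)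
    from chart_curve.chaotic_sum_zero[OF cc cg Xl, of k] z a nz \<open>c \<in> atlas M\<close> \<open>\<gamma> 0 \<in> chart_dom c\<close>
    show False by blast
  qed
qed

end

lemma chaotic_curvature_region:
  assumes "open U" "smooth_metric U h"
  shows "chaotic_curvature (region U h) k \<longleftrightarrow> (\<forall>x\<in>U. \<forall>\<theta>. \<not> zero_frame k (jet h x) \<theta>)"
  using smooth_riem.chaotic_curvature_iff[OF smooth_riem_region[OF assms], of k] by (simp add: region_def)

section \<open>Symmetries of the curvature tensor\<close>

lemma matrix_vector_mult_neg: "A *v (- u) = - (A *v u)" for A :: "real^3^3"
  by (simp add: matrix_vector_mult_def vec_eq_iff sum_negf)

locale metric_region =
  fixes U :: "R3 set" and h :: metric
  assumes U: "open U" and h: "smooth_metric U h"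
begin

lemma pd: "x \<in> U \<Longrightarrow> posdef (h x)"
  using h by (simp add: smooth_metric_def riemannian_metric_posdef)

lemma comps: "smooth_comps U h" by (rule smooth_metric_comps[OF h])

lemma dt: "x \<in> U \<Longrightarrow> det (h x) \<noteq> 0" by (rule posdef_det[OF pd])

lemma sym: "x \<in> U \<Longrightarrow> sym_jet (jet h x)"
  by (rule sym_jet_jet[OF U]) (use h in \<open>auto simp: smooth_metric_def riemannian_metric_def\<close>)

lemma comm: "x \<in> U \<Longrightarrow> u \<bullet> (h x *v v) = v \<bullet> (h x *v u)"
  using pd inner_matrix_commute by (auto simp: posdef_def)

lemma christoffel_sym: "x \<in> U \<Longrightarrow> christoffel h x a b = christoffel h x b a"
  unfolding christoffel_chr by (rule chr_sym[OF sym])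

lemma riemann_antisym: "riemann h x v u w = - riemann h x u v w"
  by (simp add: riemann_def)

lemma bianchi:
  assumes x: "x \<in> U"
  shows "riemann h x u v w + riemann h x v w u + riemann h x w u v = 0"
proof -
  have fd: "frechet_derivative (\<lambda>y. christoffel h y a b) (at x) = frechet_derivative (\<lambda>y. christoffel h y b a) (at x)" for a b
    by (rule frechet_derivative_cong_open[OF U x]) (rule christoffel_sym)
  show ?thesis
    unfolding riemann_def fd[of w v] fd[of w u] fd[of v u] christoffel_sym[OF x, of w v] christoffel_sym[OF x, of w u] christoffel_sym[OF x, of v u]
    by simp
qed

text \<open>The second derivatives of the function h(w, z) for constant w and z commute. When both
  orders are expanded by the product rule of \<open>inner_along_curve\<close>, their difference
  consists of the curvature terms.\<close>

lemma riemann_skew: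
  assumes x: "x \<in> U"
  shows "z \<bullet> (h x *v riemann h x u v w) + w \<bullet> (h x *v riemann h x u v z) = 0"
proof -
  define f where "f y = h y *v z" for y
  have f: "smooth_map U f"
    unfolding smooth_map_def
  proof
    fix a
    have s: "smooth_on U (\<lambda>y. h y $ a $ j)" for j using comps by (simp add: smooth_comps_def)
    have "smooth_on U (\<lambda>y. 1 * (z $ 1 * h y $ a $ 1 + z $ 2 * h y $ a $ 2) + z $ 3 * h y $ a $ 3)"
      by (intro smooth_on_lincomb U s)
    then show "smooth_on U (\<lambda>y. f y $ a)" by (simp add: f_def matrix_vector_mult_def sum_3 mult.commute)
  qed
  let ?H = "h x" and ?G = "christoffel h x"
  have line: "((\<lambda>t. y + t *\<^sub>R u) has_vector_derivative u) (at 0)" for y u :: R3 by (auto intro!: derivative_eq_intros)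
  have D1: "w \<bullet> d1 f y v = christoffel h y v w \<bullet> (h y *v z) + w \<bullet> (h y *v christoffel h y v z)" if y: "y \<in> U" for y v
  proof -
    have "((\<lambda>t. w \<bullet> (h (y + t *\<^sub>R v) *v z)) has_real_derivative
       christoffel h y v w \<bullet> (h y *v z) + w \<bullet> (h y *v christoffel h y v z)) (at 0)"
      using inner_along_curve[OF comps, of "\<lambda>t. y + t *\<^sub>R v" 0 v "\<lambda>_. w" 0 "\<lambda>_. z" 0] y sym[OF y] dt[OF y] line by simp
    moreover have "((\<lambda>t. f (y + t *\<^sub>R v)) has_derivative (\<lambda>r. d1 f y (r *\<^sub>R v))) (at 0)"
      using has_derivative_compose[where f="\<lambda>t. y + t *\<^sub>R v" and g=f, OF line[unfolded has_vector_derivative_def], of "d1 f y"]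
        d1_has_derivative[OF f y] by simp
    from has_derivative_inner_right[OF this, of w]
    have "((\<lambda>t. w \<bullet> (h (y + t *\<^sub>R v) *v z)) has_real_derivative w \<bullet> d1 f y v) (at 0)"
      by (simp add: f_def has_field_derivative_def linear_cmul[OF linear_d1] mult_commute_abs)
    ultimately show ?thesis using DERIV_unique by blast
  qed
  have D2: "w \<bullet> d2 f x u v = (frechet_derivative (\<lambda>y. christoffel h y v w) (at x) u + ?G u (?G v w)) \<bullet> (?H *v z)
      + ?G v w \<bullet> (?H *v ?G u z) + (?G u w \<bullet> (?H *v ?G v z)
      + w \<bullet> (?H *v (frechet_derivative (\<lambda>y. christoffel h y v z) (at x) u + ?G u (?G v z))))" for u v
  proof -
    let ?c = "\<lambda>t. x + t *\<^sub>R u"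
    have P: "((\<lambda>t. christoffel h (?c t) v a) has_vector_derivative frechet_derivative (\<lambda>y. christoffel h y v a) (at x) u) (at 0)" for a
      using christoffel_along_curve[OF comps line, of x u "\<lambda>_. v" 0 "\<lambda>_. a" 0] x dt[OF x]
      by (simp add: christoffel_chr bilinear_lzero[OF bilinear_chr] bilinear_rzero[OF bilinear_chr])
    note ic = inner_along_curve[OF comps, of ?c 0 u]
    have 1: "((\<lambda>t. christoffel h (?c t) v w \<bullet> (h (?c t) *v z)) has_real_derivative
        (frechet_derivative (\<lambda>y. christoffel h y v w) (at x) u + ?G u (?G v w)) \<bullet> (?H *v z) + ?G v w \<bullet> (?H *v ?G u z)) (at 0)"
      using ic[OF _ _ _ line P[of w], of "\<lambda>_. z" 0] x sym[OF x] dt[OF x] by simp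
    have 2: "((\<lambda>t. w \<bullet> (h (?c t) *v christoffel h (?c t) v z)) has_real_derivative
        ?G u w \<bullet> (?H *v ?G v z) + w \<bullet> (?H *v (frechet_derivative (\<lambda>y. christoffel h y v z) (at x) u + ?G u (?G v z)))) (at 0)"
      using ic[OF _ _ _ line _ P[of z], of "\<lambda>_. w" 0] x sym[OF x] dt[OF x] by simp
    have op: "open (?c -` U)" by (rule open_vimage[OF U]) (intro continuous_intros)
    have 3: "((\<lambda>t. w \<bullet> d1 f (?c t) v) has_real_derivative
        (frechet_derivative (\<lambda>y. christoffel h y v w) (at x) u + ?G u (?G v w)) \<bullet> (?H *v z) + ?G v w \<bullet> (?H *v ?G u z) + (
        ?G u w \<bullet> (?H *v ?G v z) + w \<bullet> (?H *v (frechet_derivative (\<lambda>y. christoffel h y v z) (at x) u + ?G u (?G v z))))) (at 0)"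
      by (rule has_field_derivative_transform_within_open[OF DERIV_add[OF 1 2] op]) (use x D1 in auto)
    have "((\<lambda>t. d1 f (?c t) v) has_derivative (\<lambda>r. d2 f x (r *\<^sub>R u) v)) (at 0)"
      using has_derivative_compose[where f="?c" and g="\<lambda>y. d1 f y v", OF line[unfolded has_vector_derivative_def], of "\<lambda>u. d2 f x u v"]
        d2_has_derivative[OF f x] by simp
    moreover have "d2 f x (r *\<^sub>R u) v = r *\<^sub>R d2 f x u v" for r
      by (simp add: d2_def vec_eq_iff sum_distrib_left mult.assoc)
    ultimately have "((\<lambda>t. d1 f (?c t) v) has_derivative (\<lambda>r. r *\<^sub>R d2 f x u v)) (at 0)" by simp
    from has_derivative_inner_right[OF this, of w]
    have "((\<lambda>t. w \<bullet> d1 f (?c t) v) has_real_derivative w \<bullet> d2 f x u v) (at 0)"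
      by (simp add: has_field_derivative_def mult_commute_abs)
    from DERIV_unique[OF this 3] show ?thesis .
  qed
  have "w \<bullet> d2 f x u v = w \<bullet> d2 f x v u" by (simp add: d2_sym[OF f U x, of u v])
  then have "riemann h x u v w \<bullet> (?H *v z) + w \<bullet> (?H *v riemann h x u v z) = 0"
    unfolding D2 riemann_def
    by (simp add: inner_add_left inner_add_right inner_diff_left inner_diff_right matrix_vector_right_distrib matrix_vector_mult_diff_distrib)
  then show ?thesis by (simp add: comm[OF x, of z])
qed

text \<open>The classical octahedron argument: four Bianchi identities combined by means of the two
  antisymmetries.\<close>

lemma riemann_pair:
  assumes x: "x \<in> U"
  shows "z \<bullet> (h x *v riemann h x u v w) = v \<bullet> (h x *v riemann h x w z u)"
proof -
  define F where "F u v w z = z \<bullet> (h x *v riemann h x u v w)" for u v w z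
  have a: "F v u w z = - F u v w z" for u v w z
    unfolding F_def riemann_antisym[of x v u] by (simp add: matrix_vector_mult_neg)
  have c: "F u v z w = - F u v w z" for u v w z
    using riemann_skew[OF x, of z u v w] by (simp add: F_def)
  have b: "F u v w z + F v w u z + F w u v z = 0" for u v w z
    using arg_cong[OF bianchi[OF x, of u v w], of "\<lambda>r. z \<bullet> (h x *v r)"]
    by (simp add: F_def matrix_vector_right_distrib inner_add_right)
  have "F u v w z = F w z u v"
    using b[of u v w z] b[of v w z u] b[of w z u v] b[of z u v w]
      c[of v w u z] c[of w u v z] c[of w z v u] c[of z u w v] c[of u v z w] a[of v z w u] a[of z v w u] c[of z v w u] c[of v z u w]
      a[of u w z v] a[of w u z v] c[of u w z v] a[of z w u v] a[of u z v w] a[of z u v w] a[of v w z u] a[of w v z u]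
      a[of w u v z] c[of z w v u]
    by linarith
  then show ?thesis by (simp add: F_def)
qed

lemma ricci_sym:
  assumes x: "x \<in> U" shows "ricci h x v w = ricci h x w v"
proof -
  note o = orthof_gs[OF pd[OF x]]
  have "s \<bullet> (h x *v riemann h x s v w) = s \<bullet> (h x *v riemann h x s w v)" for s
  proof -
    have "s \<bullet> (h x *v riemann h x s v w) = v \<bullet> (h x *v riemann h x w s s)" by (rule riemann_pair[OF x])
    also have "\<dots> = - (v \<bullet> (h x *v riemann h x s w s))" unfolding riemann_antisym[of x w s] by (simp add: matrix_vector_mult_neg)
    also have "\<dots> = s \<bullet> (h x *v riemann h x s w v)" using riemann_skew[OF x, of v s w s] by simp
    finally show ?thesis .
  qed
  then show ?thesis unfolding ricci_frame[OF comps x dt[OF x] o] by simp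
qed

text \<open>In the trace over the frame the terms of the second and third vectors vanish by
  antisymmetry, and pair symmetry turns the remaining one into the Jacobi operator of the first
  vector. This is special to dimension three.\<close>

lemma ricci_jacobi:
  assumes x: "x \<in> U" and o: "orthof (h x) \<theta>"
  shows "ricci h x (\<theta> $ 3) (\<theta> $ 2) = \<theta> $ 3 \<bullet> (h x *v riemann h x (\<theta> $ 2) (\<theta> $ 1) (\<theta> $ 1))"
proof -
  have "\<theta> $ 2 \<bullet> (h x *v riemann h x (\<theta> $ 2) (\<theta> $ 3) (\<theta> $ 2)) = 0"
    using riemann_skew[OF x, of "\<theta> $ 2" "\<theta> $ 2" "\<theta> $ 3" "\<theta> $ 2"] by simp
  moreover have "riemann h x (\<theta> $ 3) (\<theta> $ 3) (\<theta> $ 2) = 0" by (simp add: riemann_def)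
  ultimately show ?thesis
    unfolding ricci_frame[OF comps x dt[OF x] o] sum_3 riemann_pair[OF x, of "\<theta> $ 1"] by simp
qed

lemma jacobi_expand:
  assumes x: "x \<in> U" and o: "orthof (h x) \<theta>"
  shows "riemann h x (\<theta> $ 2) (\<theta> $ 1) (\<theta> $ 1) =
    (\<theta> $ 2 \<bullet> (h x *v riemann h x (\<theta> $ 2) (\<theta> $ 1) (\<theta> $ 1))) *\<^sub>R \<theta> $ 2 + ev (jet h x) \<theta> (FE 0) *\<^sub>R \<theta> $ 3"
proof -
  have "\<theta> $ 1 \<bullet> (h x *v riemann h x (\<theta> $ 2) (\<theta> $ 1) (\<theta> $ 1)) = 0"
    using riemann_skew[OF x, of "\<theta> $ 1" "\<theta> $ 2" "\<theta> $ 1" "\<theta> $ 1"] by simp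
  then show ?thesis
    unfolding ev_FE_0[OF comps x dt[OF x]] ricci_jacobi[OF x o]
    using orthof_expand[OF o, of "riemann h x (\<theta> $ 2) (\<theta> $ 1) (\<theta> $ 1)"] by (simp add: sum_3)
qed

text \<open>By symmetry of the Ricci form \<open>FE 0\<close> changes sign when (u, z) becomes (z,
  -u); \<open>FE 1\<close> is its derivative in the direction v and inherits the sign.\<close>

lemma FE_1_swap:
  assumes x: "x \<in> U"
  shows "ev (jet h x) (vector [v, z, - u]) (FE 1) = - ev (jet h x) (vector [v, u, z]) (FE 1)"
proof -
  \<comment> \<open>Only derivatives at t = 0 count, so a straight line and affine fields with the
    right first derivatives replace the geodesic and the parallel fields.\<close>
  let ?c = "\<lambda>t. x + t *\<^sub>R v"
  define A where "A a t = a - t *\<^sub>R christoffel h x v a" for a and t :: real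
  have c: "(?c has_vector_derivative v) (at 0)" by (auto intro!: derivative_eq_intros)
  have A: "(A a has_vector_derivative - christoffel h x v a) (at 0)" "A a 0 = a" for a
    unfolding A_def[abs_def] by (auto intro!: derivative_eq_intros)
  have mA: "A (- a) t = - A a t" for a t
    by (simp add: A_def christoffel_chr bilinear_rneg[OF bilinear_chr])
  have D: "((\<lambda>t. ev (jet h (?c t)) (vector [A v t, A a t, A b t]) (FE 0)) has_real_derivative
     ev (jet h x) (vector [v, a, b]) (FE 1)) (at 0)" for a b
  proof -
    have fr: "\<forall>s. ((\<lambda>t. (vector [A v t, A a t, A b t] :: frame) $ s) has_vector_derivative
        - christoffel h (?c 0) ((vector [A v 0, A a 0, A b 0] :: frame) $ 1) ((vector [A v 0, A a 0, A b 0] :: frame) $ s)) (at 0)"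
      unfolding forall_3 by (simp add: A)
    have "((\<lambda>t. ev (jet h (?c t)) (vector [A v t, A a t, A b t]) (FE 0)) has_real_derivative
      ev (jet h (?c 0)) (vector [A v 0, A a 0, A b 0]) (der (FE 0))) (at 0)"
      by (rule ev_along_geodesic[where x="?c" and t=0 and \<theta>="\<lambda>t. vector [A v t, A a t, A b t]", OF comps])
        (use x dt[OF x] c fr in \<open>simp_all add: A\<close>)
    then show ?thesis by (simp add: A FE_Suc[symmetric])
  qed
  have op: "open (?c -` U)" by (rule open_vimage[OF U]) (intro continuous_intros)
  have "((\<lambda>t. ev (jet h (?c t)) (vector [A v t, A z t, A (- u) t]) (FE 0)) has_real_derivative
     - ev (jet h x) (vector [v, u, z]) (FE 1)) (at 0)"
  proof (rule has_field_derivative_transform_within_open[OF DERIV_minus[OF D[of u z]] op])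
    fix t assume "t \<in> ?c -` U"
    then have y: "?c t \<in> U" by simp
    have "linear (\<lambda>u. ricci h (?c t) u (A z t))"
      by (rule linearI) (simp_all add: ricci_ricE[OF comps y dt[OF y], of _ _ 0] sum.distrib distrib_right distrib_left sum_distrib_left mult_ac)
    from linear_neg[OF this, of "A u t"] show "- ev (jet h (?c t)) (vector [A v t, A u t, A z t]) (FE 0) = ev (jet h (?c t)) (vector [A v t, A z t, A (- u) t]) (FE 0)"
      unfolding ev_FE_0[OF comps y dt[OF y]] vector_3 mA ricci_sym[OF y, of "A z t"] by simp
  qed (use x in simp)
  from DERIV_unique[OF D this] show ?thesis .
qed

end

text \<open>R' is the derivative of the curvature along the curve with its three arguments frozen.
  One R' serves all fields, so derivatives for different fields can be compared.\<close>

lemma riemann_along_curve: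
  assumes h: "smooth_comps U h" "\<And>y. y \<in> U \<Longrightarrow> det (h y) \<noteq> 0" and S: "open S" "t \<in> S" "\<And>s. s \<in> S \<Longrightarrow> x s \<in> U"
    and x: "(x has_vector_derivative x') (at t)"
  obtains R' where "\<And>A B C A' B' C'. (A has_vector_derivative A') (at t) \<Longrightarrow> (B has_vector_derivative B') (at t) \<Longrightarrow>
    (C has_vector_derivative C') (at t) \<Longrightarrow> ((\<lambda>s. riemann h (x s) (A s) (B s) (C s)) has_vector_derivative
      R' (A t) (B t) (C t) + riemann h (x t) A' (B t) (C t) + riemann h (x t) (A t) B' (C t) + riemann h (x t) (A t) (B t) C') (at t)"
proof -
  note xt = S(3)[OF S(2)]
  let ?e = "\<lambda>s m i j k. ev (jet h (x s)) 0 (rmE m i j k)"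
  define K where "K m i j k = (\<Sum>l\<in>UNIV. x' $ l * ev (jet h (x t)) 0 (dx l (rmE m i j k)))" for m i j k
  have e: "((\<lambda>s. ?e s m i j k) has_derivative (\<lambda>r. r * K m i j k)) (at t)" for m i j k
    using has_derivative_compose[where f=x and g="\<lambda>y. ev (jet h y) 0 (rmE m i j k)", OF x[unfolded has_vector_derivative_def] ev_jet_derivative_at[OF h(1) xt h(2)[OF xt]]]
    by (simp add: K_def sum_distrib_left mult.assoc)
  show thesis
  proof (rule that[of "\<lambda>u v w. \<chi> m. \<Sum>i\<in>UNIV. \<Sum>j\<in>UNIV. \<Sum>k\<in>UNIV. u $ i * v $ j * w $ k * K m i j k"], rule vec_has_vector_derivativeI)
    fix A B C :: "real \<Rightarrow> R3" and A' B' C' :: R3 and m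
    assume ABC: "(A has_vector_derivative A') (at t)" "(B has_vector_derivative B') (at t)" "(C has_vector_derivative C') (at t)"
    have D: "((\<lambda>s. \<Sum>i\<in>UNIV. \<Sum>j\<in>UNIV. \<Sum>k\<in>UNIV. A s $ i * B s $ j * C s $ k * ?e s m i j k) has_derivative (\<lambda>r. \<Sum>i\<in>UNIV. \<Sum>j\<in>UNIV. \<Sum>k\<in>UNIV.
       A t $ i * B t $ j * C t $ k * (r * K m i j k) + (A t $ i * B t $ j * (r * C' $ k) + (A t $ i * (r * B' $ j) + (r * A' $ i) * B t $ j) * C t $ k) * ?e t m i j k)) (at t)"
      by (intro has_derivative_sum has_derivative_mult e vec_nth_has_derivative ABC)
    have D': "((\<lambda>s. riemann h (x s) (A s) (B s) (C s) $ m) has_derivative (\<lambda>r. \<Sum>i\<in>UNIV. \<Sum>j\<in>UNIV. \<Sum>k\<in>UNIV.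
       A t $ i * B t $ j * C t $ k * (r * K m i j k) + (A t $ i * B t $ j * (r * C' $ k) + (A t $ i * (r * B' $ j) + (r * A' $ i) * B t $ j) * C t $ k) * ?e t m i j k)) (at t)"
      by (rule has_derivative_transform_within_open[OF D S(1,2)]) (simp add: riemann_rmE[OF h(1) S(3) h(2)[OF S(3)]])
    show "((\<lambda>s. riemann h (x s) (A s) (B s) (C s) $ m) has_derivative (\<lambda>r. r * ((\<chi> m. \<Sum>i\<in>UNIV. \<Sum>j\<in>UNIV. \<Sum>k\<in>UNIV. A t $ i * B t $ j * C t $ k * K m i j k)
      + riemann h (x t) A' (B t) (C t) + riemann h (x t) (A t) B' (C t) + riemann h (x t) (A t) (B t) C') $ m)) (at t)"
      by (rule has_derivative_eq_rhs[OF D'], rule ext,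
          unfold vector_add_component vec_lambda_beta riemann_rmE[OF h(1) xt h(2)[OF xt]] sum.distrib[symmetric] sum_distrib_left,
          intro sum.cong refl) (simp add: algebra_simps)
  qed
qed

section \<open>Circular sections of the Ricci form\<close>

lemma unit_orthogonal_exists: obtains a :: R3 where "a \<bullet> a = 1" "c \<bullet> a = 0"
proof -
  obtain b :: R3 where b: "b \<noteq> 0" "c \<bullet> b = 0"
  proof (cases "c $ 1 = 0")
    case True
    show ?thesis by (rule that[of "axis 1 1"]) (use True in \<open>simp_all add: inner_axis\<close>)
  next
    case False
    show ?thesis by (rule that[of "vector [- c $ 2, c $ 1, 0]"])
      (use False in \<open>simp_all add: vec_eq_iff forall_3 inner_vec_def sum_3\<close>)
  qed
  show ?thesis
    by (rule that[of "(1 / norm b) *\<^sub>R b"]) (use b in \<open>simp_all add: power2_norm_eq_inner[symmetric] power2_eq_square\<close>)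
qed

text \<open>For c = 0 the maximum is over the whole sphere, for c \<noteq> 0 over a great circle.
  The last conclusion is the critical point equation.\<close>

lemma constrained_max:
  fixes A :: "real^3^3"
  assumes sy: "\<And>u v. u \<bullet> (A *v v) = v \<bullet> (A *v u)"
  obtains e where "e \<bullet> e = 1" "c \<bullet> e = 0" "\<And>a. c \<bullet> a = 0 \<Longrightarrow> a \<bullet> (A *v a) \<le> (e \<bullet> (A *v e)) * (a \<bullet> a)"
    "\<And>b. c \<bullet> b = 0 \<Longrightarrow> e \<bullet> b = 0 \<Longrightarrow> e \<bullet> (A *v b) = 0"
proof -
  define S where "S = sphere (0::R3) 1 \<inter> {a. c \<bullet> a = 0}"
  have S: "a \<in> S \<longleftrightarrow> a \<bullet> a = 1 \<and> c \<bullet> a = 0" for a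
    by (simp add: S_def norm_eq_sqrt_inner)
  have "compact S" unfolding S_def by (intro compact_Int_closed closed_hyperplane) simp
  moreover have "S \<noteq> {}" using unit_orthogonal_exists[of c] S by blast
  moreover have "continuous_on S (\<lambda>a. a \<bullet> (A *v a))"
    by (intro continuous_intros linear_continuous_on matrix_vector_mul_bounded_linear)
  ultimately obtain e where e: "e \<in> S" "\<And>a. a \<in> S \<Longrightarrow> a \<bullet> (A *v a) \<le> e \<bullet> (A *v e)"
    using continuous_attains_sup[of S "\<lambda>a. a \<bullet> (A *v a)"] by blast
  let ?l = "e \<bullet> (A *v e)"
  have max: "a \<bullet> (A *v a) \<le> ?l * (a \<bullet> a)" if "c \<bullet> a = 0" for a
  proof (cases "a = 0")
    case False
    let ?n = "norm a"
    have "(1 / ?n) *\<^sub>R a \<in> S" using False that by (simp add: S power2_norm_eq_inner[symmetric] power2_eq_square)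
    from e(2)[OF this] have "(a \<bullet> (A *v a)) / (?n * ?n) \<le> ?l" by (simp add: matrix_vector_mult_scaleR)
    then show ?thesis using False by (simp add: pos_divide_le_eq power2_norm_eq_inner[symmetric] power2_eq_square)
  qed simp
  show thesis
  proof (rule that)
    show "e \<bullet> e = 1" "c \<bullet> e = 0" using e(1) S by blast+
    fix b assume b: "c \<bullet> b = 0" "e \<bullet> b = 0"
    define s where "s = e \<bullet> (A *v b)"
    \<comment> \<open>K > 0 bounds the quadratic coefficient. The step t = s / K makes the second
      order term at most t s, half of the first order term 2 t s, which forces s = 0.\<close>
    define K where "K = 1 + \<bar>?l * (b \<bullet> b) - b \<bullet> (A *v b)\<bar>"
    have K: "K > 0" "?l * (b \<bullet> b) - b \<bullet> (A *v b) \<le> K" by (auto simp: K_def)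
    define t where "t = s / K"
    have "(e + t *\<^sub>R b) \<bullet> (A *v (e + t *\<^sub>R b)) \<le> ?l * ((e + t *\<^sub>R b) \<bullet> (e + t *\<^sub>R b))"
      by (rule max) (use e(1) b S in \<open>simp add: inner_add_right\<close>)
    then have "?l + 2 * t * s + t * t * (b \<bullet> (A *v b)) \<le> ?l * (1 + t * t * (b \<bullet> b))"
      using e(1) b S sy[of b e] by (simp add: inner_add_left inner_add_right matrix_vector_right_distrib matrix_vector_mult_scaleR inner_commute[of b e] s_def algebra_simps)
    then have "2 * t * s \<le> t * t * (?l * (b \<bullet> b) - b \<bullet> (A *v b))" by (simp add: algebra_simps)
    also have "\<dots> \<le> t * t * K" using K(2) by (intro mult_left_mono) auto
    also have "\<dots> = t * s" using K(1) by (simp add: t_def)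
    finally have "t * s \<le> 0" by (simp add: mult.commute)
    then have "s * s \<le> 0" using K(1) by (simp add: t_def divide_le_0_iff)
    then show "e \<bullet> (A *v b) = 0" unfolding s_def by (metis mult_eq_0_iff order_antisym zero_le_square)
  qed (rule max)
qed

text \<open>The vectors p, q and e = p x q are eigenvectors for the largest, smallest and middle
  eigenvalue. Turning from p towards q reaches, by the intermediate value theorem, a unit vector w
  with the middle value, and on the plane of w and e the form is a multiple of the inner
  product.\<close>

lemma circular_section:
  fixes A :: "real^3^3"
  assumes sy: "\<And>u v. u \<bullet> (A *v v) = v \<bullet> (A *v u)"
  obtains v w e where "w \<bullet> w = 1" "e \<bullet> e = 1" "w \<bullet> e = 0" "v = cross3 w e" "w \<bullet> (A *v e) = 0" "w \<bullet> (A *v w) = e \<bullet> (A *v e)"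
proof -
  obtain p where p: "p \<bullet> p = 1" "\<And>a. a \<bullet> (A *v a) \<le> (p \<bullet> (A *v p)) * (a \<bullet> a)" "\<And>b. p \<bullet> b = 0 \<Longrightarrow> p \<bullet> (A *v b) = 0"
    using constrained_max[OF sy, of 0] by (metis inner_zero_left)
  have mA: "(- A) *v v = - (A *v v)" for v by (simp add: matrix_vector_mult_def vec_eq_iff sum_negf)
  \<comment> \<open>Maximising -A on the circle orthogonal to p gives the minimum of A
    there.\<close>
  obtain q where q: "q \<bullet> q = 1" "p \<bullet> q = 0" "\<And>a. p \<bullet> a = 0 \<Longrightarrow> (q \<bullet> (A *v q)) * (a \<bullet> a) \<le> a \<bullet> (A *v a)"
    "\<And>b. p \<bullet> b = 0 \<Longrightarrow> q \<bullet> b = 0 \<Longrightarrow> q \<bullet> (A *v b) = 0"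
    by (rule constrained_max[of "- A" p]) (auto simp: mA sy)
  define e where "e = cross3 p q"
  have e: "p \<bullet> e = 0" "q \<bullet> e = 0" by (simp_all add: e_def dot_cross_self)
  have e1: "e \<bullet> e = 1"
    using norm_cross_dot[of p q] p(1) q(1,2) by (simp add: e_def power2_norm_eq_inner power_mult_distrib)
  let ?P = "p \<bullet> (A *v p)" and ?Q = "q \<bullet> (A *v q)" and ?E = "e \<bullet> (A *v e)"
  have PE: "?E \<le> ?P" "?Q \<le> ?E" using p(2)[of e] q(3)[OF e(1)] e1 by simp_all
  have "continuous_on {0..pi/2} (\<lambda>a. (cos a)\<^sup>2 * ?P + (sin a)\<^sup>2 * ?Q)" by (intro continuous_intros)
  then obtain a where a: "(cos a)\<^sup>2 * ?P + (sin a)\<^sup>2 * ?Q = ?E"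
    using IVT2'[of "\<lambda>a. (cos a)\<^sup>2 * ?P + (sin a)\<^sup>2 * ?Q" "pi/2" ?E 0] PE by auto
  define w where "w = cos a *\<^sub>R p + sin a *\<^sub>R q"
  have pq: "p \<bullet> (A *v q) = 0" "q \<bullet> (A *v p) = 0" using p(3)[OF q(2)] sy[of q p] by simp_all
  show thesis
  proof (rule that[OF _ e1 _ refl])
    show "w \<bullet> w = 1" using p(1) q(1,2)
      by (simp add: w_def inner_add_left inner_add_right inner_commute[of q p] power2_eq_square[symmetric])
    show "w \<bullet> e = 0" by (simp add: w_def inner_add_left e)
    show "w \<bullet> (A *v e) = 0" using p(3)[OF e(1)] q(4)[OF e] by (simp add: w_def inner_add_left)
    show "w \<bullet> (A *v w) = ?E"
      using a pq by (simp add: w_def inner_add_left inner_add_right matrix_vector_right_distrib matrix_vector_mult_scaleR power2_eq_square algebra_simps)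
  qed
qed

context metric_region
begin

text \<open>In a circular section \<open>v\<^sup>\<perp>\<close> the Ricci form is a multiple of the metric, so \<open>Ric(Z, X) = 0\<close> for all its
  orthonormal frames \<open>X, Z\<close>; the first derivative changes sign under the quarter turn \<open>(X, Z) \<mapsto> (Z, -X)\<close>.\<close>

lemma zero_frame_1_exists:
  assumes x: "x \<in> U"
  obtains \<theta> where "zero_frame 1 (jet h x) \<theta>"
proof -
  define T where "T = gs (h x)"
  have o: "T ** h x ** transpose T = mat 1"
    using orthof_gs[OF pd[OF x]] by (simp add: orthof_matrix T_def)
  define R :: "real^3^3" where "R = (\<chi> j k. ev (jet h x) 0 (ricE j k))"
  have R: "ricci h x u w = u \<bullet> (R *v w)" for u w
    unfolding inner_matrix_expand ricci_ricE[OF comps x dt[OF x], of u w 0] by (simp add: R_def mult_ac)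
  \<comment> \<open>Coordinates with respect to the frame T turn the metric into the Euclidean inner
    product and the Ricci form into the symmetric matrix A, to which \<open>circular_section\<close>
    applies.\<close>
  define cb where "cb a = transpose T *v a" for a
  have tr: "cb a \<bullet> (H *v cb b) = a \<bullet> ((T ** H ** transpose T) *v b)" for H :: "real^3^3" and a b
    by (simp add: cb_def matrix_vector_mul_assoc[symmetric] dot_lmul_matrix[symmetric] transpose_matrix_vector)
  have inn: "cb a \<bullet> (h x *v cb b) = a \<bullet> b" for a b by (simp add: tr o)
  define A where "A = T ** R ** transpose T"
  have Q: "ricci h x (cb a) (cb b) = a \<bullet> (A *v b)" for a b by (simp add: R tr A_def)
  have sy: "a \<bullet> (A *v b) = b \<bullet> (A *v a)" for a b unfolding Q[symmetric] by (rule ricci_sym[OF x])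
  obtain v w e where c: "w \<bullet> w = 1" "e \<bullet> e = 1" "w \<bullet> e = 0" "v = cross3 w e" "w \<bullet> (A *v e) = 0" "w \<bullet> (A *v w) = e \<bullet> (A *v e)"
    using circular_section[OF sy] by metis
  have v: "v \<bullet> v = 1" "v \<bullet> w = 0" "v \<bullet> e = 0" "w \<bullet> v = 0" "e \<bullet> v = 0" "e \<bullet> w = 0" "e \<bullet> (A *v w) = 0"
    using norm_cross_dot[of w e] c(1-3,5) sy[of e w]
    by (simp_all add: c(4) power2_norm_eq_inner power_mult_distrib dot_cross_self inner_commute[of e w])
  define X where "X \<alpha> = cos \<alpha> *\<^sub>R w + sin \<alpha> *\<^sub>R e" for \<alpha>
  define Z where "Z \<alpha> = - sin \<alpha> *\<^sub>R w + cos \<alpha> *\<^sub>R e" for \<alpha>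
  define \<theta> :: "real \<Rightarrow> frame" where "\<theta> \<alpha> = vector [cb v, cb (X \<alpha>), cb (Z \<alpha>)]" for \<alpha>
  have sc: "cos \<alpha> * cos \<alpha> + sin \<alpha> * sin \<alpha> = 1" "sin \<alpha> * sin \<alpha> + cos \<alpha> * cos \<alpha> = 1" for \<alpha> :: real
    using sin_cos_squared_add[of \<alpha>] by (simp_all add: power2_eq_square)
  have orth: "orthof (h x) (\<theta> \<alpha>)" for \<alpha>
    unfolding orthof_def forall_3 \<theta>_def vector_3 inn
    by (simp add: X_def Z_def inner_add_left inner_add_right inner_diff_left inner_diff_right c(1-3) v sc)
  have FE0: "ev (jet h x) (\<theta> \<alpha>) (FE 0) = 0" for \<alpha>
    unfolding ev_FE_0[OF comps x dt[OF x]] \<theta>_def vector_3 Q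
    by (simp add: X_def Z_def inner_add_left inner_add_right inner_diff_left inner_diff_right
      matrix_vector_right_distrib matrix_vector_mult_diff_distrib matrix_vector_mult_scaleR c(5,6) v)
  define f where "f \<alpha> = ev (jet h x) (\<theta> \<alpha>) (FE 1)" for \<alpha>
  have "isCont f \<alpha>" for \<alpha>
    unfolding isCont_def f_def
  proof (rule ev_tendsto)
    have lin: "linear cb" unfolding cb_def[abs_def] by (rule matrix_vector_mul_linear)
    have "\<forall>s. \<forall>k. ((\<lambda>\<alpha>. \<theta> \<alpha> $ s $ k) \<longlongrightarrow> \<theta> \<alpha> $ s $ k) (at \<alpha>)"
      unfolding forall_3[of "\<lambda>s. \<forall>k. _ s k"] \<theta>_def vector_3 X_def Z_def linear_add[OF lin] linear_cmul[OF lin]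
        vector_add_component vector_scaleR_component real_scaleR_def by (intro conjI allI tendsto_intros)
    then show "((\<lambda>\<alpha>. \<theta> \<alpha> $ s $ k) \<longlongrightarrow> \<theta> \<alpha> $ s $ k) (at \<alpha>)" for s k by blast
  qed (use dt[OF x] in auto)
  then have cont: "continuous_on {0..pi/2} f" by (simp add: continuous_at_imp_continuous_on)
  \<comment> \<open>At the angle pi/2 the pair (X, Z) is (e, -w), the quarter turn of its value (w,
    e) at 0.\<close>
  have swap: "f (pi/2) = - f 0"
  proof -
    have "cb (- w) = - cb w" by (simp add: cb_def matrix_vector_mult_neg)
    then show ?thesis using FE_1_swap[OF x, of "cb v" "cb e" "cb w"] by (simp add: f_def \<theta>_def X_def Z_def)
  qed
  have "\<exists>\<alpha>. f \<alpha> = 0"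
  proof (cases "f 0 \<le> 0")
    case True
    then show ?thesis using IVT'[of f 0 0 "pi/2", OF _ _ _ cont] swap by auto
  next
    case False
    then show ?thesis using IVT2'[of f "pi/2" 0 0, OF _ _ _ cont] swap by auto
  qed
  then obtain \<alpha> where "f \<alpha> = 0" ..
  then have "zero_frame 1 (jet h x) (\<theta> \<alpha>)"
    using orth FE0 by (auto simp: zero_frame_def f_def le_Suc_eq)
  then show thesis by (rule that)
qed

end

lemma (in smooth_riem) not_chaotic_curvature_1:
  assumes "topspace (mtop M) \<noteq> {}" shows "\<not> chaotic_curvature M 1"
proof -
  obtain c p where c: "c \<in> atlas M" "p \<in> chart_dom c" using assms cover by blast
  interpret metric_region "img c" "met M c" by unfold_locales (rule oi[OF c(1)], rule sm[OF c(1)])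
  obtain \<theta> where "zero_frame 1 (jet (met M c) (chart_map c p)) \<theta>" using zero_frame_1_exists c(2) by blast
  then show ?thesis unfolding chaotic_curvature_iff using c by blast
qed

section \<open>Exceptional geodesics\<close>

text \<open>By \<open>jacobi_expand\<close> the Jacobi operator of V sends X to \<kappa> X +
  \<open>\<phi> 0\<close> Z along the curve. When \<open>\<phi> 0\<close> and its derivative
  \<open>\<phi> 1\<close> vanish at 0, this operator and its covariant derivative map the plane of V
  and X into the line of X.\<close>

lemma (in chart_curve) exceptional_in_chart:
  assumes cg: "chart_geodesic (chart_map c ` chart_dom c) (met M c) I x V X \<sigma>"
    and z: "chart_geodesic.\<phi> (met M c) x V X \<sigma> 0 0 = 0" "chart_geodesic.\<phi> (met M c) x V X \<sigma> 1 0 = 0"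
  defines "\<kappa> \<equiv> \<lambda>t. X t \<bullet> (met M c (x t) *v riemann (met M c) (x t) (X t) (V t) (V t))"
  obtains \<kappa>' where "(\<kappa> has_real_derivative \<kappa>') (at 0)"
    "\<And>a b. riemann (met M c) (x 0) (a *\<^sub>R V 0 + b *\<^sub>R X 0) (V 0) (V 0) = (b * \<kappa> 0) *\<^sub>R X 0"
    "\<And>a b. tensor_cov_deriv M \<gamma> (\<lambda>t. curvature_tensor M (\<gamma> t)) 0 c (a *\<^sub>R V 0 + b *\<^sub>R X 0) (V 0) (V 0) = (b * \<kappa>') *\<^sub>R X 0"
proof -
  let ?h = "met M c"
  interpret G: chart_geodesic "chart_map c ` chart_dom c" ?h I x V X \<sigma> by (rule cg)
  interpret R: metric_region "chart_map c ` chart_dom c" ?h by unfold_locales (rule G.U, rule G.h)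
  note I0 = G.I(3)
  let ?G = "christoffel ?h (x 0) (V 0)"
  have neg: "?G (- u) = - ?G u" for u by (simp add: christoffel_chr bilinear_rneg[OF bilinear_chr])
  have Glin: "?G (a *\<^sub>R u + b *\<^sub>R w) = a *\<^sub>R ?G u + b *\<^sub>R ?G w" for a b u w
    by (simp add: christoffel_chr bilinear_radd[OF bilinear_chr] bilinear_rmul[OF bilinear_chr])
  obtain R' where R': "\<And>A B C A' B' C'. (A has_vector_derivative A') (at 0) \<Longrightarrow> (B has_vector_derivative B') (at 0) \<Longrightarrow>
    (C has_vector_derivative C') (at 0) \<Longrightarrow> ((\<lambda>s. riemann ?h (x s) (A s) (B s) (C s)) has_vector_derivative
      R' (A 0) (B 0) (C 0) + riemann ?h (x 0) A' (B 0) (C 0) + riemann ?h (x 0) (A 0) B' (C 0) + riemann ?h (x 0) (A 0) (B 0) C') (at 0)"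
  proof (rule riemann_along_curve[OF G.comps R.dt oI I0 G.xU G.x[OF I0]])
    fix R' assume a: "\<And>A B C A' B' C'. (A has_vector_derivative A') (at 0) \<Longrightarrow> (B has_vector_derivative B') (at 0) \<Longrightarrow>
    (C has_vector_derivative C') (at 0) \<Longrightarrow> ((\<lambda>s. riemann ?h (x s) (A s) (B s) (C s)) has_vector_derivative
      R' (A 0) (B 0) (C 0) + riemann ?h (x 0) A' (B 0) (C 0) + riemann ?h (x 0) (A 0) B' (C 0) + riemann ?h (x 0) (A 0) (B 0) C') (at 0)"
    show thesis by (rule that[of R']) (rule a)
  qed
  note rl = riemann_linear[OF G.comps G.xU R.dt[OF G.xU]]
  have exp: "riemann ?h (x t) (a *\<^sub>R V t + b *\<^sub>R X t) (V t) (V t) = b *\<^sub>R (\<kappa> t *\<^sub>R X t + G.\<phi> 0 t *\<^sub>R G.Z t)" if t: "t \<in> I" for a b t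
  proof -
    have "riemann ?h (x t) (X t) (V t) (V t) = \<kappa> t *\<^sub>R X t + G.\<phi> 0 t *\<^sub>R G.Z t"
      using R.jacobi_expand[OF G.xU[OF t] G.orth(1)[OF t]] unfolding \<kappa>_def G.\<phi>_def by (simp add: G.\<theta>_def)
    moreover have "riemann ?h (x t) (V t) (V t) (V t) = 0" by (simp add: riemann_def)
    moreover have "riemann ?h (x t) (a *\<^sub>R V t + b *\<^sub>R X t) (V t) (V t)
        = a *\<^sub>R riemann ?h (x t) (V t) (V t) (V t) + b *\<^sub>R riemann ?h (x t) (X t) (V t) (V t)"
      by (simp only: linear_add[OF rl(1)[OF t t]] linear_cmul[OF rl(1)[OF t t]])
    ultimately show ?thesis by simp
  qed
  have "((\<lambda>s. riemann ?h (x s) (X s) (V s) (V s)) has_vector_derivative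
      R' (X 0) (V 0) (V 0) + riemann ?h (x 0) (- ?G (X 0)) (V 0) (V 0) + riemann ?h (x 0) (X 0) (- ?G (V 0)) (V 0)
        + riemann ?h (x 0) (X 0) (V 0) (- ?G (V 0))) (at 0)"
    by (rule R'[OF G.X[OF I0] G.V[OF I0] G.V[OF I0]])
  from inner_along_curve[OF G.comps G.xU[OF I0] G.sym[OF I0] R.dt[OF G.xU[OF I0]] G.x[OF I0] G.X[OF I0] this]
  obtain \<kappa>' where k: "(\<kappa> has_real_derivative \<kappa>') (at 0)" unfolding \<kappa>_def by blast
  show thesis
  proof (rule that[OF k])
    show "riemann ?h (x 0) (a *\<^sub>R V 0 + b *\<^sub>R X 0) (V 0) (V 0) = (b * \<kappa> 0) *\<^sub>R X 0" for a b
      using exp[OF I0, of a b] z(1) by simp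
    fix a b
    define A where "A t = a *\<^sub>R V t + b *\<^sub>R X t" for t
    have A: "(A has_vector_derivative - ?G (A 0)) (at 0)"
    proof -
      have "(A has_vector_derivative a *\<^sub>R (- ?G (V 0)) + b *\<^sub>R (- ?G (X 0))) (at 0)"
        unfolding A_def[abs_def] by (intro has_vector_derivative_add bounded_linear.has_vector_derivative[OF bounded_linear_scaleR_right] G.V G.X I0)
      then show ?thesis by (simp add: A_def Glin)
    qed
    have 1: "((\<lambda>s. riemann ?h (x s) (A s) (V s) (V s)) has_vector_derivative
      R' (A 0) (V 0) (V 0) + riemann ?h (x 0) (- ?G (A 0)) (V 0) (V 0) + riemann ?h (x 0) (A 0) (- ?G (V 0)) (V 0)
        + riemann ?h (x 0) (A 0) (V 0) (- ?G (V 0))) (at 0)"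
      by (rule R'[OF A G.V[OF I0] G.V[OF I0]])
    have 2: "((\<lambda>t. b *\<^sub>R (\<kappa> t *\<^sub>R X t + G.\<phi> 0 t *\<^sub>R G.Z t)) has_vector_derivative
        b *\<^sub>R ((\<kappa> 0 *\<^sub>R (- ?G (X 0)) + \<kappa>' *\<^sub>R X 0) + (G.\<phi> 0 0 *\<^sub>R (- ?G (G.Z 0)) + G.\<phi> (Suc 0) 0 *\<^sub>R G.Z 0))) (at 0)"
      by (intro bounded_linear.has_vector_derivative[OF bounded_linear_scaleR_right] has_vector_derivative_add
        has_vector_derivative_scaleR k G.X G.Zderiv G.\<phi>_deriv I0)
    have "((\<lambda>s. riemann ?h (x s) (A s) (V s) (V s)) has_vector_derivative
        b *\<^sub>R ((\<kappa> 0 *\<^sub>R (- ?G (X 0)) + \<kappa>' *\<^sub>R X 0) + (G.\<phi> 0 0 *\<^sub>R (- ?G (G.Z 0)) + G.\<phi> (Suc 0) 0 *\<^sub>R G.Z 0))) (at 0)"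
      by (rule has_vector_derivative_transform_within_open[OF 2 oI I0]) (simp add: A_def exp)
    \<comment> \<open>Two computations of the derivative of R(A, V)V along the curve are compared:
      the product rule with R', and the expansion in X and Z.\<close>
    from vector_derivative_unique_at[OF 1 this]
    have key: "R' (A 0) (V 0) (V 0) - riemann ?h (x 0) (?G (A 0)) (V 0) (V 0) - riemann ?h (x 0) (A 0) (?G (V 0)) (V 0)
        - riemann ?h (x 0) (A 0) (V 0) (?G (V 0)) = b *\<^sub>R (\<kappa>' *\<^sub>R X 0 - \<kappa> 0 *\<^sub>R ?G (X 0))"
      using z by (simp add: linear_neg[OF rl(1)[OF I0 I0]] linear_neg[OF rl(2)[OF I0 I0]] linear_neg[OF rl(3)[OF I0 I0]])
    have c0: "c \<in> charts_at M (\<gamma> 0)" by (rule c_at[OF I0])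
    have "((\<lambda>s. riemann ?h (x s) (A 0) (V 0) (V 0)) has_vector_derivative R' (A 0) (V 0) (V 0)) (at 0)"
      using R'[of "\<lambda>_. A 0" 0 "\<lambda>_. V 0" 0 "\<lambda>_. V 0" 0]
      by (simp add: linear_0[OF rl(1)[OF I0 I0]] linear_0[OF rl(2)[OF I0 I0]] linear_0[OF rl(3)[OF I0 I0]])
    then have "((\<lambda>s. curvature_tensor M (\<gamma> s) c (A 0) (V 0) (V 0)) has_vector_derivative R' (A 0) (V 0) (V 0)) (at 0)"
      by (rule has_vector_derivative_transform_within_open[OF _ oI I0]) (simp add: curvature_tensor_def c_at x)
    note vd = vector_derivative_at[OF this]
    have vel: "velocity M \<gamma> 0 c = V 0" by (simp add: velocity_lift[OF I0] lift_self[OF c0])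
    have ct: "curvature_tensor M (\<gamma> 0) c = riemann ?h (x 0)" by (simp add: curvature_tensor_def c0 x[OF I0])
    have "tensor_cov_deriv M \<gamma> (\<lambda>t. curvature_tensor M (\<gamma> t)) 0 c (A 0) (V 0) (V 0)
      = R' (A 0) (V 0) (V 0) + ?G (riemann ?h (x 0) (A 0) (V 0) (V 0)) - riemann ?h (x 0) (?G (A 0)) (V 0) (V 0)
        - riemann ?h (x 0) (A 0) (?G (V 0)) (V 0) - riemann ?h (x 0) (A 0) (V 0) (?G (V 0))"
      unfolding tensor_cov_deriv_def Let_def vd vel ct x[OF I0, symmetric] using c0 by simp
    also have "\<dots> = b *\<^sub>R (\<kappa>' *\<^sub>R X 0 - \<kappa> 0 *\<^sub>R ?G (X 0)) + ?G (riemann ?h (x 0) (A 0) (V 0) (V 0))"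
      unfolding key[symmetric] by simp
    also have "riemann ?h (x 0) (A 0) (V 0) (V 0) = (b * \<kappa> 0) *\<^sub>R X 0"
      using exp[OF I0, of a b] z(1) by (simp add: A_def)
    also have "?G ((b * \<kappa> 0) *\<^sub>R X 0) = (b * \<kappa> 0) *\<^sub>R ?G (X 0)" using Glin[of "b * \<kappa> 0" "X 0" 0 0] by simp
    also have "b *\<^sub>R (\<kappa>' *\<^sub>R X 0 - \<kappa> 0 *\<^sub>R ?G (X 0)) + (b * \<kappa> 0) *\<^sub>R ?G (X 0) = (b * \<kappa>') *\<^sub>R X 0"
      by (simp add: scaleR_right_diff_distrib)
    finally show "tensor_cov_deriv M \<gamma> (\<lambda>t. curvature_tensor M (\<gamma> t)) 0 c (a *\<^sub>R V 0 + b *\<^sub>R X 0) (V 0) (V 0) = (b * \<kappa>') *\<^sub>R X 0"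
      by (simp add: A_def)
  qed
qed

context smooth_riem
begin

text \<open>The invariant plane is spanned by the velocity and X. The operators are families over
  all charts at \<open>\<gamma> 0\<close>, so the factors \<kappa> and \<kappa>' must be shown
  independent of the chart before the images are multiples of the tangent vector
  \<open>X 0\<close>.\<close>

lemma exceptional_3:
  assumes "\<not> chaotic_curvature M 1" shows "exceptional_manifold M 3"
proof -
  obtain p I \<gamma> X where p: "p \<in> topspace (mtop M)" and a: "unit_speed_geodesic M I \<gamma>" "\<gamma> 0 = p" "parallel_field M \<gamma> I X"
        "tnorm M p (X 0) = 1" "tinner M p (X 0) (velocity M \<gamma> 0) = 0"
      and z: "(\<Sum>j\<le>1. tnorm M p ((cov_deriv M \<gamma> ^^ j) (Yperp M \<gamma> X) 0)) = 0"
    using assms unfolding chaotic_curvature_def by blast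
  have n: "tnorm M (\<gamma> 0) (X 0) = 1" "tinner M (\<gamma> 0) (X 0) (velocity M \<gamma> 0) = 0"
    "(\<Sum>j\<le>1. tnorm M (\<gamma> 0) ((cov_deriv M \<gamma> ^^ j) (Yperp M \<gamma> X) 0)) = 0" using a z by simp_all
  let ?v = "velocity M \<gamma>"
  define \<kappa> where "\<kappa> d t = X t d \<bullet> (met M d (chart_map d (\<gamma> t)) *v riemann (met M d) (chart_map d (\<gamma> t)) (X t d) (?v t d) (?v t d))" for d t
  define Loc where "Loc d e \<kappa>' \<longleftrightarrow> e > 0 \<and> (\<forall>t\<in>{-e<..<e}. d \<in> charts_at M (\<gamma> t) \<and> X t = lift d (\<gamma> t) (X t d) \<and> ?v t = lift d (\<gamma> t) (?v t d))
      \<and> ((\<kappa> d) has_real_derivative \<kappa>') (at 0)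
      \<and> (\<forall>a b. riemann (met M d) (chart_map d (\<gamma> 0)) (a *\<^sub>R ?v 0 d + b *\<^sub>R X 0 d) (?v 0 d) (?v 0 d) = (b * \<kappa> d 0) *\<^sub>R X 0 d)
      \<and> (\<forall>a b. tensor_cov_deriv M \<gamma> (\<lambda>t. curvature_tensor M (\<gamma> t)) 0 d (a *\<^sub>R ?v 0 d + b *\<^sub>R X 0 d) (?v 0 d) (?v 0 d) = (b * \<kappa>') *\<^sub>R X 0 d)
      \<and> ?v 0 d \<bullet> (met M d (chart_map d (\<gamma> 0)) *v ?v 0 d) = 1 \<and> X 0 d \<bullet> (met M d (chart_map d (\<gamma> 0)) *v X 0 d) = 1
      \<and> ?v 0 d \<bullet> (met M d (chart_map d (\<gamma> 0)) *v X 0 d) = 0" for d e \<kappa>'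
  have loc: "\<exists>e \<kappa>'. Loc d e \<kappa>'"
    if d: "d \<in> charts_at M (\<gamma> 0)" for d
  proof -
    obtain e where e: "e > 0" and cc: "chart_curve M d {-e<..<e} \<gamma> (\<lambda>t. chart_map d (\<gamma> t)) (\<lambda>t. ?v t d)"
      and cg: "chart_geodesic (img d) (met M d) {-e<..<e} (\<lambda>t. chart_map d (\<gamma> t)) (\<lambda>t. ?v t d) (\<lambda>t. X t d) 1"
      and Xl: "\<And>t. t \<in> {-e<..<e} \<Longrightarrow> X t = lift d (\<gamma> t) (X t d)"
      by (rule geodesic_in_chart[OF a(1,3) n(1,2) d]) blast
    have "zero_frame 1 (jet (met M d) (chart_map d (\<gamma> 0))) (chart_geodesic.\<theta> (met M d) (\<lambda>t. chart_map d (\<gamma> t)) (\<lambda>t. ?v t d) (\<lambda>t. X t d) 1 0)"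
      using chart_curve.chaotic_sum_zero[OF cc cg Xl, of 1] n(3) by blast
    then have "chart_geodesic.\<phi> (met M d) (\<lambda>t. chart_map d (\<gamma> t)) (\<lambda>t. ?v t d) (\<lambda>t. X t d) 1 0 0 = 0"
      "chart_geodesic.\<phi> (met M d) (\<lambda>t. chart_map d (\<gamma> t)) (\<lambda>t. ?v t d) (\<lambda>t. X t d) 1 1 0 = 0"
      unfolding chart_geodesic.\<phi>_def[OF cg] zero_frame_def by blast+
    from chart_curve.exceptional_in_chart[OF cc cg this] obtain \<kappa>' where k: "((\<kappa> d) has_real_derivative \<kappa>') (at 0)"
      "\<And>a b. riemann (met M d) (chart_map d (\<gamma> 0)) (a *\<^sub>R ?v 0 d + b *\<^sub>R X 0 d) (?v 0 d) (?v 0 d) = (b * \<kappa> d 0) *\<^sub>R X 0 d"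
      "\<And>a b. tensor_cov_deriv M \<gamma> (\<lambda>t. curvature_tensor M (\<gamma> t)) 0 d (a *\<^sub>R ?v 0 d + b *\<^sub>R X 0 d) (?v 0 d) (?v 0 d) = (b * \<kappa>') *\<^sub>R X 0 d"
      unfolding \<kappa>_def[abs_def] by blast
    have "\<forall>t\<in>{-e<..<e}. d \<in> charts_at M (\<gamma> t) \<and> X t = lift d (\<gamma> t) (X t d) \<and> ?v t = lift d (\<gamma> t) (?v t d)"
      using chart_curve.c_at[OF cc] Xl chart_curve.velocity_lift[OF cc] by blast
    with e k chart_geodesic.o0[OF cg] show ?thesis unfolding Loc_def by (intro exI[of _ e] exI[of _ \<kappa>'] conjI allI) blast+
  qed
  have cov: "\<kappa> d t = \<kappa> c t" if c: "c \<in> charts_at M (\<gamma> t)" "X t = lift c (\<gamma> t) (X t c)" "?v t = lift c (\<gamma> t) (?v t c)"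
    and d: "d \<in> charts_at M (\<gamma> t)" for c d t
  proof -
    have a: "c \<in> atlas M" "d \<in> atlas M" "\<gamma> t \<in> chart_dom c" using c d charts_atD by blast+
    interpret C: coord_change "overlap c d" "img d" "transition c d" "met M c" "met M d" by (rule coord_change[OF a(1,2)])
    have Xd: "X t d = d1 (transition c d) (chart_map c (\<gamma> t)) (X t c)" using fun_cong[OF c(2), of d] d by (simp add: lift_def)
    have Vd: "?v t d = d1 (transition c d) (chart_map c (\<gamma> t)) (?v t c)" using fun_cong[OF c(3), of d] d by (simp add: lift_def)
    note ov = overlap_charts_at[OF c(1) d]
    show ?thesis
      unfolding \<kappa>_def Xd Vd transition_chart[OF a(1,3), of d, symmetric] C.riemann_transform[OF ov, symmetric] C.iso[OF ov] ..
  qed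
  have "\<exists>c\<in>atlas M. \<gamma> 0 \<in> chart_dom c" using p cover a(2) by blast
  then obtain c where c: "c \<in> charts_at M (\<gamma> 0)" unfolding charts_at_def by blast
  obtain e \<kappa>' where L: "Loc c e \<kappa>'" using loc[OF c] by blast
  have e: "e > 0" and lc: "\<And>t. t \<in> {-e<..<e} \<Longrightarrow> c \<in> charts_at M (\<gamma> t)"
      "\<And>t. t \<in> {-e<..<e} \<Longrightarrow> X t = lift c (\<gamma> t) (X t c)" "\<And>t. t \<in> {-e<..<e} \<Longrightarrow> ?v t = lift c (\<gamma> t) (?v t c)"
    and k: "((\<kappa> c) has_real_derivative \<kappa>') (at 0)"
    and o: "?v 0 c \<bullet> (met M c (chart_map c (\<gamma> 0)) *v ?v 0 c) = 1" "X 0 c \<bullet> (met M c (chart_map c (\<gamma> 0)) *v X 0 c) = 1"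
      "?v 0 c \<bullet> (met M c (chart_map c (\<gamma> 0)) *v X 0 c) = 0"
    using L unfolding Loc_def by blast+
  have l0: "X 0 = lift c (\<gamma> 0) (X 0 c)" "?v 0 = lift c (\<gamma> 0) (?v 0 c)" using lc[of 0] e by auto
  have out: "X 0 d = 0" if "d \<notin> charts_at M (\<gamma> 0)" for d using fun_cong[OF l0(1), of d] that by (simp add: lift_def)
  have ex2: "exc_operator M \<gamma> 2 (a *\<^sub>R ?v 0 + b *\<^sub>R X 0) = (b * \<kappa> c 0) *\<^sub>R X 0" for a b
  proof
    fix d show "exc_operator M \<gamma> 2 (a *\<^sub>R ?v 0 + b *\<^sub>R X 0) d = ((b * \<kappa> c 0) *\<^sub>R X 0) d"
    proof (cases "d \<in> charts_at M (\<gamma> 0)")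
      case True
      obtain e' \<kappa>'' where "Loc d e' \<kappa>''" using loc[OF True] by blast
      then have "riemann (met M d) (chart_map d (\<gamma> 0)) (a *\<^sub>R ?v 0 d + b *\<^sub>R X 0 d) (?v 0 d) (?v 0 d) = (b * \<kappa> d 0) *\<^sub>R X 0 d"
        unfolding Loc_def by blast
      then show ?thesis using cov[OF c l0 True] True
        by (simp add: exc_operator_def curvature_tensor_def scaleR_fun_def)
    qed (simp add: exc_operator_def out scaleR_fun_def)
  qed
  have ex3: "exc_operator M \<gamma> 3 (a *\<^sub>R ?v 0 + b *\<^sub>R X 0) = (b * \<kappa>') *\<^sub>R X 0" for a b
  proof
    fix d show "exc_operator M \<gamma> 3 (a *\<^sub>R ?v 0 + b *\<^sub>R X 0) d = ((b * \<kappa>') *\<^sub>R X 0) d"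
    proof (cases "d \<in> charts_at M (\<gamma> 0)")
      case True
      obtain e' \<kappa>'' where L': "Loc d e' \<kappa>''" using loc[OF True] by blast
      have e': "e' > 0" "\<And>t. t \<in> {-e'<..<e'} \<Longrightarrow> d \<in> charts_at M (\<gamma> t)" "((\<kappa> d) has_real_derivative \<kappa>'') (at 0)"
        "\<And>a b. tensor_cov_deriv M \<gamma> (\<lambda>t. curvature_tensor M (\<gamma> t)) 0 d (a *\<^sub>R ?v 0 d + b *\<^sub>R X 0 d) (?v 0 d) (?v 0 d) = (b * \<kappa>'') *\<^sub>R X 0 d"
        using L' unfolding Loc_def by blast+
      \<comment> \<open>By \<open>cov\<close> the functions \<kappa> of the two charts agree near 0,
        so their derivatives at 0 agree as well.\<close>
      have "((\<kappa> c) has_real_derivative \<kappa>'') (at 0)"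
      proof (rule has_field_derivative_transform_within_open[OF e'(3), of "{-e<..<e} \<inter> {-e'<..<e'}"])
        show "\<kappa> d t = \<kappa> c t" if "t \<in> {-e<..<e} \<inter> {-e'<..<e'}" for t
          by (rule cov) (use that lc e'(2) in blast)+
      qed (use e e' in \<open>auto intro: open_Int\<close>)
      then have "\<kappa>'' = \<kappa>'" using k DERIV_unique by blast
      then show ?thesis using e'(4) True
        by (simp add: exc_operator_def scaleR_fun_def numeral_eq_Suc)
    qed (simp add: exc_operator_def out scaleR_fun_def)
  qed
  let ?S = "span {X 0, ?v 0}"
  have form: "\<exists>a b. s = a *\<^sub>R ?v 0 + b *\<^sub>R X 0" if "s \<in> ?S" for s
    using that unfolding span_pair by (metis add.commute)
  have "dim ?S = 2"
  proof -
    have "?v 0 c \<noteq> 0" "X 0 c \<noteq> 0" using o by auto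
    then have v0: "?v 0 \<noteq> 0" by (metis zero_fun_apply)
    have "X 0 \<notin> span {?v 0}"
    proof
      assume "X 0 \<in> span {?v 0}"
      then obtain s where "X 0 = s *\<^sub>R ?v 0" unfolding span_singleton by auto
      then have s: "X 0 c = s *\<^sub>R ?v 0 c" by (simp add: scaleR_fun_def)
      then have "s = 0" using o(1,3) by (simp add: matrix_vector_mult_scaleR)
      then show False using s \<open>X 0 c \<noteq> 0\<close> by simp
    qed
    then have i: "independent {X 0, ?v 0}" and "X 0 \<noteq> ?v 0"
      using v0 by (auto simp: independent_insert span_base)
    then have "card {X 0, ?v 0} = 2" by simp
    then show ?thesis unfolding dim_span_eq_card_independent[OF i] .
  qed
  moreover have "?S \<subseteq> tangent_space M (\<gamma> 0)"
  proof
    fix s assume "s \<in> ?S"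
    then obtain a b where "s = a *\<^sub>R ?v 0 + b *\<^sub>R X 0" using form by blast
    then have "s = lift c (\<gamma> 0) (a *\<^sub>R ?v 0 c + b *\<^sub>R X 0 c)" unfolding lift_linear l0[symmetric] .
    then show "s \<in> tangent_space M (\<gamma> 0)" using lift_tangent[OF c] by simp
  qed
  moreover have "exc_operator M \<gamma> q ` ?S \<subseteq> ?S" if "q \<in> {2..3}" for q
  proof
    fix r assume "r \<in> exc_operator M \<gamma> q ` ?S"
    then obtain a b where r: "r = exc_operator M \<gamma> q (a *\<^sub>R ?v 0 + b *\<^sub>R X 0)" using form by blast
    have "X 0 \<in> ?S" by (simp add: span_base)
    then have sc: "s *\<^sub>R X 0 \<in> ?S" for s by (rule span_scale)
    have "q = 2 \<or> q = 3" using that by auto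
    then show "r \<in> ?S"
    proof
      assume q: "q = 2" show ?thesis unfolding r q ex2 by (rule sc)
    next
      assume q: "q = 3" show ?thesis unfolding r q ex3 by (rule sc)
    qed
  qed
  moreover have "?v 0 \<in> ?S" by (simp add: span_base)
  ultimately show ?thesis
    unfolding exceptional_manifold_def exceptional_geodesic_def using a(1) subspace_span by blast
qed

end

section \<open>Perturbed metrics\<close>

definition pf :: "(nat \<times> real \<times> R3) list \<Rightarrow> R3 \<Rightarrow> real" where
  "pf ps x = (\<Sum>p\<leftarrow>ps. fst (snd p) * ((snd (snd p) \<bullet> x) ^ fst p / fact (fst p)))"

lemma
  assumes "open U"
  shows smooth_on_pf: "smooth_on U (pf ps)"
    and partials_pf: "x \<in> U \<Longrightarrow> partials ks (pf ps) x = (\<Sum>p\<leftarrow>ps. fst (snd p) * linpow (snd (snd p)) (fst p) ks x)"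
proof -
  have 1: "smooth_on U (\<lambda>x. c * ((w \<bullet> x) ^ d / fact d))" for c w d
    using smooth_on_lincomb[OF assms smooth_on_linpow smooth_on_linpow, of c w d 0 w d] by simp
  have 2: "partials ks (\<lambda>x. c * ((w \<bullet> x) ^ d / fact d)) x = c * linpow w d ks x" if "x \<in> U" for c w d x ks
    using partials_lincomb[OF assms smooth_on_linpow smooth_on_linpow that, of ks c w d 0 w d] by (simp add: partials_linpow)
  show "smooth_on U (pf ps)" unfolding pf_def[abs_def] by (rule smooth_on_sum_list[OF 1 assms])
  show "partials ks (pf ps) x = (\<Sum>p\<leftarrow>ps. fst (snd p) * linpow (snd (snd p)) (fst p) ks x)" if "x \<in> U"
    unfolding pf_def[abs_def] partials_sum_list[OF 1 assms that] 2[OF that] ..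
qed

lemma partials_pf_0: "partials ks (pf ps) 0 = pjet ps ks"
proof -
  have "(\<Sum>p\<leftarrow>ps. fst (snd p) * linpow (snd (snd p)) (fst p) ks 0) = pjet ps ks"
  proof (induction ps)
    case (Cons p ps)
    obtain d c w where "p = (d, c, w)" by (cases p)
    then show ?case using Cons by (auto simp: linpow_def)
  qed simp
  then show ?thesis using partials_pf[OF open_UNIV, of 0 ks ps] by simp
qed

text \<open>The bound does not depend on \<open>ks\<close>, so a single estimate by
  \<open>psize\<close> controls the norm C^K for every K at once.\<close>

lemma abs_linpow_le:
  assumes "norm x \<le> 1" shows "\<bar>linpow w d ks x\<bar> \<le> (1 + norm w) ^ d"
proof (cases "length ks \<le> d")
  case True
  have wx: "\<bar>w \<bullet> x\<bar> \<le> 1 + norm w"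
    using Cauchy_Schwarz_ineq2[of w x] mult_left_mono[OF assms norm_ge_zero[of w]] by simp
  have "\<bar>(w \<bullet> x) ^ (d - length ks) / fact (d - length ks)\<bar> \<le> \<bar>w \<bullet> x\<bar> ^ (d - length ks)"
    using fact_ge_1[of "d - length ks"] by (simp add: power_abs divide_le_eq mult_left_le_one_le mult_le_cancel_left1)
  also have "\<dots> \<le> (1 + norm w) ^ (d - length ks)" by (rule power_mono[OF wx]) simp
  finally have q: "\<bar>(w \<bullet> x) ^ (d - length ks) / fact (d - length ks)\<bar> \<le> (1 + norm w) ^ (d - length ks)" .
  have "\<bar>linpow w d ks x\<bar> = \<bar>prod_list (map (($) w) ks)\<bar> * \<bar>(w \<bullet> x) ^ (d - length ks) / fact (d - length ks)\<bar>"
    unfolding linpow_def abs_mult[symmetric] using True by simp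
  also have "\<dots> \<le> (1 + norm w) ^ length ks * (1 + norm w) ^ (d - length ks)"
    by (rule mult_mono[OF abs_prod_list_nth_le q]) simp_all
  finally show ?thesis using True by (simp add: power_add[symmetric])
qed (simp add: linpow_def)

lemma abs_partials_pf_le:
  assumes "norm x \<le> 1" shows "\<bar>partials ks (pf ps) x\<bar> \<le> psize ps"
proof -
  have "\<bar>\<Sum>p\<leftarrow>ps. fst (snd p) * linpow (snd (snd p)) (fst p) ks x\<bar> \<le> psize ps"
  proof (induction ps)
    case (Cons p ps)
    obtain d c w where p: "p = (d, c, w)" by (cases p)
    have "\<bar>c * linpow w d ks x\<bar> \<le> \<bar>c\<bar> * (1 + norm w) ^ d"
      unfolding abs_mult by (intro mult_left_mono abs_linpow_le assms) simp
    then show ?case using Cons by (simp add: p)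
  qed (simp add: psize_def)
  then show ?thesis using partials_pf[OF open_UNIV, of x ks ps] by simp
qed

lemma real_analytic_on_pf: "real_analytic_on U (pf ps)"
proof -
  have "real_analytic_on U (\<lambda>x. (c / fact d) * (w \<bullet> x) ^ d)" for c w d
    by (rule real_analytic_on_cmult[OF real_analytic_on_inner_power])
  then have "real_analytic_on U (\<lambda>x. c * ((w \<bullet> x) ^ d / fact d))" for c w d by simp
  then show ?thesis unfolding pf_def[abs_def] by (intro real_analytic_on_sum_list)
qed

text \<open>Adding a multiple of the constant matrix g(0), rather than multiplying g by a function,
  makes the jet at 0 exactly \<open>conf (jet g 0) ps\<close>.\<close>

definition pert :: "metric \<Rightarrow> (nat \<times> real \<times> R3) list \<Rightarrow> metric" where
  "pert g ps x = g x + pf ps x *\<^sub>R g 0"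

lemma posdef_ball:
  assumes U: "open U" "0 \<in> U" and h: "smooth_comps U h" and sy: "\<And>x. x \<in> U \<Longrightarrow> transpose (h x) = h x"
    and pd: "posdef (h 0)"
  obtains \<delta> where "\<delta> > 0" "ball 0 \<delta> \<subseteq> U" "\<And>x. x \<in> ball 0 \<delta> \<Longrightarrow> posdef (h x)"
proof -
  obtain e where e: "e > 0" "\<And>A. transpose A = A \<Longrightarrow> (\<And>i j. \<bar>A $ i $ j - h 0 $ i $ j\<bar> \<le> e) \<Longrightarrow> posdef A"
    using posdef_nearby[OF pd] by metis
  have "\<forall>\<^sub>F x in nhds 0. \<bar>h x $ i $ j - h 0 $ i $ j\<bar> < e" for i j
  proof -
    have "partials [] (\<lambda>x. h x $ i $ j) differentiable at 0" using h U(2) unfolding smooth_comps_def smooth_on_def by blast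
    then have "isCont (\<lambda>x. h x $ i $ j) 0" by (simp add: differentiable_imp_continuous_within)
    then have "((\<lambda>x. h x $ i $ j) \<longlongrightarrow> h 0 $ i $ j) (nhds 0)"
      unfolding isCont_def tendsto_at_iff_tendsto_nhds[of "\<lambda>x. h x $ i $ j" 0] .
    from tendstoD[OF this e(1)] show ?thesis by (simp add: dist_real_def)
  qed
  then have "\<forall>\<^sub>F x in nhds 0. \<forall>i j. \<bar>h x $ i $ j - h 0 $ i $ j\<bar> < e" by (intro eventually_all_finite)
  moreover have "\<forall>\<^sub>F x in nhds 0. x \<in> U" using U by (rule eventually_nhds_in_open)
  ultimately have "\<forall>\<^sub>F x in nhds 0. x \<in> U \<and> (\<forall>i j. \<bar>h x $ i $ j - h 0 $ i $ j\<bar> < e)" by eventually_elim blast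
  then obtain \<delta> where \<delta>: "\<delta> > 0" "\<And>x. dist x 0 < \<delta> \<Longrightarrow> x \<in> U \<and> (\<forall>i j. \<bar>h x $ i $ j - h 0 $ i $ j\<bar> < e)"
    unfolding eventually_nhds_metric by blast
  show thesis
  proof (rule that[OF \<delta>(1)])
    show "ball 0 \<delta> \<subseteq> U" using \<delta>(2) by (auto simp: dist_commute)
    show "posdef (h x)" if "x \<in> ball 0 \<delta>" for x
    proof (rule e(2))
      have x: "x \<in> U \<and> (\<forall>i j. \<bar>h x $ i $ j - h 0 $ i $ j\<bar> < e)" using \<delta>(2)[of x] that by (simp add: dist_commute)
      then show "transpose (h x) = h x" using sy by blast
      show "\<bar>h x $ i $ j - h 0 $ i $ j\<bar> \<le> e" for i j using x less_imp_le by blast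
    qed
  qed
qed

context
  fixes U :: "R3 set" and g :: metric and ps :: "(nat \<times> real \<times> R3) list"
  assumes U: "open U" "0 \<in> U" and g: "analytic_metric U g" and ps: "degs {2..} ps"
begin

lemma pert_component: "(\<lambda>x. pert g ps x $ i $ j) = (\<lambda>x. 1 * g x $ i $ j + g 0 $ i $ j * pf ps x)"
  by (simp add: pert_def fun_eq_iff)

lemma smooth_g: "smooth_on U (\<lambda>x. g x $ i $ j)"
  using g by (simp add: analytic_metric_def real_analytic_on_imp_smooth_on)

lemma partials_pert: "x \<in> U \<Longrightarrow>
    partials ks (\<lambda>x. pert g ps x $ i $ j) x = partials ks (\<lambda>x. g x $ i $ j) x + g 0 $ i $ j * partials ks (pf ps) x"
  unfolding pert_component using partials_lincomb[OF U(1) smooth_g smooth_on_pf[OF U(1)], of x ks 1] by simp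

lemma jet_pert_0: "jet (pert g ps) 0 = conf (jet g 0) ps"
  by (simp add: fun_eq_iff jet_def[of "pert g ps"] conf_def partials_pert[OF U(2)] partials_pf_0) (simp add: jet_def)

lemma pert_0: "pert g ps 0 = g 0"
proof -
  have "jmat (jet (pert g ps) 0) = jmat (jet g 0)" unfolding jet_pert_0 by (rule degs_jmat[OF ps]) simp
  then show ?thesis by simp
qed

lemma pert_analytic: "real_analytic_on U (\<lambda>x. pert g ps x $ i $ j)"
  using g unfolding pert_component
  by (intro real_analytic_on_add real_analytic_on_cmult real_analytic_on_pf) (simp add: analytic_metric_def)

lemma pert_comps: "smooth_comps U (pert g ps)"
  unfolding smooth_comps_def using pert_analytic real_analytic_on_imp_smooth_on by blast

lemma pert_metric:
  obtains \<delta> where "\<delta> > 0" "ball 0 \<delta> \<subseteq> U" "analytic_metric (ball 0 \<delta>) (pert g ps)"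
proof -
  have gp: "posdef (g x)" if "x \<in> U" for x using g that by (simp add: analytic_metric_def riemannian_metric_posdef)
  have sy: "transpose (pert g ps x) = pert g ps x" if "x \<in> U" for x
    using gp[OF that] gp[OF U(2)] by (simp add: pert_def posdef_def transpose_def vec_eq_iff)
  have p0: "posdef (pert g ps 0)" using gp[OF U(2)] by (simp add: pert_0)
  obtain \<delta> where d: "\<delta> > 0" "ball 0 \<delta> \<subseteq> U" "\<And>x. x \<in> ball 0 \<delta> \<Longrightarrow> posdef (pert g ps x)"
    by (rule posdef_ball[OF U pert_comps sy p0]) blast+
  then have "analytic_metric (ball 0 \<delta>) (pert g ps)"
    unfolding analytic_metric_def riemannian_metric_posdef using real_analytic_on_subset[OF pert_analytic d(2)] by blast
  then show thesis using d(1,2) that by blast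
qed

lemma CK_pert:
  assumes "\<delta> \<le> 1" "ball 0 \<delta> \<subseteq> U"
  shows "CK_norm K (ball 0 \<delta>) (\<lambda>x. g x $ i $ j - pert g ps x $ i $ j) \<le> ereal (psize ps * \<bar>g 0 $ i $ j\<bar>)"
  unfolding CK_norm_def
proof (rule SUP_least, clarify)
  fix ks and x :: R3 assume x: "x \<in> ball 0 \<delta>"
  have xU: "x \<in> U" using x assms by blast
  have "partials ks (\<lambda>x. g x $ i $ j - pert g ps x $ i $ j) x = - (g 0 $ i $ j * partials ks (pf ps) x)"
    using partials_diff[OF U(1) smooth_g real_analytic_on_imp_smooth_on[OF pert_analytic] xU, of ks i j i j]
    by (simp add: partials_pert[OF xU])
  then show "ereal \<bar>partials ks (\<lambda>x. g x $ i $ j - pert g ps x $ i $ j) x\<bar> \<le> ereal (psize ps * \<bar>g 0 $ i $ j\<bar>)"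
    using abs_partials_pf_le[of x ks ps] x assms(1) by (simp add: abs_mult mult.commute mult_right_mono)
qed

end

section \<open>Persistence in the base point and under perturbation\<close>

lemma jet_tendsto:
  assumes U: "open U" "a \<in> U" and h: "smooth_comps U h" and y: "y \<longlonglongrightarrow> a"
  shows "(\<lambda>n. jet h (y n) ks i j) \<longlonglongrightarrow> jet h a ks i j"
proof -
  have "smooth_on U (\<lambda>x. h x $ i $ j)" using h by (simp add: smooth_comps_def)
  then have "continuous_on U (partials ks (\<lambda>x. h x $ i $ j))" by (rule continuous_on_partials)
  then have "isCont (partials ks (\<lambda>x. h x $ i $ j)) a" using U continuous_on_eq_continuous_at by blast
  then show ?thesis unfolding jet_def by (rule isCont_tendsto_compose[OF _ y])
qed

text \<open>Zero frames at points tending to 0 would accumulate at a zero frame at 0. This extends a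
  property arranged at the origin to a ball.\<close>

lemma zero_free_ball:
  assumes U: "open U" "0 \<in> U" and h: "smooth_comps U h" and pd: "posdef (h 0)" and nz: "\<And>\<theta>. \<not> zero_frame k (jet h 0) \<theta>"
  obtains \<delta> where "\<delta> > 0" "\<And>x \<theta>. x \<in> ball 0 \<delta> \<Longrightarrow> \<not> zero_frame k (jet h x) \<theta>"
proof (rule ccontr)
  assume neg: "\<not> thesis"
  have "\<exists>x \<theta>. x \<in> ball 0 (1 / real (Suc n)) \<and> zero_frame k (jet h x) \<theta>" for n
  proof (rule ccontr)
    assume "\<not> ?thesis"
    then show False using neg that[of "1 / real (Suc n)"] by auto
  qed
  then obtain y \<theta> where y: "\<And>n. y n \<in> ball 0 (1 / real (Suc n))" and z: "\<And>n. zero_frame k (jet h (y n)) (\<theta> n)" by metis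
  have "y \<longlonglongrightarrow> 0"
    by (rule Lim_null_comparison[OF _ LIMSEQ_inverse_real_of_nat])
      (use y in \<open>auto simp: inverse_eq_divide intro!: always_eventually less_imp_le\<close>)
  note J = jet_tendsto[OF U h this]
  have "posdef (jmat (jet h 0))" using pd by simp
  from zero_frame_limit[OF J this z] obtain \<theta>' where "zero_frame k (jet h 0) \<theta>'" by metis
  then show False using nz by blast
qed

text \<open>Smallness in C^4 says nothing about higher derivatives. As \<open>FE 0\<close>,
  \<open>FE 1\<close> and \<open>FE 2\<close> involve orders up to 4 only, the higher orders are
  replaced by those of the limit L, so that the whole jet converges.\<close>

definition trunc :: "jet \<Rightarrow> jet \<Rightarrow> jet" where
  "trunc L J = (\<lambda>ks i j. if length ks \<le> 4 then J ks i j else L ks i j)"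

lemma zero_frame_trunc: "zero_frame 2 (trunc L J) \<theta> \<longleftrightarrow> zero_frame 2 J \<theta>"
proof -
  have m: "jmat (trunc L J) = jmat J" by (simp add: jmat_def trunc_def)
  have t: "length ks \<le> 4 \<Longrightarrow> trunc L J ks i j = J ks i j" for ks i j by (simp add: trunc_def)
  have "ordle 4 e \<Longrightarrow> ev (trunc L J) \<theta> e = ev J \<theta> e" for e by (induction e) (auto simp: m t)
  moreover have "j \<le> 2 \<Longrightarrow> ordle 4 (FE j)" for j by (rule ordle_mono[OF ordle_FE]) simp
  ultimately show ?thesis by (auto simp: zero_frame_def m)
qed

lemma CK_jet_bound:
  assumes U: "open U" "x \<in> U" and h: "smooth_comps U h" "smooth_comps U g" and k: "length ks \<le> 4"
    and ck: "CK_norm 4 U (\<lambda>x. h x $ i $ j - g x $ i $ j) \<le> ereal \<eta>"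
  shows "\<bar>jet h x ks i j - jet g x ks i j\<bar> \<le> \<eta>"
proof -
  have "ereal \<bar>partials ks (\<lambda>x. h x $ i $ j - g x $ i $ j) x\<bar> \<le> CK_norm 4 U (\<lambda>x. h x $ i $ j - g x $ i $ j)"
    unfolding CK_norm_def by (rule SUP_upper2[of "(ks, x)"]) (use U k in auto)
  from order_trans[OF this ck] show ?thesis
    using partials_diff[OF U(1) _ _ U(2), of "\<lambda>x. h x $ i $ j" "\<lambda>x. g x $ i $ j" ks] h
    by (simp add: jet_def smooth_comps_def)
qed

lemma trunc_tendsto:
  assumes U: "open U" "0 \<in> U" and g: "smooth_comps U g" and y: "y \<longlonglongrightarrow> 0" "\<And>n. y n \<in> V n" and V: "\<And>n. open (V n)" "\<And>n. V n \<subseteq> U"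
    and h: "\<And>n. smooth_comps (V n) (h n)"
    and ck: "\<And>n i j. CK_norm 4 (V n) (\<lambda>x. h n x $ i $ j - g x $ i $ j) \<le> ereal (1 / real (Suc n))"
  shows "(\<lambda>n. trunc (jet g 0) (jet (h n) (y n)) ks i j) \<longlonglongrightarrow> jet g 0 ks i j"
proof (cases "length ks \<le> 4")
  case True
  have gV: "smooth_comps (V n) g" for n using g V(2) smooth_on_subset unfolding smooth_comps_def by blast
  have "(\<lambda>n. jet (h n) (y n) ks i j - jet g (y n) ks i j) \<longlonglongrightarrow> 0"
    by (rule Lim_null_comparison[OF _ LIMSEQ_inverse_real_of_nat])
      (use CK_jet_bound[OF V(1) y(2) h gV True ck] in \<open>auto simp: inverse_eq_divide intro!: always_eventually\<close>)
  from tendsto_add[OF this jet_tendsto[OF U g y(1), of ks i j]] show ?thesis using True by (simp add: trunc_def)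
qed (simp add: trunc_def)

lemma CK_norm_self: "CK_norm K U (\<lambda>x. g x $ i $ j - g x $ i $ j) \<le> ereal \<eta>" if "\<eta> > 0" for g :: metric
  unfolding CK_norm_def by (rule SUP_least) (use that in \<open>auto simp: partials_const\<close>)

lemma smooth_metric_subset: "smooth_metric U g \<Longrightarrow> V \<subseteq> U \<Longrightarrow> smooth_metric V g"
  using smooth_on_subset unfolding smooth_metric_def riemannian_metric_def by blast

lemma smooth_metric_posdef: "smooth_metric U g \<Longrightarrow> x \<in> U \<Longrightarrow> posdef (g x)"
  by (simp add: smooth_metric_def riemannian_metric_posdef)

lemma flat_model:
  assumes "degs {2..} ps"
  obtains r g where "r > 0" "analytic_metric (ball 0 r) g" "jet g 0 = conf flat_jet ps"
proof -
  let ?g = "\<lambda>_. mat 1 :: real^3^3"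
  have a: "analytic_metric UNIV ?g"
    unfolding analytic_metric_def riemannian_metric_posdef using posdef_mat_1 real_analytic_on_const by blast
  have "jet ?g 0 = flat_jet" by (simp add: fun_eq_iff jet_def flat_jet_def partials_const mat_def)
  then have "jet (pert ?g ps) 0 = conf flat_jet ps" using jet_pert_0[OF open_UNIV UNIV_I a assms] by simp
  then show thesis using pert_metric[OF open_UNIV UNIV_I a assms] that by metis
qed

text \<open>Radius and tolerance shrink together in the argument by contradiction, so that the
  offending points tend to 0, where the limit jet has no zero frame. The radius of the metric is
  fixed afterwards from the n obtained.\<close>

lemma stably_chaotic:
  "\<exists>r>0. \<exists>g. analytic_metric (ball 0 r) g \<and> chaotic_curvature (region (ball 0 r) g) 2 \<and>
        (\<exists>K. \<exists>\<eta>>0. \<forall>h. smooth_metric (ball 0 r) h \<and>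
           (\<forall>i j. CK_norm K (ball 0 r) (\<lambda>x. h x $ i $ j - g x $ i $ j) \<le> ereal \<eta>) \<longrightarrow>
           chaotic_curvature (region (ball 0 r) h) 2)"
proof -
  obtain ps where ps: "degs {2..} ps" "\<And>\<theta>. \<not> zero_frame 2 (conf flat_jet ps) \<theta>" using conf_flat_without_zero_frame by blast
  obtain r g where r: "r > 0" and g: "analytic_metric (ball 0 r) g" and j: "jet g 0 = conf flat_jet ps" using flat_model[OF ps(1)] by blast
  have gs: "smooth_metric (ball 0 r) g" by (rule analytic_imp_smooth_metric[OF g])
  have "\<exists>n. \<forall>h. smooth_metric (ball 0 (r / real (Suc n))) h \<and>
     (\<forall>i j. CK_norm 4 (ball 0 (r / real (Suc n))) (\<lambda>x. h x $ i $ j - g x $ i $ j) \<le> ereal (1 / real (Suc n))) \<longrightarrow>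
           chaotic_curvature (region (ball 0 (r / real (Suc n))) h) 2"
  proof (rule ccontr)
    assume "\<not> ?thesis"
    then have "\<forall>n. \<exists>h. smooth_metric (ball 0 (r / real (Suc n))) h \<and>
     (\<forall>i j. CK_norm 4 (ball 0 (r / real (Suc n))) (\<lambda>x. h x $ i $ j - g x $ i $ j) \<le> ereal (1 / real (Suc n))) \<and>
           \<not> chaotic_curvature (region (ball 0 (r / real (Suc n))) h) 2" by blast
    then have "\<exists>h. \<forall>n. smooth_metric (ball 0 (r / real (Suc n))) (h n) \<and>
     (\<forall>i j. CK_norm 4 (ball 0 (r / real (Suc n))) (\<lambda>x. h n x $ i $ j - g x $ i $ j) \<le> ereal (1 / real (Suc n))) \<and>
           \<not> chaotic_curvature (region (ball 0 (r / real (Suc n))) (h n)) 2" by (rule choice)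
    then obtain h where H: "\<forall>n. smooth_metric (ball 0 (r / real (Suc n))) (h n) \<and>
     (\<forall>i j. CK_norm 4 (ball 0 (r / real (Suc n))) (\<lambda>x. h n x $ i $ j - g x $ i $ j) \<le> ereal (1 / real (Suc n))) \<and>
           \<not> chaotic_curvature (region (ball 0 (r / real (Suc n))) (h n)) 2" ..
    have h: "\<And>n. smooth_metric (ball 0 (r / real (Suc n))) (h n)"
      "\<And>n i j. CK_norm 4 (ball 0 (r / real (Suc n))) (\<lambda>x. h n x $ i $ j - g x $ i $ j) \<le> ereal (1 / real (Suc n))"
      "\<And>n. \<not> chaotic_curvature (region (ball 0 (r / real (Suc n))) (h n)) 2"
      using H by blast+
    have "\<exists>x \<theta>. x \<in> ball 0 (r / real (Suc n)) \<and> zero_frame 2 (jet (h n) x) \<theta>" for n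
      using h(3)[of n] unfolding chaotic_curvature_region[OF open_ball h(1)] by blast
    then obtain y \<theta> where y: "\<And>n. y n \<in> ball 0 (r / real (Suc n))" and z: "\<And>n. zero_frame 2 (jet (h n) (y n)) (\<theta> n)" by metis
    have y0: "y \<longlonglongrightarrow> 0"
    proof (rule Lim_null_comparison)
      show "\<forall>\<^sub>F n in sequentially. norm (y n) \<le> r * inverse (real (Suc n))"
        using y by (auto simp: divide_inverse intro!: always_eventually less_imp_le)
      show "(\<lambda>n. r * inverse (real (Suc n))) \<longlonglongrightarrow> 0" using tendsto_mult_right_zero[OF LIMSEQ_inverse_real_of_nat] .
    qed
    have sub: "ball 0 (r / real (Suc n)) \<subseteq> ball (0::R3) r" for n
      by (rule subset_ball) (use r in \<open>simp add: divide_le_eq mult_le_cancel_left1\<close>)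
    have J: "(\<lambda>n. trunc (jet g 0) (jet (h n) (y n)) ks i j) \<longlonglongrightarrow> jet g 0 ks i j" for ks i j
      by (rule trunc_tendsto[OF open_ball _ smooth_metric_comps[OF gs] y0 y open_ball sub smooth_metric_comps[OF h(1)] h(2)])
        (use r in simp)
    have pd: "posdef (jmat (jet g 0))" using smooth_metric_posdef[OF gs, of 0] r by simp
    have "zero_frame 2 (trunc (jet g 0) (jet (h n) (y n))) (\<theta> n)" for n using z by (simp add: zero_frame_trunc)
    from zero_frame_limit[OF J pd this] obtain \<theta>' where "zero_frame 2 (jet g 0) \<theta>'" by metis
    then show False using ps(2) j by simp
  qed
  then obtain n where n: "\<And>h. smooth_metric (ball 0 (r / real (Suc n))) h \<Longrightarrow>
     (\<And>i j. CK_norm 4 (ball 0 (r / real (Suc n))) (\<lambda>x. h x $ i $ j - g x $ i $ j) \<le> ereal (1 / real (Suc n))) \<Longrightarrow>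
           chaotic_curvature (region (ball 0 (r / real (Suc n))) h) 2" by blast
  define s where "s = r / real (Suc n)"
  have s: "s > 0" "ball 0 s \<subseteq> ball (0::R3) r"
    using r by (auto simp: s_def divide_le_eq mult_le_cancel_left1 intro!: subset_ball)
  have a: "analytic_metric (ball 0 s) g"
    using g s(2) real_analytic_on_subset unfolding analytic_metric_def riemannian_metric_def by blast
  have "chaotic_curvature (region (ball 0 s) g) 2"
    using n[folded s_def, OF analytic_imp_smooth_metric[OF a]] CK_norm_self[of "1 / real (Suc n)" 4 "ball 0 s" g] by simp
  moreover have "(1 :: real) / real (Suc n) > 0" by simp
  ultimately show ?thesis using s(1) a n[folded s_def] by blast
qed

text \<open>Here the radius of the model can stay fixed, because the zero frame of a nearby metric
  is found at the origin itself.\<close>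

lemma stably_nonchaotic:
  "\<exists>r>0. \<exists>g. analytic_metric (ball 0 r) g \<and> \<not> chaotic_curvature (region (ball 0 r) g) 2 \<and>
        (\<exists>K. \<exists>\<eta>>0. \<forall>h. smooth_metric (ball 0 r) h \<and>
           (\<forall>i j. CK_norm K (ball 0 r) (\<lambda>x. h x $ i $ j - g x $ i $ j) \<le> ereal \<eta>) \<longrightarrow>
           \<not> chaotic_curvature (region (ball 0 r) h) 2)"
proof -
  obtain ps where ps: "degs {2..} ps" "\<And>J. (\<And>n. posdef (jmat (J n))) \<Longrightarrow>
      (\<And>ks i j. (\<lambda>n. J n ks i j) \<longlonglongrightarrow> conf flat_jet ps ks i j) \<Longrightarrow> \<exists>n \<theta>. zero_frame 2 (J n) \<theta>"
    using conf_flat_stable_zero_frame by metis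
  obtain r g where r: "r > 0" and g: "analytic_metric (ball 0 r) g" and j: "jet g 0 = conf flat_jet ps" using flat_model[OF ps(1)] by blast
  have gs: "smooth_metric (ball 0 r) g" by (rule analytic_imp_smooth_metric[OF g])
  have "\<exists>n. \<forall>h. smooth_metric (ball 0 r) h \<and>
     (\<forall>i j. CK_norm 4 (ball 0 r) (\<lambda>x. h x $ i $ j - g x $ i $ j) \<le> ereal (1 / real (Suc n))) \<longrightarrow>
           \<not> chaotic_curvature (region (ball 0 r) h) 2"
  proof (rule ccontr)
    assume "\<not> ?thesis"
    then have "\<forall>n. \<exists>h. smooth_metric (ball 0 r) h \<and>
     (\<forall>i j. CK_norm 4 (ball 0 r) (\<lambda>x. h x $ i $ j - g x $ i $ j) \<le> ereal (1 / real (Suc n))) \<and>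
           chaotic_curvature (region (ball 0 r) h) 2" by blast
    then have "\<exists>h. \<forall>n. smooth_metric (ball 0 r) (h n) \<and>
     (\<forall>i j. CK_norm 4 (ball 0 r) (\<lambda>x. h n x $ i $ j - g x $ i $ j) \<le> ereal (1 / real (Suc n))) \<and>
           chaotic_curvature (region (ball 0 r) (h n)) 2" by (rule choice)
    then obtain h where H: "\<forall>n. smooth_metric (ball 0 r) (h n) \<and>
     (\<forall>i j. CK_norm 4 (ball 0 r) (\<lambda>x. h n x $ i $ j - g x $ i $ j) \<le> ereal (1 / real (Suc n))) \<and>
           chaotic_curvature (region (ball 0 r) (h n)) 2" ..
    have h: "\<And>n. smooth_metric (ball 0 r) (h n)"
      "\<And>n i j. CK_norm 4 (ball 0 r) (\<lambda>x. h n x $ i $ j - g x $ i $ j) \<le> ereal (1 / real (Suc n))"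
      "\<And>n. chaotic_curvature (region (ball 0 r) (h n)) 2"
      using H by blast+
    have z0: "0 \<in> ball (0::R3) r" using r by simp
    have nz: "\<not> zero_frame 2 (jet (h n) 0) \<theta>" for n \<theta>
      using h(3)[of n] z0 unfolding chaotic_curvature_region[OF open_ball h(1)] by blast
    have J: "(\<lambda>n. trunc (jet g 0) (jet (h n) 0) ks i j) \<longlonglongrightarrow> jet g 0 ks i j" for ks i j
      by (rule trunc_tendsto[OF open_ball z0 smooth_metric_comps[OF gs] tendsto_const z0 open_ball subset_refl smooth_metric_comps[OF h(1)] h(2)])
    have pd: "posdef (jmat (trunc (jet g 0) (jet (h n) 0)))" for n
    proof -
      have "jmat (trunc (jet g 0) (jet (h n) 0)) = h n 0" by (simp add: jmat_def trunc_def jet_def vec_eq_iff)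
      then show ?thesis using smooth_metric_posdef[OF h(1) z0] by simp
    qed
    have "\<exists>n \<theta>. zero_frame 2 (trunc (jet g 0) (jet (h n) 0)) \<theta>"
      by (rule ps(2)[of "\<lambda>n. trunc (jet g 0) (jet (h n) 0)"], rule pd) (unfold j[symmetric], rule J)
    then show False using nz by (simp add: zero_frame_trunc)
  qed
  then obtain n where n: "\<And>h. smooth_metric (ball 0 r) h \<Longrightarrow>
     (\<And>i j. CK_norm 4 (ball 0 r) (\<lambda>x. h x $ i $ j - g x $ i $ j) \<le> ereal (1 / real (Suc n))) \<Longrightarrow>
           \<not> chaotic_curvature (region (ball 0 r) h) 2" by blast
  have "\<not> chaotic_curvature (region (ball 0 r) g) 2"
    using n[OF gs] CK_norm_self[of "1 / real (Suc n)" 4 "ball 0 r" g] by simp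
  moreover have "(1 :: real) / real (Suc n) > 0" by simp
  ultimately show ?thesis using r g n by blast
qed

lemma generic_chaotic_3:
  fixes \<epsilon> :: real
  assumes U: "open U" "0 \<in> U" and g: "analytic_metric U g" and \<epsilon>: "\<epsilon> > 0"
  shows "\<exists>\<delta>>0. \<exists>h. ball 0 \<delta> \<subseteq> U \<and> analytic_metric (ball 0 \<delta>) h \<and>
     (\<forall>i j. CK_norm K (ball 0 \<delta>) (\<lambda>x. g x $ i $ j - h x $ i $ j) \<le> ereal \<epsilon>) \<and>
     chaotic_curvature (region (ball 0 \<delta>) h) 3"
proof -
  \<comment> \<open>The change of g is a polynomial times g(0), so its admissible size is \<epsilon>
    divided by a bound for the entries of g(0); the summand 1 makes that bound positive.\<close>
  define m where "m = 1 + (\<Sum>i\<in>UNIV. \<Sum>j\<in>UNIV. \<bar>g 0 $ i $ j\<bar>)"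
  have m: "m > 0" "\<bar>g 0 $ i $ j\<bar> \<le> m" for i j
  proof -
    have "\<bar>g 0 $ i $ j\<bar> \<le> (\<Sum>j\<in>UNIV. \<bar>g 0 $ i $ j\<bar>)" by (rule member_le_sum) auto
    also have "\<dots> \<le> (\<Sum>i\<in>UNIV. \<Sum>j\<in>UNIV. \<bar>g 0 $ i $ j\<bar>)"
      by (rule member_le_sum[of i UNIV "\<lambda>i. \<Sum>j\<in>UNIV. \<bar>g 0 $ i $ j\<bar>"]) (auto intro: sum_nonneg)
    finally show "\<bar>g 0 $ i $ j\<bar> \<le> m" by (simp add: m_def)
    show "m > 0" unfolding m_def by (intro add_pos_nonneg sum_nonneg) auto
  qed
  have pd0: "posdef (jmat (jet g 0))" using g U(2) by (simp add: analytic_metric_def riemannian_metric_posdef)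
  obtain ps where ps: "degs {2..} ps" "psize ps < \<epsilon> / m" "\<And>\<theta>. \<not> zero_frame 3 (conf (jet g 0) ps) \<theta>"
    using generic_perturbation[OF pd0, of "\<epsilon> / m"] \<epsilon> m(1) by (metis divide_pos_pos)
  obtain \<delta>1 where d1: "\<delta>1 > 0" "ball 0 \<delta>1 \<subseteq> U" "analytic_metric (ball 0 \<delta>1) (pert g ps)"
    by (rule pert_metric[OF U g ps(1)])
  have sm: "smooth_metric (ball 0 \<delta>1) (pert g ps)" by (rule analytic_imp_smooth_metric[OF d1(3)])
  have z0: "0 \<in> ball (0::R3) \<delta>1" using d1(1) by simp
  have nz: "\<not> zero_frame 3 (jet (pert g ps) 0) \<theta>" for \<theta> unfolding jet_pert_0[OF U g ps(1)] by (rule ps(3))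
  obtain \<delta>2 where d2: "\<delta>2 > 0" "\<And>x \<theta>. x \<in> ball 0 \<delta>2 \<Longrightarrow> \<not> zero_frame 3 (jet (pert g ps) x) \<theta>"
    using zero_free_ball[OF open_ball z0 smooth_metric_comps[OF sm] smooth_metric_posdef[OF sm z0] nz] by blast
  define \<delta> where "\<delta> = min \<delta>1 (min \<delta>2 1)"
  have d: "\<delta> > 0" "\<delta> \<le> 1" "ball 0 \<delta> \<subseteq> ball (0::R3) \<delta>1" "ball 0 \<delta> \<subseteq> ball (0::R3) \<delta>2"
    using d1(1) d2(1) by (auto simp: \<delta>_def)
  have dU: "ball 0 \<delta> \<subseteq> U" using d(3) d1(2) by blast
  have "analytic_metric (ball 0 \<delta>) (pert g ps)"
    using d1(3) d(3) real_analytic_on_subset unfolding analytic_metric_def riemannian_metric_def by blast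
  moreover have "CK_norm K (ball 0 \<delta>) (\<lambda>x. g x $ i $ j - pert g ps x $ i $ j) \<le> ereal \<epsilon>" for i j
  proof -
    have "psize ps * \<bar>g 0 $ i $ j\<bar> \<le> (\<epsilon> / m) * m"
      using ps(2) m psize_nonneg \<epsilon> by (intro mult_mono) auto
    then have "ereal (psize ps * \<bar>g 0 $ i $ j\<bar>) \<le> ereal \<epsilon>" using m(1) by simp
    with CK_pert[OF U g ps(1) d(2) dU] show ?thesis by (rule order_trans)
  qed
  moreover have "chaotic_curvature (region (ball 0 \<delta>) (pert g ps)) 3"
    unfolding chaotic_curvature_region[OF open_ball smooth_metric_subset[OF sm d(3)]] using d2(2) d(4) by blast
  ultimately show ?thesis using d(1) dU by blast
qed

theorem theorem2p7:
  shows
    "(\<forall>M :: 'a riem_manifold. analytic_riemannian_manifold M \<longrightarrow> \<not> chaotic_curvature M 1) \<and>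
     (\<forall>M :: 'a riem_manifold. analytic_riemannian_manifold M \<longrightarrow> exceptional_manifold M 3) \<and>
     (\<exists>r>0. \<exists>g. analytic_metric (ball 0 r) g \<and> chaotic_curvature (region (ball 0 r) g) 2 \<and>
        (\<exists>K. \<exists>\<eta>>0. \<forall>h. smooth_metric (ball 0 r) h \<and>
           (\<forall>i j. CK_norm K (ball 0 r) (\<lambda>x. h x $ i $ j - g x $ i $ j) \<le> ereal \<eta>) \<longrightarrow>
           chaotic_curvature (region (ball 0 r) h) 2)) \<and>
     (\<exists>r>0. \<exists>g. analytic_metric (ball 0 r) g \<and> \<not> chaotic_curvature (region (ball 0 r) g) 2 \<and>
        (\<exists>K. \<exists>\<eta>>0. \<forall>h. smooth_metric (ball 0 r) h \<and>
           (\<forall>i j. CK_norm K (ball 0 r) (\<lambda>x. h x $ i $ j - g x $ i $ j) \<le> ereal \<eta>) \<longrightarrow>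
           \<not> chaotic_curvature (region (ball 0 r) h) 2)) \<and>
     (\<forall>U g. open U \<and> 0 \<in> U \<and> analytic_metric U g \<longrightarrow>
        (\<forall>\<epsilon>>0. \<forall>K\<ge>10. \<exists>\<delta>>0. \<exists>h. ball 0 \<delta> \<subseteq> U \<and> analytic_metric (ball 0 \<delta>) h \<and>
           (\<forall>i j. CK_norm K (ball 0 \<delta>) (\<lambda>x. g x $ i $ j - h x $ i $ j) \<le> ereal \<epsilon>) \<and>
           chaotic_curvature (region (ball 0 \<delta>) h) 3))"
proof (intro conjI)
  have 1: "\<not> chaotic_curvature M 1" if M: "analytic_riemannian_manifold M" for M :: "'a riem_manifold"
    by (rule smooth_riem.not_chaotic_curvature_1[OF analytic_imp_smooth_riem[OF M]])
      (use M in \<open>simp add: analytic_riemannian_manifold_def\<close>)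
  then show "\<forall>M :: 'a riem_manifold. analytic_riemannian_manifold M \<longrightarrow> \<not> chaotic_curvature M 1" by blast
  show "\<forall>M :: 'a riem_manifold. analytic_riemannian_manifold M \<longrightarrow> exceptional_manifold M 3"
    using smooth_riem.exceptional_3[OF analytic_imp_smooth_riem 1] by blast
qed (rule stably_chaotic, rule stably_nonchaotic, use generic_chaotic_3 in blast)

end
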